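(* Let $d\geq 1$. Suppose that $\{N_t, t\geq 0\}$ is a Poisson process, $\{Y_t, t\geq 0\}$ is a Lévy process on $\mathbb R^d$, and $\{N_t\}$ and $\{Y_t\}$ are independent. Suppose that the Lévy measure $\nu_Y$ of $\{Y_t\}$ satisfies $$\int_{\mathbb R^d}\log^+|y|\,\nu_Y(dy)<\infty .$$ Let $$\mu=\mathcal L\left(\int_0^{\infty-}e^{-N_{s-}}\,dY_s\right).$$ Then the following statements are true. (i) The law $\mu$ is infinitely divisible and, furthermore, $e^{-1}$-semi-selfdecomposable. (ii) Suppose that either $\{Y_t\}$ is a strictly $\alpha$-stable Lévy process on $\mathbb R^d$, $d\geq 1$, with $0<\alpha\leq 2$, or $d=1$ and $\{Y_t\}$ is a Brownian motion with drift. Then $\mu$ is selfdecomposable and of class $L_1(e^{-1},\mathbb R^d)$. (iii) Suppose that $d=1$ and $\{Y_t\}$ is integer-valued and not identically zero. Let $$D=\begin{cases}(0,\infty)&\text{if }\{Y_t\}\text{ is increasing},\\(-\infty,0)&\text{if }\{Y_t\}\text{ is decreasing},\\ \mathbb R&\text{if }\{Y_t\}\text{ is neither increasing nor decreasing}.\end{cases}$$ Then $\mu$ is not selfdecomposable and, furthermore, the Lévy measure $\nu_\mu$ of $\mu$ is discrete and the set of points with positive $\nu_\mu$-measure is dense in $D$.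
   Context: $\mathcal L(\cdot)$ denotes the law of a random variable, $\log^+u=0\vee\log u$ (with $\log^+ 0=0$), and $|y|$ is the Euclidean norm. The improper stochastic integral is $\int_0^{\infty-}e^{-N_{s-}}dY_s=\lim_{t\to\infty}\int_0^te^{-N_{s-}}dY_s$, which exists and is finite a.s. under the stated hypotheses. Let $\mu$ be a distribution on $\mathbb R^d$ with characteristic function $\widehat\mu$, and consider the relation $$\widehat\mu(z)=\widehat\mu(bz)\widehat\rho_b(z),\quad z\in\mathbb R^d.\qquad( * )$$ - $\mu$ is selfdecomposable if for every $b\in(0,1)$ there is a distribution $\rho_b$ on $\mathbb R^d$ satisfying $( * )$. - For a fixed $b\in(0,1)$, $\mu$ is $b$-semi-selfdecomposable, or of class $L_0(b,\mathbb R^d)$, if there is an infinitely divisible distribution $\rho_b$ on $\mathbb R^d$ satisfying $( * )$; then $\mu$ is infinitely divisible and $\rho_b$ is uniquely determined. - For a fixed $b\in(0,1)$, $\mu$ is of class $L_1(b,\mathbb R^d)$ if it is $b$-semi-selfdecomposable and the corresponding $\rho_b$ is of class $L_0(b,\mathbb R^d)$. A measure $\nu$ on $\mathbb R^d$ is called discrete if it is concentrated on some countable set $C$, i.e. $\nu(\mathbb R^d\setminus C)=0$. "Increasing" and "decreasing" are meant in the wide sense, allowing flatness (and, for processes, almost surely). *)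

theory Defs
  imports "HOL-Probability.Probability"
begin

section \<open>Distributions and characteristic functions\<close>

definition distribution :: "'a::euclidean_space measure \<Rightarrow> bool" where
  "distribution \<mu> \<longleftrightarrow> prob_space \<mu> \<and> sets \<mu> = sets borel"

definition char_fun :: "'a::euclidean_space measure \<Rightarrow> 'a \<Rightarrow> complex" where
  "char_fun \<mu> z = (CLINT x|\<mu>. iexp (z \<bullet> x))"

primrec convolution_power :: "'a::ordered_euclidean_space measure \<Rightarrow> nat \<Rightarrow> 'a measure" where
  "convolution_power \<mu> 0 = return borel 0"
| "convolution_power \<mu> (Suc n) = convolution \<mu> (convolution_power \<mu> n)"

definition infinitely_divisible :: "'a::ordered_euclidean_space measure \<Rightarrow> bool" where
  "infinitely_divisible \<mu> \<longleftrightarrow>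
     distribution \<mu> \<and> (\<forall>n\<ge>1. \<exists>\<mu>\<^sub>n. distribution \<mu>\<^sub>n \<and> \<mu> = convolution_power \<mu>\<^sub>n n)"


section \<open>Selfdecomposability\<close>

definition decomposition_factor :: "real \<Rightarrow> 'a::euclidean_space measure \<Rightarrow> 'a measure \<Rightarrow> bool" where
  "decomposition_factor b \<mu> \<rho> \<longleftrightarrow>
     (\<forall>z. char_fun \<mu> z = char_fun \<mu> (b *\<^sub>R z) * char_fun \<rho> z)"

definition selfdecomposable :: "'a::euclidean_space measure \<Rightarrow> bool" where
  "selfdecomposable \<mu> \<longleftrightarrow>
     distribution \<mu> \<and> (\<forall>b\<in>{0<..<1}. \<exists>\<rho>. distribution \<rho> \<and> decomposition_factor b \<mu> \<rho>)"

definition semi_selfdecomposable :: "real \<Rightarrow> 'a::ordered_euclidean_space measure \<Rightarrow> bool" where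
  "semi_selfdecomposable b \<mu> \<longleftrightarrow>
     0 < b \<and> b < 1 \<and> distribution \<mu> \<and>
     (\<exists>\<rho>. infinitely_divisible \<rho> \<and> decomposition_factor b \<mu> \<rho>)"

text \<open>The factor \<open>\<rho>\<close> of a semi-selfdecomposable distribution is unique, so that the
  existential quantifier below refers to the factor of \<open>\<mu>\<close>.\<close>

definition class_L1 :: "real \<Rightarrow> 'a::ordered_euclidean_space measure \<Rightarrow> bool" where
  "class_L1 b \<mu> \<longleftrightarrow>
     0 < b \<and> b < 1 \<and> distribution \<mu> \<and>
     (\<exists>\<rho>. infinitely_divisible \<rho> \<and> decomposition_factor b \<mu> \<rho> \<and> semi_selfdecomposable b \<rho>)"


section \<open>Levy measures\<close>

definition levy_khintchine ::
  "(real^'d) measure \<Rightarrow> real^'d^'d \<Rightarrow> (real^'d) measure \<Rightarrow> real^'d \<Rightarrow> bool" where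
  "levy_khintchine \<mu> A \<nu> \<gamma> \<longleftrightarrow>
     transpose A = A \<and> (\<forall>z. 0 \<le> z \<bullet> (A *v z)) \<and>
     sets \<nu> = sets borel \<and> emeasure \<nu> {0} = 0 \<and>
     (\<integral>\<^sup>+x. ennreal (min ((norm x)\<^sup>2) 1) \<partial>\<nu>) < \<infinity> \<and>
     (\<forall>z. char_fun \<mu> z =
        exp (- complex_of_real (z \<bullet> (A *v z)) / 2 + \<i> * complex_of_real (\<gamma> \<bullet> z)
             + (CLINT x|\<nu>. iexp (z \<bullet> x) - 1
                  - \<i> * complex_of_real (z \<bullet> x * indicator (cball 0 1) x))))"

text \<open>By the uniqueness part of the Levy--Khintchine theorem there is at most one such \<open>\<nu>\<close>.\<close>

definition has_levy_measure :: "(real^'d) measure \<Rightarrow> (real^'d) measure \<Rightarrow> bool" where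
  "has_levy_measure \<mu> \<nu> \<longleftrightarrow> distribution \<mu> \<and> (\<exists>A \<gamma>. levy_khintchine \<mu> A \<nu> \<gamma>)"

definition log_plus :: "real \<Rightarrow> real" where
  "log_plus u = (if u = 0 then 0 else max 0 (ln u))"

definition discrete_measure :: "'a::euclidean_space measure \<Rightarrow> bool" where
  "discrete_measure \<nu> \<longleftrightarrow> (\<exists>C. countable C \<and> emeasure \<nu> (UNIV - C) = 0)"


section \<open>Levy processes\<close>

text \<open>A stochastic process is a function of time and of the sample point, of which only the
  times in \<open>{0..}\<close> are relevant.\<close>

definition cadlag_paths :: "'w measure \<Rightarrow> (real \<Rightarrow> 'w \<Rightarrow> 'a::euclidean_space) \<Rightarrow> bool" where
  "cadlag_paths M X \<longleftrightarrow>
     (AE \<omega> in M. (\<forall>t\<ge>0. continuous (at_right t) (\<lambda>s. X s \<omega>)) \<and>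
                 (\<forall>t>0. \<exists>l. ((\<lambda>s. X s \<omega>) \<longlongrightarrow> l) (at_left t)))"

definition levy_process :: "'w measure \<Rightarrow> (real \<Rightarrow> 'w \<Rightarrow> 'a::euclidean_space) \<Rightarrow> bool" where
  "levy_process M X \<longleftrightarrow>
     prob_space M \<and>
     (\<forall>t\<ge>0. X t \<in> borel_measurable M) \<and>
     (AE \<omega> in M. X 0 \<omega> = 0) \<and>
     (\<forall>n. \<forall>t::nat \<Rightarrow> real. 0 \<le> t 0 \<longrightarrow> (\<forall>i<n. t i \<le> t (Suc i)) \<longrightarrow>
        prob_space.indep_vars M (\<lambda>_. borel) (\<lambda>i \<omega>. X (t (Suc i)) \<omega> - X (t i) \<omega>) {..<n}) \<and>
     (\<forall>s\<ge>0. \<forall>t\<ge>0. distr M borel (\<lambda>\<omega>. X (s + t) \<omega> - X s \<omega>) = distr M borel (X t)) \<and>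
     (\<forall>t\<ge>0. \<forall>\<epsilon>>0.
        ((\<lambda>s. measure M {\<omega> \<in> space M. \<epsilon> < dist (X s \<omega>) (X t \<omega>)}) \<longlongrightarrow> 0) (at t within {0..})) \<and>
     cadlag_paths M X"

definition poisson_process :: "'w measure \<Rightarrow> (real \<Rightarrow> 'w \<Rightarrow> real) \<Rightarrow> bool" where
  "poisson_process M N \<longleftrightarrow>
     levy_process M N \<and>
     (\<exists>c>0. \<forall>t>0. distr M borel (N t) = distr (measure_pmf (poisson_pmf (c * t))) borel real)"

definition brownian_motion_with_drift :: "'w measure \<Rightarrow> (real \<Rightarrow> 'w \<Rightarrow> real) \<Rightarrow> bool" where
  "brownian_motion_with_drift M X \<longleftrightarrow>
     levy_process M X \<and>
     (AE \<omega> in M. continuous_on {0..} (\<lambda>t. X t \<omega>)) \<and>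
     (\<exists>\<sigma>>0. \<exists>\<gamma>. \<forall>t>0. distributed M lborel (X t) (normal_density (\<gamma> * t) (\<sigma> * sqrt t)))"

definition process_law ::
  "'w measure \<Rightarrow> (real \<Rightarrow> 'w \<Rightarrow> 'a::euclidean_space) \<Rightarrow> (real \<Rightarrow> 'a) measure" where
  "process_law M X = distr M (PiM {0..} (\<lambda>_. borel)) (\<lambda>\<omega>. \<lambda>t\<in>{0..}. X t \<omega>)"

text \<open>The degenerate strictly stable processes (the zero process for all \<open>\<alpha>\<close>, and deterministic
  linear motion for \<open>\<alpha> = 1\<close>) are included.\<close>

definition strictly_stable_process ::
  "'w measure \<Rightarrow> real \<Rightarrow> (real \<Rightarrow> 'w \<Rightarrow> 'a::euclidean_space) \<Rightarrow> bool" where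
  "strictly_stable_process M \<alpha> X \<longleftrightarrow>
     levy_process M X \<and>
     (\<forall>a>0. process_law M (\<lambda>t. X (a * t)) = process_law M (\<lambda>t \<omega>. a powr (1 / \<alpha>) *\<^sub>R X t \<omega>))"

definition process_events ::
  "'w measure \<Rightarrow> (real \<Rightarrow> 'w \<Rightarrow> 'a::euclidean_space) \<Rightarrow> 'w set set" where
  "process_events M X =
     sigma_sets (space M) {X t -` A \<inter> space M |t A. 0 \<le> t \<and> A \<in> sets borel}"

definition independent_processes :: "'w measure \<Rightarrow> (real \<Rightarrow> 'w \<Rightarrow> 'a::euclidean_space) \<Rightarrow>
    (real \<Rightarrow> 'w \<Rightarrow> 'b::euclidean_space) \<Rightarrow> bool" where
  "independent_processes M X Y \<longleftrightarrow>
     prob_space.indep_set M (process_events M X) (process_events M Y)"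

text \<open>The order of \<open>real^'d\<close> is componentwise; for \<open>CARD('d) = 1\<close> it is the usual order of
  the reals.\<close>

definition increasing_process :: "'w measure \<Rightarrow> (real \<Rightarrow> 'w \<Rightarrow> 'a::order) \<Rightarrow> bool" where
  "increasing_process M X \<longleftrightarrow> (AE \<omega> in M. \<forall>s\<ge>0. \<forall>t\<ge>s. X s \<omega> \<le> X t \<omega>)"

definition decreasing_process :: "'w measure \<Rightarrow> (real \<Rightarrow> 'w \<Rightarrow> 'a::order) \<Rightarrow> bool" where
  "decreasing_process M X \<longleftrightarrow> (AE \<omega> in M. \<forall>s\<ge>0. \<forall>t\<ge>s. X t \<omega> \<le> X s \<omega>)"

definition integer_valued_process :: "'w measure \<Rightarrow> (real \<Rightarrow> 'w \<Rightarrow> real^'d) \<Rightarrow> bool" where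
  "integer_valued_process M X \<longleftrightarrow> (AE \<omega> in M. \<forall>t\<ge>0. \<forall>i. X t \<omega> $ i \<in> \<int>)"

definition zero_process :: "'w measure \<Rightarrow> (real \<Rightarrow> 'w \<Rightarrow> 'a::zero) \<Rightarrow> bool" where
  "zero_process M X \<longleftrightarrow> (AE \<omega> in M. \<forall>t\<ge>0. X t \<omega> = 0)"


section \<open>Stochastic integrals of left-continuous integrands\<close>

text \<open>The process \<open>X\<^sub>t\<^sub>-\<close>, with \<open>X\<^sub>0\<^sub>- = X\<^sub>0\<close>.\<close>

definition left_limit :: "(real \<Rightarrow> 'w \<Rightarrow> 'a::euclidean_space) \<Rightarrow> real \<Rightarrow> 'w \<Rightarrow> 'a" where
  "left_limit X t \<omega> = (if t \<le> 0 then X 0 \<omega> else Lim (at_left t) (\<lambda>s. X s \<omega>))"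

text \<open>Convergence in probability.  The completion is needed because \<open>left_limit\<close> of a process
  whose paths have left limits only almost surely need not be measurable with respect to an
  incomplete \<open>M\<close>.\<close>

definition tendsto_in_prob ::
  "'w measure \<Rightarrow> (nat \<Rightarrow> 'w \<Rightarrow> 'a::euclidean_space) \<Rightarrow> ('w \<Rightarrow> 'a) \<Rightarrow> bool" where
  "tendsto_in_prob M Z L \<longleftrightarrow>
     (\<forall>n. Z n \<in> borel_measurable (completion M)) \<and> L \<in> borel_measurable (completion M) \<and>
     (\<forall>\<epsilon>>0. (\<lambda>n. measure (completion M) {\<omega> \<in> space M. \<epsilon> < dist (Z n \<omega>) (L \<omega>)}) \<longlonglongrightarrow> 0)"

definition partition_seq :: "real \<Rightarrow> (nat \<Rightarrow> nat) \<Rightarrow> (nat \<Rightarrow> nat \<Rightarrow> real) \<Rightarrow> bool" where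
  "partition_seq t k p \<longleftrightarrow>
     (\<forall>n. p n 0 = 0 \<and> p n (k n) = t \<and> (\<forall>i<k n. p n i \<le> p n (Suc i))) \<and>
     (\<forall>\<epsilon>>0. \<forall>\<^sub>F n in sequentially. \<forall>i<k n. p n (Suc i) - p n i < \<epsilon>)"

text \<open>\<open>I\<close> is a version with right-continuous paths with left limits of the process
  \<open>t \<mapsto> \<integral>\<^sub>0\<^sup>t H\<^sub>s dX\<^sub>s\<close>, for \<open>X\<close> a semimartingale and \<open>H\<close> adapted with left-continuous paths with
  right limits.  For such integrands, Ito's integral is the limit in probability of the
  left-endpoint sums along every sequence of partitions of \<open>{0..t}\<close> with mesh tending to 0.
  This determines \<open>I\<close> up to indistinguishability.\<close>

definition has_stochastic_integral :: "'w measure \<Rightarrow> (real \<Rightarrow> 'w \<Rightarrow> real) \<Rightarrow>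
    (real \<Rightarrow> 'w \<Rightarrow> 'a::euclidean_space) \<Rightarrow> (real \<Rightarrow> 'w \<Rightarrow> 'a) \<Rightarrow> bool" where
  "has_stochastic_integral M H X I \<longleftrightarrow>
     (\<forall>t\<ge>0. I t \<in> borel_measurable M) \<and> cadlag_paths M I \<and>
     (\<forall>t\<ge>0. \<forall>k p. partition_seq t k p \<longrightarrow>
        tendsto_in_prob M
          (\<lambda>n \<omega>. \<Sum>i<k n. H (p n i) \<omega> *\<^sub>R (X (p n (Suc i)) \<omega> - X (p n i) \<omega>)) (I t))"

text \<open>\<open>\<integral>\<^sub>0\<^sup>\<infinity>\<^sup>- H\<^sub>s dX\<^sub>s\<close> as the almost sure limit of \<open>\<integral>\<^sub>0\<^sup>t H\<^sub>s dX\<^sub>s\<close> for \<open>t \<longlonglongrightarrow> \<infinity>\<close>: a random variable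
  determined up to almost sure equality, and unspecified if the limit does not exist.\<close>

definition has_improper_integral :: "'w measure \<Rightarrow> (real \<Rightarrow> 'w \<Rightarrow> real) \<Rightarrow>
    (real \<Rightarrow> 'w \<Rightarrow> 'a::euclidean_space) \<Rightarrow> ('w \<Rightarrow> 'a) \<Rightarrow> bool" where
  "has_improper_integral M H X Z \<longleftrightarrow>
     Z \<in> borel_measurable M \<and>
     (\<exists>I. has_stochastic_integral M H X I \<and> (AE \<omega> in M. ((\<lambda>t. I t \<omega>) \<longlongrightarrow> Z \<omega>) at_top))"

definition improper_integral :: "'w measure \<Rightarrow> (real \<Rightarrow> 'w \<Rightarrow> real) \<Rightarrow>
    (real \<Rightarrow> 'w \<Rightarrow> 'a::euclidean_space) \<Rightarrow> 'w \<Rightarrow> 'a" where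
  "improper_integral M H X = (SOME Z. has_improper_integral M H X Z)"

end

theory Submission
  imports Defs
begin

text \<open>Let \<open>\<psi>\<close> be the exponent of \<open>Y\<close> and \<open>c\<close> the rate of \<open>N\<close>.  Between two jumps of \<open>N\<close> the process \<open>Y\<close>
  runs for an independent exponential time, after which the integral starts afresh with the factor \<open>1 / e\<close>.  Hence
  \<open>f(z) = f(z / e) r(z)\<close>, where \<open>f\<close> is the characteristic function of \<open>\<mu>\<close> and \<open>r = 1 / (1 - \<psi> / c)\<close> that of
  the law of \<open>Y\<close> at an exponential time.  The latter law is infinitely divisible, because the exponential law is, and
  \<open>\<mu>\<close> is the law of a series of independent copies of it, dilated by \<open>exp (- j)\<close>.

  In (ii), \<open>r(z) / r(b z)\<close> is for every \<open>b < 1\<close> the characteristic function of a geometric compound law (by scaling of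
  \<open>\<psi>\<close> in the stable case; for Brownian motion \<open>r\<close> is a product of two exponential laws on rays).

  In (iii), \<open>r\<close> is \<open>2 \<pi>\<close>-periodic.  If \<open>\<mu>\<close> were selfdecomposable, \<open>\<bar>f\<bar>\<close> would be nonincreasing along rays, and
  \<open>f(2 \<pi> n) = f(2 \<pi> n / e)\<close> forces it to be eventually constant, so that \<open>\<bar>r\<bar> = 1\<close> and \<open>Y = 0\<close>.  The Levy measure of
  \<open>\<mu>\<close> lives on the points \<open>exp (- j) k\<close> with \<open>k\<close> an integer, and charges all \<open>exp (- j) n k\<close> if \<open>Y\<close> charges \<open>k\<close>.\<close>

section \<open>Characteristic functions\<close>

text \<open>The integral is given only by left-endpoint sums converging in probability, so the
  restart after a jump of \<open>N\<close> is not argued with stopping times. On an equidistant grid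
  the characteristic function of a sum is an iterate of a one-step operator acting on functions of
  the current value of \<open>N\<close>. A time span \<open>s\<close> costs an error of order
  \<open>s^2\<close>, uniformly in the mesh and in the time horizon; division by \<open>s\<close>
  and \<open>s -> 0\<close> give the functional equation. As the integral is defined by choice, its
  existence must be proved; this is done path by path, with the linear growth of \<open>N\<close>
  beating any small exponential growth of \<open>Y\<close>. The logarithmic condition enters through
  one series, a majorant of the modulus of \<psi> summed over the scales \<open>exp (- k)\<close>:
  it bounds the tails of \<open>Y t\<close> and so their logarithmic moments. Such moments pass to
  convolution factors, which makes the infinite products for roots and factors of \<mu> converge. In
  (iii) the bounds on \<open>Y t\<close> must be linear in \<open>t\<close> without a constant term,
  to cancel the density \<open>1 / u\<close> in the Levy measure; integer values provide this, since
  \<open>Y t\<close> is nonzero only with probability \<open>O(t)\<close>.\<close>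

lemma char_fun_0 [simp]: "distribution \<mu> \<Longrightarrow> char_fun \<mu> 0 = 1"
  by (simp add: char_fun_def distribution_def prob_space.prob_space)

lemma norm_char_fun_le_1:
  assumes "distribution \<mu>"
  shows "norm (char_fun \<mu> z) \<le> 1"
proof -
  interpret prob_space \<mu> using assms by (simp add: distribution_def)
  have "norm (char_fun \<mu> z) \<le> (\<integral>x. norm (iexp (z \<bullet> x)) \<partial>\<mu>)"
    unfolding char_fun_def by (rule integral_norm_bound)
  then show ?thesis by (simp add: prob_space)
qed

lemma char_fun_tendsto:
  assumes "distribution \<mu>" "(u \<longlongrightarrow> z) sequentially"
  shows "(\<lambda>n. char_fun \<mu> (u n)) \<longlonglongrightarrow> char_fun \<mu> z"
proof -
  interpret prob_space \<mu> using assms by (simp add: distribution_def)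
  have [measurable_cong]: "sets \<mu> = sets borel" using assms by (simp add: distribution_def)
  show ?thesis unfolding char_fun_def
    by (rule integral_dominated_convergence[where w="\<lambda>_. 1"])
       (auto intro!: tendsto_intros assms)
qed

lemma char_fun_distr:
  fixes f :: "'b \<Rightarrow> 'a::euclidean_space"
  assumes [measurable]: "f \<in> borel_measurable M"
  shows "char_fun (distr M borel f) z = (CLINT x|M. iexp (z \<bullet> f x))"
  by (simp add: char_fun_def integral_distr)

lemma distribution_distr:
  assumes "prob_space M" "f \<in> borel_measurable M"
  shows "distribution (distr M borel f)"
  using assms by (simp add: distribution_def prob_space.prob_space_distr)

lemma distribution_convolution:
  assumes "distribution \<mu>" "distribution \<nu>"
  shows "distribution (\<mu> \<star> \<nu>)"
proof -
  interpret \<mu>: prob_space \<mu> using assms by (simp add: distribution_def)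
  interpret \<nu>: prob_space \<nu> using assms by (simp add: distribution_def)
  interpret pair_prob_space \<mu> \<nu> ..
  have [measurable_cong]: "sets \<mu> = sets borel" "sets \<nu> = sets borel"
    using assms by (simp_all add: distribution_def)
  show ?thesis unfolding convolution_def
    by (rule distribution_distr) (auto intro: prob_space_axioms)
qed

lemma char_fun_convolution:
  assumes "distribution \<mu>" "distribution \<nu>"
  shows "char_fun (\<mu> \<star> \<nu>) z = char_fun \<mu> z * char_fun \<nu> z"
proof -
  interpret \<mu>: prob_space \<mu> using assms by (simp add: distribution_def)
  interpret \<nu>: prob_space \<nu> using assms by (simp add: distribution_def)
  interpret pair_prob_space \<mu> \<nu> ..
  have [measurable_cong]: "sets \<mu> = sets borel" "sets \<nu> = sets borel"
    using assms by (simp_all add: distribution_def)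
  have "char_fun (\<mu> \<star> \<nu>) z = (CLINT p|\<mu> \<Otimes>\<^sub>M \<nu>. iexp (z \<bullet> fst p) * iexp (z \<bullet> snd p))"
    unfolding convolution_def
    by (subst char_fun_distr) (auto simp: inner_add_right ring_distribs exp_add case_prod_beta)
  also have "\<dots> = (CLINT x|\<mu>. CLINT y|\<nu>. iexp (z \<bullet> x) * iexp (z \<bullet> y))"
    by (subst integral_fst'[symmetric]) (auto intro!: integrable_const_bound[where B=1] simp: norm_mult)
  also have "\<dots> = char_fun \<mu> z * char_fun \<nu> z"
    unfolding char_fun_def by simp
  finally show ?thesis .
qed

lemma distribution_return: "distribution (return borel x)"
  by (simp add: distribution_def prob_space_return)

lemma distribution_convolution_power:
  "distribution \<mu> \<Longrightarrow> distribution (convolution_power \<mu> n)"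
  by (induction n) (auto intro: distribution_convolution distribution_return)

lemma char_fun_convolution_power:
  "distribution \<mu> \<Longrightarrow> char_fun (convolution_power \<mu> n) z = char_fun \<mu> z ^ n"
proof (induction n)
  case 0
  show ?case by (simp add: char_fun_def integral_return)
next
  case (Suc n)
  then show ?case by (simp add: char_fun_convolution distribution_convolution_power)
qed

section \<open>Uniqueness of a law on a Euclidean space with given characteristic function\<close>

lemma finite_real_measure_eqI:
  fixes M1 M2 :: "real measure"
  assumes "finite_measure M1" "finite_measure M2"
    and sets: "sets M1 = sets borel" "sets M2 = sets borel"
    and eq: "\<And>t. (CLINT x|M1. iexp (t * x)) = (CLINT x|M2. iexp (t * x))"
  shows "M1 = M2"
proof -
  interpret M1: finite_measure M1 by fact
  interpret M2: finite_measure M2 by fact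
  have sp: "space M1 = UNIV" "space M2 = UNIV"
    using sets_eq_imp_space_eq[OF sets(1)] sets_eq_imp_space_eq[OF sets(2)] by auto
  note [measurable_cong] = sets
  \<comment> \<open>\<open>Levy_uniqueness\<close> speaks of probability laws, so both measures are
    divided by their common mass, read off at \<open>t = 0\<close>. Mass zero has to be treated
    apart.\<close>
  define a where "a = measure M1 UNIV"
  have a2: "a = measure M2 UNIV"
    using eq[of 0] by (simp add: a_def sp)
  show ?thesis
  proof (cases "a = 0")
    case True
    have "emeasure M1 A = 0 \<and> emeasure M2 A = 0" for A
    proof -
      have "emeasure M1 UNIV = 0" "emeasure M2 UNIV = 0"
        using True a2 by (simp_all add: a_def M1.emeasure_eq_measure M2.emeasure_eq_measure)
      then show ?thesis
        by (metis emeasure_space le_zero_eq sp)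
    qed
    then show ?thesis using sets by (intro measure_eqI) auto
  next
    case False
    then have a: "a > 0" by (simp add: a_def zero_less_measure_iff less_le)
    have 1: "real_distribution (density M (\<lambda>_. ennreal (1 / a)))"
      if "finite_measure M" "sets M = sets borel" "measure M UNIV = a" for M :: "real measure"
    proof -
      interpret M: finite_measure M by fact
      have "space M = UNIV" using sets_eq_imp_space_eq[OF that(2)] by auto
      then have "emeasure (density M (\<lambda>_. ennreal (1 / a))) UNIV = ennreal (1/a) * ennreal a"
        using that a by (subst emeasure_density) (auto simp: M.emeasure_eq_measure)
      also have "\<dots> = 1" using a by (simp flip: ennreal_mult)
      finally show ?thesis
        using that \<open>space M = UNIV\<close> by (auto simp: real_distribution_def real_distribution_axioms_def intro!: prob_spaceI)
    qed
    have "char (density M1 (\<lambda>_. ennreal (1 / a))) = char (density M2 (\<lambda>_. ennreal (1 / a)))"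
      using a eq by (auto simp: char_def fun_eq_iff integral_density)
    then have eq2: "density M1 (\<lambda>_. ennreal (1 / a)) = density M2 (\<lambda>_. ennreal (1 / a))"
      using assms a2 a_def by (intro Levy_uniqueness 1) auto
    have "emeasure M1 A = emeasure M2 A" if [measurable]: "A \<in> sets borel" for A
    proof -
      have A: "A \<in> sets M1" "A \<in> sets M2" using that sets by auto
      have "ennreal (1/a) * emeasure M1 A = ennreal (1/a) * emeasure M2 A"
        using arg_cong[OF eq2, of "\<lambda>M. emeasure M A"] A
        by (simp add: emeasure_density nn_integral_cmult_indicator)
      then show ?thesis
        using a by (simp add: ennreal_mult_cancel_left)
    qed
    then show ?thesis using sets by (intro measure_eqI) auto
  qed
qed


text \<open>The coordinates are treated one by one: once those in \<open>S\<close> have been passed, Levy's uniqueness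
  theorem on the line is applied to the image under the next coordinate of the law weighted by
  \<open>\<Prod>\<^bsub>i\<in>S\<^esub> 1\<^bsub>A i\<^esub>(x\<^sub>i) (1 + cos (z \<bullet> x + \<theta>)) \<ge> 0\<close>.\<close>

lemma char_fun_eq_imp_eq_aux:
  fixes \<mu> \<nu> :: "'a::euclidean_space measure"
  assumes d: "distribution \<mu>" "distribution \<nu>"
    and eq: "\<And>z. char_fun \<mu> z = char_fun \<nu> z"
    and S: "finite S" "S \<subseteq> Basis"
    and A: "\<And>i. i \<in> S \<Longrightarrow> A i \<in> sets borel"
  shows "(CLINT x|\<mu>. (\<Prod>i\<in>S. indicator (A i) (x \<bullet> i)) * iexp (z \<bullet> x)) =
         (CLINT x|\<nu>. (\<Prod>i\<in>S. indicator (A i) (x \<bullet> i)) * iexp (z \<bullet> x))"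
  using S A
proof (induction S arbitrary: z rule: finite_induct)
  case empty
  then show ?case using eq[of z] by (simp add: char_fun_def)
next
  case (insert i S)
  define w :: "'a \<Rightarrow> real" where "w = (\<lambda>x. \<Prod>j\<in>S. indicator (A j) (x \<bullet> j))"
  have [measurable]: "A j \<in> sets borel" if "j \<in> S" for j using insert that by auto
  have [measurable]: "A i \<in> sets borel" using insert by auto
  have w_meas [measurable]: "w \<in> borel_measurable borel"
    unfolding w_def by measurable
  have w01: "0 \<le> w x" "w x \<le> 1" for x
    unfolding w_def by (auto intro!: prod_nonneg prod_le_1)
  have wc: "complex_of_real (w x) = (\<Prod>j\<in>S. indicator (A j) (x \<bullet> j))" for x
    unfolding w_def by (simp add: of_real_prod of_real_indicator)
  have IH: "(CLINT x|\<mu>. w x * iexp (z \<bullet> x)) = (CLINT x|\<nu>. w x * iexp (z \<bullet> x))" for z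
    unfolding wc using insert by auto
  have int: "integrable m (\<lambda>x. complex_of_real (w x) * iexp (z \<bullet> x))" if "distribution m" for m z
  proof -
    interpret prob_space m using that by (simp add: distribution_def)
    have [measurable_cong]: "sets m = sets borel" using that by (simp add: distribution_def)
    show ?thesis using w01 by (intro integrable_const_bound[where B=1]) (auto simp: norm_mult)
  qed
  \<comment> \<open>The phase \<theta> stays free: adding the values for \<open>0\<close> and
    \<open>pi\<close> cancels the cosine and isolates the integral without it; after that,
    \<open>0\<close> and \<open>- pi / 2\<close> give the real and the imaginary part.\<close>
  define q where "q = (\<lambda>\<theta> x. w x * (1 + cos (z \<bullet> x + \<theta>)))"
  have q_meas [measurable]: "q \<theta> \<in> borel_measurable borel" for \<theta>
    unfolding q_def by measurable
  have q01: "0 \<le> q \<theta> x" "q \<theta> x \<le> 2" for \<theta> x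
  proof -
    have "-1 \<le> cos (z \<bullet> x + \<theta>)" "cos (z \<bullet> x + \<theta>) \<le> 1" by auto
    then have "0 \<le> 1 + cos (z \<bullet> x + \<theta>)" "1 + cos (z \<bullet> x + \<theta>) \<le> 2" by linarith+
    then show "0 \<le> q \<theta> x" "q \<theta> x \<le> 2" unfolding q_def
      using w01[of x] mult_mono[of "w x" 1 "1 + cos (z \<bullet> x + \<theta>)" 2] by auto
  qed
  have q_expand: "complex_of_real (q \<theta> x) * iexp (t * (x \<bullet> i)) =
      complex_of_real (w x) * iexp ((t *\<^sub>R i) \<bullet> x)
      + iexp \<theta> / 2 * (complex_of_real (w x) * iexp ((z + t *\<^sub>R i) \<bullet> x))
      + iexp (- \<theta>) / 2 * (complex_of_real (w x) * iexp ((t *\<^sub>R i - z) \<bullet> x))" for \<theta> x t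
    unfolding q_def of_real_mult of_real_add cos_of_real[symmetric] cos_exp_eq
    by (simp add: inner_commute[of x i] inner_add_left inner_diff_left exp_add exp_diff exp_minus field_simps)
  define m where "m = (\<lambda>\<theta> P. distr (density P (\<lambda>x. ennreal (q \<theta> x))) borel (\<lambda>x. x \<bullet> i))"
  have fin: "finite_measure (m \<theta> P)" "sets (m \<theta> P) = sets borel"
    and cf: "(CLINT y|m \<theta> P. iexp (t * y)) = (CLINT x|P. complex_of_real (w x) * iexp ((t *\<^sub>R i) \<bullet> x))
      + iexp \<theta> / 2 * (CLINT x|P. complex_of_real (w x) * iexp ((z + t *\<^sub>R i) \<bullet> x))
      + iexp (- \<theta>) / 2 * (CLINT x|P. complex_of_real (w x) * iexp ((t *\<^sub>R i - z) \<bullet> x))"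
    and em: "emeasure (m \<theta> P) B = (\<integral>\<^sup>+x. ennreal (q \<theta> x) * indicator B (x \<bullet> i) \<partial>P)"
      if P: "distribution P" and [measurable]: "B \<in> sets borel" for P \<theta> t B
  proof -
    interpret prob_space P using P by (simp add: distribution_def)
    have [measurable_cong]: "sets P = sets borel" using P by (simp add: distribution_def)
    have em: "emeasure (m \<theta> P) B = (\<integral>\<^sup>+x. ennreal (q \<theta> x) * indicator B (x \<bullet> i) \<partial>P)" if [measurable]: "B \<in> sets borel" for B
      unfolding m_def by (subst emeasure_distr) (auto simp: emeasure_density intro!: nn_integral_cong split: split_indicator)
    then show "emeasure (m \<theta> P) B = (\<integral>\<^sup>+x. ennreal (q \<theta> x) * indicator B (x \<bullet> i) \<partial>P)" by simp
    have "emeasure (m \<theta> P) UNIV = (\<integral>\<^sup>+x. ennreal (q \<theta> x) \<partial>P)"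
      by (subst em) auto
    also have "\<dots> \<le> (\<integral>\<^sup>+x. ennreal 2 \<partial>P)"
      by (intro nn_integral_mono ennreal_leI q01)
    also have "\<dots> < \<infinity>" by (simp add: emeasure_space_1)
    finally show "finite_measure (m \<theta> P)"
      by (intro finite_measureI) (auto simp: m_def)
    show "sets (m \<theta> P) = sets borel" by (simp add: m_def)
    have "(CLINT y|m \<theta> P. iexp (t * y)) = (CLINT x|P. complex_of_real (q \<theta> x) * iexp (t * (x \<bullet> i)))"
      unfolding m_def using q01 by (subst integral_distr) (auto simp: integral_density scaleR_conv_of_real)
    also have "\<dots> = (CLINT x|P. complex_of_real (w x) * iexp ((t *\<^sub>R i) \<bullet> x)
      + iexp \<theta> / 2 * (complex_of_real (w x) * iexp ((z + t *\<^sub>R i) \<bullet> x))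
      + iexp (- \<theta>) / 2 * (complex_of_real (w x) * iexp ((t *\<^sub>R i - z) \<bullet> x)))"
      unfolding q_expand ..
    also have "\<dots> = (CLINT x|P. complex_of_real (w x) * iexp ((t *\<^sub>R i) \<bullet> x))
      + iexp \<theta> / 2 * (CLINT x|P. complex_of_real (w x) * iexp ((z + t *\<^sub>R i) \<bullet> x))
      + iexp (- \<theta>) / 2 * (CLINT x|P. complex_of_real (w x) * iexp ((t *\<^sub>R i - z) \<bullet> x))"
      by (simp only: Bochner_Integration.integral_add Bochner_Integration.integrable_add integrable_mult_right integral_mult_right_zero int[OF P])
    finally show "(CLINT y|m \<theta> P. iexp (t * y)) = \<dots>" .
  qed
  have mm: "m \<theta> \<mu> = m \<theta> \<nu>" for \<theta>
  proof (rule finite_real_measure_eqI)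
    show "(CLINT x|m \<theta> \<mu>. iexp (t * x)) = (CLINT x|m \<theta> \<nu>. iexp (t * x))" for t
      unfolding cf[OF d(1) sets.empty_sets] cf[OF d(2) sets.empty_sets] IH ..
  qed (rule fin[OF d(1) sets.empty_sets] fin[OF d(2) sets.empty_sets])+
  have Q: "(LINT x|\<mu>. q \<theta> x * indicator (A i) (x \<bullet> i)) = (LINT x|\<nu>. q \<theta> x * indicator (A i) (x \<bullet> i))" for \<theta>
  proof -
    have "(LINT x|P. q \<theta> x * indicator (A i) (x \<bullet> i)) = enn2real (emeasure (m \<theta> P) (A i))" if P: "distribution P" for P
    proof -
      have [measurable_cong]: "sets P = sets borel" using P by (simp add: distribution_def)
      show ?thesis
        using q01 by (subst em[OF P]) (auto simp: integral_eq_nn_integral ennreal_mult ennreal_indicator intro!: arg_cong[of _ _ enn2real] nn_integral_cong)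
    qed
    then show ?thesis using d mm by simp
  qed
  have intr: "integrable P (\<lambda>x. w x * indicator (A i) (x \<bullet> i))" 
      "integrable P (\<lambda>x. w x * indicator (A i) (x \<bullet> i) * cos (z \<bullet> x + \<theta>))"
      "integrable P (\<lambda>x. q \<theta> x * indicator (A i) (x \<bullet> i))"
    if "distribution P" for P \<theta>
  proof -
    interpret prob_space P using that by (simp add: distribution_def)
    have [measurable_cong]: "sets P = sets borel" using that by (simp add: distribution_def)
    show "integrable P (\<lambda>x. w x * indicator (A i) (x \<bullet> i))" 
      using w01 by (intro integrable_const_bound[where B=1]) (auto split: split_indicator)
    show "integrable P (\<lambda>x. w x * indicator (A i) (x \<bullet> i) * cos (z \<bullet> x + \<theta>))" 
      using w01 by (intro integrable_const_bound[where B=1]) (auto split: split_indicator simp: abs_mult intro!: mult_le_one)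
    show "integrable P (\<lambda>x. q \<theta> x * indicator (A i) (x \<bullet> i))" 
      using q01 by (intro integrable_const_bound[where B=2]) (auto split: split_indicator)
  qed
  have Qsum: "(LINT x|P. q \<theta> x * indicator (A i) (x \<bullet> i)) = (LINT x|P. w x * indicator (A i) (x \<bullet> i))
     + (LINT x|P. w x * indicator (A i) (x \<bullet> i) * cos (z \<bullet> x + \<theta>))" if "distribution P" for P \<theta>
    using intr[OF that] by (subst Bochner_Integration.integral_add[symmetric]) (auto simp: q_def algebra_simps)
  define J where "J = (\<lambda>P. LINT x|P. w x * indicator (A i) (x \<bullet> i))"
  have J: "2 * J P = (LINT x|P. q 0 x * indicator (A i) (x \<bullet> i)) + (LINT x|P. q pi x * indicator (A i) (x \<bullet> i))"
    if P: "distribution P" for P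
  proof -
    have "(LINT x|P. w x * indicator (A i) (x \<bullet> i) * cos (z \<bullet> x + pi)) = - (LINT x|P. w x * indicator (A i) (x \<bullet> i) * cos (z \<bullet> x + 0))"
      by simp
    then show ?thesis unfolding Qsum[OF P] J_def by simp
  qed
  have Jeq: "J \<mu> = J \<nu>" using J[OF d(1)] J[OF d(2)] Q by simp
  have cs: "(LINT x|\<mu>. w x * indicator (A i) (x \<bullet> i) * cos (z \<bullet> x + \<theta>)) = (LINT x|\<nu>. w x * indicator (A i) (x \<bullet> i) * cos (z \<bullet> x + \<theta>))" for \<theta>
    using Q[of \<theta>] Qsum[OF d(1), of \<theta>] Qsum[OF d(2), of \<theta>] Jeq unfolding J_def by simp
  have final: "(CLINT x|P. (\<Prod>i\<in>insert i S. indicator (A i) (x \<bullet> i)) * iexp (z \<bullet> x)) =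
     complex_of_real (LINT x|P. w x * indicator (A i) (x \<bullet> i) * cos (z \<bullet> x + 0))
     + \<i> * complex_of_real (LINT x|P. w x * indicator (A i) (x \<bullet> i) * cos (z \<bullet> x + (- pi / 2)))" if P: "distribution P" for P
  proof -
    have "(CLINT x|P. (\<Prod>i\<in>insert i S. indicator (A i) (x \<bullet> i)) * iexp (z \<bullet> x)) =
      (CLINT x|P. complex_of_real (w x * indicator (A i) (x \<bullet> i) * cos (z \<bullet> x + 0)) + \<i> * complex_of_real (w x * indicator (A i) (x \<bullet> i) * cos (z \<bullet> x + (- pi / 2))))"
    proof (rule Bochner_Integration.integral_cong[OF refl])
      fix x
      have "iexp (z \<bullet> x) = complex_of_real (cos (z \<bullet> x + 0)) + \<i> * complex_of_real (cos (z \<bullet> x + (- pi / 2)))"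
        by (simp add: cos_add cos_diff cis_conv_exp[symmetric] complex_eq_iff)
      then show "(\<Prod>i\<in>insert i S. indicator (A i) (x \<bullet> i)) * iexp (z \<bullet> x) = complex_of_real (w x * indicator (A i) (x \<bullet> i) * cos (z \<bullet> x + 0)) + \<i> * complex_of_real (w x * indicator (A i) (x \<bullet> i) * cos (z \<bullet> x + (- pi / 2)))"
        using insert(1,2) by (simp add: wc[symmetric] algebra_simps of_real_indicator)
    qed
    also have "\<dots> = complex_of_real (LINT x|P. w x * indicator (A i) (x \<bullet> i) * cos (z \<bullet> x + 0))
     + \<i> * complex_of_real (LINT x|P. w x * indicator (A i) (x \<bullet> i) * cos (z \<bullet> x + (- pi / 2)))"
      using intr(2)[OF P, of 0] intr(2)[OF P, of "-pi/2"]
      by (subst Bochner_Integration.integral_add) (auto simp del: of_real_mult minus_divide_left)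
    finally show ?thesis .
  qed
  show ?case unfolding final[OF d(1)] final[OF d(2)] cs ..
qed

text \<open>With all coordinates treated and \<open>z = 0\<close>, the auxiliary lemma compares the
  masses of open boxes, which form an intersection-stable generator exhausting the space.\<close>

theorem char_fun_eq_imp_eq:
  fixes \<mu> \<nu> :: "'a::euclidean_space measure"
  assumes d: "distribution \<mu>" "distribution \<nu>"
    and eq: "\<And>z. char_fun \<mu> z = char_fun \<nu> z"
  shows "\<mu> = \<nu>"
proof -
  interpret \<mu>: prob_space \<mu> using d by (simp add: distribution_def)
  interpret \<nu>: prob_space \<nu> using d by (simp add: distribution_def)
  have s [measurable_cong]: "sets \<mu> = sets borel" "sets \<nu> = sets borel" using d by (simp_all add: distribution_def)
  let ?E = "range (\<lambda>(a, b). box a b :: 'a set)"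
  have box: "emeasure \<mu> (box a b) = emeasure \<nu> (box a b)" for a b :: 'a
  proof -
    have "complex_of_real (measure P (box a b)) = (CLINT x|P. (\<Prod>i\<in>Basis. indicator {a \<bullet> i<..<b \<bullet> i} (x \<bullet> i)) * iexp (0 \<bullet> x))"
      if P: "distribution P" for P :: "'a measure"
    proof -
      interpret P: prob_space P using P by (simp add: distribution_def)
      have [measurable_cong]: "sets P = sets borel" using P by (simp add: distribution_def)
      have "(\<Prod>i\<in>Basis. indicator {a \<bullet> i<..<b \<bullet> i} (x \<bullet> i)) = (indicator (box a b) x :: complex)" for x
        by (auto simp: box_def indicator_def prod_zero_iff split: if_splits)
      then have "(CLINT x|P. (\<Prod>i\<in>Basis. indicator {a \<bullet> i<..<b \<bullet> i} (x \<bullet> i)) * iexp (0 \<bullet> x)) =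
          (CLINT x|P. complex_of_real (indicator (box a b) x))"
        by (simp add: of_real_indicator)
      also have "\<dots> = complex_of_real (measure P (box a b))" by (subst integral_complex_of_real) simp
      finally show ?thesis ..
    qed
    then have "measure \<mu> (box a b) = measure \<nu> (box a b)"
      using char_fun_eq_imp_eq_aux[OF d eq finite_Basis subset_refl, of "\<lambda>i. {a \<bullet> i<..<b \<bullet> i}" 0] d
      by (metis (no_types, lifting) borel_open greaterThanLessThan_borel of_real_eq_iff)
    then show ?thesis by (simp add: \<mu>.emeasure_eq_measure \<nu>.emeasure_eq_measure)
  qed
  show ?thesis
  proof (rule measure_eqI_generator_eq[where E="?E" and \<Omega>=UNIV and A="\<lambda>n. box (- (real n *\<^sub>R One)) (real n *\<^sub>R One)"])
    show "Int_stable ?E" by (auto simp: Int_stable_def Int_interval box_Int_box)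
    show "emeasure \<mu> X = emeasure \<nu> X" if "X \<in> ?E" for X using that box by auto
    show "sets \<mu> = sigma_sets UNIV ?E" "sets \<nu> = sigma_sets UNIV ?E"
      by (simp_all add: s borel_eq_box sets_measure_of)
    show "(\<Union>i. box (- (real i *\<^sub>R One)) (real i *\<^sub>R One :: 'a)) = UNIV" by (rule UN_box_eq_UNIV)
  qed (auto)
qed

text \<open>By uniqueness, convolution roots may be sought among characteristic functions; all later
  proofs of infinite divisibility use this form.\<close>

lemma infinitely_divisibleI:
  assumes "distribution \<mu>"
    and "\<And>n. n \<ge> 1 \<Longrightarrow> \<exists>\<mu>\<^sub>n. distribution \<mu>\<^sub>n \<and> (\<forall>z. char_fun \<mu> z = char_fun \<mu>\<^sub>n z ^ n)"
  shows "infinitely_divisible \<mu>"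
  unfolding infinitely_divisible_def
proof (intro conjI allI impI assms)
  fix n :: nat assume "n \<ge> 1"
  from assms(2)[OF this] obtain m where m: "distribution m" "\<And>z. char_fun \<mu> z = char_fun m z ^ n" by blast
  then have "\<mu> = convolution_power m n"
    by (intro char_fun_eq_imp_eq assms distribution_convolution_power) (auto simp: char_fun_convolution_power)
  then show "\<exists>m. distribution m \<and> \<mu> = convolution_power m n" using m by blast
qed

lemma infinitely_divisibleD:
  assumes "infinitely_divisible \<mu>" "n \<ge> 1"
  shows "\<exists>\<mu>\<^sub>n. distribution \<mu>\<^sub>n \<and> \<mu> = convolution_power \<mu>\<^sub>n n \<and> (\<forall>z. char_fun \<mu> z = char_fun \<mu>\<^sub>n z ^ n)"
  using assms unfolding infinitely_divisible_def by (metis char_fun_convolution_power)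

section \<open>Logarithmic moments and random series\<close>

text \<open>For a probability law this is equivalent to integrability of
  \<open>log_plus (norm x)\<close>, but \<open>ln (1 + norm x)\<close> is subadditive in
  \<open>x\<close> without an additive constant.\<close>

definition log_moment :: "'a::euclidean_space measure \<Rightarrow> bool" where
  "log_moment \<mu> \<longleftrightarrow> (\<integral>\<^sup>+x. ennreal (ln (1 + norm x)) \<partial>\<mu>) < \<infinity>"

lemma ln_1_plus_norm_add_le:
  fixes x y :: "'a::real_normed_vector"
  shows "ln (1 + norm (x + y)) \<le> ln (1 + norm x) + ln (1 + norm y)"
proof -
  have "1 + norm (x + y) \<le> (1 + norm x) * (1 + norm y)"
    using norm_triangle_ineq[of x y] mult_nonneg_nonneg[of "norm x" "norm y"] by (simp add: algebra_simps del: mult_nonneg_nonneg)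
  moreover have "0 < 1 + norm x" "0 < 1 + norm y" "0 < 1 + norm (x + y)"
    by (simp_all add: add_pos_nonneg)
  ultimately show ?thesis
    by (metis ln_le_cancel_iff ln_mult_pos zero_less_mult_iff)
qed

text \<open>Fubini leaves some fixed \<open>x\<close> for which the translate of \<nu> by
  \<open>x\<close> has a finite logarithmic moment, and a translation changes
  \<open>ln (1 + norm y)\<close> by at most \<open>ln (1 + norm x)\<close>. This is how such moments
  reach roots and factors.\<close>

lemma log_moment_convolution_factor:
  assumes d: "distribution \<mu>" "distribution \<nu>" "distribution \<kappa>" and lm: "log_moment \<kappa>"
    and eq: "\<And>z. char_fun \<kappa> z = char_fun \<mu> z * char_fun \<nu> z"
  shows "log_moment \<nu>"
proof -
  interpret \<mu>: prob_space \<mu> using d by (simp add: distribution_def)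
  interpret \<nu>: prob_space \<nu> using d by (simp add: distribution_def)
  interpret pair_prob_space \<mu> \<nu> ..
  have [measurable_cong]: "sets \<mu> = sets borel" "sets \<nu> = sets borel"
    using d by (simp_all add: distribution_def)
  define P where "P = distr (\<mu> \<Otimes>\<^sub>M \<nu>) borel (\<lambda>(x, y). x + y)"
  have P: "distribution P"
    unfolding P_def by (rule distribution_distr) (auto intro: prob_space_axioms)
  have "char_fun P z = char_fun \<kappa> z" for z
  proof -
    have "char_fun P z = (CLINT p|\<mu> \<Otimes>\<^sub>M \<nu>. iexp (z \<bullet> fst p) * iexp (z \<bullet> snd p))"
      unfolding P_def
      by (subst char_fun_distr) (auto simp: inner_add_right ring_distribs exp_add case_prod_beta)
    also have "\<dots> = (CLINT x|\<mu>. CLINT y|\<nu>. iexp (z \<bullet> x) * iexp (z \<bullet> y))"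
      by (subst integral_fst'[symmetric]) (auto intro!: integrable_const_bound[where B=1] simp: norm_mult)
    finally show ?thesis using eq[of z] by (simp add: char_fun_def)
  qed
  then have "\<kappa> = P" using d P by (intro char_fun_eq_imp_eq) auto
  then have "(\<integral>\<^sup>+p. ennreal (ln (1 + norm (fst p + snd p))) \<partial>(\<mu> \<Otimes>\<^sub>M \<nu>)) < \<infinity>"
    using lm by (simp add: log_moment_def P_def nn_integral_distr case_prod_beta)
  then have "(\<integral>\<^sup>+x. (\<integral>\<^sup>+y. ennreal (ln (1 + norm (x + y))) \<partial>\<nu>) \<partial>\<mu>) < \<infinity>"
    by (subst (asm) \<nu>.nn_integral_fst[symmetric]) auto
  then have "AE x in \<mu>. (\<integral>\<^sup>+y. ennreal (ln (1 + norm (x + y))) \<partial>\<nu>) \<noteq> \<infinity>"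
    by (intro nn_integral_PInf_AE) auto
  then obtain x where x: "(\<integral>\<^sup>+y. ennreal (ln (1 + norm (x + y))) \<partial>\<nu>) \<noteq> \<infinity>"
    using eventually_happens'[OF \<mu>.ae_filter_bot] by blast
  have "(\<integral>\<^sup>+y. ennreal (ln (1 + norm y)) \<partial>\<nu>) \<le> (\<integral>\<^sup>+y. ennreal (ln (1 + norm (x + y))) + ennreal (ln (1 + norm x)) \<partial>\<nu>)"
  proof (intro nn_integral_mono)
    fix y
    have "ln (1 + norm y) \<le> ln (1 + norm (x + y)) + ln (1 + norm x)"
      using ln_1_plus_norm_add_le[of "x + y" "- x"] by simp
    then show "ennreal (ln (1 + norm y)) \<le> ennreal (ln (1 + norm (x + y))) + ennreal (ln (1 + norm x))"
      by (simp add: ennreal_plus[symmetric] del: ennreal_plus)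
  qed
  also have "\<dots> = (\<integral>\<^sup>+y. ennreal (ln (1 + norm (x + y))) \<partial>\<nu>) + ennreal (ln (1 + norm x))"
    by (subst nn_integral_add) (auto simp: \<nu>.emeasure_space_1)
  also have "\<dots> < \<infinity>" using x by (simp add: less_top)
  finally show ?thesis by (simp add: log_moment_def)
qed

lemma suminf_indicator_powers_le:
  fixes R y :: real
  assumes "R > 1" "y \<ge> 0"
  shows "(\<Sum>k. indicator {R ^ k..} y :: ennreal) \<le> ennreal (1 + ln (1 + y) / ln R)"
proof -
  define m where "m = nat \<lfloor>ln (1 + y) / ln R\<rfloor>"
  have R: "ln R > 0" using assms by simp
  have 0: "indicator {R ^ k..} y = (0 :: ennreal)" if "k \<notin> {..m}" for k
  proof -
    have "ln (1 + y) / ln R < real k"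
      using that assms R unfolding m_def by (simp add: not_le nat_less_iff floor_less_iff)
    then have "ln (1 + y) < real k * ln R" using R by (simp add: field_simps)
    also have "\<dots> = ln (R ^ k)" using assms by (simp add: ln_realpow)
    finally have "1 + y < R ^ k" using assms by (subst (asm) ln_less_cancel_iff) auto
    then show ?thesis by simp
  qed
  have "(\<Sum>k. indicator {R ^ k..} y :: ennreal) = (\<Sum>k\<le>m. indicator {R ^ k..} y)"
    by (rule suminf_finite) (use 0 in auto)
  also have "\<dots> \<le> (\<Sum>k\<le>m. 1)" by (intro sum_mono) (auto split: split_indicator)
  also have "\<dots> = ennreal (1 + real m)" by (simp add: ennreal_of_nat_eq_real_of_nat)
  also have "\<dots> \<le> ennreal (1 + ln (1 + y) / ln R)"
    using assms R unfolding m_def by (intro ennreal_leI) (auto simp: of_nat_nat)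
  finally show ?thesis .
qed

text \<open>The series is the expected number of powers of \<open>R\<close> not exceeding the norm,
  and that number is logarithmic in the norm. It serves as the input of Borel--Cantelli
  arguments.\<close>

lemma log_moment_summable_tails:
  fixes \<rho> :: "'a::euclidean_space measure"
  assumes d: "distribution \<rho>" and lm: "log_moment \<rho>" and R: "R > 1"
  shows "summable (\<lambda>k. measure \<rho> {x. R ^ k \<le> norm x})"
proof -
  interpret prob_space \<rho> using d by (simp add: distribution_def)
  have s [measurable_cong]: "sets \<rho> = sets borel"
    using d by (simp_all add: distribution_def)
  have "(\<Sum>k. emeasure \<rho> {x. R ^ k \<le> norm x}) = (\<Sum>k. \<integral>\<^sup>+x. indicator {R ^ k..} (norm x) \<partial>\<rho>)"
  proof (intro suminf_cong)
    fix k
    have "emeasure \<rho> {x. R ^ k \<le> norm x} = (\<integral>\<^sup>+x. indicator {x. R ^ k \<le> norm x} x \<partial>\<rho>)"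
      by (subst nn_integral_indicator) (auto simp: s)
    also have "\<dots> = (\<integral>\<^sup>+x. indicator {R ^ k..} (norm x) \<partial>\<rho>)"
      by (intro nn_integral_cong) (auto split: split_indicator)
    finally show "emeasure \<rho> {x. R ^ k \<le> norm x} = (\<integral>\<^sup>+x. indicator {R ^ k..} (norm x) \<partial>\<rho>)" .
  qed
  also have "\<dots> = (\<integral>\<^sup>+x. (\<Sum>k. indicator {R ^ k..} (norm x)) \<partial>\<rho>)"
    by (subst nn_integral_suminf) auto
  also have "\<dots> \<le> (\<integral>\<^sup>+x. 1 + ennreal (1 / ln R) * ennreal (ln (1 + norm x)) \<partial>\<rho>)"
  proof (intro nn_integral_mono)
    fix x :: 'a
    have "(\<Sum>k. indicator {R ^ k..} (norm x) :: ennreal) \<le> ennreal (1 + ln (1 + norm x) / ln R)"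
      by (rule suminf_indicator_powers_le) (use R in auto)
    also have "\<dots> = 1 + ennreal (1 / ln R) * ennreal (ln (1 + norm x))"
      using R ennreal_plus[of 1 "ln (1 + norm x) / ln R"] by (subst ennreal_mult[symmetric]) auto
    finally show "(\<Sum>k. indicator {R ^ k..} (norm x)) \<le> 1 + ennreal (1 / ln R) * ennreal (ln (1 + norm x))" .
  qed
  also have "\<dots> = 1 + ennreal (1 / ln R) * (\<integral>\<^sup>+x. ennreal (ln (1 + norm x)) \<partial>\<rho>)"
    by (subst nn_integral_add) (auto simp: nn_integral_cmult emeasure_space_1)
  also have "\<dots> < \<infinity>" using lm by (simp add: log_moment_def ennreal_mult_less_top)
  finally have "(\<Sum>k. ennreal (measure \<rho> {x. R ^ k \<le> norm x})) < \<infinity>"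
    by (simp add: emeasure_eq_measure)
  then show ?thesis
    by (intro summable_suminf_not_top) (auto simp: less_top)
qed

lemma char_fun_iid_sum:
  fixes \<rho> :: "'a::euclidean_space measure" and a :: "nat \<Rightarrow> real"
  assumes d: "distribution \<rho>"
  shows "(CLINT \<omega>|PiM UNIV (\<lambda>_. \<rho>). iexp (z \<bullet> (\<Sum>j<J. a j *\<^sub>R \<omega> j))) = (\<Prod>j<J. char_fun \<rho> (a j *\<^sub>R z))"
proof -
  interpret prob_space \<rho> using d by (simp add: distribution_def)
  interpret P: product_prob_space "\<lambda>_::nat. \<rho>" UNIV ..
  have s [measurable_cong]: "sets \<rho> = sets borel"
    using d by (simp_all add: distribution_def)
  have e: "iexp (z \<bullet> (\<Sum>j<J. a j *\<^sub>R \<omega> j)) = (\<Prod>j<J. iexp ((a j *\<^sub>R z) \<bullet> \<omega> j))" for \<omega>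
    by (simp add: inner_sum_right sum_distrib_left exp_sum)
  have "(CLINT \<omega>|PiM UNIV (\<lambda>_. \<rho>). iexp (z \<bullet> (\<Sum>j<J. a j *\<^sub>R \<omega> j)))
      = (CLINT \<omega>|PiM UNIV (\<lambda>_. \<rho>). (\<Prod>j<J. iexp ((a j *\<^sub>R z) \<bullet> (restrict \<omega> {..<J}) j)))"
    unfolding e by (intro Bochner_Integration.integral_cong prod.cong) auto
  also have "\<dots> = (CLINT \<omega>|distr (PiM UNIV (\<lambda>_. \<rho>)) (PiM {..<J} (\<lambda>_. \<rho>)) (\<lambda>\<omega>. restrict \<omega> {..<J}). (\<Prod>j<J. iexp ((a j *\<^sub>R z) \<bullet> \<omega> j)))"
    by (subst integral_distr) auto
  also have "distr (PiM UNIV (\<lambda>_. \<rho>)) (PiM {..<J} (\<lambda>_. \<rho>)) (\<lambda>\<omega>. restrict \<omega> {..<J}) = PiM {..<J} (\<lambda>_. \<rho>)"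
    by (rule P.distr_PiM_restrict_finite) auto
  also have "(CLINT \<omega>|PiM {..<J} (\<lambda>_. \<rho>). (\<Prod>j<J. iexp ((a j *\<^sub>R z) \<bullet> \<omega> j))) = (\<Prod>j<J. char_fun \<rho> (a j *\<^sub>R z))"
    unfolding char_fun_def
    by (rule P.product_integral_prod) (auto intro!: integrable_const_bound[where B=1])
  finally show ?thesis .
qed

text \<open>By Borel--Cantelli the iid terms are eventually bounded by \<open>b\<^bsup>-j/2\<^esup>\<close>, so the random series
  \<open>\<Sum>j. b\<^sup>j V\<^sub>j\<close> converges almost surely.\<close>

lemma log_moment_series:
  fixes \<rho> :: "'a::euclidean_space measure"
  assumes d: "distribution \<rho>" and lm: "log_moment \<rho>" and b: "0 < b" "b < 1"
  shows "\<exists>\<mu>. distribution \<mu> \<and> (\<forall>z. (\<lambda>J. \<Prod>j<J. char_fun \<rho> (b ^ j *\<^sub>R z)) \<longlonglongrightarrow> char_fun \<mu> z)"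
proof -
  interpret prob_space \<rho> using d by (simp add: distribution_def)
  interpret P: product_prob_space "\<lambda>_::nat. \<rho>" UNIV ..
  have s [measurable_cong]: "sets \<rho> = sets borel"
    using d by (simp_all add: distribution_def)
  define W where "W = PiM UNIV (\<lambda>_::nat. \<rho>)"
  have [measurable]: "(\<lambda>\<omega>. \<omega> j) \<in> borel_measurable W" for j
    unfolding W_def by measurable
  interpret W: prob_space W unfolding W_def by (rule P.prob_space_axioms)
  define R where "R = 1 / sqrt b"
  have R: "R > 1" using b by (simp add: R_def real_sqrt_lt_1_iff)
  have bR: "b * R < 1" "0 < b * R"
    using b by (auto simp: R_def real_div_sqrt)
  define A where "A = (\<lambda>j. {\<omega> \<in> space W. R ^ j \<le> norm (\<omega> j)})"
  have [measurable]: "A j \<in> sets W" for j unfolding A_def by measurable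
  have mA: "measure W (A j) = measure \<rho> {x. R ^ j \<le> norm x}" for j
  proof -
    have "\<rho> = distr W \<rho> (\<lambda>\<omega>. \<omega> j)"
      unfolding W_def by (rule distr_PiM_component[symmetric]) (auto intro: prob_space_axioms)
    then have "measure \<rho> {x. R ^ j \<le> norm x} = measure (distr W \<rho> (\<lambda>\<omega>. \<omega> j)) {x. R ^ j \<le> norm x}" by simp
    also have "\<dots> = measure W (A j)"
      by (subst measure_distr) (auto simp: A_def s intro!: arg_cong[of _ _ "measure W"])
    finally show ?thesis ..
  qed
  have "AE \<omega> in W. eventually (\<lambda>j. \<omega> \<in> space W - A j) sequentially"
    by (rule borel_cantelli_AE1) (auto simp: mA less_top[symmetric] intro: log_moment_summable_tails[OF d lm R])
  then have summ: "AE \<omega> in W. summable (\<lambda>j. b ^ j *\<^sub>R \<omega> j)"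
  proof eventually_elim
    case (elim \<omega>)
    have "summable (\<lambda>j. (b * R) ^ j)" using bR by (intro summable_geometric) auto
    moreover have "\<forall>\<^sub>F j in sequentially. norm (b ^ j *\<^sub>R \<omega> j) \<le> (b * R) ^ j"
      using elim by eventually_elim (use b in \<open>auto simp: A_def power_mult_distrib\<close>)
    ultimately show ?case by (rule summable_comparison_test_ev[rotated])
  qed
  define Z :: "(nat \<Rightarrow> 'a) \<Rightarrow> 'a" where "Z = (\<lambda>\<omega>. \<Sum>j. b ^ j *\<^sub>R \<omega> j)"
  have [measurable]: "Z \<in> borel_measurable W" unfolding Z_def by measurable
  have "(\<lambda>J. \<Prod>j<J. char_fun \<rho> (b ^ j *\<^sub>R z)) \<longlonglongrightarrow> char_fun (distr W borel Z) z" for z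
  proof -
    have "(\<lambda>J. CLINT \<omega>|W. iexp (z \<bullet> (\<Sum>j<J. b ^ j *\<^sub>R \<omega> j))) \<longlonglongrightarrow> (CLINT \<omega>|W. iexp (z \<bullet> Z \<omega>))"
    proof (rule integral_dominated_convergence[where w="\<lambda>_. 1"])
      show "AE \<omega> in W. (\<lambda>J. iexp (z \<bullet> (\<Sum>j<J. b ^ j *\<^sub>R \<omega> j))) \<longlonglongrightarrow> iexp (z \<bullet> Z \<omega>)"
        using summ
      proof eventually_elim
        case (elim \<omega>)
        then have "(\<lambda>J. \<Sum>j<J. b ^ j *\<^sub>R \<omega> j) \<longlonglongrightarrow> Z \<omega>"
          unfolding Z_def using summable_LIMSEQ by blast
        then show ?case by (intro tendsto_intros)
      qed
    qed auto
    then show ?thesis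
      unfolding char_fun_iid_sum[OF d, folded W_def] by (subst char_fun_distr) auto
  qed
  then show ?thesis
    by (intro exI[of _ "distr W borel Z"] conjI distribution_distr allI) (auto intro: W.prob_space_axioms)
qed

text \<open>The assumption \<open>pow\<close> supplies the law of the other \<open>n - 1\<close>
  summands, so that \<sigma> is a convolution factor of \<rho>.\<close>

lemma log_moment_root:
  fixes \<rho> :: "'a::euclidean_space measure"
  assumes d: "distribution \<rho>" "distribution \<sigma>" and lm: "log_moment \<rho>"
    and eq: "\<And>z. char_fun \<rho> z = char_fun \<sigma> z ^ n" and n: "n \<ge> 1"
    and pow: "\<exists>\<tau>. distribution \<tau> \<and> (\<forall>z. char_fun \<tau> z = char_fun \<sigma> z ^ (n - 1))"
  shows "log_moment \<sigma>"
proof -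
  obtain \<tau> where "distribution \<tau>" "\<And>z. char_fun \<tau> z = char_fun \<sigma> z ^ (n - 1)" using pow by blast
  then show ?thesis
    using n by (intro log_moment_convolution_factor[OF _ d(2) d(1) lm, of \<tau>]) (auto simp: eq power_eq_if mult.commute)
qed

text \<open>An \<open>n\<close>-th root of \<rho> inherits the logarithmic moment, so its own series
  of dilations converges; the \<open>n\<close>-th power of that limit is \<mu>.\<close>

lemma log_moment_series_infinitely_divisible:
  fixes \<rho> :: "'a::ordered_euclidean_space measure"
  assumes id: "infinitely_divisible \<rho>" and lm: "log_moment \<rho>" and b: "0 < b" "b < 1"
    and d: "distribution \<mu>" and lim: "\<And>z. (\<lambda>J. \<Prod>j<J. char_fun \<rho> (b ^ j *\<^sub>R z)) \<longlonglongrightarrow> char_fun \<mu> z"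
  shows "infinitely_divisible \<mu>"
proof (rule infinitely_divisibleI[OF d])
  fix n :: nat assume n: "n \<ge> 1"
  have d\<rho>: "distribution \<rho>" using id by (simp add: infinitely_divisible_def)
  obtain \<rho>' where \<rho>': "distribution \<rho>'" "\<And>z. char_fun \<rho> z = char_fun \<rho>' z ^ n"
    using infinitely_divisibleD[OF id n] by blast
  have "log_moment \<rho>'"
    using \<rho>' by (intro log_moment_root[OF d\<rho> _ lm _ n])
      (auto intro!: exI[of _ "convolution_power \<rho>' (n - 1)"] distribution_convolution_power char_fun_convolution_power)
  from log_moment_series[OF \<rho>'(1) this b] obtain \<mu>' where
    \<mu>': "distribution \<mu>'" "\<And>z. (\<lambda>J. \<Prod>j<J. char_fun \<rho>' (b ^ j *\<^sub>R z)) \<longlonglongrightarrow> char_fun \<mu>' z" by blast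
  have "char_fun \<mu> z = char_fun \<mu>' z ^ n" for z
  proof (rule LIMSEQ_unique[OF lim])
    show "(\<lambda>J. \<Prod>j<J. char_fun \<rho> (b ^ j *\<^sub>R z)) \<longlonglongrightarrow> char_fun \<mu>' z ^ n"
      unfolding \<rho>'(2) prod_power_distrib[symmetric] by (intro tendsto_power \<mu>')
  qed
  then show "\<exists>\<mu>\<^sub>n. distribution \<mu>\<^sub>n \<and> (\<forall>z. char_fun \<mu> z = char_fun \<mu>\<^sub>n z ^ n)" using \<mu>' by blast
qed

text \<open>After \<open>J\<close> iterations the remainder is the value at
  \<open>b ^ J *R z\<close>, which tends to 1. It is therefore eventually nonzero and may be divided
  by, even where the characteristic function at \<open>z\<close> vanishes.\<close>

lemma char_fun_scaling_product:
  assumes d: "distribution \<mu>" and b: "0 < b" "b < (1::real)"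
    and eq: "\<And>z. char_fun \<mu> z = char_fun \<mu> (b *\<^sub>R z) * g z"
  shows "(\<lambda>J. \<Prod>j<J. g (b ^ j *\<^sub>R z)) \<longlonglongrightarrow> char_fun \<mu> z"
proof -
  have prod: "char_fun \<mu> z = char_fun \<mu> (b ^ J *\<^sub>R z) * (\<Prod>j<J. g (b ^ j *\<^sub>R z))" for J
  proof (induction J)
    case (Suc J)
    then show ?case using eq[of "b ^ J *\<^sub>R z"] by (simp add: mult_ac)
  qed simp
  have "(\<lambda>J. b ^ J *\<^sub>R z) \<longlonglongrightarrow> 0 *\<^sub>R z"
    using b by (intro tendsto_intros LIMSEQ_realpow_zero) auto
  then have lim: "(\<lambda>J. char_fun \<mu> (b ^ J *\<^sub>R z)) \<longlonglongrightarrow> 1"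
    using char_fun_tendsto[OF d] d by fastforce
  then have "(\<lambda>J. char_fun \<mu> z / char_fun \<mu> (b ^ J *\<^sub>R z)) \<longlonglongrightarrow> char_fun \<mu> z / 1"
    by (intro tendsto_intros) auto
  moreover have "\<forall>\<^sub>F J in sequentially. char_fun \<mu> z / char_fun \<mu> (b ^ J *\<^sub>R z) = (\<Prod>j<J. g (b ^ j *\<^sub>R z))"
  proof -
    have "\<forall>\<^sub>F J in sequentially. char_fun \<mu> (b ^ J *\<^sub>R z) \<noteq> 0"
      using lim by (rule tendsto_imp_eventually_ne) simp
    then show ?thesis by eventually_elim (metis nonzero_mult_div_cancel_left prod)
  qed
  ultimately show ?thesis by (simp add: filterlim_cong)
qed

lemma infinitely_divisible_scaling_product:
  fixes \<mu> :: "'a::ordered_euclidean_space measure"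
  assumes d: "distribution \<mu>" and b: "0 < b" "b < 1"
    and id: "infinitely_divisible \<rho>" and lm: "log_moment \<rho>" 
    and eq: "\<And>z. char_fun \<mu> z = char_fun \<mu> (b *\<^sub>R z) * char_fun \<rho> z"
  shows "infinitely_divisible \<mu>"
  by (rule log_moment_series_infinitely_divisible[OF id lm b d char_fun_scaling_product[OF d b eq]])

section \<open>Geometric compounds and the exponential law\<close>

text \<open>A random sum whose number of terms \<open>k\<close> is drawn independently with weight
  \<open>a k\<close>; given \<open>k\<close>, the characteristic function is the \<open>k\<close>-th
  power. Drawing infinitely many terms in advance puts all cases on one probability space.\<close>

lemma compound_distribution:
  fixes \<rho> :: "'a::euclidean_space measure" and a :: "nat \<Rightarrow> real"
  assumes d: "distribution \<rho>" and a: "\<And>k. 0 \<le> a k" "a sums 1"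
  shows "\<exists>\<sigma>. distribution \<sigma> \<and> (\<forall>z. (\<lambda>k. complex_of_real (a k) * char_fun \<rho> z ^ k) sums char_fun \<sigma> z)"
proof -
  interpret prob_space \<rho> using d by (simp add: distribution_def)
  interpret P: product_prob_space "\<lambda>_::nat. \<rho>" UNIV ..
  have s [measurable_cong]: "sets \<rho> = sets borel"
    using d by (simp_all add: distribution_def)
  define W where "W = PiM UNIV (\<lambda>_::nat. \<rho>)"
  have [measurable]: "(\<lambda>\<omega>. \<omega> j) \<in> borel_measurable W" for j
    unfolding W_def by measurable
  interpret W: prob_space W unfolding W_def by (rule P.prob_space_axioms)
  define K where "K = density (count_space (UNIV :: nat set)) (\<lambda>k. ennreal (a k))"
  have "emeasure K UNIV = (\<Sum>k. ennreal (a k))"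
    unfolding K_def by (subst emeasure_density) (auto simp: nn_integral_count_space_nat)
  also have "\<dots> = 1"
    using a by (subst suminf_ennreal_eq) auto
  finally interpret K: prob_space K by (intro prob_spaceI) (simp add: K_def)
  have [measurable_cong]: "sets K = sets (count_space UNIV)" by (simp add: K_def)
  interpret KW: pair_prob_space K W ..
  define S :: "nat \<times> (nat \<Rightarrow> 'a) \<Rightarrow> 'a" where "S = (\<lambda>(k, \<omega>). \<Sum>j<k. \<omega> j :: 'a)"
  have [measurable]: "S \<in> borel_measurable (K \<Otimes>\<^sub>M W)"
  proof -
    have "(\<lambda>p. (\<lambda>k p. \<Sum>j<k. snd p j :: 'a) (fst p) p) \<in> borel_measurable (K \<Otimes>\<^sub>M W)"
      by (rule measurable_compose_countable) measurable
    then show ?thesis by (simp add: S_def case_prod_beta')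
  qed
  have "(\<lambda>k. complex_of_real (a k) * char_fun \<rho> z ^ k) sums char_fun (distr (K \<Otimes>\<^sub>M W) borel S) z" for z
  proof -
    have "char_fun (distr (K \<Otimes>\<^sub>M W) borel S) z = (CLINT k|K. (CLINT \<omega>|W. iexp (z \<bullet> S (k, \<omega>))))"
      by (subst char_fun_distr, simp) (auto intro!: KW.integral_fst'[symmetric] KW.integrable_const_bound[where B=1])
    also have "\<dots> = (CLINT k|K. char_fun \<rho> z ^ k)"
      using char_fun_iid_sum[OF d, where a="\<lambda>_. 1"] by (simp add: W_def S_def)
    also have "\<dots> = (CLINT k|count_space UNIV. complex_of_real (a k) * char_fun \<rho> z ^ k)"
      unfolding K_def using a by (subst integral_density) (auto simp: scaleR_conv_of_real)
    finally show ?thesis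
    proof (rule ssubst, intro sums_integral_count_space_nat)
      have "summable (\<lambda>k. norm (complex_of_real (a k) * char_fun \<rho> z ^ k))"
      proof (rule summable_comparison_test)
        show "\<exists>N. \<forall>n\<ge>N. norm (norm (complex_of_real (a n) * char_fun \<rho> z ^ n)) \<le> a n"
          using a norm_char_fun_le_1[OF d] by (auto simp: norm_mult norm_power mult_left_le power_le_one)
      qed (use a sums_summable in auto)
      then show "integrable (count_space UNIV) (\<lambda>k. complex_of_real (a k) * char_fun \<rho> z ^ k)"
        by (simp add: integrable_count_space_nat_iff)
    qed
  qed
  then show ?thesis
    by (intro exI[of _ "distr (K \<Otimes>\<^sub>M W) borel S"] conjI distribution_distr allI) (auto intro: KW.prob_space_axioms)
qed

text \<open>The \<open>n\<close>-th root of a geometric compound is the negative binomial compound of order \<open>1 / n\<close>.\<close>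

lemma geometric_compound_infinitely_divisible:
  fixes \<rho> :: "'a::ordered_euclidean_space measure"
  assumes d: "distribution \<rho>" and b: "0 < b" "b < 1"
  shows "\<exists>\<sigma>. infinitely_divisible \<sigma> \<and>
    (\<forall>z. char_fun \<sigma> z = complex_of_real b / (1 - complex_of_real (1 - b) * char_fun \<rho> z))"
proof -
  have root: "\<exists>\<sigma>. distribution \<sigma> \<and> (\<forall>z. char_fun \<sigma> z ^ n = complex_of_real b / (1 - complex_of_real (1 - b) * char_fun \<rho> z))"
    if n: "n \<ge> 1" for n :: nat
  proof -
    define r where "r = 1 / real n"
    have r: "r > 0" using n by (simp add: r_def)
    \<comment> \<open>Negative binomial weights: the coefficients of
      \<open>b^r (1 - (1 - b) w)^(-r)\<close> as a power series in \<open>w\<close>, nonnegative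
      because \<open>r > 0\<close>.\<close>
    define a where "a = (\<lambda>k. b powr r * pochhammer r k / fact k * (1 - b) ^ k)"
    have a0: "0 \<le> a k" for k
      unfolding a_def using r b by (auto intro!: mult_nonneg_nonneg divide_nonneg_nonneg pochhammer_nonneg)
    have S: "(\<lambda>k. complex_of_real (a k) * w ^ k) sums (complex_of_real b powr of_real r * (1 - complex_of_real (1 - b) * w) powr (- of_real r))"
      if w: "norm w \<le> 1" for w :: complex
    proof -
      have nz: "norm (- (complex_of_real (1 - b) * w)) < 1"
      proof -
        have "norm (- (complex_of_real (1 - b) * w)) = (1 - b) * norm w" using b by (simp only: norm_minus_cancel norm_mult norm_of_real)
        also have "\<dots> \<le> (1 - b) * 1" using w b by (intro mult_left_mono) auto
        finally show ?thesis using b by simp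
      qed
      have "complex_of_real (a k) * w ^ k = complex_of_real b powr of_real r * (((- of_real r) gchoose k) * (- (complex_of_real (1 - b) * w)) ^ k)" for k
      proof -
        have 1: "(- of_real r) gchoose k = (- 1) ^ k * complex_of_real (pochhammer r k) / fact k"
          by (simp add: gbinomial_pochhammer pochhammer_of_real)
        have 2: "(- (complex_of_real (1 - b) * w)) ^ k = (- 1) ^ k * complex_of_real ((1 - b) ^ k) * w ^ k"
          by (subst power_minus) (simp add: power_mult_distrib)
        have 3: "complex_of_real b powr of_real r = complex_of_real (b powr r)" using b by (simp add: powr_of_real)
        have 4: "(- 1 :: complex) ^ k * (- 1) ^ k = 1" by (metis power_mult_distrib mult_minus1 minus_minus power_one)
        have "complex_of_real b powr of_real r * (((- of_real r) gchoose k) * (- (complex_of_real (1 - b) * w)) ^ k)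
            = ((- 1) ^ k * (- 1) ^ k) * (complex_of_real (b powr r) * complex_of_real (pochhammer r k) / fact k * complex_of_real ((1 - b) ^ k) * w ^ k)"
          unfolding 1 2 3 by (simp add: mult_ac)
        also have "\<dots> = complex_of_real (a k) * w ^ k" unfolding 4 by (simp add: a_def)
        finally show ?thesis ..
      qed
      moreover have "(\<lambda>k. complex_of_real b powr of_real r * (((- of_real r) gchoose k) * (- (complex_of_real (1 - b) * w)) ^ k)) sums
          (complex_of_real b powr of_real r * (1 + (- (complex_of_real (1 - b) * w))) powr (- of_real r))"
        by (intro sums_mult gen_binomial_complex nz)
      ultimately show ?thesis by simp
    qed
    have a1: "a sums 1"
    proof -
      have "(1 - complex_of_real (1 - b) * 1) = complex_of_real b" by simp
      moreover have "complex_of_real b powr of_real r * complex_of_real b powr (- of_real r) = 1"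
        using b by (simp add: powr_minus)
      ultimately have "(\<lambda>k. complex_of_real (a k)) sums complex_of_real 1" using S[of 1] by simp
      then show ?thesis by (simp only: sums_of_real_iff)
    qed
    from compound_distribution[OF d a0 a1] obtain \<sigma> where \<sigma>: "distribution \<sigma>"
      "\<And>z. (\<lambda>k. complex_of_real (a k) * char_fun \<rho> z ^ k) sums char_fun \<sigma> z" by blast
    have "char_fun \<sigma> z ^ n = complex_of_real b / (1 - complex_of_real (1 - b) * char_fun \<rho> z)" for z
    proof -
      have nz: "1 - complex_of_real (1 - b) * char_fun \<rho> z \<noteq> 0"
      proof
        assume "1 - complex_of_real (1 - b) * char_fun \<rho> z = 0"
        then have "norm (complex_of_real (1 - b) * char_fun \<rho> z) = 1" by simp
        moreover have "norm (complex_of_real (1 - b) * char_fun \<rho> z) \<le> (1 - b) * 1"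
          unfolding norm_mult norm_of_real using b norm_char_fun_le_1[OF d] by (intro mult_mono) auto
        ultimately show False using b by simp
      qed
      \<comment> \<open>The principal branch is harmless: raising \<open>exp (r Ln x)\<close> to the
        power \<open>n = 1 / r\<close> returns \<open>x\<close>.\<close>
      have P: "(x powr of_real r) ^ n = x" "(x powr (- of_real r)) ^ n = 1 / x" if "x \<noteq> 0" for x :: complex
        using n that by (simp_all add: powr_def exp_of_nat_mult[symmetric] r_def exp_minus field_simps)
      have "char_fun \<sigma> z = complex_of_real b powr of_real r * (1 - complex_of_real (1 - b) * char_fun \<rho> z) powr (- of_real r)"
        using S[OF norm_char_fun_le_1[OF d]] \<sigma>(2) sums_unique2 by blast
      then show ?thesis using P(1)[of b] P(2)[OF nz] b by (simp add: power_mult_distrib)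
    qed
    then show ?thesis using \<sigma>(1) by blast
  qed
  \<comment> \<open>\<open>n = 1\<close> yields the compound law itself, the other \<open>n\<close>
    its roots.\<close>
  obtain \<sigma> where \<sigma>: "distribution \<sigma>" "\<And>z. char_fun \<sigma> z = complex_of_real b / (1 - complex_of_real (1 - b) * char_fun \<rho> z)"
    using root[of 1] by auto
  have "infinitely_divisible \<sigma>"
    by (rule infinitely_divisibleI[OF \<sigma>(1)]) (use root \<sigma>(2) in metis)
  then show ?thesis using \<sigma>(2) by blast
qed

definition exp_law :: "real measure" where
  "exp_law = density lborel (\<lambda>t. ennreal (exponential_density 1 t))"

lemma sets_exp_law [simp, measurable_cong]: "sets exp_law = sets borel"
  by (simp add: exp_law_def)

lemma prob_space_exp_law: "prob_space exp_law"
  unfolding exp_law_def by (rule prob_space_exponential_density) simp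

lemma distribution_exp_law: "distribution exp_law"
  by (simp add: distribution_def prob_space_exp_law)

lemma AE_exp_law_pos: "AE t in exp_law. 0 \<le> t"
  unfolding exp_law_def by (subst AE_density) (auto simp: exponential_density_def)

lemma nn_integral_exp_law:
  assumes [measurable]: "f \<in> borel_measurable borel"
  shows "(\<integral>\<^sup>+t. f t \<partial>exp_law) = (\<integral>\<^sup>+t. ennreal (exp (- t)) * f t * indicator {0..} t \<partial>lborel)"
  unfolding exp_law_def
  by (subst nn_integral_density) (auto simp: exponential_density_def intro!: nn_integral_cong split: split_indicator)

lemma exp_law_mean: "(\<integral>\<^sup>+t. ennreal t \<partial>exp_law) = 1"
proof -
  have "(\<integral>\<^sup>+t. ennreal t \<partial>exp_law) = (\<integral>\<^sup>+t. ennreal (t ^ 1 * exp (- t)) * indicator {0..} t \<partial>lborel)"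
    by (subst nn_integral_exp_law) (auto intro!: nn_integral_cong simp: ennreal_mult[symmetric] mult.commute split: split_indicator)
  then show ?thesis using nn_intergal_power_times_exp_Ici[of 1] by simp
qed

lemma LBINT_exp_complex:
  assumes "Re w < 0"
  shows "integrable lborel (\<lambda>t. indicator {0..} t *\<^sub>R exp (complex_of_real t * w))"
    and "(CLINT t|lborel. indicator {0..} t *\<^sub>R exp (complex_of_real t * w)) = - 1 / w"
proof -
  have w: "w \<noteq> 0" using assms by auto
  have n: "norm (exp (complex_of_real t * w)) = exp (Re w * t)" for t
    by (simp add: norm_exp_eq_Re mult.commute)
  have "((\<lambda>t. exp (Re w * t)) has_integral (- exp (Re w * 0) / Re w)) {0..}"
    using has_integral_exp_minus_to_infinity[of "- Re w" 0] assms by simp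
  then have "(\<lambda>t. exp (Re w * t)) absolutely_integrable_on {0..}"
    by (intro nonnegative_absolutely_integrable_1) (auto simp: integrable_on_def)
  then have "set_integrable lborel {0..} (\<lambda>t. exp (Re w * t))"
    by (simp add: set_integrable_def integrable_completion)
  then show int: "integrable lborel (\<lambda>t. indicator {0..} t *\<^sub>R exp (complex_of_real t * w))"
    unfolding set_integrable_def by (rule Bochner_Integration.integrable_bound) (auto simp: n mult.commute)
  have "(LBINT t=ereal 0..\<infinity>. exp (complex_of_real t * w)) = 0 - exp (complex_of_real 0 * w) / w"
  proof (rule interval_integral_FTC_integrable)
    show "((\<lambda>t. exp (complex_of_real t * w) / w) has_vector_derivative exp (complex_of_real x * w)) (at x)" for x
    proof -
      have "((\<lambda>t. exp (t * w) / w) has_field_derivative exp (complex_of_real x * w)) (at (complex_of_real x))"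
        using w by (auto intro!: derivative_eq_intros)
      then show ?thesis
        by (rule has_vector_derivative_real_field)
    qed
    show "set_integrable lborel (einterval (ereal 0) \<infinity>) (\<lambda>t. exp (complex_of_real t * w))"
      using int unfolding set_integrable_def by (rule Bochner_Integration.integrable_bound) (auto simp: einterval_def split: split_indicator)
    show "(((\<lambda>t. exp (complex_of_real t * w) / w) \<circ> real_of_ereal) \<longlongrightarrow> exp (complex_of_real 0 * w) / w) (at_right (ereal 0))"
      by (subst ereal_tendsto_simps) (auto intro!: tendsto_eq_intros simp: w)
    show "(((\<lambda>t. exp (complex_of_real t * w) / w) \<circ> real_of_ereal) \<longlongrightarrow> 0) (at_left \<infinity>)"
    proof (subst ereal_tendsto_simps)
      show "((\<lambda>t. exp (complex_of_real t * w) / w) \<longlongrightarrow> 0) at_top"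
      proof (rule tendsto_norm_zero_cancel)
        have "((\<lambda>t. exp (Re w * t) / norm w) \<longlongrightarrow> 0 / norm w) at_top"
          using assms w by (intro tendsto_divide) (real_asymp, auto)
        then show "((\<lambda>t. norm (exp (complex_of_real t * w) / w)) \<longlongrightarrow> 0) at_top"
          by (simp add: norm_divide n mult.commute)
      qed
    qed
    show "isCont (\<lambda>t. exp (complex_of_real t * w)) x" for x by (intro continuous_intros)
  qed auto
  also have "(LBINT t=ereal 0..\<infinity>. exp (complex_of_real t * w)) = (CLINT t|lborel. indicator {0..} t *\<^sub>R exp (complex_of_real t * w))"
    unfolding interval_lebesgue_integral_def set_lebesgue_integral_def
    by (auto simp: einterval_def indicator_def of_bool_def intro!: integral_cong_AE AE_I[where N="{0}"] split: if_splits)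
  finally show "(CLINT t|lborel. indicator {0..} t *\<^sub>R exp (complex_of_real t * w)) = - 1 / w" by simp
qed

lemma exp_law_integral_exp:
  assumes "Re w < 1"
  shows "(CLINT t|exp_law. exp (complex_of_real t * w)) = 1 / (1 - w)"
proof -
  have "(CLINT t|exp_law. exp (complex_of_real t * w)) = (CLINT t|lborel. exponential_density 1 t *\<^sub>R exp (complex_of_real t * w))"
    unfolding exp_law_def by (subst integral_density) (auto simp: exponential_density_def)
  also have "\<dots> = (CLINT t|lborel. indicator {0..} t *\<^sub>R exp (complex_of_real t * (w - 1)))"
    by (intro Bochner_Integration.integral_cong)
       (auto simp: exponential_density_def scaleR_conv_of_real ring_distribs exp_diff exp_minus exp_of_real[symmetric] field_simps split: split_indicator)
  also have "\<dots> = - 1 / (w - 1)" using assms by (intro LBINT_exp_complex) simp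
  also have "\<dots> = 1 / (1 - w)" by (metis minus_diff_eq minus_divide_divide)
  finally show ?thesis .
qed

lemma char_fun_exp_law: "char_fun exp_law z = 1 / (1 - \<i> * z)"
  using exp_law_integral_exp[of "\<i> * z"] by (simp add: char_fun_def mult_ac)

lemma log_moment_exp_law: "log_moment exp_law"
proof -
  have "(\<integral>\<^sup>+x. ennreal (ln (1 + norm x)) \<partial>exp_law) \<le> (\<integral>\<^sup>+t. ennreal t \<partial>exp_law)"
    using AE_exp_law_pos by (intro nn_integral_mono_AE, eventually_elim) (auto intro!: ennreal_leI ln_add_one_self_le_self)
  then show ?thesis unfolding log_moment_def exp_law_mean by (simp add: le_less_trans)
qed

text \<open>The function \<open>w\<close> below is \<open>1 / (1 - s)\<close> for some \<open>s\<close> with nonpositive real part, and \<open>w'\<close> is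
  \<open>1 / (1 - b s)\<close>.\<close>

lemma compound_exponential_identity:
  fixes s :: complex
  assumes "Re s \<le> 0" "0 < b" "b < 1"
  defines "w \<equiv> 1 / (1 - s)" and "w' \<equiv> 1 / (1 - of_real b * s)"
  shows "w = w' * (of_real b + of_real (1 - b) * w)"
    and "of_real b / (1 - of_real (1 - b) * w') = of_real b + of_real (1 - b) * w"
proof -
  have "Re (1 - s) > 0" "Re (1 - of_real b * s) > 0"
    using assms mult_nonneg_nonpos[of b "Re s"] by auto
  then have nz: "1 - s \<noteq> 0" "1 - of_real b * s \<noteq> 0" by fastforce+
  show "w = w' * (of_real b + of_real (1 - b) * w)"
    unfolding w_def w'_def using nz by (simp add: field_simps)
  have "1 - of_real (1 - b) * w' = of_real b * (1 - s) * w'"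
    unfolding w'_def using nz by (simp add: field_simps)
  moreover have "w' \<noteq> 0" using nz by (simp add: w'_def)
  ultimately show "of_real b / (1 - of_real (1 - b) * w') = of_real b + of_real (1 - b) * w"
    unfolding w_def w'_def using nz assms(2) by (simp add: field_simps)
qed

text \<open>The exponential law is its own dilation by \<open>b\<close> convolved with a law that is
  0 with probability \<open>b\<close> and exponential otherwise. The latter is a geometric compound
  of the dilated law, hence infinitely divisible, and iteration carries this over to the exponential
  law. The value \<open>1 / 2\<close> of \<open>b\<close> is arbitrary.\<close>

lemma exp_law_infinitely_divisible: "infinitely_divisible exp_law"
proof -
  define b :: real where "b = 1 / 2"
  have b: "0 < b" "b < 1" by (auto simp: b_def)
  define \<rho> where "\<rho> = distr exp_law borel (\<lambda>t. b * t)"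
  have \<rho>: "distribution \<rho>" unfolding \<rho>_def by (rule distribution_distr) (auto intro: prob_space_exp_law)
  have c\<rho>: "char_fun \<rho> z = 1 / (1 - of_real b * (\<i> * z))" for z
    unfolding \<rho>_def using char_fun_exp_law[of "b * z"] by (subst char_fun_distr) (auto simp: char_fun_def mult_ac)
  obtain \<sigma> where \<sigma>: "infinitely_divisible \<sigma>" "\<And>z. char_fun \<sigma> z = complex_of_real b / (1 - complex_of_real (1 - b) * char_fun \<rho> z)"
    using geometric_compound_infinitely_divisible[OF \<rho> b] by blast
  have d\<sigma>: "distribution \<sigma>" using \<sigma> by (simp add: infinitely_divisible_def)
  have eq: "char_fun exp_law z = char_fun exp_law (b *\<^sub>R z) * char_fun \<sigma> z" for z
  proof -
    have re: "Re (\<i> * complex_of_real z) \<le> 0" by simp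
    have "char_fun \<sigma> z = of_real b + of_real (1 - b) * (1 / (1 - \<i> * z))"
      unfolding \<sigma>(2) c\<rho> by (rule compound_exponential_identity(2)[OF re b])
    moreover have "char_fun exp_law (b *\<^sub>R z) = 1 / (1 - of_real b * (\<i> * z))"
      by (simp add: char_fun_exp_law mult_ac)
    ultimately show ?thesis
      using compound_exponential_identity(1)[OF re b] by (simp only: char_fun_exp_law)
  qed
  have "log_moment \<sigma>"
    using eq by (intro log_moment_convolution_factor[OF \<rho> d\<sigma> distribution_exp_law log_moment_exp_law])
       (simp add: c\<rho> char_fun_exp_law mult_ac)
  then show ?thesis
    by (rule infinitely_divisible_scaling_product[OF distribution_exp_law b \<sigma>(1) _ eq])
qed

text \<open>If a single summand were negative with probability \<open>p > 0\<close>, all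
  \<open>n\<close> of them would be with probability \<open>p ^ n\<close>. Consequently the roots of
  the exponential law are again laws of random times.\<close>

lemma convolution_power_nonneg_factor:
  fixes \<tau> :: "real measure"
  assumes d: "distribution \<tau>" and pos: "AE t in convolution_power \<tau> n. 0 \<le> t" and n: "n \<ge> 1"
  shows "AE t in \<tau>. 0 \<le> t"
proof -
  interpret prob_space \<tau> using d by (simp add: distribution_def)
  have s [measurable_cong, simp]: "sets \<tau> = sets borel" using d by (simp add: distribution_def)
  have fin: "finite_measure (convolution_power \<tau> k)" "sets (convolution_power \<tau> k) = sets borel" for k
    using distribution_convolution_power[OF d, of k] by (auto simp: distribution_def prob_space_def)
  have low: "emeasure \<tau> {..<0} * emeasure (convolution_power \<tau> k) {..0} \<le> emeasure (convolution_power \<tau> (Suc k)) {..<0}" for k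
  proof -
    have [measurable_cong]: "sets (convolution_power \<tau> k) = sets borel" by (rule fin)
    have "emeasure \<tau> {..<0} * emeasure (convolution_power \<tau> k) {..0} = (\<integral>\<^sup>+x. indicator {..<0} x * emeasure (convolution_power \<tau> k) {..0} \<partial>\<tau>)"
      by (subst nn_integral_multc) auto
    also have "\<dots> \<le> (\<integral>\<^sup>+x. emeasure (convolution_power \<tau> k) {a. a + x \<in> {..<0}} \<partial>\<tau>)"
      by (intro nn_integral_mono) (auto split: split_indicator intro!: emeasure_mono simp: fin)
    also have "\<dots> = emeasure (convolution_power \<tau> (Suc k)) {..<0}"
      using fin finite_measure_axioms sets_eq_imp_space_eq[OF s] sets_eq_imp_space_eq[OF fin(2)] by (simp add: convolution_emeasure)
    finally show ?thesis .
  qed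
  have pk: "emeasure \<tau> {..<0} ^ k \<le> emeasure (convolution_power \<tau> k) {..0}" for k
  proof (induction k)
    case (Suc k)
    have "emeasure \<tau> {..<0} ^ Suc k \<le> emeasure \<tau> {..<0} * emeasure (convolution_power \<tau> k) {..0}"
      using Suc by (simp add: mult_left_mono)
    also have "\<dots> \<le> emeasure (convolution_power \<tau> (Suc k)) {..<0}" by (rule low)
    also have "\<dots> \<le> emeasure (convolution_power \<tau> (Suc k)) {..0}" by (intro emeasure_mono) auto
    finally show ?case .
  qed simp
  obtain k where k: "n = Suc k" using n by (cases n) auto
  have "emeasure (convolution_power \<tau> n) {..<0} = 0"
    using pos by (subst (asm) AE_iff_measurable[where N="{..<0}"]) (auto simp: fin not_le sets_eq_imp_space_eq[OF fin(2)])
  then have "emeasure \<tau> {..<0} * emeasure \<tau> {..<0} ^ k = 0"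
    using low[of k] mult_left_mono[OF pk[of k], of "emeasure \<tau> {..<0}"] k by (metis le_zero_eq order_trans zero_le)
  then have "emeasure \<tau> {..<0} = 0" by (auto simp: power_0_left split: if_splits)
  then show ?thesis
    by (subst AE_iff_measurable[where N="{..<0}"]) (auto simp: not_le sets_eq_imp_space_eq[OF s])
qed

text \<open>Multiplicativity of the Laplace transform for nonnegative times. The truncation
  \<open>max 0 t\<close> keeps the integrand bounded on the whole line; it splits over a sum only
  for nonnegative summands, so nonnegativity is carried along in the induction.\<close>

lemma convolution_power_integral_exp:
  fixes \<tau> :: "real measure"
  assumes d: "distribution \<tau>" and pos: "AE t in \<tau>. 0 \<le> t" and w: "Re w \<le> 0"
  shows "(AE t in convolution_power \<tau> n. 0 \<le> t) \<and>
    (CLINT t|convolution_power \<tau> n. exp (complex_of_real (max 0 t) * w)) = (CLINT t|\<tau>. exp (complex_of_real (max 0 t) * w)) ^ n"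
proof (induction n)
  case 0
  have "AE t in return borel (0::real). 0 \<le> t" by (subst AE_return) auto
  then show ?case unfolding convolution_power.simps by (simp add: integral_return)
next
  case (Suc n)
  let ?P = "convolution_power \<tau> n"
  have dP: "distribution ?P" using d by (rule distribution_convolution_power)
  interpret t: prob_space \<tau> using d by (simp add: distribution_def)
  interpret Q: prob_space ?P using dP by (simp add: distribution_def)
  interpret pair_prob_space \<tau> ?P ..
  have [measurable_cong]: "sets \<tau> = sets borel" "sets ?P = sets borel" using d dP by (auto simp: distribution_def)
  have 1: "AE p in \<tau> \<Otimes>\<^sub>M ?P. 0 \<le> fst p" "AE p in \<tau> \<Otimes>\<^sub>M ?P. 0 \<le> snd p"
    using pos Suc by (auto simp: AE_pair_iff[symmetric] intro!: AE_pair_measure)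
  then have 2: "AE p in \<tau> \<Otimes>\<^sub>M ?P. 0 \<le> fst p + snd p" by eventually_elim simp
  have bd: "norm (exp (complex_of_real (max 0 t) * w)) \<le> 1" for t
    using w mult_nonneg_nonpos[of "max 0 t" "Re w"] by (simp add: norm_exp_eq_Re)
  have "(CLINT t|convolution_power \<tau> (Suc n). exp (complex_of_real (max 0 t) * w))
      = (CLINT p|\<tau> \<Otimes>\<^sub>M ?P. exp (complex_of_real (max 0 (fst p + snd p)) * w))"
    by (simp add: convolution_def integral_distr case_prod_beta)
  also have "\<dots> = (CLINT p|\<tau> \<Otimes>\<^sub>M ?P. exp (complex_of_real (max 0 (fst p)) * w) * exp (complex_of_real (max 0 (snd p)) * w))"
    using 1 by (intro integral_cong_AE) (auto simp: ring_distribs exp_add elim!: eventually_rev_mp)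
  also have "\<dots> = (CLINT x|\<tau>. CLINT y|?P. exp (complex_of_real (max 0 x) * w) * exp (complex_of_real (max 0 y) * w))"
    using bd by (subst integral_fst'[symmetric])
      (auto intro!: integrable_const_bound[where B=1] AE_I2 mult_le_one simp del: norm_exp_eq_Re simp: norm_mult)
  also have "\<dots> = (CLINT t|\<tau>. exp (complex_of_real (max 0 t) * w)) ^ Suc n"
    using Suc by simp
  finally show ?case using 2 unfolding convolution_power.simps convolution_def
    by (simp add: AE_distr_iff case_prod_beta)
qed

section \<open>Levy processes\<close>

lemma norm_exp_minus_1_le:
  fixes w :: complex
  assumes "Re w \<le> 0"
  shows "norm (exp w - 1) \<le> norm w"
proof -
  have "norm (exp w - exp 0) \<le> 1 * norm (w - 0)"
  proof (rule field_differentiable_bound[where S="{z. Re z \<le> 0}" and f'=exp])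
    show "convex {z. Re z \<le> 0}" by (rule convex_halfspace_Re_le)
  qed (use assms in \<open>auto intro!: derivative_eq_intros\<close>)
  then show ?thesis by simp
qed

text \<open>At most \<open>1 + ln x\<close> terms precede the index at which
  \<open>exp (- k) * x\<close> drops to 1 or below; each is at most 1. The rest is dominated by a
  geometric series with sum at most 2.\<close>

lemma suminf_min_exp_le:
  fixes x :: real
  assumes "x \<ge> 1"
  shows "summable (\<lambda>k. min 1 (exp (- real k) * x))" and "(\<Sum>k. min 1 (exp (- real k) * x)) \<le> 3 + ln x"
proof -
  define m where "m = nat \<lceil>ln x\<rceil>"
  have e: "exp (- real k) = exp (- 1) ^ k" for k :: nat
    by (simp add: exp_of_nat_mult[symmetric])
  have g: "summable (\<lambda>k. exp (- real k))" unfolding e by (intro summable_geometric) simp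
  then show s: "summable (\<lambda>k. min 1 (exp (- real k) * x))"
    by (intro summable_comparison_test[OF _ summable_mult2[OF g, of x]]) (use assms in \<open>auto intro!: exI[of _ 0]\<close>)
  have "(\<Sum>k. min 1 (exp (- real k) * x)) = (\<Sum>k. min 1 (exp (- real (k + m)) * x)) + (\<Sum>k<m. min 1 (exp (- real k) * x))"
    by (rule suminf_split_initial_segment[OF s])
  also have "(\<Sum>k. min 1 (exp (- real (k + m)) * x)) \<le> (\<Sum>k. exp (- real k))"
  proof (rule suminf_le)
    have "ln x \<le> real m" unfolding m_def using assms by (simp add: real_nat_ceiling_ge)
    then have "x \<le> exp (real m)" using assms by (metis exp_ln exp_le_cancel_iff less_le_trans zero_less_one)
    then have "exp (- real m) * x \<le> 1" by (simp add: exp_minus field_simps)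
    then have "exp (- real k) * (exp (- real m) * x) \<le> exp (- real k) * 1" for k by (intro mult_left_mono) auto
    moreover have "exp (- real (k + m)) * x = exp (- real k) * (exp (- real m) * x)" for k
      by (simp add: mult.assoc[symmetric] exp_add[symmetric])
    ultimately show "min 1 (exp (- real (k + m)) * x) \<le> exp (- real k)" for k
      by (intro min.coboundedI2) (simp only: mult_1_right)
    show "summable (\<lambda>k. min 1 (exp (- real (k + m)) * x))" using s by (subst summable_iff_shift)
  qed (rule g)
  also have "(\<Sum>k. exp (- real k)) = 1 / (1 - exp (-1))" unfolding e by (rule suminf_geometric) simp
  also have "\<dots> \<le> 2"
  proof -
    have "2 \<le> exp (1::real)" using exp_ge_add_one_self[of 1] by simp
    then have "exp (- 1) \<le> (1/2::real)" by (simp add: exp_minus field_simps)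
    then show ?thesis by (simp add: field_simps)
  qed
  also have "(\<Sum>k<m. min 1 (exp (- real k) * x)) \<le> (\<Sum>k<m. 1)" by (intro sum_mono) auto
  also have "\<dots> = real m" by simp
  also have "real m \<le> 1 + ln x"
  proof -
    have "0 \<le> ln x" using assms by simp
    then show ?thesis unfolding m_def by linarith
  qed
  finally show "(\<Sum>k. min 1 (exp (- real k) * x)) \<le> 3 + ln x" by simp
qed

text \<open>The logarithm is estimated by counting the levels \<open>2 * exp k\<close> reached by
  \<open>y\<close>; the levels have this form because the tail bound with
  \<open>u = exp (- k)\<close> works at \<open>2 / u\<close>. The term with \<open>ln 3\<close>
  absorbs rounding but vanishes at \<open>y = 0\<close>, which keeps bounds for integer-valued
  processes linear in time.\<close>

lemma ln_1_plus_le_suminf_indicator: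
  fixes y :: real
  assumes "y \<ge> 0"
  shows "ennreal (ln (1 + y)) \<le> ennreal (ln 3 * indicator {0<..} y) + (\<Sum>k. indicator {2 * exp (real k)..} y)"
proof (cases "y < 2")
  case True
  then have "ln (1 + y) \<le> ln 3 * indicator {0<..} y" using assms by (auto split: split_indicator)
  then show ?thesis by (meson add_increasing2 ennreal_leI zero_le)
next
  case False
  define m where "m = nat \<lfloor>ln (y / 2)\<rfloor>"
  have "ln (1 + y) \<le> ln (3 * (y / 2))" using False by (intro ln_mono) auto
  also have "\<dots> = ln 3 + ln (y / 2)" using False by (subst ln_mult_pos) auto
  also have "ln (y / 2) \<le> real (Suc m)" unfolding m_def using False by (simp add: of_nat_nat) linarith
  finally have le: "ln (1 + y) \<le> ln 3 + real (Suc m)" by simp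
  have "(\<Sum>k<Suc m. 1) \<le> (\<Sum>k<Suc m. indicator {2 * exp (real k)..} y :: ennreal)"
  proof (intro sum_mono)
    fix k assume "k \<in> {..<Suc m}"
    then have "int k \<le> \<lfloor>ln (y / 2)\<rfloor>" unfolding m_def using False by (auto simp: less_Suc_eq_le le_nat_iff)
    then have "real k \<le> ln (y / 2)" by (simp add: le_floor_iff)
    then have "exp (real k) \<le> y / 2" using False by (metis exp_le_cancel_iff exp_ln half_gt_zero less_le_trans not_less zero_less_numeral)
    then show "1 \<le> (indicator {2 * exp (real k)..} y :: ennreal)" by simp
  qed
  also have "\<dots> \<le> (\<Sum>k. indicator {2 * exp (real k)..} y :: ennreal)" by (rule sum_le_suminf) auto
  finally have "ennreal (real (Suc m)) \<le> (\<Sum>k. indicator {2 * exp (real k)..} y)"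
    by (simp add: ennreal_of_nat_eq_real_of_nat[symmetric] del: of_nat_Suc)
  then have "ennreal (ln 3) + ennreal (real (Suc m)) \<le> ennreal (ln 3 * indicator {0<..} y) + (\<Sum>k. indicator {2 * exp (real k)..} y)"
    using False by (intro add_mono) auto
  then show ?thesis using ennreal_leI[OF le] by (subst (asm) ennreal_plus[symmetric]) auto
qed

section \<open>Levy processes: the multiplicative semigroup of characteristic functions\<close>

locale levy_proc = prob_space M for M :: "'w measure" +
  fixes X :: "real \<Rightarrow> 'w \<Rightarrow> 'a::euclidean_space"
  assumes levy: "levy_process M X"
begin

lemma meas [measurable]: "t \<ge> 0 \<Longrightarrow> X t \<in> borel_measurable M"
  using levy by (simp add: levy_process_def)

lemma start_0: "AE \<omega> in M. X 0 \<omega> = 0"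
  using levy by (simp add: levy_process_def)

lemma distr_increment: "s \<ge> 0 \<Longrightarrow> t \<ge> 0 \<Longrightarrow> distr M borel (\<lambda>\<omega>. X (s + t) \<omega> - X s \<omega>) = distr M borel (X t)"
  using levy by (simp add: levy_process_def)

lemma indep_increments: "0 \<le> t 0 \<Longrightarrow> (\<And>i. i < n \<Longrightarrow> t i \<le> t (Suc i)) \<Longrightarrow>
   indep_vars (\<lambda>_. borel) (\<lambda>i \<omega>. X (t (Suc i)) \<omega> - X (t i) \<omega>) {..<n}"
  using levy unfolding levy_process_def by blast

lemma cadlag: "AE \<omega> in M. (\<forall>t\<ge>0. continuous (at_right t) (\<lambda>s. X s \<omega>)) \<and> (\<forall>t>0. \<exists>l. ((\<lambda>s. X s \<omega>) \<longlongrightarrow> l) (at_left t))"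
  using levy unfolding levy_process_def cadlag_paths_def by blast

lemma stoch_cont: "t \<ge> 0 \<Longrightarrow> \<epsilon> > 0 \<Longrightarrow> ((\<lambda>s. measure M {\<omega> \<in> space M. \<epsilon> < dist (X s \<omega>) (X t \<omega>)}) \<longlongrightarrow> 0) (at t within {0..})"
  using levy unfolding levy_process_def by blast

definition \<phi> :: "real \<Rightarrow> 'a \<Rightarrow> complex" where
  "\<phi> t z = char_fun (distr M borel (X t)) z"

lemma distribution_X: "t \<ge> 0 \<Longrightarrow> distribution (distr M borel (X t))"
  by (rule distribution_distr) (auto intro: prob_space_axioms)

lemma \<phi>_increment: "s \<ge> 0 \<Longrightarrow> t \<ge> 0 \<Longrightarrow> (CLINT \<omega>|M. iexp (z \<bullet> (X (s + t) \<omega> - X s \<omega>))) = \<phi> t z"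
  unfolding \<phi>_def distr_increment[symmetric] by (subst char_fun_distr) auto

lemma \<phi>_expectation: "t \<ge> 0 \<Longrightarrow> \<phi> t z = (CLINT \<omega>|M. iexp (z \<bullet> X t \<omega>))"
  unfolding \<phi>_def by (subst char_fun_distr) auto

lemma \<phi>_0: "\<phi> 0 z = 1"
proof -
  have "\<phi> 0 z = (CLINT \<omega>|M. 1)"
    unfolding \<phi>_expectation[OF order_refl] using start_0
    by (intro integral_cong_AE) (auto elim!: eventually_mono)
  then show ?thesis by (simp add: prob_space)
qed

lemma \<phi>_add:
  assumes "s \<ge> 0" "t \<ge> 0"
  shows "\<phi> (s + t) z = \<phi> s z * \<phi> t z"
proof -
  define \<tau> :: "nat \<Rightarrow> real" where "\<tau> = (\<lambda>i. if i = 0 then 0 else if i = 1 then s else s + t)"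
  have \<tau>: "\<tau> 0 = 0" "\<tau> 1 = s" "\<tau> (Suc (Suc 0)) = s + t" "\<tau> (Suc 0) = s" by (auto simp: \<tau>_def)
  have ind: "indep_vars (\<lambda>_. borel) (\<lambda>i \<omega>. X (\<tau> (Suc i)) \<omega> - X (\<tau> i) \<omega>) {..<2}"
    by (rule indep_increments) (use assms in \<open>auto simp: \<tau>_def\<close>)
  have "indep_vars (\<lambda>_. borel) (\<lambda>i \<omega>. iexp (z \<bullet> (X (\<tau> (Suc i)) \<omega> - X (\<tau> i) \<omega>))) {..<2}"
    by (rule indep_vars_compose2[OF ind]) measurable
  then have "(CLINT \<omega>|M. (\<Prod>i<2. iexp (z \<bullet> (X (\<tau> (Suc i)) \<omega> - X (\<tau> i) \<omega>)))) = (\<Prod>i<2. CLINT \<omega>|M. iexp (z \<bullet> (X (\<tau> (Suc i)) \<omega> - X (\<tau> i) \<omega>)))"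
  proof (rule indep_vars_lebesgue_integral[rotated])
    fix i :: nat assume "i \<in> {..<2}"
    have [measurable]: "X (\<tau> j) \<in> borel_measurable M" for j using assms by (auto simp: \<tau>_def)
    show "integrable M (\<lambda>\<omega>. iexp (z \<bullet> (X (\<tau> (Suc i)) \<omega> - X (\<tau> i) \<omega>)))"
      by (intro integrable_const_bound[where B=1]) auto
  qed auto
  also have "\<dots> = (CLINT \<omega>|M. iexp (z \<bullet> (X (0 + s) \<omega> - X 0 \<omega>))) * (CLINT \<omega>|M. iexp (z \<bullet> (X (s + t) \<omega> - X s \<omega>)))"
    by (simp add: numeral_2_eq_2 \<tau> lessThan_Suc mult.commute)
  also have "\<dots> = \<phi> s z * \<phi> t z" using assms by (subst (1 2) \<phi>_increment) auto
  also have "(CLINT \<omega>|M. (\<Prod>i<2. iexp (z \<bullet> (X (\<tau> (Suc i)) \<omega> - X (\<tau> i) \<omega>)))) = (CLINT \<omega>|M. iexp (z \<bullet> (X (s + t) \<omega> - X 0 \<omega>)))"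
    by (simp add: numeral_2_eq_2 \<tau> lessThan_Suc inner_diff_right exp_diff right_diff_distrib)
  also have "\<dots> = \<phi> (s + t) z" using \<phi>_increment[of 0 "s + t"] assms by simp
  finally show ?thesis .
qed

lemma \<phi>_mult: "t \<ge> 0 \<Longrightarrow> \<phi> (real n * t) z = \<phi> t z ^ n"
proof (induction n)
  case (Suc n)
  have "\<phi> (real (Suc n) * t) z = \<phi> (t + real n * t) z" by (simp add: ring_distribs)
  also have "\<dots> = \<phi> t z * \<phi> (real n * t) z" using Suc by (intro \<phi>_add) auto
  finally show ?case using Suc by simp
qed (simp add: \<phi>_0)

lemma AE_right_continuous_LIMSEQ:
  assumes t: "t \<ge> 0" and s: "s \<longlonglongrightarrow> t" "\<And>n. s n > t"
  shows "AE \<omega> in M. (\<lambda>n. X (s n) \<omega>) \<longlonglongrightarrow> X t \<omega>"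
  using cadlag
proof eventually_elim
  case (elim \<omega>)
  then have "((\<lambda>s. X s \<omega>) \<longlongrightarrow> X t \<omega>) (at_right t)" using t by (simp add: continuous_within)
  moreover have "filterlim s (at_right t) sequentially"
    using s by (auto simp: filterlim_at less_imp_neq[THEN not_sym])
  ultimately show ?case by (rule filterlim_compose)
qed

lemma \<phi>_right_LIMSEQ:
  assumes t: "t \<ge> 0" and s: "s \<longlonglongrightarrow> t" "\<And>n. s n > t"
  shows "(\<lambda>n. \<phi> (s n) z) \<longlonglongrightarrow> \<phi> t z"
proof -
  have [simp]: "s n \<ge> 0" for n using s(2)[of n] t by linarith
  have "(\<lambda>n. CLINT \<omega>|M. iexp (z \<bullet> X (s n) \<omega>)) \<longlonglongrightarrow> (CLINT \<omega>|M. iexp (z \<bullet> X t \<omega>))"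
  proof (rule integral_dominated_convergence[where w="\<lambda>_. 1"])
    show "AE \<omega> in M. (\<lambda>n. iexp (z \<bullet> X (s n) \<omega>)) \<longlonglongrightarrow> iexp (z \<bullet> X t \<omega>)"
      using AE_right_continuous_LIMSEQ[OF t s] by eventually_elim (intro tendsto_intros)
  qed (use t in auto)
  then show ?thesis using t by (simp add: \<phi>_expectation)
qed

end

section \<open>The Levy--Khintchine exponent and tail bounds derived from it\<close>

locale levy_lk = levy_proc M Y for M :: "'w measure" and Y :: "real \<Rightarrow> 'w \<Rightarrow> real^'d" +
  fixes A :: "real^'d^'d" and \<nu> :: "(real^'d) measure" and \<gamma> :: "real^'d"
  assumes lk: "levy_khintchine (distr M borel (Y 1)) A \<nu> \<gamma>"
begin

lemma sets_\<nu> [simp, measurable_cong]: "sets \<nu> = sets borel"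
  using lk by (simp add: levy_khintchine_def)

lemma nn_\<nu>: "(\<integral>\<^sup>+x. ennreal (min ((norm x)\<^sup>2) 1) \<partial>\<nu>) < \<infinity>"
  using lk by (simp add: levy_khintchine_def)

lemma integrable_min: "integrable \<nu> (\<lambda>x. min ((norm x)\<^sup>2) 1)"
  using nn_\<nu> by (intro integrableI_bounded) (auto simp: min_def)

definition k :: "real^'d \<Rightarrow> real^'d \<Rightarrow> complex" where
  "k z x = iexp (z \<bullet> x) - 1 - \<i> * complex_of_real (z \<bullet> x * indicator (cball 0 1) x)"

definition \<psi> :: "real^'d \<Rightarrow> complex" where
  "\<psi> z = - complex_of_real (z \<bullet> (A *v z)) / 2 + \<i> * complex_of_real (\<gamma> \<bullet> z) + (CLINT x|\<nu>. k z x)"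

lemma k_measurable [measurable]: "k z \<in> borel_measurable borel"
  unfolding k_def by (auto intro!: measurable_If borel_measurable_times borel_measurable_diff
      borel_measurable_indicator measurable_compose[OF _ borel_measurable_of_real] simp del: of_real_mult)

lemma \<phi>_1: "\<phi> 1 z = exp (\<psi> z)"
  using lk unfolding levy_khintchine_def \<phi>_def \<psi>_def k_def by blast

lemma k_small: "norm x \<le> 1 \<Longrightarrow> norm (k z x) \<le> (norm z)\<^sup>2 * (norm x)\<^sup>2 / 2"
proof -
  assume "norm x \<le> 1"
  then have "k z x = iexp (z \<bullet> x) - (\<Sum>j\<le>1. (\<i> * complex_of_real (z \<bullet> x)) ^ j / fact j)"
    by (simp add: k_def)
  then have "norm (k z x) \<le> \<bar>z \<bullet> x\<bar> ^ 2 / 2"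
    using iexp_approx1[of "z \<bullet> x" 1] by (simp add: numeral_2_eq_2)
  also have "\<bar>z \<bullet> x\<bar> ^ 2 \<le> (norm z * norm x)\<^sup>2" by (intro power_mono Cauchy_Schwarz_ineq2) auto
  finally show ?thesis by (simp add: power_mult_distrib)
qed

lemma k_large: "norm x > 1 \<Longrightarrow> norm (k z x) \<le> min 2 (norm z * norm x)"
proof -
  assume "norm x > 1"
  then have 0: "k z x = iexp (z \<bullet> x) - 1" by (simp add: k_def)
  have "norm (k z x) \<le> \<bar>z \<bullet> x\<bar>"
    using iexp_approx1[of "z \<bullet> x" 0] 0 by simp
  also have "\<dots> \<le> norm z * norm x" by (rule Cauchy_Schwarz_ineq2)
  finally show ?thesis
    using norm_triangle_ineq4[of "iexp (z \<bullet> x)" 1] 0 by simp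
qed

lemma k_bound:
  assumes "norm z \<le> B"
  shows "norm (k z x) \<le> (B\<^sup>2 / 2 + 2) * min ((norm x)\<^sup>2) 1"
proof (cases "norm x \<le> 1")
  case True
  then have "norm (k z x) \<le> (norm z)\<^sup>2 * (norm x)\<^sup>2 / 2" by (rule k_small)
  also have "\<dots> \<le> B\<^sup>2 * (norm x)\<^sup>2 / 2" using assms by (intro divide_right_mono mult_right_mono power_mono) auto
  also have "\<dots> \<le> (B\<^sup>2 / 2 + 2) * (norm x)\<^sup>2" by (simp add: ring_distribs)
  also have "(norm x)\<^sup>2 = min ((norm x)\<^sup>2) 1" using True by (simp add: power_le_one min_def)
  finally show ?thesis .
next
  case False
  then have "norm (k z x) \<le> 2" using k_large[of x z] by simp
  also have "\<dots> \<le> (B\<^sup>2 / 2 + 2) * 1" by simp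
  also have "1 = min ((norm x)\<^sup>2) 1" using False one_le_power[of "norm x" 2] by (simp add: min.absorb2)
  finally show ?thesis .
qed

lemma k_integrable: "integrable \<nu> (k z)"
  by (rule Bochner_Integration.integrable_bound[OF integrable_mult_right[OF integrable_min, of "(norm z)\<^sup>2 / 2 + 2"]])
     (use k_bound[OF order_refl, of z] in \<open>auto intro!: AE_I2 simp: abs_mult\<close>)

lemma \<psi>_tendsto:
  assumes u: "u \<longlonglongrightarrow> z"
  shows "(\<lambda>n. \<psi> (u n)) \<longlonglongrightarrow> \<psi> z"
proof -
  obtain B where B: "\<And>n. norm (u n) \<le> B"
    using convergent_imp_Bseq[of u] u by (auto simp: convergent_def Bseq_def)
  have "(\<lambda>n. CLINT x|\<nu>. k (u n) x) \<longlonglongrightarrow> (CLINT x|\<nu>. k z x)"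
  proof (rule integral_dominated_convergence[where w="\<lambda>x. (B\<^sup>2 / 2 + 2) * min ((norm x)\<^sup>2) 1"])
    show "AE x in \<nu>. (\<lambda>n. k (u n) x) \<longlonglongrightarrow> k z x" unfolding k_def by (intro AE_I2 tendsto_intros u)
    show "AE x in \<nu>. norm (k (u n) x) \<le> (B\<^sup>2 / 2 + 2) * min ((norm x)\<^sup>2) 1" for n using B k_bound by (intro AE_I2) auto
  qed (auto intro: integrable_min)
  moreover have "(\<lambda>n. A *v u n) \<longlonglongrightarrow> A *v z"
    by (rule bounded_linear.tendsto[OF _ u]) (simp add: linear_linear matrix_vector_mul_linear)
  ultimately show ?thesis unfolding \<psi>_def by (intro tendsto_intros u) auto
qed

lemma \<psi>_0 [simp]: "\<psi> 0 = 0"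
  by (simp add: \<psi>_def k_def)

lemma Re_\<psi>_le_0: "Re (\<psi> z) \<le> 0"
proof -
  have "norm (exp (\<psi> z)) \<le> 1" unfolding \<phi>_1[symmetric] \<phi>_def by (rule norm_char_fun_le_1[OF distribution_X]) simp
  then show ?thesis by simp
qed

text \<open>Along the segment from \<open>0\<close> to \<open>z\<close>, the quotient of \<open>\<phi>\<^bsub>1/n\<^esub>\<close> and \<open>exp (\<psi> / n)\<close> is
  continuous with values in the \<open>n\<close>-th roots of unity, hence constant.\<close>

lemma \<phi>_inverse_nat:
  assumes n: "n \<ge> 1"
  shows "\<phi> (1 / real n) z = exp (\<psi> z / of_nat n)"
proof -
  define q where "q = (\<lambda>r. \<phi> (1 / real n) (r *\<^sub>R z) * exp (- \<psi> (r *\<^sub>R z) / of_nat n))"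
  have qn: "q r ^ n = 1" for r
  proof -
    have "\<phi> (1 / real n) (r *\<^sub>R z) ^ n = exp (\<psi> (r *\<^sub>R z))"
      using \<phi>_mult[of "1 / real n" n "r *\<^sub>R z"] n \<phi>_1 by simp
    moreover have "exp (- \<psi> (r *\<^sub>R z) / of_nat n) ^ n = exp (- \<psi> (r *\<^sub>R z))"
      using n by (simp add: exp_of_nat_mult[symmetric])
    ultimately show ?thesis unfolding q_def by (simp add: power_mult_distrib exp_minus)
  qed
  have "continuous_on {0..1} q"
  proof (unfold continuous_on_sequentially comp_def, intro allI ballI impI)
    fix x a assume x: "(\<forall>n. x n \<in> {0..1::real}) \<and> x \<longlonglongrightarrow> a"
    then have "(\<lambda>n. x n *\<^sub>R z) \<longlonglongrightarrow> a *\<^sub>R z" by (intro tendsto_intros) auto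
    then show "(\<lambda>n. q (x n)) \<longlonglongrightarrow> q a" unfolding q_def \<phi>_def
      using n x by (intro tendsto_intros char_fun_tendsto distribution_X \<psi>_tendsto) auto
  qed
  moreover have "finite (q ` {0..1})"
  proof (rule finite_subset)
    show "q ` {0..1} \<subseteq> {w. w ^ n = 1}" using qn by auto
    show "finite {w::complex. w ^ n = 1}" using n by (intro finite_roots_unity) auto
  qed
  ultimately have "q constant_on {0..1}"
    by (intro continuous_finite_range_constant) auto
  then have "q 1 = q 0" unfolding constant_on_def by (metis atLeastAtMost_iff order_refl zero_le_one)
  also have "q 0 = 1" unfolding q_def \<phi>_def using n distribution_X by simp
  finally show ?thesis by (simp add: q_def exp_minus field_simps)
qed

text \<open>Rational times follow from inverse integers by taking powers. The remaining times are
  approached strictly from the right, which is why \<open>s n\<close> rounds \<open>t\<close> up by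
  adding 1 to the floor: right-continuity of paths is the continuity at hand.\<close>

lemma \<phi>_eq:
  assumes t: "t \<ge> 0"
  shows "\<phi> t z = exp (of_real t * \<psi> z)"
proof -
  have rat: "\<phi> (real m / real (Suc n)) z = exp (of_real (real m / real (Suc n)) * \<psi> z)" for m n
  proof -
    have "\<phi> (real m * (1 / real (Suc n))) z = exp (\<psi> z / of_nat (Suc n)) ^ m"
      by (subst \<phi>_mult) (simp, subst \<phi>_inverse_nat, auto)
    then show ?thesis by (simp add: exp_of_nat_mult[symmetric])
  qed
  define s where "s = (\<lambda>n. real (Suc (nat \<lfloor>real (Suc n) * t\<rfloor>)) / real (Suc n))"
  have s1: "s n > t" for n
  proof -
    have "real (Suc n) * t < real (Suc (nat \<lfloor>real (Suc n) * t\<rfloor>))" using t by (simp add: of_nat_nat) linarith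
    then show ?thesis unfolding s_def by (simp add: field_simps)
  qed
  have s2: "s n \<le> t + 1 / real (Suc n)" for n
  proof -
    have "0 \<le> real (Suc n) * t" using t by simp
    then have "real (Suc (nat \<lfloor>real (Suc n) * t\<rfloor>)) \<le> real (Suc n) * t + 1" by linarith
    then have "s n \<le> (real (Suc n) * t + 1) / real (Suc n)"
      unfolding s_def by (intro divide_right_mono) auto
    also have "\<dots> = t + 1 / real (Suc n)" by (simp only: add_divide_distrib) simp
    finally show ?thesis .
  qed
  have s: "s \<longlonglongrightarrow> t"
  proof (rule tendsto_sandwich)
    show "\<forall>\<^sub>F n in sequentially. t \<le> s n" using s1 by (auto intro!: always_eventually less_imp_le)
    show "\<forall>\<^sub>F n in sequentially. s n \<le> t + 1 / real (Suc n)" using s2 by auto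
    show "(\<lambda>n. t + 1 / real (Suc n)) \<longlonglongrightarrow> t" using LIMSEQ_inverse_real_of_nat_add[of t] by (simp add: inverse_eq_divide)
  qed auto
  have "(\<lambda>n. \<phi> (s n) z) \<longlonglongrightarrow> exp (of_real t * \<psi> z)"
    using s unfolding s_def rat by (intro tendsto_intros)
  then show ?thesis using \<phi>_right_LIMSEQ[OF t s s1] LIMSEQ_unique by blast
qed

definition K\<^sub>0 :: real where
  "K\<^sub>0 = onorm ((*v) A) / 2 + norm \<gamma> + (LINT x|\<nu>. min ((norm x)\<^sup>2) 1)"

text \<open>A majorant of the modulus of \<psi> on the ball of radius \<open>u\<close>, for
  \<open>u <= 1\<close>. Gaussian part, drift and small jumps are linear in \<open>u\<close>; large
  jumps keep the truncated form because its sum over \<open>u = exp (- k)\<close> is only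
  logarithmic in the jump size.\<close>

definition \<beta> :: "real \<Rightarrow> real" where
  "\<beta> u = K\<^sub>0 * u + (LINT x|\<nu>. indicator {x. norm x > 1} x * min 2 (u * norm x))"

lemma \<beta>_integrable:
  assumes "u \<ge> 0"
  shows "integrable \<nu> (\<lambda>x. indicator {x. norm x > 1} x * min 2 (u * norm x))"
proof (rule Bochner_Integration.integrable_bound[OF integrable_mult_right[OF integrable_min, of 2]])
  show "AE x in \<nu>. norm (indicator {x. norm x > 1} x * min 2 (u * norm x)) \<le> norm (2 * min ((norm x)\<^sup>2) 1)"
  proof (rule AE_I2)
    fix x :: "real^'d"
    show "norm (indicator {x. norm x > 1} x * min 2 (u * norm x)) \<le> norm (2 * min ((norm x)\<^sup>2) 1)"
    proof (cases "norm x > 1")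
      case True
      then have "min ((norm x)\<^sup>2) 1 = 1" using one_le_power[of "norm x" 2] by (simp add: min.absorb2)
      then show ?thesis using assms by (auto split: split_indicator)
    qed simp
  qed
qed auto

lemma norm_\<psi>_le_\<beta>:
  assumes z: "norm z \<le> u" and u: "u \<le> 1"
  shows "norm (\<psi> z) \<le> \<beta> u"
proof -
  have u0: "0 \<le> u" using z norm_ge_zero order_trans by blast
  have lin: "bounded_linear ((*v) A)" by (simp add: linear_linear matrix_vector_mul_linear)
  have uu: "u * u \<le> u" using u u0 by (simp add: mult_left_le)
  have "\<bar>z \<bullet> (A *v z)\<bar> \<le> norm z * (onorm ((*v) A) * norm z)"
    by (rule order_trans[OF Cauchy_Schwarz_ineq2]) (intro mult_left_mono onorm[OF lin], auto)
  also have "\<dots> \<le> onorm ((*v) A) * (u * u)"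
    using mult_left_mono[OF mult_mono[OF z z u0 norm_ge_zero] onorm_pos_le[OF lin]] by (simp only: mult_ac)
  also have "\<dots> \<le> onorm ((*v) A) * u" by (intro mult_left_mono uu onorm_pos_le lin)
  finally have 1: "norm (- complex_of_real (z \<bullet> (A *v z)) / 2) \<le> onorm ((*v) A) / 2 * u"
    by (simp add: norm_divide)
  have "\<bar>\<gamma> \<bullet> z\<bar> \<le> norm \<gamma> * u"
    by (rule order_trans[OF Cauchy_Schwarz_ineq2]) (use z in \<open>auto intro!: mult_left_mono\<close>)
  then have 2: "norm (\<i> * complex_of_real (\<gamma> \<bullet> z)) \<le> norm \<gamma> * u" by (simp add: norm_mult)
  have "norm (CLINT x|\<nu>. k z x) \<le> (LINT x|\<nu>. norm (k z x))" by (rule integral_norm_bound)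
  also have "\<dots> \<le> (LINT x|\<nu>. u * min ((norm x)\<^sup>2) 1 + indicator {x. norm x > 1} x * min 2 (u * norm x))"
  proof (rule integral_mono)
    show "integrable \<nu> (\<lambda>x. norm (k z x))" by (intro integrable_norm k_integrable)
    show "integrable \<nu> (\<lambda>x. u * min ((norm x)\<^sup>2) 1 + indicator {x. norm x > 1} x * min 2 (u * norm x))"
      by (intro Bochner_Integration.integrable_add integrable_mult_right integrable_min \<beta>_integrable u0)
    show "norm (k z x) \<le> u * min ((norm x)\<^sup>2) 1 + indicator {x. norm x > 1} x * min 2 (u * norm x)" for x
    proof (cases "norm x \<le> 1")
      case True
      then have "norm (k z x) \<le> (norm z)\<^sup>2 * (norm x)\<^sup>2 / 2" by (rule k_small)
      also have "\<dots> \<le> (norm z)\<^sup>2 * (norm x)\<^sup>2" by simp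
      also have "\<dots> \<le> u * (norm x)\<^sup>2"
        using z uu power_mono[OF z, of 2] by (intro mult_right_mono) (auto simp: power2_eq_square)
      finally show ?thesis using True by (simp add: power_le_one min_def)
    next
      case False
      then have "norm (k z x) \<le> min 2 (norm z * norm x)" by (intro k_large) auto
      also have "\<dots> \<le> min 2 (u * norm x)" using z by (auto simp: min_le_iff_disj intro!: min.mono mult_right_mono)
      also have "\<dots> \<le> u * min ((norm x)\<^sup>2) 1 + min 2 (u * norm x)" using u0 by simp
      finally show ?thesis using False by simp
    qed
  qed
  also have "\<dots> = u * (LINT x|\<nu>. min ((norm x)\<^sup>2) 1) + (LINT x|\<nu>. indicator {x. norm x > 1} x * min 2 (u * norm x))"
    by (subst Bochner_Integration.integral_add) (auto intro: integrable_min \<beta>_integrable u0)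
  finally have 3: "norm (CLINT x|\<nu>. k z x) \<le> u * (LINT x|\<nu>. min ((norm x)\<^sup>2) 1) + (LINT x|\<nu>. indicator {x. norm x > 1} x * min 2 (u * norm x))" .
  have "norm (\<psi> z) \<le> norm (- complex_of_real (z \<bullet> (A *v z)) / 2) + norm (\<i> * complex_of_real (\<gamma> \<bullet> z)) + norm (CLINT x|\<nu>. k z x)"
    unfolding \<psi>_def by (intro order_trans[OF norm_triangle_ineq] add_right_mono norm_triangle_ineq)
  then have "norm (\<psi> z) \<le> onorm ((*v) A) / 2 * u + norm \<gamma> * u + (u * (LINT x|\<nu>. min ((norm x)\<^sup>2) 1)
      + (LINT x|\<nu>. indicator {x. norm x > 1} x * min 2 (u * norm x)))"
    using 1 2 3 by linarith
  then show ?thesis unfolding \<beta>_def K\<^sub>0_def by (simp add: ring_distribs mult.commute)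
qed

lemma norm_1_minus_\<phi>_le:
  assumes "t \<ge> 0"
  shows "norm (1 - \<phi> t z) \<le> t * norm (\<psi> z)"
proof -
  have "norm (exp (of_real t * \<psi> z) - 1) \<le> norm (of_real t * \<psi> z)"
    using assms Re_\<psi>_le_0 by (intro norm_exp_minus_1_le) (auto simp: mult_nonneg_nonpos)
  then show ?thesis using assms by (simp add: \<phi>_eq norm_mult norm_minus_commute)
qed

text \<open>Averaging \<open>1 - cos\<close> over \<open>[0, 1]\<close> gives \<open>1 - sin a / a\<close>, which is at least \<open>1 / 2\<close> for \<open>\<bar>a\<bar> \<ge> 2\<close>.\<close>

lemma nn_integral_1_minus_cos_ge:
  fixes a :: real
  assumes "\<bar>a\<bar> \<ge> 2"
  shows "ennreal (1 / 2) \<le> (\<integral>\<^sup>+v. ennreal (1 - cos (a * v)) * indicator {0..1} v \<partial>lborel)"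
proof -
  have a: "a \<noteq> 0" using assms by auto
  have "(\<integral>\<^sup>+v. ennreal (1 - cos (a * v)) * indicator {0..1} v \<partial>lborel) = ennreal ((1 - sin (a * 1) / a) - (0 - sin (a * 0) / a))"
  proof (rule nn_integral_FTC_Icc)
    fix x :: real
    show "DERIV (\<lambda>v. v - sin (a * v) / a) x :> 1 - cos (a * x)"
      using a by (auto intro!: derivative_eq_intros simp: field_simps)
  qed auto
  moreover have "sin a / a \<le> 1 / 2"
  proof -
    have "\<bar>sin a\<bar> * 2 \<le> \<bar>a\<bar>" using assms abs_sin_le_one[of a] by linarith
    then have "\<bar>sin a / a\<bar> \<le> 1 / 2" using a by (simp add: abs_divide field_simps)
    then show ?thesis by linarith
  qed
  then have "ennreal (1 / 2) \<le> ennreal (1 - sin a / a)" by (intro ennreal_leI) simp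
  ultimately show ?thesis by simp
qed

text \<open>Fubini turns the inner average into values of \<open>1 - Re \<phi>\<close> along the
  segment from 0 to \<open>u\<close> times \<open>e\<close>, each at most \<open>t\<close> times the
  modulus of \<psi>. The bound is linear in \<open>t\<close> and needs no moments of
  \<open>Y t\<close>.\<close>

lemma nn_integral_1_minus_cos_Y_le:
  assumes t: "t \<ge> 0" and u: "0 < u" "u \<le> 1" and e: "norm e = 1"
  shows "(\<integral>\<^sup>+\<omega>. (\<integral>\<^sup>+v. ennreal (1 - cos (u * (e \<bullet> Y t \<omega>) * v)) * indicator {0..1} v \<partial>lborel) \<partial>M) \<le> ennreal (t * \<beta> u)"
proof -
  have [measurable]: "Y t \<in> borel_measurable M" using t by simp
  have "(\<integral>\<^sup>+\<omega>. (\<integral>\<^sup>+v. ennreal (1 - cos (u * (e \<bullet> Y t \<omega>) * v)) * indicator {0..1} v \<partial>lborel) \<partial>M)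
    = (\<integral>\<^sup>+v. (\<integral>\<^sup>+\<omega>. ennreal (1 - cos (u * (e \<bullet> Y t \<omega>) * v)) * indicator {0..1} v \<partial>M) \<partial>lborel)"
  proof -
    interpret pair_sigma_finite M lborel ..
    show ?thesis by (rule Fubini'[symmetric]) measurable
  qed
  also have "\<dots> \<le> (\<integral>\<^sup>+(v::real). ennreal (t * \<beta> u) * indicator {0..1} v \<partial>lborel)"
  proof (intro nn_integral_mono)
    fix v :: real
    show "(\<integral>\<^sup>+\<omega>. ennreal (1 - cos (u * (e \<bullet> Y t \<omega>) * v)) * indicator {0..1} v \<partial>M) \<le> ennreal (t * \<beta> u) * indicator {0..1} v"
    proof (cases "v \<in> {0..1}")
      case True
      let ?z = "(u * v) *\<^sub>R e"
      have int: "integrable M (\<lambda>\<omega>. iexp (?z \<bullet> Y t \<omega>))" by (intro integrable_const_bound[where B=1]) auto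
      have intc: "integrable M (\<lambda>\<omega>. 1 - cos (?z \<bullet> Y t \<omega>))" by (intro integrable_const_bound[where B=2]) auto
      have "(LINT \<omega>|M. 1 - cos (?z \<bullet> Y t \<omega>)) = (LINT \<omega>|M. Re (1 - iexp (?z \<bullet> Y t \<omega>)))"
        by (simp add: Re_exp)
      also have "\<dots> = Re (CLINT \<omega>|M. 1 - iexp (?z \<bullet> Y t \<omega>))"
        using int by (subst integral_Re) auto
      also have "\<dots> = Re (1 - \<phi> t ?z)"
        using int t by (simp add: \<phi>_expectation prob_space)
      also have "\<dots> \<le> norm (1 - \<phi> t ?z)" by (rule complex_Re_le_cmod)
      also have "\<dots> \<le> t * norm (\<psi> ?z)" by (rule norm_1_minus_\<phi>_le[OF t])
      also have "\<dots> \<le> t * \<beta> u"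
        using t u True e by (intro mult_left_mono norm_\<psi>_le_\<beta>) (auto simp: mult_left_le)
      finally have "(LINT \<omega>|M. 1 - cos (?z \<bullet> Y t \<omega>)) \<le> t * \<beta> u" .
      then have "(\<integral>\<^sup>+\<omega>. ennreal (1 - cos (?z \<bullet> Y t \<omega>)) \<partial>M) \<le> ennreal (t * \<beta> u)"
        using intc by (subst nn_integral_eq_integral) (auto intro: ennreal_leI)
      then show ?thesis using True by (simp add: mult_ac)
    qed simp
  qed
  also have "\<dots> = ennreal (t * \<beta> u)" by (simp add: nn_integral_cmult_indicator)
  finally show ?thesis .
qed

text \<open>A Chebyshev argument with the averaged \<open>1 - cos\<close> as test function, which is
  at least \<open>1 / 2\<close> on the event in question; hence the factor 2.\<close>

lemma tail_bound:
  assumes t: "t \<ge> 0" and u: "0 < u" "u \<le> 1" and e: "norm e = 1"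
  shows "measure M {\<omega> \<in> space M. 2 / u \<le> \<bar>e \<bullet> Y t \<omega>\<bar>} \<le> 2 * t * \<beta> u"
proof -
  have [measurable]: "Y t \<in> borel_measurable M" using t by simp
  let ?B = "{\<omega> \<in> space M. 2 / u \<le> \<bar>e \<bullet> Y t \<omega>\<bar>}"
  have "ennreal (1/2) * emeasure M ?B = (\<integral>\<^sup>+\<omega>. ennreal (1/2) * indicator ?B \<omega> \<partial>M)"
    by (simp add: nn_integral_cmult_indicator)
  also have "\<dots> \<le> (\<integral>\<^sup>+\<omega>. (\<integral>\<^sup>+v. ennreal (1 - cos (u * (e \<bullet> Y t \<omega>) * v)) * indicator {0..1} v \<partial>lborel) \<partial>M)"
  proof (intro nn_integral_mono)
    fix \<omega>
    show "ennreal (1/2) * indicator ?B \<omega> \<le> (\<integral>\<^sup>+v. ennreal (1 - cos (u * (e \<bullet> Y t \<omega>) * v)) * indicator {0..1} v \<partial>lborel)"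
    proof (cases "\<omega> \<in> ?B")
      case True
      then have "2 \<le> \<bar>u * (e \<bullet> Y t \<omega>)\<bar>" using u by (simp add: abs_mult field_simps)
      from nn_integral_1_minus_cos_ge[OF this] show ?thesis using True by simp
    qed simp
  qed
  also have "\<dots> \<le> ennreal (t * \<beta> u)" by (rule nn_integral_1_minus_cos_Y_le[OF t u e])
  finally have "ennreal (1/2) * ennreal (measure M ?B) \<le> ennreal (t * \<beta> u)"
    by (simp only: emeasure_eq_measure)
  moreover have "ennreal (1/2 * measure M ?B) = ennreal (1/2) * ennreal (measure M ?B)"
    by (rule ennreal_mult) auto
  ultimately have "ennreal (1/2 * measure M ?B) \<le> ennreal (t * \<beta> u)" by simp
  moreover have "0 \<le> t * \<beta> u"
    using t u norm_\<psi>_le_\<beta>[of 0 u] by simp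
  ultimately show ?thesis by (simp add: ennreal_le_iff)
qed

lemma K\<^sub>0_nonneg: "0 \<le> K\<^sub>0"
proof -
  have "bounded_linear ((*v) A)" by (simp add: linear_linear matrix_vector_mul_linear)
  then show ?thesis unfolding K\<^sub>0_def
    by (intro add_nonneg_nonneg divide_nonneg_nonneg onorm_pos_le integral_nonneg) (auto simp: min_def)
qed

lemma \<beta>_nonneg: "0 \<le> u \<Longrightarrow> 0 \<le> \<beta> u"
  unfolding \<beta>_def using K\<^sub>0_nonneg by (intro add_nonneg_nonneg integral_nonneg) auto

lemma emeasure_\<nu>_large: "emeasure \<nu> {x. 1 < norm x} < \<infinity>"
proof -
  have "emeasure \<nu> {x. 1 < norm x} = (\<integral>\<^sup>+x. indicator {x. 1 < norm x} x \<partial>\<nu>)"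
    by (subst nn_integral_indicator) auto
  also have "\<dots> \<le> (\<integral>\<^sup>+x. ennreal (min ((norm x)\<^sup>2) 1) \<partial>\<nu>)"
  proof (intro nn_integral_mono)
    fix x :: "real^'d"
    show "indicator {x. 1 < norm x} x \<le> ennreal (min ((norm x)\<^sup>2) 1)"
    proof (cases "1 < norm x")
      case True
      then have "min ((norm x)\<^sup>2) 1 = 1" using one_le_power[of "norm x" 2] by (simp add: min.absorb2)
      then show ?thesis by (simp split: split_indicator)
    qed simp
  qed
  finally show ?thesis using nn_\<nu> by (rule le_less_trans)
qed

end

section \<open>Logarithmic moments of \<open>Y t\<close>, growing at most linearly in
  \<open>t\<close>\<close>

locale levy_log = levy_lk M Y A \<nu> \<gamma>
  for M :: "'w measure" and Y :: "real \<Rightarrow> 'w \<Rightarrow> real^'d" and A \<nu> \<gamma> +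
  assumes log_moment_\<nu>: "(\<integral>\<^sup>+y. ennreal (log_plus (norm y)) \<partial>\<nu>) < \<infinity>"
begin

definition S\<^sub>0 :: ennreal where "S\<^sub>0 = (\<Sum>k. ennreal (\<beta> (exp (- real k))))"

text \<open>This is the entry point of the logarithmic condition on \<nu>: by Tonelli the truncated
  contributions of a jump \<open>x\<close> of norm above 1 are summed over all scales first, giving
  at most \<open>6 + 2 * ln (norm x)\<close>.\<close>

lemma S\<^sub>0_finite: "S\<^sub>0 < \<infinity>"
proof -
  let ?f = "\<lambda>k x. indicator {x. 1 < norm x} x * min 2 (exp (- real k) * norm x)"
  have "S\<^sub>0 = (\<Sum>k. ennreal (K\<^sub>0 * exp (- real k)) + (\<integral>\<^sup>+x. ennreal (?f k x) \<partial>\<nu>))"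
    unfolding S\<^sub>0_def \<beta>_def
  proof (intro suminf_cong)
    fix k :: nat
    have "ennreal (K\<^sub>0 * exp (- real k) + (LINT x|\<nu>. ?f k x)) = ennreal (K\<^sub>0 * exp (- real k)) + ennreal (LINT x|\<nu>. ?f k x)"
      using K\<^sub>0_nonneg by (intro ennreal_plus integral_nonneg) auto
    also have "ennreal (LINT x|\<nu>. ?f k x) = (\<integral>\<^sup>+x. ennreal (?f k x) \<partial>\<nu>)"
      by (rule nn_integral_eq_integral[symmetric]) (auto intro: \<beta>_integrable)
    finally show "ennreal (K\<^sub>0 * exp (- real k) + (LINT x|\<nu>. ?f k x)) = ennreal (K\<^sub>0 * exp (- real k)) + (\<integral>\<^sup>+x. ennreal (?f k x) \<partial>\<nu>)" .
  qed
  also have "\<dots> = (\<Sum>k. ennreal (K\<^sub>0 * exp (- real k))) + (\<Sum>k. \<integral>\<^sup>+x. ennreal (?f k x) \<partial>\<nu>)"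
    by (rule suminf_add[symmetric]) auto
  also have "(\<Sum>k. \<integral>\<^sup>+x. ennreal (?f k x) \<partial>\<nu>) = (\<integral>\<^sup>+x. (\<Sum>k. ennreal (?f k x)) \<partial>\<nu>)"
    by (rule nn_integral_suminf[symmetric]) measurable
  also have "\<dots> \<le> (\<integral>\<^sup>+x. 6 * indicator {x. 1 < norm x} x + 2 * ennreal (log_plus (norm x)) \<partial>\<nu>)"
  proof (intro nn_integral_mono)
    fix x :: "real^'d"
    show "(\<Sum>k. ennreal (?f k x)) \<le> 6 * indicator {x. 1 < norm x} x + 2 * ennreal (log_plus (norm x))"
    proof (cases "1 < norm x")
      case True
      then have sm: "summable (\<lambda>k. 2 * min 1 (exp (- real k) * norm x))" "(\<Sum>k. 2 * min 1 (exp (- real k) * norm x)) \<le> 2 * (3 + ln (norm x))"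
        using suminf_min_exp_le[of "norm x"] by (auto simp: suminf_mult)
      have "(\<Sum>k. ennreal (?f k x)) \<le> (\<Sum>k. ennreal (2 * min 1 (exp (- real k) * norm x)))"
        using True by (intro suminf_le ennreal_leI) (auto simp: min_def)
      also have "\<dots> = ennreal (\<Sum>k. 2 * min 1 (exp (- real k) * norm x))"
        using sm by (intro suminf_ennreal2) auto
      also have "\<dots> \<le> ennreal (6 + 2 * ln (norm x))" using sm by (intro ennreal_leI) simp
      also have "\<dots> = 6 + 2 * ennreal (log_plus (norm x))"
      proof -
        have "x \<noteq> 0" using True by auto
        then show ?thesis using True by (simp add: log_plus_def ennreal_mult ennreal_plus[of 6, simplified])
      qed
      finally show ?thesis using True by simp
    qed simp
  qed
  also have "\<dots> = 6 * emeasure \<nu> {x. 1 < norm x} + 2 * (\<integral>\<^sup>+x. ennreal (log_plus (norm x)) \<partial>\<nu>)"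
  proof -
    have [measurable]: "(\<lambda>x::real^'d. log_plus (norm x)) \<in> borel_measurable borel"
      unfolding log_plus_def by measurable
    show ?thesis by (subst nn_integral_add) (auto simp: nn_integral_cmult)
  qed
  finally have le: "S\<^sub>0 \<le> (\<Sum>k. ennreal (K\<^sub>0 * exp (- real k))) + (6 * emeasure \<nu> {x. 1 < norm x} + 2 * (\<integral>\<^sup>+x. ennreal (log_plus (norm x)) \<partial>\<nu>))"
    by (simp add: add_left_mono)
  have "summable (\<lambda>k. K\<^sub>0 * exp (- real k))"
  proof -
    have "exp (- real k) = exp (- 1) ^ k" for k :: nat by (simp add: exp_of_nat_mult[symmetric])
    then show ?thesis by (auto intro!: summable_mult summable_geometric)
  qed
  then have "(\<Sum>k. ennreal (K\<^sub>0 * exp (- real k))) \<noteq> top"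
    by (rule ennreal_suminf_neq_top) (simp add: K\<^sub>0_nonneg)
  then have "(\<Sum>k. ennreal (K\<^sub>0 * exp (- real k))) < \<infinity>"
    unfolding infinity_ennreal_def by (rule less_top[THEN iffD1])
  then have "(\<Sum>k. ennreal (K\<^sub>0 * exp (- real k))) + (6 * emeasure \<nu> {x. 1 < norm x} + 2 * (\<integral>\<^sup>+x. ennreal (log_plus (norm x)) \<partial>\<nu>)) < \<infinity>"
    using emeasure_\<nu>_large log_moment_\<nu> unfolding infinity_ennreal_def
    by (simp only: ennreal_add_less_top ennreal_mult_less_top) simp
  with le show ?thesis by (rule le_less_trans)
qed

lemma tail_sum:
  assumes t: "t \<ge> 0" and e: "norm e = 1"
  shows "(\<integral>\<^sup>+\<omega>. (\<Sum>k. indicator {2 * exp (real k)..} \<bar>e \<bullet> Y t \<omega>\<bar>) \<partial>M) \<le> ennreal (2 * t) * S\<^sub>0"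
proof -
  have [measurable]: "Y t \<in> borel_measurable M" using t by simp
  have "(\<integral>\<^sup>+\<omega>. (\<Sum>k. indicator {2 * exp (real k)..} \<bar>e \<bullet> Y t \<omega>\<bar>) \<partial>M) = (\<Sum>k. \<integral>\<^sup>+\<omega>. indicator {2 * exp (real k)..} \<bar>e \<bullet> Y t \<omega>\<bar> \<partial>M)"
    by (rule nn_integral_suminf) measurable
  also have "\<dots> \<le> (\<Sum>k. ennreal (2 * t) * ennreal (\<beta> (exp (- real k))))"
  proof (intro suminf_le)
    fix k :: nat
    have "(\<integral>\<^sup>+\<omega>. indicator {2 * exp (real k)..} \<bar>e \<bullet> Y t \<omega>\<bar> \<partial>M) = (\<integral>\<^sup>+\<omega>. indicator {\<omega> \<in> space M. 2 / exp (- real k) \<le> \<bar>e \<bullet> Y t \<omega>\<bar>} \<omega> \<partial>M)"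
      by (intro nn_integral_cong) (auto simp: exp_minus field_simps split: split_indicator)
    also have "\<dots> = ennreal (measure M {\<omega> \<in> space M. 2 / exp (- real k) \<le> \<bar>e \<bullet> Y t \<omega>\<bar>})"
      by (simp add: emeasure_eq_measure)
    also have "\<dots> \<le> ennreal (2 * t * \<beta> (exp (- real k)))"
      by (intro ennreal_leI tail_bound t e) auto
    also have "\<dots> = ennreal (2 * t) * ennreal (\<beta> (exp (- real k)))"
      using t \<beta>_nonneg by (intro ennreal_mult) auto
    finally show "(\<integral>\<^sup>+\<omega>. indicator {2 * exp (real k)..} \<bar>e \<bullet> Y t \<omega>\<bar> \<partial>M) \<le> ennreal (2 * t) * ennreal (\<beta> (exp (- real k)))" .
  qed auto
  also have "\<dots> = ennreal (2 * t) * S\<^sub>0" by (simp add: S\<^sub>0_def)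
  finally show ?thesis .
qed

text \<open>The tail bounds concern linear functionals, so the norm is split into coordinates. The
  indicator term is left unevaluated: in general it is only bounded, but for integer values its
  integral is of order \<open>t\<close>.\<close>

lemma nn_integral_ln_le:
  assumes t: "t \<ge> 0"
  shows "(\<integral>\<^sup>+\<omega>. ennreal (ln (1 + norm (Y t \<omega>))) \<partial>M) \<le>
    (\<Sum>e\<in>(Basis :: (real^'d) set). (\<integral>\<^sup>+\<omega>. ennreal (ln 3 * indicator {0<..} \<bar>e \<bullet> Y t \<omega>\<bar>) \<partial>M) + ennreal (2 * t) * S\<^sub>0)"
proof -
  have [measurable]: "Y t \<in> borel_measurable M" using t by simp
  have ln_sum: "ln (1 + norm (sum f B)) \<le> (\<Sum>b\<in>B. ln (1 + norm (f b)))" if "finite B" for B and f :: "real^'d \<Rightarrow> real^'d"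
    using that
  proof induction
    case (insert b B)
    then show ?case using ln_1_plus_norm_add_le[of "f b" "sum f B"] by simp
  qed simp
  have "ennreal (ln (1 + norm y)) \<le> (\<Sum>e\<in>Basis. ennreal (ln 3 * indicator {0<..} \<bar>e \<bullet> y\<bar>) + (\<Sum>k. indicator {2 * exp (real k)..} \<bar>e \<bullet> y\<bar>))" for y :: "real^'d"
  proof -
    have "ln (1 + norm y) = ln (1 + norm (\<Sum>e\<in>Basis. (e \<bullet> y) *\<^sub>R e))"
      unfolding inner_commute[of _ y] by (simp only: euclidean_representation)
    also have "\<dots> \<le> (\<Sum>e\<in>Basis. ln (1 + norm ((e \<bullet> y) *\<^sub>R e)))" by (rule ln_sum) simp
    also have "\<dots> = (\<Sum>e\<in>Basis. ln (1 + \<bar>e \<bullet> y\<bar>))" by (intro sum.cong) auto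
    finally have "ennreal (ln (1 + norm y)) \<le> (\<Sum>e\<in>Basis. ennreal (ln (1 + \<bar>e \<bullet> y\<bar>)))"
      by (subst sum_ennreal) (auto intro: ennreal_leI)
    also have "\<dots> \<le> (\<Sum>e\<in>Basis. ennreal (ln 3 * indicator {0<..} \<bar>e \<bullet> y\<bar>) + (\<Sum>k. indicator {2 * exp (real k)..} \<bar>e \<bullet> y\<bar>))"
      by (intro sum_mono ln_1_plus_le_suminf_indicator) simp
    finally show ?thesis .
  qed
  then have "(\<integral>\<^sup>+\<omega>. ennreal (ln (1 + norm (Y t \<omega>))) \<partial>M) \<le> (\<integral>\<^sup>+\<omega>. (\<Sum>e\<in>Basis. ennreal (ln 3 * indicator {0<..} \<bar>e \<bullet> Y t \<omega>\<bar>) + (\<Sum>k. indicator {2 * exp (real k)..} \<bar>e \<bullet> Y t \<omega>\<bar>)) \<partial>M)"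
    by (intro nn_integral_mono)
  also have "\<dots> = (\<Sum>e\<in>(Basis :: (real^'d) set). (\<integral>\<^sup>+\<omega>. ennreal (ln 3 * indicator {0<..} \<bar>e \<bullet> Y t \<omega>\<bar>) \<partial>M) + (\<integral>\<^sup>+\<omega>. (\<Sum>k. indicator {2 * exp (real k)..} \<bar>e \<bullet> Y t \<omega>\<bar>) \<partial>M))"
    by (subst nn_integral_sum) (auto simp: nn_integral_add)
  also have "\<dots> \<le> (\<Sum>e\<in>(Basis :: (real^'d) set). (\<integral>\<^sup>+\<omega>. ennreal (ln 3 * indicator {0<..} \<bar>e \<bullet> Y t \<omega>\<bar>) \<partial>M) + ennreal (2 * t) * S\<^sub>0)"
    using t by (intro sum_mono add_left_mono tail_sum) auto
  finally show ?thesis .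
qed

lemma nn_integral_ln_linear:
  obtains C where "C \<ge> 0" "\<And>t. t \<ge> 0 \<Longrightarrow> (\<integral>\<^sup>+\<omega>. ennreal (ln (1 + norm (Y t \<omega>))) \<partial>M) \<le> ennreal (C * (1 + t))"
proof -
  define s where "s = enn2real S\<^sub>0"
  have s: "S\<^sub>0 = ennreal s" "s \<ge> 0" using S\<^sub>0_finite by (auto simp: s_def)
  define D where "D = real DIM(real^'d)"
  have D: "D \<ge> 0" by (simp add: D_def)
  have "(\<integral>\<^sup>+\<omega>. ennreal (ln (1 + norm (Y t \<omega>))) \<partial>M) \<le> ennreal (D * (ln 3 + 2 * s) * (1 + t))" if t: "t \<ge> 0" for t
  proof -
    have 1: "(\<integral>\<^sup>+\<omega>. ennreal (ln 3 * indicator {0<..} \<bar>e \<bullet> Y t \<omega>\<bar>) \<partial>M) \<le> ennreal (ln 3)" for e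
    proof -
      have "(\<integral>\<^sup>+\<omega>. ennreal (ln 3 * indicator {0<..} \<bar>e \<bullet> Y t \<omega>\<bar>) \<partial>M) \<le> (\<integral>\<^sup>+\<omega>. ennreal (ln 3) \<partial>M)"
        by (intro nn_integral_mono ennreal_leI) (auto split: split_indicator)
      then show ?thesis by (simp add: emeasure_space_1)
    qed
    have "(\<integral>\<^sup>+\<omega>. ennreal (ln (1 + norm (Y t \<omega>))) \<partial>M) \<le> (\<Sum>e\<in>(Basis :: (real^'d) set). ennreal (ln 3) + ennreal (2 * t) * S\<^sub>0)"
      by (rule order_trans[OF nn_integral_ln_le[OF t]]) (intro sum_mono add_right_mono 1)
    also have "\<dots> = (\<Sum>e\<in>(Basis :: (real^'d) set). ennreal (ln 3 + 2 * t * s))"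
      using t s by (intro sum.cong) (auto simp: ennreal_plus ennreal_mult)
    also have "\<dots> = ennreal (D * (ln 3 + 2 * t * s))"
      using t s by (subst sum_ennreal) (auto simp: D_def)
    also have "\<dots> \<le> ennreal (D * (ln 3 + 2 * s) * (1 + t))"
    proof (rule ennreal_leI)
      have "ln 3 + 2 * t * s \<le> (ln 3 + 2 * s) * (1 + t)" using t s by (simp add: ring_distribs)
      then show "D * (ln 3 + 2 * t * s) \<le> D * (ln 3 + 2 * s) * (1 + t)"
        using D by (simp add: mult.assoc mult_left_mono)
    qed
    finally show ?thesis .
  qed
  moreover have "D * (ln 3 + 2 * s) \<ge> 0" using D s by simp
  ultimately show ?thesis using that by blast
qed

lemma log_moment_Y:
  assumes "t \<ge> 0"
  shows "log_moment (distr M borel (Y t))"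
proof -
  obtain C where C: "C \<ge> 0" "\<And>t. t \<ge> 0 \<Longrightarrow> (\<integral>\<^sup>+\<omega>. ennreal (ln (1 + norm (Y t \<omega>))) \<partial>M) \<le> ennreal (C * (1 + t))"
    using nn_integral_ln_linear by blast
  show ?thesis unfolding log_moment_def
    using assms by (subst nn_integral_distr) (auto intro: le_less_trans[OF C(2)])
qed

end

section \<open>A jointly measurable version and the process at an independent time\<close>

context levy_proc
begin

text \<open>A measurable set of full probability on which the paths are regular; the set of all such
  sample points need not be measurable.\<close>

definition good :: "'w set" where
  "good = (SOME G. G \<in> sets M \<and> emeasure M (space M - G) = 0 \<and>
     (\<forall>\<omega>\<in>G. (\<forall>t\<ge>0. continuous (at_right t) (\<lambda>s. X s \<omega>)) \<and> (\<forall>t>0. \<exists>l. ((\<lambda>s. X s \<omega>) \<longlongrightarrow> l) (at_left t))))"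

lemma good: "good \<in> sets M" "emeasure M (space M - good) = 0"
  "\<And>\<omega> t. \<omega> \<in> good \<Longrightarrow> t \<ge> 0 \<Longrightarrow> continuous (at_right t) (\<lambda>s. X s \<omega>)"
  "\<And>\<omega> t. \<omega> \<in> good \<Longrightarrow> t > 0 \<Longrightarrow> \<exists>l. ((\<lambda>s. X s \<omega>) \<longlongrightarrow> l) (at_left t)"
proof -
  obtain Z where Z: "Z \<in> null_sets M" "{\<omega> \<in> space M. \<not> ((\<forall>t\<ge>0. continuous (at_right t) (\<lambda>s. X s \<omega>)) \<and> (\<forall>t>0. \<exists>l. ((\<lambda>s. X s \<omega>) \<longlongrightarrow> l) (at_left t)))} \<subseteq> Z"
    using cadlag unfolding eventually_ae_filter by blast
  have "\<exists>G. G \<in> sets M \<and> emeasure M (space M - G) = 0 \<and>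
     (\<forall>\<omega>\<in>G. (\<forall>t\<ge>0. continuous (at_right t) (\<lambda>s. X s \<omega>)) \<and> (\<forall>t>0. \<exists>l. ((\<lambda>s. X s \<omega>) \<longlongrightarrow> l) (at_left t)))"
  proof (intro exI[of _ "space M - Z"] conjI)
    have "space M - (space M - Z) = Z" using sets.sets_into_space[of Z M] Z(1) by auto
    then show "emeasure M (space M - (space M - Z)) = 0" using Z by auto
    show "space M - Z \<in> sets M" using Z by auto
    show "\<forall>\<omega>\<in>space M - Z. (\<forall>t\<ge>0. continuous (at_right t) (\<lambda>s. X s \<omega>)) \<and> (\<forall>t>0. \<exists>l. ((\<lambda>s. X s \<omega>) \<longlongrightarrow> l) (at_left t))"
      using Z(2) by blast
  qed
  from someI_ex[OF this, folded good_def]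
  show "good \<in> sets M" "emeasure M (space M - good) = 0"
    "\<And>\<omega> t. \<omega> \<in> good \<Longrightarrow> t \<ge> 0 \<Longrightarrow> continuous (at_right t) (\<lambda>s. X s \<omega>)"
    "\<And>\<omega> t. \<omega> \<in> good \<Longrightarrow> t > 0 \<Longrightarrow> \<exists>l. ((\<lambda>s. X s \<omega>) \<longlongrightarrow> l) (at_left t)"
    by blast+
qed

lemma AE_good: "AE \<omega> in M. \<omega> \<in> good"
  by (rule AE_I[where N="space M - good"]) (use good(1,2) in auto)

text \<open>A version that is right-continuous for every sample point and at every real time:
  negative times are mapped to 0 and exceptional paths are replaced by 0.\<close>

definition regular :: "real \<Rightarrow> 'w \<Rightarrow> 'a" where
  "regular t \<omega> = (if \<omega> \<in> good then X (max 0 t) \<omega> else 0)"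

lemma regular_measurable1 [measurable]: "regular t \<in> borel_measurable M"
  unfolding regular_def using good(1) by measurable

lemma regular_right_LIMSEQ:
  assumes s: "s \<longlonglongrightarrow> t" "\<And>n. s n > t"
  shows "(\<lambda>n. regular (s n) \<omega>) \<longlonglongrightarrow> regular t \<omega>"
proof (cases "\<omega> \<in> good")
  case True
  show ?thesis
  proof (cases "t \<ge> 0")
    case t: True
    then have "((\<lambda>s. X s \<omega>) \<longlongrightarrow> X t \<omega>) (at_right t)" using good(3)[OF True] by (simp add: continuous_within)
    moreover have "filterlim s (at_right t) sequentially"
      using s by (auto simp: filterlim_at less_imp_neq[THEN not_sym])
    ultimately have "(\<lambda>n. X (s n) \<omega>) \<longlonglongrightarrow> X t \<omega>" by (rule filterlim_compose)
    moreover have "max 0 (s n) = s n" for n using s(2)[of n] t by simp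
    ultimately show ?thesis using True t by (simp add: regular_def max_def)
  next
    case False
    then have "\<forall>\<^sub>F n in sequentially. s n < 0" using s(1) by (intro order_tendstoD) auto
    then have "\<forall>\<^sub>F n in sequentially. regular (s n) \<omega> = regular t \<omega>"
      by eventually_elim (use False in \<open>simp add: regular_def\<close>)
    then show ?thesis by (rule tendsto_eventually)
  qed
qed (simp add: regular_def)

text \<open>Rounding the time strictly up to multiples of \<open>1 / (n + 1)\<close> selects among
  countably many measurable sections; right-continuity gives the pointwise limit.\<close>

lemma regular_measurable [measurable]: "(\<lambda>p. regular (fst p) (snd p)) \<in> borel_measurable (borel \<Otimes>\<^sub>M M)"
proof (rule borel_measurable_LIMSEQ_metric)
  define d :: "nat \<Rightarrow> int \<Rightarrow> real" where "d = (\<lambda>n i. (of_int i + 1) / real (Suc n))"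
  show "(\<lambda>p. regular (d n \<lfloor>real (Suc n) * fst p\<rfloor>) (snd p)) \<in> borel_measurable (borel \<Otimes>\<^sub>M M)" for n
    by (rule measurable_compose_countable[where f="\<lambda>i p. regular (d n i) (snd p)" and g="\<lambda>p. \<lfloor>real (Suc n) * fst p\<rfloor>"]) measurable
  show "(\<lambda>n. regular (d n \<lfloor>real (Suc n) * fst p\<rfloor>) (snd p)) \<longlonglongrightarrow> regular (fst p) (snd p)" for p :: "real \<times> 'w"
  proof (rule regular_right_LIMSEQ)
    let ?t = "fst p"
    have 1: "d n \<lfloor>real (Suc n) * ?t\<rfloor> > ?t" for n
    proof -
      have "real (Suc n) * ?t < of_int \<lfloor>real (Suc n) * ?t\<rfloor> + 1" by linarith
      then show ?thesis unfolding d_def by (simp add: field_simps)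
    qed
    then show "\<And>n. d n \<lfloor>real (Suc n) * ?t\<rfloor> > ?t" .
    have 2: "d n \<lfloor>real (Suc n) * ?t\<rfloor> \<le> ?t + 1 / real (Suc n)" for n
    proof -
      have "of_int \<lfloor>real (Suc n) * ?t\<rfloor> + 1 \<le> real (Suc n) * ?t + 1" by linarith
      then have "d n \<lfloor>real (Suc n) * ?t\<rfloor> \<le> (real (Suc n) * ?t + 1) / real (Suc n)"
        unfolding d_def by (intro divide_right_mono) auto
      also have "\<dots> = ?t + 1 / real (Suc n)" by (simp only: add_divide_distrib) simp
      finally show ?thesis .
    qed
    show "(\<lambda>n. d n \<lfloor>real (Suc n) * ?t\<rfloor>) \<longlonglongrightarrow> ?t"
    proof (rule tendsto_sandwich)
      show "\<forall>\<^sub>F n in sequentially. ?t \<le> d n \<lfloor>real (Suc n) * ?t\<rfloor>" using 1 by (auto intro!: always_eventually less_imp_le)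
      show "\<forall>\<^sub>F n in sequentially. d n \<lfloor>real (Suc n) * ?t\<rfloor> \<le> ?t + 1 / real (Suc n)" using 2 by auto
      show "(\<lambda>n. ?t + 1 / real (Suc n)) \<longlonglongrightarrow> ?t" using LIMSEQ_inverse_real_of_nat_add[of ?t] by (simp add: inverse_eq_divide)
    qed auto
  qed
qed

lemma regular_AE: "AE \<omega> in M. \<forall>t. regular t \<omega> = X (max 0 t) \<omega>"
  using AE_good by eventually_elim (simp add: regular_def)

definition at_time :: "real measure \<Rightarrow> 'a measure" where
  "at_time \<tau> = distr (\<tau> \<Otimes>\<^sub>M M) borel (\<lambda>p. regular (fst p) (snd p))"

lemma
  assumes \<tau>: "distribution \<tau>"
  shows distribution_at_time: "distribution (at_time \<tau>)"
    and char_fun_at_time: "char_fun (at_time \<tau>) z = (CLINT t|\<tau>. \<phi> (max 0 t) z)"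
    and nn_integral_at_time: "\<And>f. f \<in> borel_measurable borel \<Longrightarrow> (\<integral>\<^sup>+x. f x \<partial>at_time \<tau>) = (\<integral>\<^sup>+t. (\<integral>\<^sup>+\<omega>. f (X (max 0 t) \<omega>) \<partial>M) \<partial>\<tau>)"
proof -
  interpret t: prob_space \<tau> using \<tau> by (simp add: distribution_def)
  have [measurable_cong]: "sets \<tau> = sets borel" using \<tau> by (simp add: distribution_def)
  interpret PP: pair_prob_space \<tau> M ..
  have [measurable]: "(\<lambda>p. regular (fst p) (snd p)) \<in> borel_measurable (\<tau> \<Otimes>\<^sub>M M)" by measurable
  show "distribution (at_time \<tau>)" unfolding at_time_def by (rule distribution_distr) (auto intro: PP.prob_space_axioms)
  have "char_fun (at_time \<tau>) z = (CLINT t|\<tau>. CLINT \<omega>|M. iexp (z \<bullet> regular t \<omega>))"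
    unfolding at_time_def
    by (subst char_fun_distr, simp, subst PP.integral_fst'[symmetric]) (auto intro!: PP.integrable_const_bound[where B=1])
  also have "\<dots> = (CLINT t|\<tau>. \<phi> (max 0 t) z)"
  proof (intro Bochner_Integration.integral_cong refl)
    fix t
    show "(CLINT \<omega>|M. iexp (z \<bullet> regular t \<omega>)) = \<phi> (max 0 t) z"
      using regular_AE by (subst \<phi>_expectation) (auto intro!: integral_cong_AE elim!: eventually_mono)
  qed
  finally show "char_fun (at_time \<tau>) z = (CLINT t|\<tau>. \<phi> (max 0 t) z)" .
  fix f :: "'a \<Rightarrow> ennreal" assume [measurable]: "f \<in> borel_measurable borel"
  have "(\<integral>\<^sup>+x. f x \<partial>at_time \<tau>) = (\<integral>\<^sup>+t. (\<integral>\<^sup>+\<omega>. f (regular t \<omega>) \<partial>M) \<partial>\<tau>)"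
    unfolding at_time_def by (subst nn_integral_distr, simp, simp, subst nn_integral_fst[symmetric]) auto
  also have "\<dots> = (\<integral>\<^sup>+t. (\<integral>\<^sup>+\<omega>. f (X (max 0 t) \<omega>) \<partial>M) \<partial>\<tau>)"
    using regular_AE by (intro nn_integral_cong nn_integral_cong_AE) (auto elim!: eventually_mono)
  finally show "(\<integral>\<^sup>+x. f x \<partial>at_time \<tau>) = (\<integral>\<^sup>+t. (\<integral>\<^sup>+\<omega>. f (X (max 0 t) \<omega>) \<partial>M) \<partial>\<tau>)" .
qed

end

context levy_lk
begin

lemma char_fun_at_scaled_time:
  assumes c: "c > 0" and \<sigma>: "distribution \<sigma>"
  shows "char_fun (at_time (distr \<sigma> borel (\<lambda>t. t / c))) z = (CLINT t|\<sigma>. exp (complex_of_real (max 0 t) * (\<psi> z / of_real c)))"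
proof -
  have [measurable_cong]: "sets \<sigma> = sets borel" using \<sigma> by (simp add: distribution_def)
  have d: "distribution (distr \<sigma> borel (\<lambda>t. t / c))"
    using \<sigma> by (intro distribution_distr) (auto simp: distribution_def)
  have "max 0 (t / c) = max 0 t / c" for t using c by (simp add: max_def field_simps)
  then have e: "\<phi> (max 0 t) z = exp (complex_of_real (max 0 t) * \<psi> z)" for t by (intro \<phi>_eq) auto
  show ?thesis
    unfolding char_fun_at_time[OF d] e using c
    by (subst integral_distr) (auto simp: max_def field_simps intro!: Bochner_Integration.integral_cong)
qed

definition exp_time_law :: "real \<Rightarrow> (real^'d) measure" where
  "exp_time_law c = at_time (distr exp_law borel (\<lambda>t. t / c))"

lemma distribution_exp_time_law: "distribution (exp_time_law c)"
  unfolding exp_time_law_def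
  by (intro distribution_at_time distribution_distr prob_space_exp_law) measurable

lemma char_fun_exp_time_law:
  assumes c: "c > 0"
  shows "char_fun (exp_time_law c) z = 1 / (1 - \<psi> z / of_real c)"
proof -
  have "char_fun (exp_time_law c) z = (CLINT t|exp_law. exp (complex_of_real (max 0 t) * (\<psi> z / of_real c)))"
    unfolding exp_time_law_def by (rule char_fun_at_scaled_time[OF c distribution_exp_law])
  also have "\<dots> = (CLINT t|exp_law. exp (complex_of_real t * (\<psi> z / of_real c)))"
    using AE_exp_law_pos by (intro integral_cong_AE) (auto elim!: eventually_mono)
  also have "\<dots> = 1 / (1 - \<psi> z / of_real c)"
    using Re_\<psi>_le_0[of z] c divide_nonpos_pos[of "Re (\<psi> z)" c] by (intro exp_law_integral_exp) (simp add: Re_divide_of_real)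
  finally show ?thesis .
qed

text \<open>Subordination: \<open>exp (t * \<psi>)\<close> is multiplicative in \<open>t\<close>, so
  \<open>Y\<close> at a time distributed as an \<open>n\<close>-th root of the exponential law is an
  \<open>n\<close>-th root of \<open>Y\<close> at the exponential time.\<close>

lemma infinitely_divisible_exp_time_law:
  assumes c: "c > 0"
  shows "infinitely_divisible (exp_time_law c)"
proof (rule infinitely_divisibleI[OF distribution_exp_time_law])
  fix n :: nat assume n: "n \<ge> 1"
  obtain \<sigma> where \<sigma>: "distribution \<sigma>" "exp_law = convolution_power \<sigma> n"
    using infinitely_divisibleD[OF exp_law_infinitely_divisible n] by blast
  have pos: "AE t in \<sigma>. 0 \<le> t"
    by (rule convolution_power_nonneg_factor[OF \<sigma>(1) _ n]) (unfold \<sigma>(2)[symmetric], rule AE_exp_law_pos)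
  have "char_fun (exp_time_law c) z = char_fun (at_time (distr \<sigma> borel (\<lambda>t. t / c))) z ^ n" for z
  proof -
    have "Re (\<psi> z / of_real c) \<le> 0"
      using Re_\<psi>_le_0[of z] c divide_nonpos_pos[of "Re (\<psi> z)" c] by (simp add: Re_divide_of_real)
    from convolution_power_integral_exp[OF \<sigma>(1) pos this, of n]
    show ?thesis
      unfolding exp_time_law_def char_fun_at_scaled_time[OF c distribution_exp_law] char_fun_at_scaled_time[OF c \<sigma>(1)]
      unfolding \<sigma>(2) by blast
  qed
  moreover have "distribution (at_time (distr \<sigma> borel (\<lambda>t. t / c)))"
    using \<sigma> by (intro distribution_at_time distribution_distr) (auto simp: distribution_def cong: measurable_cong_sets)
  ultimately show "\<exists>\<mu>\<^sub>n. distribution \<mu>\<^sub>n \<and> (\<forall>z. char_fun (exp_time_law c) z = char_fun \<mu>\<^sub>n z ^ n)" by blast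
qed

end

context levy_log
begin

text \<open>The bound \<open>C * (1 + t)\<close> for a fixed time is integrable because the
  exponential time has a finite mean.\<close>

lemma log_moment_exp_time_law:
  assumes c: "c > 0"
  shows "log_moment (exp_time_law c)"
proof -
  obtain C where C: "C \<ge> 0" "\<And>t. t \<ge> 0 \<Longrightarrow> (\<integral>\<^sup>+\<omega>. ennreal (ln (1 + norm (Y t \<omega>))) \<partial>M) \<le> ennreal (C * (1 + t))"
    using nn_integral_ln_linear by blast
  interpret E: prob_space exp_law by (rule prob_space_exp_law)
  have d: "distribution (distr exp_law borel (\<lambda>t. t / c))"
    by (intro distribution_distr prob_space_exp_law) measurable
  have "(\<integral>\<^sup>+x. ennreal (ln (1 + norm x)) \<partial>exp_time_law c) = (\<integral>\<^sup>+t. (\<integral>\<^sup>+\<omega>. ennreal (ln (1 + norm (Y (max 0 t) \<omega>))) \<partial>M) \<partial>distr exp_law borel (\<lambda>t. t / c))"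
    unfolding exp_time_law_def by (rule nn_integral_at_time[OF d]) measurable
  also have "\<dots> \<le> (\<integral>\<^sup>+t. ennreal (C * (1 + max 0 t)) \<partial>distr exp_law borel (\<lambda>t. t / c))"
    by (intro nn_integral_mono C) simp
  also have "\<dots> = (\<integral>\<^sup>+t. ennreal (C * (1 + max 0 (t / c))) \<partial>exp_law)"
    by (subst nn_integral_distr) auto
  also have "\<dots> = (\<integral>\<^sup>+t. ennreal C + ennreal (C / c) * ennreal t \<partial>exp_law)"
    using AE_exp_law_pos
  proof (intro nn_integral_cong_AE, eventually_elim)
    fix t :: real assume "0 \<le> t"
    then have "C * (1 + max 0 (t / c)) = C + C / c * t" using c by (simp add: max_def field_simps)
    then show "ennreal (C * (1 + max 0 (t / c))) = ennreal C + ennreal (C / c) * ennreal t"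
      using C c \<open>0 \<le> t\<close> by (simp add: ennreal_mult[symmetric] ennreal_plus[symmetric] del: ennreal_plus)
  qed
  also have "\<dots> = ennreal C + ennreal (C / c)"
    by (subst nn_integral_add) (auto simp: nn_integral_cmult exp_law_mean E.emeasure_space_1)
  also have "\<dots> < \<infinity>" by simp
  finally show ?thesis unfolding log_moment_def .
qed

end

section \<open>The functional equation of the integral\<close>

text \<open>Freezing: by independence \<open>U\<close> may be held fixed while \<open>V\<close> is
  integrated out.\<close>

lemma (in prob_space) indep_var_expectation:
  fixes F :: "'b \<times> 'b \<Rightarrow> complex"
  assumes ind: "indep_var S U T V"
    and [measurable]: "F \<in> borel_measurable (S \<Otimes>\<^sub>M T)" and bd: "\<And>p. norm (F p) \<le> B"
  shows "(\<integral>\<omega>. F (U \<omega>, V \<omega>) \<partial>M) = (\<integral>\<omega>. (\<integral>\<omega>'. F (U \<omega>, V \<omega>') \<partial>M) \<partial>M)"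
proof -
  have UV [measurable]: "U \<in> measurable M S" "V \<in> measurable M T" using ind by (auto dest: indep_var_rv1 indep_var_rv2)
  interpret U: prob_space "distr M S U" by (rule prob_space_distr) measurable
  interpret V: prob_space "distr M T V" by (rule prob_space_distr) measurable
  interpret UV: pair_prob_space "distr M S U" "distr M T V" ..
  have "(\<integral>\<omega>. F (U \<omega>, V \<omega>) \<partial>M) = (\<integral>p. F p \<partial>distr M (S \<Otimes>\<^sub>M T) (\<lambda>\<omega>. (U \<omega>, V \<omega>)))"
    by (subst integral_distr) auto
  also have "\<dots> = (\<integral>p. F p \<partial>(distr M S U \<Otimes>\<^sub>M distr M T V))"
    using ind by (simp add: indep_var_distribution_eq)
  also have "\<dots> = (\<integral>u. (\<integral>v. F (u, v) \<partial>distr M T V) \<partial>distr M S U)"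
    using bd by (intro UV.integral_fst'[symmetric] UV.integrable_const_bound[where B=B]) auto
  also have "\<dots> = (\<integral>\<omega>. (\<integral>\<omega>'. F (U \<omega>, V \<omega>') \<partial>M) \<partial>M)"
  proof (subst integral_distr)
    show "(\<lambda>u. \<integral>v. F (u, v) \<partial>distr M T V) \<in> borel_measurable S"
      by (rule V.borel_measurable_lebesgue_integral) (simp cong: measurable_cong_sets)
    show "(\<integral>\<omega>. (\<integral>v. F (U \<omega>, v) \<partial>distr M T V) \<partial>M) = (\<integral>\<omega>. (\<integral>\<omega>'. F (U \<omega>, V \<omega>') \<partial>M) \<partial>M)"
      by (intro Bochner_Integration.integral_cong refl integral_distr) (auto dest: measurable_space[OF UV(1)])
  qed auto
  finally show ?thesis .
qed

lemma process_events_eq_sigma: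
  fixes X :: "real \<Rightarrow> 'w \<Rightarrow> 'a::euclidean_space"
  assumes "\<And>t. t \<ge> 0 \<Longrightarrow> X t \<in> borel_measurable M"
  shows "process_events M X = sets (sigma (space M) {X t -` A \<inter> space M |t A. 0 \<le> t \<and> A \<in> sets borel})"
    and "\<And>t. t \<ge> 0 \<Longrightarrow> X t \<in> borel_measurable (sigma (space M) {X t -` A \<inter> space M |t A. 0 \<le> t \<and> A \<in> sets borel})"
proof -
  let ?G = "{X t -` A \<inter> space M |t A. 0 \<le> t \<and> A \<in> sets borel}"
  have G: "?G \<subseteq> Pow (space M)" by auto
  then show "process_events M X = sets (sigma (space M) ?G)"
    unfolding process_events_def by (subst sets_measure_of) auto
  fix t :: real assume "t \<ge> 0"
  show "X t \<in> borel_measurable (sigma (space M) ?G)"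
  proof (rule measurableI)
    fix A :: "'a set" assume "A \<in> sets borel"
    then have "X t -` A \<inter> space M \<in> ?G" using \<open>t \<ge> 0\<close> by blast
    then show "X t -` A \<inter> space (sigma (space M) ?G) \<in> sets (sigma (space M) ?G)"
      using G by (simp add: space_measure_of)
  qed auto
qed

lemma borel_measurable_fst_snd [measurable]:
  "(fst :: 'a::second_countable_topology \<times> 'b::second_countable_topology \<Rightarrow> 'a) \<in> borel_measurable borel"
  "(snd :: 'a::second_countable_topology \<times> 'b::second_countable_topology \<Rightarrow> 'b) \<in> borel_measurable borel"
  unfolding borel_prod[symmetric] by measurable

section \<open>Joint independence of the increments of both processes on a grid\<close>

locale pois_levy = levy_log M Y A \<nu> \<gamma> + N: levy_proc M N
  for M :: "'w measure" and Y :: "real \<Rightarrow> 'w \<Rightarrow> real^'d" and A \<nu> \<gamma> and N :: "real \<Rightarrow> 'w \<Rightarrow> real" +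
  fixes c :: real
  assumes c: "c > 0"
    and poisson: "\<And>t. t > 0 \<Longrightarrow> distr M borel (N t) = distr (measure_pmf (poisson_pmf (c * t))) borel real"
    and indep: "independent_processes M N Y"
begin

definition \<xi> :: "real \<Rightarrow> nat \<Rightarrow> 'w \<Rightarrow> real" where
  "\<xi> h j \<omega> = N (real (Suc j) * h) \<omega> - N (real j * h) \<omega>"

definition \<eta> :: "real \<Rightarrow> nat \<Rightarrow> 'w \<Rightarrow> real^'d" where
  "\<eta> h j \<omega> = Y (real (Suc j) * h) \<omega> - Y (real j * h) \<omega>"

lemma \<xi>_meas [measurable]: "h \<ge> 0 \<Longrightarrow> \<xi> h j \<in> borel_measurable M"
  unfolding \<xi>_def by measurable

lemma \<eta>_meas [measurable]: "h \<ge> 0 \<Longrightarrow> \<eta> h j \<in> borel_measurable M"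
  unfolding \<eta>_def by measurable

lemma distr_\<xi>: "h > 0 \<Longrightarrow> distr M borel (\<xi> h j) = distr (measure_pmf (poisson_pmf (c * h))) borel real"
  unfolding \<xi>_def using N.distr_increment[of "real j * h" h] poisson[of h] by (simp add: ring_distribs add.commute)

lemma \<eta>_char: "h \<ge> 0 \<Longrightarrow> (CLINT \<omega>|M. iexp (z \<bullet> \<eta> h j \<omega>)) = exp (of_real h * \<psi> z)"
  unfolding \<eta>_def using \<phi>_increment[of "real j * h" h z] by (simp add: ring_distribs add.commute \<phi>_eq)

text \<open>The increments of \<open>N\<close> and of \<open>Y\<close> have different types. Padding
  both with zeros into one product type allows a single family and a single independence
  statement.\<close>

definition \<zeta> :: "real \<Rightarrow> nat + nat \<Rightarrow> 'w \<Rightarrow> real \<times> (real^'d)" where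
  "\<zeta> h i \<omega> = (case i of Inl j \<Rightarrow> (\<xi> h j \<omega>, 0) | Inr j \<Rightarrow> (0, \<eta> h j \<omega>))"

text \<open>The probability of an intersection is split twice: between the two processes, since each
  part is an event of one of them, and then inside each process by its independent
  increments.\<close>

lemma indep_\<zeta>:
  assumes h: "h \<ge> 0"
  shows "indep_vars (\<lambda>_. borel) (\<zeta> h) ({..<Suc m} <+> {..<Suc m})"
  unfolding indep_vars_def2
proof (intro conjI ballI)
  let ?I = "{..<Suc m} <+> {..<Suc m}"
  show "random_variable borel (\<zeta> h i)" if "i \<in> ?I" for i
    unfolding \<zeta>_def using h by (cases i) auto
  have peN: "process_events M N = sets (sigma (space M) {N t -` A \<inter> space M |t A. 0 \<le> t \<and> A \<in> sets borel})"
    by (rule process_events_eq_sigma(1)) auto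
  have peY: "process_events M Y = sets (sigma (space M) {Y t -` A \<inter> space M |t A. 0 \<le> t \<and> A \<in> sets borel})"
    by (rule process_events_eq_sigma(1)) auto
  have N\<sigma>: "N t \<in> borel_measurable (sigma (space M) {N t -` A \<inter> space M |t A. 0 \<le> t \<and> A \<in> sets borel})" if "t \<ge> 0" for t
    by (rule process_events_eq_sigma(2)) (use that in auto)
  have Y\<sigma>: "Y t \<in> borel_measurable (sigma (space M) {Y t -` A \<inter> space M |t A. 0 \<le> t \<and> A \<in> sets borel})" if "t \<ge> 0" for t
    by (rule process_events_eq_sigma(2)) (use that in auto)
  have \<xi>_ev: "\<xi> h j -` B \<inter> space M \<in> process_events M N" if "B \<in> sets borel" for j B
  proof -
    have "\<xi> h j \<in> borel_measurable (sigma (space M) {N t -` A \<inter> space M |t A. 0 \<le> t \<and> A \<in> sets borel})"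
      unfolding \<xi>_def using h by (intro borel_measurable_diff N\<sigma>) auto
    from measurable_sets[OF this that] show ?thesis
      by (subst process_events_eq_sigma(1)) (auto simp: space_measure_of_conv)
  qed
  have \<eta>_ev: "\<eta> h j -` B \<inter> space M \<in> process_events M Y" if "B \<in> sets borel" for j B
  proof -
    have "\<eta> h j \<in> borel_measurable (sigma (space M) {Y t -` A \<inter> space M |t A. 0 \<le> t \<and> A \<in> sets borel})"
      unfolding \<eta>_def using h by (intro borel_measurable_diff Y\<sigma>) auto
    from measurable_sets[OF this that] show ?thesis
      by (subst process_events_eq_sigma(1)) (auto simp: space_measure_of_conv)
  qed
  have indN: "indep_vars (\<lambda>_. borel) (\<xi> h) {..<Suc m}"
    unfolding \<xi>_def using h by (intro N.indep_increments) (auto intro: mult_right_mono)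
  have indY: "indep_vars (\<lambda>_. borel) (\<eta> h) {..<Suc m}"
    unfolding \<eta>_def using h by (intro indep_increments) (auto intro: mult_right_mono)
  show "indep_sets (\<lambda>i. {\<zeta> h i -` A \<inter> space M |A. A \<in> sets borel}) ?I"
  proof (subst indep_sets_finite)
    show "?I \<noteq> {}" "finite ?I" by auto
    show "space M \<in> {\<zeta> h i -` A \<inter> space M |A. A \<in> sets borel}" for i by (rule CollectI, rule exI[of _ UNIV]) auto
    show "{\<zeta> h i -` A \<inter> space M |A. A \<in> sets borel} \<subseteq> events" if "i \<in> ?I" for i
      using \<open>\<And>i. i \<in> ?I \<Longrightarrow> random_variable borel (\<zeta> h i)\<close>[OF that] by (auto intro: measurable_sets)
    show "\<forall>B\<in>Pi ?I (\<lambda>i. {\<zeta> h i -` A \<inter> space M |A. A \<in> sets borel}). prob (\<Inter>j\<in>?I. B j) = (\<Prod>j\<in>?I. prob (B j))"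
    proof
      fix B assume B: "B \<in> Pi ?I (\<lambda>i. {\<zeta> h i -` A \<inter> space M |A. A \<in> sets borel})"
      then have "\<forall>i\<in>?I. \<exists>A. A \<in> sets borel \<and> B i = \<zeta> h i -` A \<inter> space M"
        unfolding Pi_iff mem_Collect_eq by metis
      then obtain A' where A': "\<And>i. i \<in> ?I \<Longrightarrow> A' i \<in> sets borel" "\<And>i. i \<in> ?I \<Longrightarrow> B i = \<zeta> h i -` A' i \<inter> space M"
        by metis
      define A1 where "A1 = (\<lambda>j. (\<lambda>x. (x, 0 :: real^'d)) -` A' (Inl j))"
      define A2 where "A2 = (\<lambda>j. (\<lambda>y. (0 :: real, y)) -` A' (Inr j))"
      have A1: "A1 j \<in> sets borel" if "j < Suc m" for j
        unfolding A1_def using measurable_sets[of "\<lambda>x. (x, 0 :: real^'d)" borel borel "A' (Inl j)"] A'(1)[of "Inl j"] that by auto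
      have A2: "A2 j \<in> sets borel" if "j < Suc m" for j
        unfolding A2_def using measurable_sets[of "\<lambda>y. (0 :: real, y)" borel borel "A' (Inr j)"] A'(1)[of "Inr j"] that by auto
      have B1: "B (Inl j) = \<xi> h j -` A1 j \<inter> space M" if "j < Suc m" for j
      proof -
        have "Inl j \<in> ?I" using that by (intro InlI) simp
        from A'(2)[OF this] show ?thesis by (auto simp: A1_def \<zeta>_def)
      qed
      have B2: "B (Inr j) = \<eta> h j -` A2 j \<inter> space M" if "j < Suc m" for j
      proof -
        have "Inr j \<in> ?I" using that by (intro InrI) simp
        from A'(2)[OF this] show ?thesis by (auto simp: A2_def \<zeta>_def)
      qed
      have pN: "prob (\<Inter>j<Suc m. B (Inl j)) = (\<Prod>j<Suc m. prob (B (Inl j)))"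
      proof -
        have "prob (\<Inter>j\<in>{..<Suc m}. \<xi> h j -` A1 j \<inter> space M) = (\<Prod>j\<in>{..<Suc m}. prob (\<xi> h j -` A1 j \<inter> space M))"
          by (rule indep_varsD_finite[OF indN]) (use A1 in \<open>auto simp: lessThan_Suc\<close>)
        moreover have "(\<Inter>j<Suc m. B (Inl j)) = (\<Inter>j\<in>{..<Suc m}. \<xi> h j -` A1 j \<inter> space M)"
          by (intro INF_cong refl B1) (simp only: lessThan_iff)
        moreover have "(\<Prod>j<Suc m. prob (B (Inl j))) = (\<Prod>j\<in>{..<Suc m}. prob (\<xi> h j -` A1 j \<inter> space M))"
          by (intro prod.cong refl arg_cong[where f=prob] B1) (simp only: lessThan_iff)
        ultimately show ?thesis by (simp only:)
      qed
      have pY: "prob (\<Inter>j<Suc m. B (Inr j)) = (\<Prod>j<Suc m. prob (B (Inr j)))"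
      proof -
        have "prob (\<Inter>j\<in>{..<Suc m}. \<eta> h j -` A2 j \<inter> space M) = (\<Prod>j\<in>{..<Suc m}. prob (\<eta> h j -` A2 j \<inter> space M))"
          by (rule indep_varsD_finite[OF indY]) (use A2 in \<open>auto simp: lessThan_Suc\<close>)
        moreover have "(\<Inter>j<Suc m. B (Inr j)) = (\<Inter>j\<in>{..<Suc m}. \<eta> h j -` A2 j \<inter> space M)"
          by (intro INF_cong refl B2) (simp only: lessThan_iff)
        moreover have "(\<Prod>j<Suc m. prob (B (Inr j))) = (\<Prod>j\<in>{..<Suc m}. prob (\<eta> h j -` A2 j \<inter> space M))"
          by (intro prod.cong refl arg_cong[where f=prob] B2) (simp only: lessThan_iff)
        ultimately show ?thesis by (simp only:)
      qed
      have e1: "(\<Inter>j<Suc m. B (Inl j)) \<in> process_events M N"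
        unfolding peN by (rule sets.finite_INT) (use B1 A1 \<xi>_ev[unfolded peN] in \<open>auto simp: lessThan_Suc\<close>)
      have e2: "(\<Inter>j<Suc m. B (Inr j)) \<in> process_events M Y"
        unfolding peY by (rule sets.finite_INT) (use B2 A2 \<eta>_ev[unfolded peY] in \<open>auto simp: lessThan_Suc\<close>)
      have "(\<Inter>j\<in>?I. B j) = (\<Inter>j<Suc m. B (Inl j)) \<inter> (\<Inter>j<Suc m. B (Inr j))" by auto
      then have "prob (\<Inter>j\<in>?I. B j) = prob (\<Inter>j<Suc m. B (Inl j)) * prob (\<Inter>j<Suc m. B (Inr j))"
        using indep_setD[OF indep[unfolded independent_processes_def] e1 e2] by simp
      also have "\<dots> = (\<Prod>j\<in>?I. prob (B j))"
        unfolding pN pY by (subst prod.Plus) auto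
      finally show "prob (\<Inter>j\<in>?I. B j) = (\<Prod>j\<in>?I. prob (B j))" .
    qed
  qed
qed

section \<open>The discretised integral: one-step operator and second-order expansion\<close>

definition \<Sigma>\<xi> :: "real \<Rightarrow> nat \<Rightarrow> 'w \<Rightarrow> real" where
  "\<Sigma>\<xi> h m \<omega> = (\<Sum>j<m. \<xi> h j \<omega>)"

text \<open>The weight of increment \<open>i\<close> sums the steps of \<open>N\<close> before
  \<open>i\<close> only, as befits a left-endpoint sum; it is therefore independent of that
  increment.\<close>

definition grid :: "real \<Rightarrow> nat \<Rightarrow> 'w \<Rightarrow> real^'d" where
  "grid h m \<omega> = (\<Sum>i<m. exp (- \<Sigma>\<xi> h i \<omega>) *\<^sub>R \<eta> h i \<omega>)"

lemma \<Sigma>\<xi>_meas [measurable]: "h \<ge> 0 \<Longrightarrow> \<Sigma>\<xi> h m \<in> borel_measurable M"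
  unfolding \<Sigma>\<xi>_def by measurable

lemma grid_meas [measurable]: "h \<ge> 0 \<Longrightarrow> grid h m \<in> borel_measurable M"
  unfolding grid_def by measurable

text \<open>Both parts regroup the same independent family: the past against the step
  \<open>m\<close>, and inside the step the increment of \<open>N\<close> against that of
  \<open>Y\<close>.\<close>

lemma indep_step:
  assumes h: "h \<ge> 0"
  shows "indep_var borel (\<lambda>\<omega>. (\<Sigma>\<xi> h m \<omega>, grid h m \<omega>)) borel (\<lambda>\<omega>. (\<xi> h m \<omega>, \<eta> h m \<omega>))"
    and "f \<in> borel_measurable borel \<Longrightarrow> g \<in> borel_measurable borel \<Longrightarrow>
      indep_var borel (\<lambda>\<omega>. f (\<xi> h m \<omega>) :: complex) borel (\<lambda>\<omega>. g (\<eta> h m \<omega>))"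
proof -
  let ?I = "{..<Suc m} <+> {..<Suc m}" and ?P = "{..<m} <+> {..<m}" and ?Q = "{Inl m, Inr m}"
  have "indep_var (PiM ?P (\<lambda>_. borel)) (\<lambda>\<omega>. restrict (\<lambda>i. \<zeta> h i \<omega>) ?P) (PiM ?Q (\<lambda>_. borel)) (\<lambda>\<omega>. restrict (\<lambda>i. \<zeta> h i \<omega>) ?Q)"
    by (rule indep_var_restrict[OF indep_\<zeta>[OF h, of m]]) auto
  then have "indep_var borel ((\<lambda>x. (\<Sum>j<m. fst (x (Inl j)), \<Sum>i<m. exp (- (\<Sum>j<i. fst (x (Inl j)))) *\<^sub>R snd (x (Inr i)))) \<circ> (\<lambda>\<omega>. restrict (\<lambda>i. \<zeta> h i \<omega>) ?P))
     borel ((\<lambda>x. (fst (x (Inl m)), snd (x (Inr m)))) \<circ> (\<lambda>\<omega>. restrict (\<lambda>i. \<zeta> h i \<omega>) ?Q))"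
  proof (rule indep_var_compose)
    have 1: "(\<lambda>x. fst (x (Inl j)) :: real) \<in> borel_measurable (PiM ?P (\<lambda>_. borel :: (real \<times> (real^'d)) measure))" if "j < m" for j
      using that by (intro measurable_compose[OF measurable_component_singleton]) auto
    have 2: "(\<lambda>x. snd (x (Inr j)) :: real^'d) \<in> borel_measurable (PiM ?P (\<lambda>_. borel :: (real \<times> (real^'d)) measure))" if "j < m" for j
      using that by (intro measurable_compose[OF measurable_component_singleton]) auto
    show "(\<lambda>x. (\<Sum>j<m. fst (x (Inl j)), \<Sum>i<m. exp (- (\<Sum>j<i. fst (x (Inl j)))) *\<^sub>R snd (x (Inr i)))) \<in> PiM ?P (\<lambda>_. borel :: (real \<times> (real^'d)) measure) \<rightarrow>\<^sub>M borel"
      by (intro borel_measurable_Pair borel_measurable_sum borel_measurable_scaleR measurable_compose[OF _ borel_measurable_exp] borel_measurable_uminus 1 2) auto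
    show "(\<lambda>x. (fst (x (Inl m)), snd (x (Inr m)))) \<in> PiM ?Q (\<lambda>_. borel :: (real \<times> (real^'d)) measure) \<rightarrow>\<^sub>M borel"
      by (intro borel_measurable_Pair measurable_compose[OF measurable_component_singleton]) auto
  qed
  moreover have "((\<lambda>x. (\<Sum>j<m. fst (x (Inl j)), \<Sum>i<m. exp (- (\<Sum>j<i. fst (x (Inl j)))) *\<^sub>R snd (x (Inr i)))) \<circ> (\<lambda>\<omega>. restrict (\<lambda>i. \<zeta> h i \<omega>) ?P)) = (\<lambda>\<omega>. (\<Sigma>\<xi> h m \<omega>, grid h m \<omega>))"
    by (auto simp: fun_eq_iff \<Sigma>\<xi>_def grid_def \<zeta>_def intro!: sum.cong arg_cong2[where f=scaleR])
  moreover have "((\<lambda>x. (fst (x (Inl m)), snd (x (Inr m)))) \<circ> (\<lambda>\<omega>. restrict (\<lambda>i. \<zeta> h i \<omega>) ?Q)) = (\<lambda>\<omega>. (\<xi> h m \<omega>, \<eta> h m \<omega>))"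
    by (auto simp: fun_eq_iff \<zeta>_def)
  ultimately show "indep_var borel (\<lambda>\<omega>. (\<Sigma>\<xi> h m \<omega>, grid h m \<omega>)) borel (\<lambda>\<omega>. (\<xi> h m \<omega>, \<eta> h m \<omega>))" by simp
  have ind2: "indep_var (PiM {Inl m} (\<lambda>_. borel)) (\<lambda>\<omega>. restrict (\<lambda>i. \<zeta> h i \<omega>) {Inl m}) (PiM {Inr m} (\<lambda>_. borel)) (\<lambda>\<omega>. restrict (\<lambda>i. \<zeta> h i \<omega>) {Inr m})"
    by (rule indep_var_restrict[OF indep_\<zeta>[OF h, of m]]) auto
  assume [measurable]: "f \<in> borel_measurable borel" "g \<in> borel_measurable borel"
  have "indep_var borel ((\<lambda>x. f (fst (x (Inl m)))) \<circ> (\<lambda>\<omega>. restrict (\<lambda>i. \<zeta> h i \<omega>) {Inl m}))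
     borel ((\<lambda>x. g (snd (x (Inr m)))) \<circ> (\<lambda>\<omega>. restrict (\<lambda>i. \<zeta> h i \<omega>) {Inr m}))"
    by (rule indep_var_compose[OF ind2]) (auto intro!: measurable_compose[OF measurable_component_singleton])
  then show "indep_var borel (\<lambda>\<omega>. f (\<xi> h m \<omega>)) borel (\<lambda>\<omega>. g (\<eta> h m \<omega>))" by (simp add: comp_def \<zeta>_def)
qed

text \<open>The one-step transition operator of the discretised integral; \<open>x\<close> is the current value of the Poisson
  process.\<close>

definition T :: "real \<Rightarrow> real^'d \<Rightarrow> (real \<Rightarrow> complex) \<Rightarrow> real \<Rightarrow> complex" where
  "T h z F x = exp (of_real h * \<psi> (exp (- x) *\<^sub>R z)) * measure_pmf.expectation (poisson_pmf (c * h)) (\<lambda>k. F (x + real k))"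

text \<open>A class of test functions preserved by the one-step operator, which averages and then
  multiplies by a number of modulus at most 1. Error bounds thus hold uniformly in the number of
  steps.\<close>

definition bounded1 :: "(real \<Rightarrow> complex) \<Rightarrow> bool" where
  "bounded1 F \<longleftrightarrow> F \<in> borel_measurable borel \<and> (\<forall>x. norm (F x) \<le> 1)"

lemma norm_exp_\<psi>_le_1: "h \<ge> 0 \<Longrightarrow> norm (exp (of_real h * \<psi> z)) \<le> 1"
  using Re_\<psi>_le_0[of z] by (simp add: mult_nonneg_nonpos)

lemma \<psi>_measurable [measurable]: "\<psi> \<in> borel_measurable borel"
proof (rule borel_measurable_continuous_onI)
  show "continuous_on UNIV \<psi>"
    by (auto simp: continuous_on_sequentially comp_def intro: \<psi>_tendsto)
qed

lemma bounded1_T: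
  assumes F: "bounded1 F" and h: "h \<ge> 0"
  shows "bounded1 (T h z F)"
  unfolding bounded1_def
proof (intro conjI allI)
  have [measurable]: "F \<in> borel_measurable borel" and bd: "\<And>x. norm (F x) \<le> 1" using F by (auto simp: bounded1_def)
  show "T h z F \<in> borel_measurable borel"
  proof -
    have "(\<lambda>x. measure_pmf.expectation (poisson_pmf (c * h)) (\<lambda>k. F (x + real k))) \<in> borel_measurable borel"
      by (rule measure_pmf.borel_measurable_lebesgue_integral) (simp add: split_beta', measurable)
    then show ?thesis unfolding T_def by measurable
  qed
  fix x
  have "norm (measure_pmf.expectation (poisson_pmf (c * h)) (\<lambda>k. F (x + real k))) \<le> measure_pmf.expectation (poisson_pmf (c * h)) (\<lambda>k. norm (F (x + real k)))"
    by (rule integral_norm_bound)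
  also have "\<dots> \<le> measure_pmf.expectation (poisson_pmf (c * h)) (\<lambda>k. 1)"
    using bd by (intro integral_mono measure_pmf.integrable_const_bound[where B=1]) auto
  finally show "norm (T h z F x) \<le> 1"
    unfolding T_def norm_mult using norm_exp_\<psi>_le_1[OF h] by (intro mult_le_one) auto
qed

lemma bounded1_T_iter: "bounded1 F \<Longrightarrow> h \<ge> 0 \<Longrightarrow> bounded1 ((T h z ^^ n) F)"
  by (induction n) (auto intro: bounded1_T)

text \<open>The last step is integrated out with the past frozen: the increment of \<open>Y\<close>
  contributes the exponential in the operator, with \<open>z\<close> scaled by the current weight,
  and the increment of \<open>N\<close> contributes the Poisson average.\<close>

lemma grid_step:
  assumes F: "bounded1 F" and h: "h > 0"
  shows "(CLINT \<omega>|M. iexp (z \<bullet> grid h (Suc m) \<omega>) * F (\<Sigma>\<xi> h (Suc m) \<omega>)) = (CLINT \<omega>|M. iexp (z \<bullet> grid h m \<omega>) * T h z F (\<Sigma>\<xi> h m \<omega>))"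
proof -
  have [measurable]: "F \<in> borel_measurable borel" and bd: "\<And>x. norm (F x) \<le> 1" using F by (auto simp: bounded1_def)
  have h0: "h \<ge> 0" using h by simp
  define G where "G = (\<lambda>p::(real \<times> (real^'d)) \<times> (real \<times> (real^'d)). iexp (z \<bullet> snd (fst p)) * (iexp ((exp (- fst (fst p)) *\<^sub>R z) \<bullet> snd (snd p)) * F (fst (fst p) + fst (snd p))))"
  have "(CLINT \<omega>|M. iexp (z \<bullet> grid h (Suc m) \<omega>) * F (\<Sigma>\<xi> h (Suc m) \<omega>)) = (CLINT \<omega>|M. G ((\<Sigma>\<xi> h m \<omega>, grid h m \<omega>), (\<xi> h m \<omega>, \<eta> h m \<omega>)))"
    by (simp add: G_def grid_def \<Sigma>\<xi>_def inner_add_right ring_distribs exp_add mult_ac)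
  also have "\<dots> = (CLINT \<omega>|M. CLINT \<omega>'|M. G ((\<Sigma>\<xi> h m \<omega>, grid h m \<omega>), (\<xi> h m \<omega>', \<eta> h m \<omega>')))"
  proof (rule indep_var_expectation[OF indep_step(1)[OF h0]])
    show "G \<in> borel_measurable (borel \<Otimes>\<^sub>M borel)"
      unfolding G_def by measurable
    show "norm (G p) \<le> 1" for p unfolding G_def using bd by (simp add: norm_mult)
  qed
  also have "\<dots> = (CLINT \<omega>|M. iexp (z \<bullet> grid h m \<omega>) * T h z F (\<Sigma>\<xi> h m \<omega>))"
  proof (intro Bochner_Integration.integral_cong refl)
    fix \<omega>
    define w where "w = exp (- \<Sigma>\<xi> h m \<omega>) *\<^sub>R z"
    have "(CLINT \<omega>'|M. F (\<Sigma>\<xi> h m \<omega> + \<xi> h m \<omega>') * iexp (w \<bullet> \<eta> h m \<omega>')) = (CLINT \<omega>'|M. F (\<Sigma>\<xi> h m \<omega> + \<xi> h m \<omega>')) * (CLINT \<omega>'|M. iexp (w \<bullet> \<eta> h m \<omega>'))"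
    proof (rule indep_var_lebesgue_integral)
      show "indep_var borel (\<lambda>\<omega>'. F (\<Sigma>\<xi> h m \<omega> + \<xi> h m \<omega>')) borel (\<lambda>\<omega>'. iexp (w \<bullet> \<eta> h m \<omega>'))"
        by (rule indep_step(2)[OF h0]) measurable
      show "integrable M (\<lambda>\<omega>'. F (\<Sigma>\<xi> h m \<omega> + \<xi> h m \<omega>'))" "integrable M (\<lambda>\<omega>'. iexp (w \<bullet> \<eta> h m \<omega>'))"
        using bd h0 by (auto intro!: integrable_const_bound[where B=1])
    qed
    also have "(CLINT \<omega>'|M. F (\<Sigma>\<xi> h m \<omega> + \<xi> h m \<omega>')) = (CLINT x|distr M borel (\<xi> h m). F (\<Sigma>\<xi> h m \<omega> + x))"
      using h0 by (subst integral_distr) auto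
    also have "\<dots> = measure_pmf.expectation (poisson_pmf (c * h)) (\<lambda>k. F (\<Sigma>\<xi> h m \<omega> + real k))"
      unfolding distr_\<xi>[OF h] by (subst integral_distr) auto
    finally show "(CLINT \<omega>'|M. G ((\<Sigma>\<xi> h m \<omega>, grid h m \<omega>), (\<xi> h m \<omega>', \<eta> h m \<omega>'))) = iexp (z \<bullet> grid h m \<omega>) * T h z F (\<Sigma>\<xi> h m \<omega>)"
      unfolding \<eta>_char[OF h0] T_def w_def[symmetric] G_def fst_conv snd_conv
      by (simp only: integral_mult_right_zero) (simp add: mult.commute)
  qed
  finally show ?thesis .
qed

lemma grid_char:
  assumes h: "h > 0"
  shows "(CLINT \<omega>|M. iexp (z \<bullet> grid h m \<omega>)) = (T h z ^^ m) (\<lambda>_. 1) 0"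
proof -
  have b1: "bounded1 (\<lambda>_. 1)" by (simp add: bounded1_def)
  \<comment> \<open>Generalised over the number \<open>n\<close> of operators already produced: each
    removed grid step is traded for one more application.\<close>
  have "(CLINT \<omega>|M. iexp (z \<bullet> grid h m \<omega>) * (T h z ^^ n) (\<lambda>_. 1) (\<Sigma>\<xi> h m \<omega>)) = (T h z ^^ (n + m)) (\<lambda>_. 1) 0" for n
  proof (induction m arbitrary: n)
    case 0
    then show ?case by (simp add: grid_def \<Sigma>\<xi>_def prob_space)
  next
    case (Suc m)
    have "(CLINT \<omega>|M. iexp (z \<bullet> grid h (Suc m) \<omega>) * (T h z ^^ n) (\<lambda>_. 1) (\<Sigma>\<xi> h (Suc m) \<omega>)) = (CLINT \<omega>|M. iexp (z \<bullet> grid h m \<omega>) * (T h z ^^ Suc n) (\<lambda>_. 1) (\<Sigma>\<xi> h m \<omega>))"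
      using h by (subst grid_step) (auto intro!: bounded1_T_iter b1)
    then show ?case using Suc[of "Suc n"] by simp
  qed
  from this[of 0] show ?thesis by simp
qed

lemma T_shift_step:
  assumes "\<And>y. G (y + 1) = G' y"
  shows "T h z G (x + 1) = T h (exp (- 1) *\<^sub>R z) G' x"
proof -
  have "G (x + 1 + real k) = G' (x + real k)" for k using assms[of "x + real k"] by (simp add: add_ac)
  moreover have "exp (- (x + 1)) = exp (- x) * exp (- 1)" by (simp add: exp_add[symmetric])
  ultimately show ?thesis unfolding T_def by simp
qed

text \<open>One jump of \<open>N\<close> scales everything still to come by \<open>1 / e\<close>,
  and this can be charged to \<open>z\<close>. Here the factor in the functional equation
  arises.\<close>

lemma T_shift: "(T h z ^^ m) (\<lambda>_. 1) (x + 1) = (T h (exp (- 1) *\<^sub>R z) ^^ m) (\<lambda>_. 1) x"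
proof (induction m arbitrary: x)
  case (Suc m)
  show ?case unfolding funpow.simps comp_def by (intro T_shift_step Suc)
qed simp

text \<open>Two or more jumps have probability \<open>1 - exp (- l) * (1 + l)\<close>, at most
  \<open>l^2\<close>, and any jump at all has probability at most \<open>l\<close>; test functions
  are bounded by 1 and their differences by 2.\<close>

lemma poisson_expectation_approx:
  assumes F: "bounded1 F" and l: "l > 0"
  shows "norm (measure_pmf.expectation (poisson_pmf l) (\<lambda>k. F (x + real k)) - exp (- l) * F x - l * exp (- l) * F (x + 1)) \<le> l\<^sup>2"
    and "norm (measure_pmf.expectation (poisson_pmf l) (\<lambda>k. F (x + real k)) - F x) \<le> 2 * l"
proof -
  have bd: "\<And>x. norm (F x) \<le> 1" using F by (auto simp: bounded1_def)
  have bd2: "norm (F x) \<le> 2" "norm (F x - F y) \<le> 2" for x y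
    using bd[of x] order_trans[OF norm_triangle_ineq4 add_mono[OF bd[of x] bd[of y]]] by auto
  let ?P = "poisson_pmf l" and ?E = "measure_pmf.expectation (poisson_pmf l)"
  have int: "integrable ?P (\<lambda>k. F (x + real k))" "integrable ?P (\<lambda>k. F (x + real k) * indicator {0} k)" "integrable ?P (\<lambda>k. F (x + real k) * indicator {1} k)"
    "integrable ?P (\<lambda>k. F (x + real k) * indicator {2..} k)" "integrable ?P (\<lambda>k. (F (x + real k) - F x) * indicator {1..} k)"
    using bd2 by (auto intro!: measure_pmf.integrable_const_bound[where B=2] AE_I2 simp: norm_mult split: split_indicator)
  have p0: "pmf ?P 0 = exp (- l)" and p1: "pmf ?P 1 = l * exp (- l)"
    using l by simp_all
  have e0: "?E (\<lambda>k. F (x + real k) * indicator {0} k) = exp (- l) * F x"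
    by (subst integral_measure_pmf[where A="{0}"]) (auto simp: p0 scaleR_conv_of_real exp_of_real[symmetric] split: split_indicator_asm)
  have e1: "?E (\<lambda>k. F (x + real k) * indicator {1} k) = l * exp (- l) * F (x + 1)"
    using p1 by (subst integral_measure_pmf[where A="{1}"]) (auto simp: scaleR_conv_of_real exp_of_real[symmetric] split: split_indicator_asm)
  have q: "measure ?P {2..} = 1 - exp (- l) - l * exp (- l)" "measure ?P {1..} = 1 - exp (- l)"
  proof -
    have "measure ?P {..<2} = pmf ?P 0 + pmf ?P 1" by (simp add: measure_measure_pmf_finite numeral_2_eq_2 lessThan_Suc)
    moreover have "{2::nat..} = UNIV - {..<2}" by auto
    ultimately show "measure ?P {2..} = 1 - exp (- l) - l * exp (- l)" using measure_pmf.prob_compl[of "{..<2}" ?P] p0 p1 by simp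
    have "measure ?P {..<1} = pmf ?P 0" by (simp add: measure_measure_pmf_finite lessThan_Suc)
    moreover have "{1::nat..} = UNIV - {..<1}" by auto
    ultimately show "measure ?P {1..} = 1 - exp (- l)" using measure_pmf.prob_compl[of "{..<1}" ?P] p0 by simp
  qed
  have ex: "1 - l \<le> exp (- l)" using exp_ge_add_one_self[of "- l"] by simp
  have "?E (\<lambda>k. F (x + real k)) = ?E (\<lambda>k. F (x + real k) * indicator {0} k + F (x + real k) * indicator {1} k + F (x + real k) * indicator {2..} k)"
    by (intro Bochner_Integration.integral_cong) (auto split: split_indicator)
  also have "\<dots> = exp (- l) * F x + l * exp (- l) * F (x + 1) + ?E (\<lambda>k. F (x + real k) * indicator {2..} k)"
    using int e0 e1 by (simp add: Bochner_Integration.integral_add)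
  finally have "norm (?E (\<lambda>k. F (x + real k)) - exp (- l) * F x - l * exp (- l) * F (x + 1)) = norm (?E (\<lambda>k. F (x + real k) * indicator {2..} k))" by simp
  also have "\<dots> \<le> ?E (\<lambda>k. norm (F (x + real k) * indicator {2..} k))" by (rule integral_norm_bound)
  also have "\<dots> \<le> ?E (\<lambda>k. indicator {2..} k)"
    using bd by (intro integral_mono integrable_norm int(4) measure_pmf.integrable_const_bound[where B=1])
      (auto simp: norm_mult split: split_indicator)
  also have "\<dots> = 1 - exp (- l) * (1 + l)" using q by (simp add: ring_distribs)
  also have "\<dots> \<le> l\<^sup>2"
  proof -
    have "(1 - l) * (1 + l) \<le> exp (- l) * (1 + l)" using l ex by (intro mult_right_mono) auto
    then show ?thesis by (simp add: power2_eq_square algebra_simps)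
  qed
  finally show "norm (?E (\<lambda>k. F (x + real k)) - exp (- l) * F x - l * exp (- l) * F (x + 1)) \<le> l\<^sup>2" .
  have "?E (\<lambda>k. F (x + real k)) - F x = ?E (\<lambda>k. F (x + real k) - F x)" using int by (simp add: Bochner_Integration.integral_diff)
  also have "\<dots> = ?E (\<lambda>k. (F (x + real k) - F x) * indicator {1..} k)"
    by (intro Bochner_Integration.integral_cong) (auto split: split_indicator simp: not_le)
  finally have "norm (?E (\<lambda>k. F (x + real k)) - F x) \<le> ?E (\<lambda>k. norm ((F (x + real k) - F x) * indicator {1..} k))"
    using integral_norm_bound by metis
  also have "\<dots> \<le> ?E (\<lambda>k. 2 * indicator {1..} k)"
    using bd2 by (intro integral_mono integrable_norm int(5) measure_pmf.integrable_const_bound[where B=2])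
      (auto simp: norm_mult split: split_indicator)
  also have "\<dots> = 2 * (1 - exp (- l))" using q by simp
  also have "\<dots> \<le> 2 * l" using ex by simp
  finally show "norm (?E (\<lambda>k. F (x + real k)) - F x) \<le> 2 * l" .
qed

lemma T_close:
  assumes F: "bounded1 F" and h: "h > 0"
  shows "norm (T h z F x - F x) \<le> h * (norm (\<psi> (exp (- x) *\<^sub>R z)) + 2 * c)"
proof -
  let ?E = "measure_pmf.expectation (poisson_pmf (c * h)) (\<lambda>k. F (x + real k))" and ?e = "exp (of_real h * \<psi> (exp (- x) *\<^sub>R z))"
  have bd: "norm (F x) \<le> 1" using F by (auto simp: bounded1_def)
  have "T h z F x - F x = ?e * (?E - F x) + (?e - 1) * F x" by (simp add: T_def algebra_simps)
  then have "norm (T h z F x - F x) \<le> norm ?e * norm (?E - F x) + norm (?e - 1) * norm (F x)"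
    by (metis norm_mult norm_triangle_ineq)
  also have "\<dots> \<le> 1 * (2 * (c * h)) + (h * norm (\<psi> (exp (- x) *\<^sub>R z))) * 1"
  proof (intro add_mono mult_mono)
    show "norm ?e \<le> 1" using h by (intro norm_exp_\<psi>_le_1) auto
    show "norm (?E - F x) \<le> 2 * (c * h)" using h c by (intro poisson_expectation_approx(2) F) auto
    have "norm (?e - 1) \<le> norm (of_real h * \<psi> (exp (- x) *\<^sub>R z))"
      using h Re_\<psi>_le_0 by (intro norm_exp_minus_1_le) (simp add: mult_nonneg_nonpos)
    then show "norm (?e - 1) \<le> h * norm (\<psi> (exp (- x) *\<^sub>R z))" using h by (simp add: norm_mult)
  qed (use h bd c in auto)
  finally show ?thesis by (simp add: algebra_simps)
qed

text \<open>A first-order bound suffices here: it is applied at the state \<open>x = 1\<close>,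
  after a jump, where the term already carries a factor \<open>c * h\<close>.\<close>

lemma T_iter_close:
  assumes F: "bounded1 F" and h: "h > 0"
  shows "norm ((T h z ^^ n) F x - F x) \<le> real n * h * (norm (\<psi> (exp (- x) *\<^sub>R z)) + 2 * c)"
proof (induction n)
  case (Suc n)
  have "bounded1 ((T h z ^^ n) F)" using F h by (intro bounded1_T_iter) auto
  from T_close[OF this h, of z x] Suc
    norm_triangle_ineq[of "T h z ((T h z ^^ n) F) x - (T h z ^^ n) F x" "(T h z ^^ n) F x - F x"]
  show ?case by (simp add: algebra_simps)
qed simp

text \<open>The number \<open>a\<close> is the contribution of \<open>Y\<close> during one step
  multiplied by the probability \<open>exp (- c * h)\<close> of no jump.\<close>

lemma T_main:
  fixes z :: "real^'d"
  assumes F: "bounded1 F" and h: "h > 0"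
  defines "a \<equiv> exp (of_real h * (\<psi> z - of_real c))"
  shows "norm (T h z F 0 - a * F 0 - of_real (c * h) * a * F 1) \<le> (c * h)\<^sup>2"
proof -
  let ?E = "measure_pmf.expectation (poisson_pmf (c * h)) (\<lambda>k. F (0 + real k))" and ?e = "exp (of_real h * \<psi> z)"
  have a: "a = ?e * exp (- of_real (c * h))" unfolding a_def by (simp add: exp_add[symmetric] algebra_simps)
  have "T h z F 0 - a * F 0 - of_real (c * h) * a * F 1 = ?e * (?E - exp (- of_real (c * h)) * F 0 - of_real (c * h) * exp (- of_real (c * h)) * F (0 + 1))"
    unfolding a T_def by (simp add: algebra_simps)
  also have "norm \<dots> \<le> 1 * (c * h)\<^sup>2"
    unfolding norm_mult
  proof (intro mult_mono)
    show "norm ?e \<le> 1" using h by (intro norm_exp_\<psi>_le_1) auto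
    show "norm (?E - exp (- of_real (c * h)) * F 0 - of_real (c * h) * exp (- of_real (c * h)) * F (0 + 1)) \<le> (c * h)\<^sup>2"
      using poisson_expectation_approx(1)[OF F, of "c * h" 0] c h by (simp add: exp_of_real[symmetric])
  qed auto
  finally show ?thesis by simp
qed

text \<open>The sum of two rates: \<open>norm (\<psi> z) + c\<close> bounds the change of the
  no-jump factor, and the value of \<open>T_iter_close\<close> at the state 1 contributes the
  rest.\<close>

definition Q :: "real^'d \<Rightarrow> real" where
  "Q z = norm (\<psi> z) + norm (\<psi> (exp (- 1) *\<^sub>R z)) + 3 * c"

text \<open>All \<open>n\<close> steps together act like one step of length \<open>n * h\<close>.
  The error is quadratic in that length with a constant independent of \<open>h\<close>, so it
  survives the refinement of the grid.\<close>

lemma T_iter_main: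
  fixes z :: "real^'d"
  assumes F: "bounded1 F" and h: "h > 0"
  defines "a \<equiv> exp (of_real h * (\<psi> z - of_real c))"
  shows "norm ((T h z ^^ n) F 0 - a ^ n * F 0 - of_real (real n * (c * h)) * a ^ n * F 1) \<le> (c\<^sup>2 + c * Q z) * (real n * h)\<^sup>2"
proof (induction n)
  case (Suc n)
  have bF: "norm (F x) \<le> 1" for x using F by (auto simp: bounded1_def)
  have Q0: "Q z \<ge> 0" unfolding Q_def using c by simp
  define G where "G = (T h z ^^ n) F"
  have G: "bounded1 G" unfolding G_def using F h by (intro bounded1_T_iter) auto
  have re: "Re (of_real t * (\<psi> z - of_real c)) \<le> 0" if "t \<ge> 0" for t
    using that c Re_\<psi>_le_0[of z] by (simp add: mult_nonneg_nonpos)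
  have na: "norm a \<le> 1" unfolding a_def using re[of h] h by simp
  have "norm (a ^ n - 1) \<le> real n * h * (norm (\<psi> z) + c)"
  proof -
    have "a ^ n = exp (of_real (real n * h) * (\<psi> z - of_real c))"
      unfolding a_def by (simp add: exp_of_nat_mult[symmetric] mult_ac)
    then have "norm (a ^ n - 1) \<le> norm (of_real (real n * h) * (\<psi> z - of_real c))"
      using norm_exp_minus_1_le[OF re[of "real n * h"]] h by simp
    also have "\<dots> = real n * h * norm (\<psi> z - of_real c)" using h by (simp add: norm_mult)
    also have "\<dots> \<le> real n * h * (norm (\<psi> z) + c)"
      using h c norm_triangle_ineq4[of "\<psi> z" "of_real c"] by (intro mult_left_mono) auto
    finally show ?thesis .
  qed
  then have "norm ((a ^ n - 1) * F 1) \<le> real n * h * (norm (\<psi> z) + c) * 1"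
    unfolding norm_mult by (intro mult_mono bF) (use h c in auto)
  moreover have "norm (G 1 - F 1) \<le> real n * h * (norm (\<psi> (exp (- 1) *\<^sub>R z)) + 2 * c)"
    unfolding G_def by (rule T_iter_close[OF F h])
  moreover have "norm (G 1 - a ^ n * F 1) \<le> norm (G 1 - F 1) + norm ((a ^ n - 1) * F 1)"
    using norm_triangle_ineq4[of "G 1 - F 1" "(a ^ n - 1) * F 1"] by (simp add: algebra_simps)
  ultimately have 3: "norm (G 1 - a ^ n * F 1) \<le> real n * h * Q z"
    unfolding Q_def by (simp add: algebra_simps)
  have "norm (of_real (c * h) * a * (G 1 - a ^ n * F 1)) \<le> ((c * h) * 1) * (real n * h * Q z)"
    unfolding norm_mult using na 3 c h Q0 by (intro mult_mono) (auto simp: norm_mult)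
  moreover have "norm (a * (G 0 - a ^ n * F 0 - of_real (real n * (c * h)) * a ^ n * F 1)) \<le> 1 * ((c\<^sup>2 + c * Q z) * (real n * h)\<^sup>2)"
    unfolding norm_mult using na Suc by (intro mult_mono) (auto simp: G_def)
  moreover have "norm (T h z G 0 - a * G 0 - of_real (c * h) * a * G 1) \<le> (c * h)\<^sup>2"
    unfolding a_def by (rule T_main[OF G h])
  \<comment> \<open>Decomposition by the first step: its own second-order error; no jump, covered by
    the induction hypothesis; one jump, where the factor \<open>c * h\<close> makes a first-order
    comparison enough.\<close>
  moreover have "(T h z ^^ Suc n) F 0 - a ^ Suc n * F 0 - of_real (real (Suc n) * (c * h)) * a ^ Suc n * F 1 =
     (T h z G 0 - a * G 0 - of_real (c * h) * a * G 1) + a * (G 0 - a ^ n * F 0 - of_real (real n * (c * h)) * a ^ n * F 1) + of_real (c * h) * a * (G 1 - a ^ n * F 1)"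
    by (simp add: G_def algebra_simps)
  ultimately have "norm ((T h z ^^ Suc n) F 0 - a ^ Suc n * F 0 - of_real (real (Suc n) * (c * h)) * a ^ Suc n * F 1)
      \<le> (c * h)\<^sup>2 + (c\<^sup>2 + c * Q z) * (real n * h)\<^sup>2 + (c * h) * (real n * h * Q z)"
    using norm_triangle_mono[OF norm_triangle_mono[of "T h z G 0 - a * G 0 - of_real (c * h) * a * G 1"]] by (simp only: mult_1_left mult_1_right)
  also have "\<dots> = (c\<^sup>2 + c * Q z * real n + (c\<^sup>2 + c * Q z) * (real n)\<^sup>2) * h\<^sup>2"
    by (simp add: power2_eq_square algebra_simps)
  also have "\<dots> \<le> ((c\<^sup>2 + c * Q z) * (real (Suc n))\<^sup>2) * h\<^sup>2"
  proof (intro mult_right_mono)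
    have "0 \<le> c\<^sup>2 * (2 * real n)" "0 \<le> c * Q z * (real n + 1)" using c Q0 by auto
    then show "c\<^sup>2 + c * Q z * real n + (c\<^sup>2 + c * Q z) * (real n)\<^sup>2 \<le> (c\<^sup>2 + c * Q z) * (real (Suc n))\<^sup>2"
      by (simp add: power2_eq_square algebra_simps)
  qed auto
  finally show ?case by (simp add: power_mult_distrib mult.assoc)
qed simp

end

section \<open>Passage from partition sums to the functional equation\<close>

lemma (in prob_space) char_tendsto_in_prob:
  fixes G :: "nat \<Rightarrow> 'a \<Rightarrow> 'b::euclidean_space"
  assumes [measurable]: "\<And>n. G n \<in> borel_measurable M" "I \<in> borel_measurable M"
    and lim: "\<And>\<epsilon>. \<epsilon> > 0 \<Longrightarrow> (\<lambda>n. prob {\<omega> \<in> space M. \<epsilon> < dist (G n \<omega>) (I \<omega>)}) \<longlonglongrightarrow> 0"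
  shows "(\<lambda>n. CLINT \<omega>|M. iexp (z \<bullet> G n \<omega>)) \<longlonglongrightarrow> (CLINT \<omega>|M. iexp (z \<bullet> I \<omega>))"
proof (rule LIMSEQ_I)
  fix r :: real assume r: "r > 0"
  define \<epsilon> where "\<epsilon> = r / (2 * (norm z + 1))"
  have \<epsilon>: "\<epsilon> > 0" using r by (simp add: \<epsilon>_def add_nonneg_pos)
  have "norm z * \<epsilon> < r / 2"
  proof -
    have "norm z * \<epsilon> < (norm z + 1) * \<epsilon>" using \<epsilon> by simp
    also have "\<dots> = r / 2" using norm_ge_zero[of z] by (simp add: \<epsilon>_def field_simps add_nonneg_eq_0_iff)
    finally show ?thesis .
  qed
  have "\<forall>\<^sub>F n in sequentially. prob {\<omega> \<in> space M. \<epsilon> < dist (G n \<omega>) (I \<omega>)} < r / 4"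
    using lim[OF \<epsilon>] r by (intro order_tendstoD) auto
  then have "\<forall>\<^sub>F n in sequentially. norm ((CLINT \<omega>|M. iexp (z \<bullet> G n \<omega>)) - (CLINT \<omega>|M. iexp (z \<bullet> I \<omega>))) < r"
  proof eventually_elim
    case (elim n)
    let ?A = "{\<omega> \<in> space M. \<epsilon> < dist (G n \<omega>) (I \<omega>)}"
    have int: "integrable M (\<lambda>\<omega>. iexp (z \<bullet> G n \<omega>))" "integrable M (\<lambda>\<omega>. iexp (z \<bullet> I \<omega>))"
      by (auto intro!: integrable_const_bound[where B=1])
    have "norm ((CLINT \<omega>|M. iexp (z \<bullet> G n \<omega>)) - (CLINT \<omega>|M. iexp (z \<bullet> I \<omega>))) = norm (CLINT \<omega>|M. iexp (z \<bullet> G n \<omega>) - iexp (z \<bullet> I \<omega>))"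
      using int by simp
    also have "\<dots> \<le> (LINT \<omega>|M. norm (iexp (z \<bullet> G n \<omega>) - iexp (z \<bullet> I \<omega>)))" by (rule integral_norm_bound)
    also have "\<dots> \<le> (LINT \<omega>|M. norm z * \<epsilon> + 2 * indicator ?A \<omega>)"
    proof (rule integral_mono)
      show "integrable M (\<lambda>\<omega>. norm (iexp (z \<bullet> G n \<omega>) - iexp (z \<bullet> I \<omega>)))" using int by auto
      show "integrable M (\<lambda>\<omega>. norm z * \<epsilon> + 2 * indicator ?A \<omega>)" by (auto simp: emeasure_eq_measure)
      fix \<omega> assume \<omega>: "\<omega> \<in> space M"
      show "norm (iexp (z \<bullet> G n \<omega>) - iexp (z \<bullet> I \<omega>)) \<le> norm z * \<epsilon> + 2 * indicator ?A \<omega>"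
      proof (cases "\<omega> \<in> ?A")
        case True
        have "norm (iexp (z \<bullet> G n \<omega>) - iexp (z \<bullet> I \<omega>)) \<le> 2"
          using norm_triangle_ineq4[of "iexp (z \<bullet> G n \<omega>)" "iexp (z \<bullet> I \<omega>)"] by simp
        moreover have "0 \<le> norm z * \<epsilon>" using \<epsilon> by simp
        ultimately show ?thesis using True by simp
      next
        case False
        have "iexp (z \<bullet> G n \<omega>) - iexp (z \<bullet> I \<omega>) = iexp (z \<bullet> I \<omega>) * (iexp (z \<bullet> (G n \<omega> - I \<omega>)) - 1)"
          by (simp add: inner_diff_right algebra_simps exp_diff)
        then have "norm (iexp (z \<bullet> G n \<omega>) - iexp (z \<bullet> I \<omega>)) = norm (iexp (z \<bullet> (G n \<omega> - I \<omega>)) - 1)" by (simp add: norm_mult)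
        also have "\<dots> \<le> \<bar>z \<bullet> (G n \<omega> - I \<omega>)\<bar>" using iexp_approx1[of "z \<bullet> (G n \<omega> - I \<omega>)" 0] by simp
        also have "\<dots> \<le> norm z * norm (G n \<omega> - I \<omega>)" by (rule Cauchy_Schwarz_ineq2)
        also have "\<dots> \<le> norm z * \<epsilon>" using False \<omega> by (intro mult_left_mono) (auto simp: dist_norm)
        finally show ?thesis using False by simp
      qed
    qed
    also have "\<dots> = norm z * \<epsilon> + 2 * prob ?A"
      by (subst Bochner_Integration.integral_add) (auto simp: emeasure_eq_measure prob_space)
    also have "\<dots> < r" using elim \<open>norm z * \<epsilon> < r / 2\<close> by simp
    finally show ?case .
  qed
  then show "\<exists>no. \<forall>n\<ge>no. norm ((CLINT \<omega>|M. iexp (z \<bullet> G n \<omega>)) - (CLINT \<omega>|M. iexp (z \<bullet> I \<omega>))) < r"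
    by (simp add: eventually_sequentially)
qed

text \<open>Sums involving left limits are measurable only for the completion. They are replaced by
  almost surely equal sums measurable for \<open>M\<close>, on whose events the completed measure
  agrees with \<open>M\<close>.\<close>

lemma (in prob_space) tendsto_in_prob_char:
  fixes G :: "nat \<Rightarrow> 'a \<Rightarrow> 'b::euclidean_space"
  assumes S: "tendsto_in_prob M S I" and G [measurable]: "\<And>n. G n \<in> borel_measurable M" "I \<in> borel_measurable M"
    and eq: "\<And>n. AE \<omega> in M. S n \<omega> = G n \<omega>"
  shows "(\<lambda>n. CLINT \<omega>|M. iexp (z \<bullet> G n \<omega>)) \<longlonglongrightarrow> (CLINT \<omega>|M. iexp (z \<bullet> I \<omega>))"
proof (rule char_tendsto_in_prob[OF G])
  fix \<epsilon> :: real assume "\<epsilon> > 0"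
  have [measurable]: "S n \<in> borel_measurable (completion M)" for n using S by (simp add: tendsto_in_prob_def)
  have [measurable]: "I \<in> borel_measurable (completion M)" "G n \<in> borel_measurable (completion M)" for n
    by (auto intro: measurable_completion)
  have eqn: "measure (completion M) {\<omega> \<in> space M. \<epsilon> < dist (S n \<omega>) (I \<omega>)} = prob {\<omega> \<in> space M. \<epsilon> < dist (G n \<omega>) (I \<omega>)}" for n
  proof -
    have "measure (completion M) {\<omega> \<in> space (completion M). \<epsilon> < dist (S n \<omega>) (I \<omega>)} = measure (completion M) {\<omega> \<in> space (completion M). \<epsilon> < dist (G n \<omega>) (I \<omega>)}"
    proof (rule measure_eq_AE)
      have "AE \<omega> in completion M. S n \<omega> = G n \<omega>" by (rule AE_completion[OF eq])
      then show "AE \<omega> in completion M. (\<omega> \<in> {\<omega> \<in> space (completion M). \<epsilon> < dist (S n \<omega>) (I \<omega>)}) = (\<omega> \<in> {\<omega> \<in> space (completion M). \<epsilon> < dist (G n \<omega>) (I \<omega>)})"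
        by eventually_elim simp
    qed measurable
    also have "\<dots> = prob {\<omega> \<in> space M. \<epsilon> < dist (G n \<omega>) (I \<omega>)}"
      unfolding space_completion by (rule measure_completion) measurable
    finally show ?thesis by simp
  qed
  have "(\<lambda>n. measure (completion M) {\<omega> \<in> space M. \<epsilon> < dist (S n \<omega>) (I \<omega>)}) \<longlonglongrightarrow> 0"
    using S \<open>\<epsilon> > 0\<close> unfolding tendsto_in_prob_def by blast
  then show "(\<lambda>n. prob {\<omega> \<in> space M. \<epsilon> < dist (G n \<omega>) (I \<omega>)}) \<longlonglongrightarrow> 0"
    unfolding eqn .
qed

text \<open>There are no fixed times of discontinuity: along a sequence increasing to
  \<open>t\<close> the path converges almost surely to its left limit, and in probability to
  \<open>X t\<close> by stochastic continuity. The expected truncated distance \<open>D\<close> of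
  the two limits is thus 0. Grid sums may therefore use \<open>N\<close> in place of its left
  limits.\<close>

lemma (in levy_proc) AE_left_limit:
  assumes t: "t \<ge> 0"
  shows "AE \<omega> in M. left_limit X t \<omega> = X t \<omega>"
proof (cases "t = 0")
  case True
  then show ?thesis by (simp add: left_limit_def)
next
  case False
  then have t: "t > 0" using t by simp
  define s where "s = (\<lambda>n. t - t / real (n + 2))"
  have s01: "0 \<le> s n" "s n < t" for n
  proof -
    have "t / real (n + 2) \<le> t / 1" using t by (intro divide_left_mono) auto
    then show "0 \<le> s n" by (simp add: s_def)
    show "s n < t" using t by (simp add: s_def)
  qed
  have s: "s \<longlonglongrightarrow> t"
  proof -
    have "(\<lambda>n. t - t / real (n + 2)) \<longlonglongrightarrow> t - 0" by (intro tendsto_intros) real_asymp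
    then show ?thesis by (simp add: s_def)
  qed
  have fl: "filterlim s (at_left t) sequentially"
    using s s01 by (auto simp: filterlim_at less_imp_neq)
  have AL: "AE \<omega> in M. (\<lambda>n. X (s n) \<omega>) \<longlonglongrightarrow> left_limit X t \<omega>"
    using cadlag
  proof eventually_elim
    case (elim \<omega>)
    then obtain l where l: "((\<lambda>s. X s \<omega>) \<longlongrightarrow> l) (at_left t)" using t by blast
    then have "left_limit X t \<omega> = l" unfolding left_limit_def using t by (auto intro: tendsto_Lim)
    then show ?case using filterlim_compose[OF l fl] by simp
  qed
  define W where "W = (\<lambda>\<omega>. lim (\<lambda>n. X (s n) \<omega>))"
  have [measurable]: "X (s n) \<in> borel_measurable M" "X t \<in> borel_measurable M" for n using s01 t by auto
  have [measurable]: "W \<in> borel_measurable M" unfolding W_def by measurable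
  have AW: "AE \<omega> in M. W \<omega> = left_limit X t \<omega>" using AL by eventually_elim (simp add: W_def limI)
  define D where "D = (LINT \<omega>|M. min 1 (dist (W \<omega>) (X t \<omega>)))"
  have lim: "(\<lambda>n. LINT \<omega>|M. min 1 (dist (X (s n) \<omega>) (X t \<omega>))) \<longlonglongrightarrow> D"
    unfolding D_def
  proof (rule integral_dominated_convergence[where w="\<lambda>_. 1"])
    show "AE \<omega> in M. (\<lambda>n. min 1 (dist (X (s n) \<omega>) (X t \<omega>))) \<longlonglongrightarrow> min 1 (dist (W \<omega>) (X t \<omega>))"
      using AL AW by eventually_elim (auto intro!: tendsto_intros)
  qed auto
  have "D \<le> \<epsilon>" if \<epsilon>: "\<epsilon> > 0" for \<epsilon>
  proof -
    let ?p = "\<lambda>n. prob {\<omega> \<in> space M. \<epsilon> < dist (X (s n) \<omega>) (X t \<omega>)}"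
    have "(\<lambda>n. ?p n) \<longlonglongrightarrow> 0"
    proof (rule filterlim_compose[OF stoch_cont[OF less_imp_le[OF t] \<epsilon>]])
      show "filterlim s (at t within {0..}) sequentially"
        using s s01 by (auto simp: filterlim_at less_imp_neq)
    qed
    then have lim': "(\<lambda>n. \<epsilon> + ?p n) \<longlonglongrightarrow> \<epsilon>" using tendsto_add[OF tendsto_const, of ?p 0 sequentially \<epsilon>] by simp
    have "(LINT \<omega>|M. min 1 (dist (X (s n) \<omega>) (X t \<omega>))) \<le> \<epsilon> + ?p n" for n
    proof -
      have "(LINT \<omega>|M. min 1 (dist (X (s n) \<omega>) (X t \<omega>))) \<le> (LINT \<omega>|M. \<epsilon> + indicator {\<omega> \<in> space M. \<epsilon> < dist (X (s n) \<omega>) (X t \<omega>)} \<omega>)"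
      proof (rule integral_mono)
        show "integrable M (\<lambda>\<omega>. min 1 (dist (X (s n) \<omega>) (X t \<omega>)))" by (intro integrable_const_bound[where B=1]) auto
        show "integrable M (\<lambda>\<omega>. \<epsilon> + indicator {\<omega> \<in> space M. \<epsilon> < dist (X (s n) \<omega>) (X t \<omega>)} \<omega>)"
          by (auto simp: emeasure_eq_measure)
      qed (use \<epsilon> in \<open>auto split: split_indicator simp: min_def\<close>)
      also have "\<dots> = \<epsilon> + ?p n" by (subst Bochner_Integration.integral_add) (auto simp: emeasure_eq_measure prob_space)
      finally show ?thesis .
    qed
    then show ?thesis by (intro LIMSEQ_le[OF lim lim']) blast
  qed
  then have "D \<le> 0" using field_le_epsilon[of D 0] by simp
  moreover have "D \<ge> 0" unfolding D_def by (intro integral_nonneg_AE) auto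
  ultimately have "D = 0" by (rule antisym)
  then have "(LINT \<omega>|M. min 1 (dist (W \<omega>) (X t \<omega>))) = 0" by (simp only: D_def)
  then have "AE \<omega> in M. min 1 (dist (W \<omega>) (X t \<omega>)) = 0"
    by (subst (asm) integral_nonneg_eq_0_iff_AE) (auto intro!: integrable_const_bound[where B=1])
  then show ?thesis using AW by eventually_elim (auto simp: min_def split: if_splits)
qed

context pois_levy
begin

abbreviation "H \<equiv> (\<lambda>s \<omega>. exp (- left_limit N s \<omega>))"

lemma AE_grid_eq:
  assumes h: "h \<ge> 0"
  shows "AE \<omega> in M. (\<Sum>i<m. H (real i * h) \<omega> *\<^sub>R (Y (real (Suc i) * h) \<omega> - Y (real i * h) \<omega>)) = grid h m \<omega>"
proof -
  have "AE \<omega> in M. \<forall>i::nat. left_limit N (real i * h) \<omega> = N (real i * h) \<omega>"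
    using h by (subst AE_all_countable) (auto intro: N.AE_left_limit)
  with N.start_0 show ?thesis
  proof eventually_elim
    case (elim \<omega>)
    have "\<Sigma>\<xi> h i \<omega> = N (real i * h) \<omega>" for i
      unfolding \<Sigma>\<xi>_def \<xi>_def using elim(1) by (subst sum_lessThan_telescope) simp
    then show ?case using elim(2) by (simp add: grid_def \<eta>_def)
  qed
qed

text \<open>The step \<open>s / (n + 1)\<close> divides every multiple of \<open>s\<close>, so the
  horizons \<open>L * s\<close> and \<open>(L + 1) * s\<close> share one grid and differ by exactly
  \<open>n + 1\<close> applications of the operator.\<close>

lemma grid_tendsto:
  assumes I: "has_stochastic_integral M H Y I" and s: "s > 0"
  shows "(\<lambda>n. (T (s / real (Suc n)) z ^^ (L * Suc n)) (\<lambda>_. 1) 0) \<longlonglongrightarrow> (CLINT \<omega>|M. iexp (z \<bullet> I (real L * s) \<omega>))"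
proof -
  have t0: "real L * s \<ge> 0" using s by simp
  define p where "p = (\<lambda>n i. real i * (s / real (Suc n)))"
  have "partition_seq (real L * s) (\<lambda>n. L * Suc n) p"
    unfolding partition_seq_def
  proof (intro conjI allI impI)
    show "p n 0 = 0" "p n (L * Suc n) = real L * s" for n by (auto simp: p_def field_simps)
    show "p n i \<le> p n (Suc i)" for n i unfolding p_def using s by (intro mult_right_mono) auto
    fix \<epsilon> :: real assume "\<epsilon> > 0"
    have "(\<lambda>n. s / real (Suc n)) \<longlonglongrightarrow> 0" by real_asymp
    then have "\<forall>\<^sub>F n in sequentially. s / real (Suc n) < \<epsilon>" using \<open>\<epsilon> > 0\<close> by (intro order_tendstoD) auto
    then show "\<forall>\<^sub>F n in sequentially. \<forall>i<L * Suc n. p n (Suc i) - p n i < \<epsilon>"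
    proof eventually_elim
      case (elim n)
      have "real (Suc i) * x - real i * x = x" for x i by (simp add: algebra_simps)
      then show ?case unfolding p_def using elim by (simp only:) simp
    qed
  qed
  then have "tendsto_in_prob M (\<lambda>n \<omega>. \<Sum>i<L * Suc n. H (p n i) \<omega> *\<^sub>R (Y (p n (Suc i)) \<omega> - Y (p n i) \<omega>)) (I (real L * s))"
    using I t0 unfolding has_stochastic_integral_def by blast
  then have "(\<lambda>n. CLINT \<omega>|M. iexp (z \<bullet> grid (s / real (Suc n)) (L * Suc n) \<omega>)) \<longlonglongrightarrow> (CLINT \<omega>|M. iexp (z \<bullet> I (real L * s) \<omega>))"
  proof (rule tendsto_in_prob_char)
    show "grid (s / real (Suc n)) (L * Suc n) \<in> borel_measurable M" for n using s by (intro grid_meas) simp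
    show "I (real L * s) \<in> borel_measurable M" using I t0 by (simp add: has_stochastic_integral_def)
    show "AE \<omega> in M. (\<Sum>i<L * Suc n. H (p n i) \<omega> *\<^sub>R (Y (p n (Suc i)) \<omega> - Y (p n i) \<omega>)) = grid (s / real (Suc n)) (L * Suc n) \<omega>" for n
      unfolding p_def by (rule AE_grid_eq) (use s in simp)
  qed
  then show ?thesis using s by (simp add: grid_char)
qed

text \<open>Conditioning on the first time step of length \<open>s\<close>: with probability \<open>1 - c s + O(s\<^sup>2)\<close> there is no jump
  and with probability \<open>c s + O(s\<^sup>2)\<close> there is exactly one, after which the integral starts afresh with the
  factor \<open>e\<^sup>-\<^sup>1\<close>.\<close>

lemma functional_equation:
  assumes I: "has_stochastic_integral M H Y I" and Z: "Z \<in> borel_measurable M"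
    and lim: "AE \<omega> in M. ((\<lambda>t. I t \<omega>) \<longlongrightarrow> Z \<omega>) at_top"
  defines "f \<equiv> char_fun (distr M borel Z)"
  shows "(of_real c - \<psi> z) * f z = of_real c * f (exp (- 1) *\<^sub>R z)"
proof -
  define cf where "cf = (\<lambda>t z. CLINT \<omega>|M. iexp (z \<bullet> I t \<omega>))"
  have cf_lim: "(\<lambda>L. cf (real (u L) * s) z) \<longlonglongrightarrow> f z" if s: "s > 0" and u: "filterlim u at_top sequentially" for s z u
  proof -
    have [measurable]: "I (real L * s) \<in> borel_measurable M" for L using I s by (simp add: has_stochastic_integral_def)
    have [measurable]: "Z \<in> borel_measurable M" by fact
    have fl: "filterlim (\<lambda>L. real (u L) * s) at_top sequentially"
      using s u by (intro filterlim_at_top_mult_tendsto_pos[OF tendsto_const]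
          filterlim_compose[OF filterlim_real_sequentially]) auto
    have "(\<lambda>L. CLINT \<omega>|M. iexp (z \<bullet> I (real (u L) * s) \<omega>)) \<longlonglongrightarrow> (CLINT \<omega>|M. iexp (z \<bullet> Z \<omega>))"
    proof (rule integral_dominated_convergence[where w="\<lambda>_. 1"])
      show "AE \<omega> in M. (\<lambda>L. iexp (z \<bullet> I (real (u L) * s) \<omega>)) \<longlonglongrightarrow> iexp (z \<bullet> Z \<omega>)"
        using lim by eventually_elim (intro tendsto_intros filterlim_compose[OF _ fl])
    qed auto
    then show ?thesis unfolding cf_def f_def by (subst char_fun_distr) auto
  qed
  define R where "R = c\<^sup>2 + c * Q z"
  have step: "norm (f z - exp (of_real s * (\<psi> z - of_real c)) * f z - of_real (c * s) * exp (of_real s * (\<psi> z - of_real c)) * f (exp (- 1) *\<^sub>R z)) \<le> R * s\<^sup>2"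
    if s: "s > 0" for s
  proof -
    let ?a = "exp (of_real s * (\<psi> z - of_real c))"
    \<comment> \<open>The bound depends neither on the mesh nor on \<open>L\<close>; it survives the
      limit in the mesh here and the limit \<open>L -> \<infinity>\<close> below.\<close>
    have 1: "norm (cf (real (L + 1) * s) z - ?a * cf (real L * s) z - of_real (c * s) * ?a * cf (real L * s) (exp (- 1) *\<^sub>R z)) \<le> R * s\<^sup>2" for L
    proof (rule LIMSEQ_le_const2)
      let ?G = "\<lambda>n z L. (T (s / real (Suc n)) z ^^ (L * Suc n)) (\<lambda>_. 1) 0"
      show "(\<lambda>n. norm (?G n z (L + 1) - ?a * ?G n z L - of_real (c * s) * ?a * ?G n (exp (- 1) *\<^sub>R z) L)) \<longlonglongrightarrow>
         norm (cf (real (L + 1) * s) z - ?a * cf (real L * s) z - of_real (c * s) * ?a * cf (real L * s) (exp (- 1) *\<^sub>R z))"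
        unfolding cf_def by (intro tendsto_intros grid_tendsto[OF I s])
      have "norm (?G n z (L + 1) - ?a * ?G n z L - of_real (c * s) * ?a * ?G n (exp (- 1) *\<^sub>R z) L) \<le> R * s\<^sup>2" for n
      proof -
        let ?h = "s / real (Suc n)"
        define F where "F = (T ?h z ^^ (L * Suc n)) (\<lambda>_. 1)"
        have h: "?h > 0" using s by simp
        have F: "bounded1 F" unfolding F_def using h by (intro bounded1_T_iter) (auto simp: bounded1_def)
        have e: "exp (of_real ?h * (\<psi> z - of_real c)) ^ Suc n = ?a"
          by (simp add: exp_of_nat_mult[symmetric] del: power_Suc of_nat_Suc)
        have "(T ?h z ^^ Suc n) F 0 = ?G n z (L + 1)" unfolding F_def
          by (simp only: funpow_add[symmetric, THEN fun_cong, unfolded comp_def]) (simp only: add_mult_distrib mult_1_left add.commute)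
        moreover have "F 1 = ?G n (exp (- 1) *\<^sub>R z) L" unfolding F_def using T_shift[where h="?h" and z=z and m="L * Suc n" and x=0] by simp
        moreover have "real (Suc n) * (c * ?h) = c * s" "real (Suc n) * ?h = s" by (simp_all del: of_nat_Suc)
        ultimately show ?thesis
          using T_iter_main[OF F h, where z=z and n="Suc n"] unfolding e R_def by (simp only: F_def)
      qed
      then show "\<exists>N. \<forall>n\<ge>N. norm (?G n z (L + 1) - ?a * ?G n z L - of_real (c * s) * ?a * ?G n (exp (- 1) *\<^sub>R z) L) \<le> R * s\<^sup>2" by blast
    qed
    have lim2: "(\<lambda>L. norm (cf (real (L + 1) * s) z - ?a * cf (real L * s) z - of_real (c * s) * ?a * cf (real L * s) (exp (- 1) *\<^sub>R z))) \<longlonglongrightarrow>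
        norm (f z - ?a * f z - of_real (c * s) * ?a * f (exp (- 1) *\<^sub>R z))"
      by (intro tendsto_intros cf_lim s filterlim_ident filterlim_add_const_nat_at_top)
    show ?thesis by (rule LIMSEQ_le_const2[OF lim2]) (use 1 in blast)
  qed
  \<comment> \<open>The estimate is divided by \<open>s\<close>. As \<open>s\<close> decreases to 0
    the no-jump factor contributes its derivative, and the error \<open>R * s\<close>
    vanishes.\<close>
  have "((\<lambda>s. (exp (of_real s * (\<psi> z - of_real c)) - 1) / of_real s) \<longlongrightarrow> \<psi> z - of_real c) (at_right 0)"
  proof -
    have "DERIV (\<lambda>s. exp (s * (\<psi> z - of_real c))) 0 :> (\<psi> z - of_real c)"
      by (auto intro!: derivative_eq_intros)
    from DERIV_D[OF this] have "((\<lambda>s. (exp (s * (\<psi> z - of_real c)) - 1) / s) \<longlongrightarrow> \<psi> z - of_real c) (at 0)" by simp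
    moreover have "filterlim complex_of_real (at 0) (at_right 0)"
      unfolding filterlim_at using eventually_at_right_less[of "0::real"]
      by (auto intro!: tendsto_eq_intros elim!: eventually_mono)
    ultimately show ?thesis by (rule filterlim_compose)
  qed
  then have D: "((\<lambda>s. - ((exp (of_real s * (\<psi> z - of_real c)) - 1) / of_real s) * f z - of_real c * exp (of_real s * (\<psi> z - of_real c)) * f (exp (- 1) *\<^sub>R z))
     \<longlongrightarrow> - (\<psi> z - of_real c) * f z - of_real c * exp (of_real 0 * (\<psi> z - of_real c)) * f (exp (- 1) *\<^sub>R z)) (at_right 0)"
    by (intro tendsto_intros)
  have "((\<lambda>s. - ((exp (of_real s * (\<psi> z - of_real c)) - 1) / of_real s) * f z - of_real c * exp (of_real s * (\<psi> z - of_real c)) * f (exp (- 1) *\<^sub>R z)) \<longlongrightarrow> 0) (at_right 0)"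
  proof (rule Lim_null_comparison)
    show "((\<lambda>s. R * s) \<longlongrightarrow> 0) (at_right 0)" by (auto intro!: tendsto_eq_intros)
    show "\<forall>\<^sub>F s in at_right 0. norm (- ((exp (of_real s * (\<psi> z - of_real c)) - 1) / of_real s) * f z - of_real c * exp (of_real s * (\<psi> z - of_real c)) * f (exp (- 1) *\<^sub>R z)) \<le> R * s"
      using eventually_at_right_less[of "0::real"]
    proof eventually_elim
      case (elim s)
      let ?a = "exp (of_real s * (\<psi> z - of_real c))"
      have "- ((?a - 1) / of_real s) * f z - of_real c * ?a * f (exp (- 1) *\<^sub>R z) = (f z - ?a * f z - of_real (c * s) * ?a * f (exp (- 1) *\<^sub>R z)) / of_real s"
        using elim by (simp add: field_simps)
      then have "norm (- ((?a - 1) / of_real s) * f z - of_real c * ?a * f (exp (- 1) *\<^sub>R z)) = norm (f z - ?a * f z - of_real (c * s) * ?a * f (exp (- 1) *\<^sub>R z)) / s"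
        using elim by (simp add: norm_divide)
      also have "\<dots> \<le> R * s\<^sup>2 / s" using elim by (intro divide_right_mono step) auto
      also have "\<dots> = R * s" using elim by (simp add: power2_eq_square)
      finally show ?case .
    qed
  qed
  from tendsto_unique[OF _ D this] show ?thesis by (simp add: algebra_simps)
qed

end

section \<open>Existence of the integral\<close>

text \<open>Paths \<open>N\<close> and \<open>Y\<close> of a counting process and of a process with regular paths.  Writing
  \<open>e\<^sup>-\<^sup>m = \<Sum>\<^bsub>j\<ge>m\<^esub> w\<^sub>j\<close> with \<open>w\<^sub>j = e\<^sup>-\<^sup>j - e\<^bsup>-j-1\<^esup>\<close>, the integral of \<open>e\<^bsup>-N(s-)\<^esup>\<close> with respect to \<open>Y\<close> becomes a
  mixture of the stopped paths \<open>Y (\<tau> j \<and> t)\<close>, where \<open>\<tau> j\<close> is the time at which \<open>N\<close> reaches \<open>j\<close>.\<close>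

locale jump_path =
  fixes N :: "real \<Rightarrow> real" and Y :: "real \<Rightarrow> 'a::euclidean_space" and \<delta> B C :: real
  assumes N_0: "N 0 = 0"
    and N_mono: "\<And>s t. 0 \<le> s \<Longrightarrow> s \<le> t \<Longrightarrow> N s \<le> N t"
    and N_Ints: "\<And>t. t \<ge> 0 \<Longrightarrow> N t \<in> \<int>"
    and N_left: "\<And>t. t > 0 \<Longrightarrow> \<exists>l. (N \<longlongrightarrow> l) (at_left t)"
    and N_growth: "\<And>t. t \<ge> 0 \<Longrightarrow> \<delta> * t - B \<le> N t"
    and \<delta>: "\<delta> > 0"
    and Y_right: "\<And>t. t \<ge> 0 \<Longrightarrow> continuous (at_right t) Y"
    and Y_left: "\<And>t. t > 0 \<Longrightarrow> \<exists>l. (Y \<longlongrightarrow> l) (at_left t)"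
    and Y_growth: "\<And>t. t \<ge> 0 \<Longrightarrow> norm (Y t) \<le> C * exp (\<delta> / 2 * t)"
begin

definition NL :: "real \<Rightarrow> real" where
  "NL s = (if s \<le> 0 then N 0 else Lim (at_left s) N)"

definition \<tau> :: "nat \<Rightarrow> real" where
  "\<tau> j = Inf {s. 0 \<le> s \<and> real j \<le> N s}"

definition w :: "nat \<Rightarrow> real" where
  "w j = exp (- real j) - exp (- real (Suc j))"

definition J :: "real \<Rightarrow> 'a" where
  "J t = (\<Sum>j. w j *\<^sub>R (Y (min (\<tau> (Suc j)) t) - Y 0))"

lemma N_nonneg: "t \<ge> 0 \<Longrightarrow> 0 \<le> N t"
  using N_mono[of 0 t] N_0 by simp

lemma NL_tendsto: "s > 0 \<Longrightarrow> (N \<longlongrightarrow> NL s) (at_left s)"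
proof -
  assume s: "s > 0"
  then obtain l where l: "(N \<longlongrightarrow> l) (at_left s)" using N_left by blast
  then have "Lim (at_left s) N = l" by (intro tendsto_Lim) auto
  then show ?thesis using s l by (simp add: NL_def)
qed

lemma eventually_at_left_ge: "u < s \<Longrightarrow> \<forall>\<^sub>F v in at_left s. (u::real) \<le> v \<and> v < s"
  using eventually_at_left_real[of u s] by (auto elim!: eventually_mono)

lemma NL_Ints: "s \<ge> 0 \<Longrightarrow> NL s \<in> \<int>"
proof (cases "s = 0")
  case False
  assume "s \<ge> 0"
  then have s: "0 < s" using False by simp
  show ?thesis
    by (rule Lim_in_closed_set[OF closed_Ints _ _ NL_tendsto[OF s]])
       (use eventually_at_left_ge[OF s] in \<open>auto elim!: eventually_mono intro: N_Ints\<close>)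
qed (simp add: NL_def N_0)

lemma NL_nonneg: "s \<ge> 0 \<Longrightarrow> NL s \<ge> 0"
proof (cases "s = 0")
  case False
  assume "s \<ge> 0"
  then have s: "0 < s" using False by simp
  show ?thesis
    by (rule tendsto_lowerbound[OF NL_tendsto[OF s]])
       (use eventually_at_left_ge[OF s] in \<open>auto elim!: eventually_mono intro: N_nonneg\<close>)
qed (simp add: NL_def N_0)

lemma NL_le: "0 \<le> s \<Longrightarrow> s \<le> t \<Longrightarrow> NL s \<le> N t"
proof (cases "s = 0")
  case False
  assume "0 \<le> s" "s \<le> t"
  then have s: "0 < s" using False by simp
  show ?thesis
    by (rule tendsto_upperbound[OF NL_tendsto[OF s]])
       (use eventually_at_left_ge[OF s] \<open>s \<le> t\<close> in \<open>auto elim!: eventually_mono intro: N_mono\<close>)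
qed (simp add: NL_def N_0 N_nonneg)

lemma \<tau>_set: "{s. 0 \<le> s \<and> real j \<le> N s} \<noteq> {}" "bdd_below {s. 0 \<le> s \<and> real j \<le> N s}"
proof -
  have "real j \<le> N ((real j + \<bar>B\<bar>) / \<delta>)" using N_growth[of "(real j + \<bar>B\<bar>) / \<delta>"] \<delta> by simp
  moreover have "0 \<le> (real j + \<bar>B\<bar>) / \<delta>" using \<delta> by simp
  ultimately show "{s. 0 \<le> s \<and> real j \<le> N s} \<noteq> {}" by blast
  show "bdd_below {s. 0 \<le> s \<and> real j \<le> N s}" by (rule bdd_belowI[of _ 0]) auto
qed

lemma \<tau>_nonneg: "0 \<le> \<tau> j"
  unfolding \<tau>_def using \<tau>_set(1) by (intro cInf_greatest) auto

lemma \<tau>_le: "\<tau> j \<le> (real j + \<bar>B\<bar>) / \<delta>"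
  unfolding \<tau>_def
proof (rule cInf_lower[OF _ \<tau>_set(2)])
  show "(real j + \<bar>B\<bar>) / \<delta> \<in> {s. 0 \<le> s \<and> real j \<le> N s}"
    using N_growth[of "(real j + \<bar>B\<bar>) / \<delta>"] \<delta> by auto
qed

text \<open>Passing to left limits makes the sublevel set the closed interval up to the hitting time
  of level \<open>j + 1\<close>, endpoint included; integrality turns \<open>N u < j + 1\<close>
  into \<open>N u <= j\<close>.\<close>

lemma NL_le_iff: "s \<ge> 0 \<Longrightarrow> NL s \<le> real j \<longleftrightarrow> s \<le> \<tau> (Suc j)"
proof (cases "s = 0")
  case False
  assume "s \<ge> 0"
  then have s: "0 < s" using False by simp
  show ?thesis
  proof
    assume le: "s \<le> \<tau> (Suc j)"
    have "N u \<le> real j" if u: "0 \<le> u" "u < s" for u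
    proof -
      have "\<not> real (Suc j) \<le> N u"
      proof
        assume "real (Suc j) \<le> N u"
        then have "\<tau> (Suc j) \<le> u" unfolding \<tau>_def using u by (intro cInf_lower[OF _ \<tau>_set(2)]) auto
        then show False using u le by simp
      qed
      moreover obtain m where "N u = of_int m" using N_Ints[OF u(1)] by (auto elim: Ints_cases)
      ultimately have "real_of_int m < real_of_int (int j + 1)" by simp
      then have "m \<le> int j" by linarith
      then have "real_of_int m \<le> real_of_int (int j)" by (simp only: of_int_le_iff)
      then show ?thesis using \<open>N u = of_int m\<close> by simp
    qed
    then show "NL s \<le> real j"
      by (intro tendsto_upperbound[OF NL_tendsto[OF s]]) (use eventually_at_left_ge[OF s] in \<open>auto elim!: eventually_mono\<close>)
  next
    assume NL: "NL s \<le> real j"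
    show "s \<le> \<tau> (Suc j)"
    proof (rule ccontr)
      assume "\<not> s \<le> \<tau> (Suc j)"
      then obtain u where u: "0 \<le> u" "real (Suc j) \<le> N u" "u < s"
        unfolding \<tau>_def not_le using cInf_lessD[OF \<tau>_set(1)] by blast
      have "real (Suc j) \<le> NL s"
        by (rule tendsto_lowerbound[OF NL_tendsto[OF s]])
           (use eventually_at_left_ge[OF u(3)] u in \<open>auto elim!: eventually_mono intro: order_trans[OF _ N_mono]\<close>)
      then show False using NL by simp
    qed
  qed
qed (simp add: NL_def N_0 \<tau>_nonneg)

lemma le_\<tau>: "t \<ge> 0 \<Longrightarrow> N t \<le> real j \<Longrightarrow> t \<le> \<tau> (Suc j)"
  using NL_le_iff[of t j] NL_le[of t t] by simp

lemma sum_w: "m \<le> K \<Longrightarrow> (\<Sum>j=m..<K. w j) = exp (- real m) - exp (- real K)"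
  unfolding w_def using sum_Suc_diff'[of m K "\<lambda>j. - exp (- real j)"] by simp

lemma w_nonneg: "0 \<le> w j"
  by (simp add: w_def)

text \<open>All indicators from level \<open>K\<close> on equal 1, and their weights add up to
  \<open>exp (- K)\<close>; thus finitely many stopped paths suffice on a bounded time
  interval.\<close>

lemma exp_NL:
  assumes "s \<ge> 0" "NL s \<le> real K"
  shows "exp (- NL s) = (\<Sum>j<K. w j * of_bool (s \<le> \<tau> (Suc j))) + exp (- real K)"
proof -
  obtain m where m: "NL s = real m"
    using NL_Ints[OF assms(1)] NL_nonneg[OF assms(1)] by (metis Ints_cases nonneg_int_cases of_int_0_le_iff of_int_of_nat_eq)
  have "(\<Sum>j<K. w j * of_bool (s \<le> \<tau> (Suc j))) = (\<Sum>j\<in>{m..<K}. w j)"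
    by (rule sum.mono_neutral_cong_right) (use NL_le_iff[OF assms(1)] m in auto)
  also have "\<dots> = exp (- real m) - exp (- real K)" using assms m by (intro sum_w) simp
  finally show ?thesis by (simp add: m)
qed

lemma w_sums: "(\<lambda>j. w (j + K)) sums exp (- real K)"
proof -
  have "(\<lambda>n. exp (- real (n + K))) \<longlonglongrightarrow> 0" by real_asymp
  then have "(\<lambda>j. exp (- real (j + K)) - exp (- real (Suc j + K))) sums (exp (- real (0 + K)) - 0)"
    by (rule telescope_sums')
  then show ?thesis by (simp add: w_def)
qed

lemma J_finite:
  assumes t: "t \<ge> 0" "N t \<le> real K"
  shows "J t = (\<Sum>j<K. w j *\<^sub>R (Y (min (\<tau> (Suc j)) t) - Y 0)) + exp (- real K) *\<^sub>R (Y t - Y 0)"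
proof -
  have "min (\<tau> (Suc (j + K))) t = t" for j using le_\<tau>[OF t(1), of "j + K"] t(2) by simp
  then have "(\<lambda>j. w (j + K) *\<^sub>R (Y (min (\<tau> (Suc (j + K))) t) - Y 0)) sums (exp (- real K) *\<^sub>R (Y t - Y 0))"
    using sums_scaleR_left[OF w_sums[of K], of "Y t - Y 0"] by simp
  from sums_unique[OF sums_iff_shift[THEN iffD1, OF this]] show ?thesis
    unfolding J_def by (simp add: add.commute)
qed

text \<open>The left-endpoint sum of the indicator of \<open>[0, T]\<close> telescopes to the increment of \<open>Y\<close> up to the first
  partition point after \<open>T\<close>.\<close>

lemma telescope_partition:
  assumes p: "p 0 = 0" "p k = t" "\<And>i. i < k \<Longrightarrow> p i \<le> (p (Suc i) :: real)"
    and mesh: "\<And>i. i < k \<Longrightarrow> p (Suc i) - p i < \<epsilon>" and T: "T \<ge> 0" and \<epsilon>: "\<epsilon> > 0"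
  shows "\<exists>q. min T t \<le> q \<and> q < min T t + \<epsilon> \<and>
    (\<Sum>i<k. of_bool (p i \<le> T) *\<^sub>R (Y (p (Suc i)) - Y (p i))) = Y q - Y 0"
proof -
  have mono: "p i \<le> p j" if "i \<le> j" "j \<le> k" for i j
    using that
  proof (induction j rule: dec_induct)
    case (step n)
    then show ?case using p(3)[of n] by simp
  qed simp
  define S where "S = {i. i \<le> k \<and> (\<forall>j<i. p j \<le> T)}"
  \<comment> \<open>The first index whose partition point exceeds \<open>T\<close>, or
    \<open>k\<close> if there is none.\<close>
  define m where "m = Max S"
  have S: "finite S" "0 \<in> S" by (auto simp: S_def)
  then have "m \<in> S" unfolding m_def by (intro Max_in) auto
  then have m: "m \<le> k" "\<And>j. j < m \<Longrightarrow> p j \<le> T" by (auto simp: S_def)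
  have above: "p i > T" if i: "m \<le> i" "i < k" for i
  proof -
    have "p m > T"
    proof (rule ccontr)
      assume "\<not> p m > T"
      then have "Suc m \<in> S" using m i by (auto simp: S_def less_Suc_eq)
      then show False using Max_ge[OF S(1), of "Suc m"] by (simp add: m_def)
    qed
    then show ?thesis using mono[of m i] i by simp
  qed
  have "(\<Sum>i<k. of_bool (p i \<le> T) *\<^sub>R (Y (p (Suc i)) - Y (p i))) = (\<Sum>i<m. Y (p (Suc i)) - Y (p i))"
  proof (rule sum.mono_neutral_cong_right)
    show "\<forall>i\<in>{..<k} - {..<m}. of_bool (p i \<le> T) *\<^sub>R (Y (p (Suc i)) - Y (p i)) = 0"
    proof
      fix i assume "i \<in> {..<k} - {..<m}"
      then have "\<not> p i \<le> T" using above[of i] by (simp add: not_le)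
      then show "of_bool (p i \<le> T) *\<^sub>R (Y (p (Suc i)) - Y (p i)) = 0" by simp
    qed
    show "of_bool (p i \<le> T) *\<^sub>R (Y (p (Suc i)) - Y (p i)) = Y (p (Suc i)) - Y (p i)" if "i \<in> {..<m}" for i
    proof -
      have "p i \<le> T" using m(2)[of i] that by simp
      then show ?thesis by simp
    qed
  qed (use m in auto)
  also have "\<dots> = Y (p m) - Y 0" using sum_lessThan_telescope[of "\<lambda>i. Y (p i)" m] p(1) by simp
  finally have sum: "(\<Sum>i<k. of_bool (p i \<le> T) *\<^sub>R (Y (p (Suc i)) - Y (p i))) = Y (p m) - Y 0" .
  have pt: "p m \<le> t" using mono[of m k] m p(2) by simp
  have low: "min T t \<le> p m"
  proof (cases "m = k")
    case False
    then show ?thesis using above[of m] m by auto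
  qed (use p(2) in auto)
  have up: "p m < min T t + \<epsilon>"
  proof (cases m)
    case 0
    then have "p m = 0" using p by simp
    moreover have "0 \<le> t" using mono[of 0 k] p by simp
    ultimately show ?thesis using T \<epsilon> by simp
  next
    case (Suc l)
    then have "p m < p l + \<epsilon>" using mesh[of l] m by simp
    moreover have "p l \<le> T" using m Suc by simp
    ultimately show ?thesis using pt \<epsilon> by (auto simp: min_def)
  qed
  from low up sum show ?thesis by blast
qed

lemma Y_right_approx:
  assumes x: "x \<ge> 0" and e: "e > 0"
  shows "\<exists>d>0. \<forall>q. x \<le> q \<longrightarrow> q < x + d \<longrightarrow> dist (Y q) (Y x) < e"
proof -
  have "(Y \<longlongrightarrow> Y x) (at_right x)" using Y_right[OF x] by (simp add: continuous_within)
  then have "\<forall>\<^sub>F q in at_right x. dist (Y q) (Y x) < e" using e by (rule tendstoD)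
  then obtain b where b: "b > x" "\<And>q. x < q \<Longrightarrow> q < b \<Longrightarrow> dist (Y q) (Y x) < e"
    unfolding eventually_at_right_field by blast
  show ?thesis
  proof (intro exI[of _ "b - x"] conjI allI impI)
    fix q assume "x \<le> q" "q < x + (b - x)"
    then show "dist (Y q) (Y x) < e" using b(2)[of q] e by (cases "q = x") auto
  qed (use b in simp)
qed

text \<open>Up to time \<open>t\<close> the integrand is a finite mixture of indicators, each of
  whose sums telescopes. The end points approach the stopping times from the right, so
  right-continuity of \<open>Y\<close> is enough even if \<open>Y\<close> jumps at those
  times.\<close>

lemma partition_sums_tendsto:
  assumes t: "t \<ge> 0" and P: "partition_seq t k p"
  shows "(\<lambda>n. \<Sum>i<k n. exp (- NL (p n i)) *\<^sub>R (Y (p n (Suc i)) - Y (p n i))) \<longlonglongrightarrow> J t"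
proof -
  define K where "K = nat \<lceil>N t\<rceil>"
  have K: "N t \<le> real K" using N_nonneg[OF t] by (simp add: K_def)
  have p: "p n 0 = 0" "p n (k n) = t" "\<And>i. i < k n \<Longrightarrow> p n i \<le> p n (Suc i)" for n
    using P by (auto simp: partition_seq_def)
  have p0t: "0 \<le> p n i \<and> p n i \<le> t" if "i \<le> k n" for n i
  proof -
    have mono: "p n a \<le> p n b" if "a \<le> b" "b \<le> k n" for a b
      using that
    proof (induction b rule: dec_induct)
      case (step m)
      then show ?case using p(3)[of m n] by simp
    qed simp
    show ?thesis using mono[of 0 i] mono[of i "k n"] p that by auto
  qed
  have ind: "(\<lambda>n. \<Sum>i<k n. of_bool (p n i \<le> T) *\<^sub>R (Y (p n (Suc i)) - Y (p n i))) \<longlonglongrightarrow> Y (min T t) - Y 0" if T: "T \<ge> 0" for T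
  proof (rule tendstoI)
    fix e :: real assume "e > 0"
    then obtain d where d: "d > 0" "\<And>q. min T t \<le> q \<Longrightarrow> q < min T t + d \<Longrightarrow> dist (Y q) (Y (min T t)) < e"
      using Y_right_approx[of "min T t" e] T t by auto
    have "\<forall>\<^sub>F n in sequentially. \<forall>i<k n. p n (Suc i) - p n i < d" using P d(1) by (simp add: partition_seq_def)
    then show "\<forall>\<^sub>F n in sequentially. dist (\<Sum>i<k n. of_bool (p n i \<le> T) *\<^sub>R (Y (p n (Suc i)) - Y (p n i))) (Y (min T t) - Y 0) < e"
    proof eventually_elim
      case (elim n)
      then obtain q where "min T t \<le> q" "q < min T t + d"
        "(\<Sum>i<k n. of_bool (p n i \<le> T) *\<^sub>R (Y (p n (Suc i)) - Y (p n i))) = Y q - Y 0"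
        using telescope_partition[of "p n" "k n" t d T] p T d(1) by blast
      then show ?case using d(2)[of q] by (simp add: dist_norm)
    qed
  qed
  have "(\<Sum>i<k n. exp (- NL (p n i)) *\<^sub>R (Y (p n (Suc i)) - Y (p n i))) =
     (\<Sum>j<K. w j *\<^sub>R (\<Sum>i<k n. of_bool (p n i \<le> \<tau> (Suc j)) *\<^sub>R (Y (p n (Suc i)) - Y (p n i)))) + exp (- real K) *\<^sub>R (Y t - Y 0)" for n
  proof -
    have "(\<Sum>i<k n. exp (- NL (p n i)) *\<^sub>R (Y (p n (Suc i)) - Y (p n i))) =
        (\<Sum>i<k n. (\<Sum>j<K. (w j * of_bool (p n i \<le> \<tau> (Suc j))) *\<^sub>R (Y (p n (Suc i)) - Y (p n i))) + exp (- real K) *\<^sub>R (Y (p n (Suc i)) - Y (p n i)))"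
    proof (intro sum.cong refl)
      fix i assume "i \<in> {..<k n}"
      then have i: "0 \<le> p n i" "p n i \<le> t" using p0t[of i n] by auto
      then have "NL (p n i) \<le> real K" using NL_le[of "p n i" t] K by simp
      from exp_NL[OF i(1) this] show "exp (- NL (p n i)) *\<^sub>R (Y (p n (Suc i)) - Y (p n i)) =
         (\<Sum>j<K. (w j * of_bool (p n i \<le> \<tau> (Suc j))) *\<^sub>R (Y (p n (Suc i)) - Y (p n i))) + exp (- real K) *\<^sub>R (Y (p n (Suc i)) - Y (p n i))"
        by (simp only: scaleR_left_distrib scaleR_sum_left)
    qed
    also have "\<dots> = (\<Sum>j<K. \<Sum>i<k n. (w j * of_bool (p n i \<le> \<tau> (Suc j))) *\<^sub>R (Y (p n (Suc i)) - Y (p n i))) + exp (- real K) *\<^sub>R (\<Sum>i<k n. Y (p n (Suc i)) - Y (p n i))"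
      by (simp only: sum.distrib sum.swap[of _ "{..<K}"] scaleR_sum_right)
    also have "(\<Sum>i<k n. Y (p n (Suc i)) - Y (p n i)) = Y t - Y 0"
      using sum_lessThan_telescope[of "\<lambda>i. Y (p n i)" "k n"] p(1,2)[of n] by simp
    finally show ?thesis by (simp only: scaleR_scaleR[symmetric] scaleR_sum_right)
  qed
  then show ?thesis
    unfolding J_finite[OF t K] by (simp only:) (intro tendsto_intros ind \<tau>_nonneg)
qed

lemma stopped_right: "t \<ge> 0 \<Longrightarrow> ((\<lambda>s. Y (min T s)) \<longlongrightarrow> Y (min T t)) (at_right t)"
proof (cases "t < T")
  case True
  assume "t \<ge> 0"
  then have "(Y \<longlongrightarrow> Y t) (at_right t)" using Y_right by (simp add: continuous_within)
  moreover have "\<forall>\<^sub>F s in at_right t. Y s = Y (min T s)"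
    using eventually_at_right_real[OF True] by (auto elim!: eventually_mono simp: min_def)
  ultimately show ?thesis using True by (simp add: min_def tendsto_cong)
next
  case False
  have "\<forall>\<^sub>F s in at_right t. Y (min T t) = Y (min T s)"
    using eventually_at_right_less[of t] False by (auto elim!: eventually_mono simp: min_def)
  then show ?thesis by (rule tendsto_cong[THEN iffD1]) simp
qed

lemma stopped_left: "t > 0 \<Longrightarrow> \<exists>l. ((\<lambda>s. Y (min T s)) \<longlongrightarrow> l) (at_left t)"
proof (cases "T < t")
  case True
  have "\<forall>\<^sub>F s in at_left t. Y T = Y (min T s)"
    using eventually_at_left_real[OF True] by (auto elim!: eventually_mono simp: min_def)
  then have "((\<lambda>s. Y (min T s)) \<longlongrightarrow> Y T) (at_left t)" by (rule tendsto_cong[THEN iffD1]) simp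
  then show ?thesis by blast
next
  case False
  assume "t > 0"
  then obtain l where "(Y \<longlongrightarrow> l) (at_left t)" using Y_left by blast
  moreover have "\<forall>\<^sub>F s in at_left t. Y s = Y (min T s)"
    using eventually_at_left_real[of "t - 1" t] False by (auto elim!: eventually_mono simp: min_def)
  ultimately show ?thesis by (auto simp: tendsto_cong)
qed

lemma J_right:
  assumes t: "t \<ge> 0"
  shows "continuous (at_right t) J"
proof -
  \<comment> \<open>Taken at \<open>t + 1\<close>, so that one finite formula for \<open>J\<close>
    is valid on a right neighbourhood of \<open>t\<close>.\<close>
  define K where "K = nat \<lceil>N (t + 1)\<rceil>"
  have K: "N (t + 1) \<le> real K" using N_nonneg[of "t + 1"] t by (simp add: K_def)
  have fin: "J s = (\<Sum>j<K. w j *\<^sub>R (Y (min (\<tau> (Suc j)) s) - Y 0)) + exp (- real K) *\<^sub>R (Y s - Y 0)" if "0 \<le> s" "s \<le> t + 1" for s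
    using that K N_mono[of s "t + 1"] by (intro J_finite) auto
  have "((\<lambda>s. (\<Sum>j<K. w j *\<^sub>R (Y (min (\<tau> (Suc j)) s) - Y 0)) + exp (- real K) *\<^sub>R (Y s - Y 0)) \<longlongrightarrow>
     (\<Sum>j<K. w j *\<^sub>R (Y (min (\<tau> (Suc j)) t) - Y 0)) + exp (- real K) *\<^sub>R (Y t - Y 0)) (at_right t)"
    using Y_right[OF t] by (intro tendsto_intros stopped_right t) (simp add: continuous_within)
  moreover have "\<forall>\<^sub>F s in at_right t. (\<Sum>j<K. w j *\<^sub>R (Y (min (\<tau> (Suc j)) s) - Y 0)) + exp (- real K) *\<^sub>R (Y s - Y 0) = J s"
    using eventually_at_right_real[of t "t + 1"] t fin by (auto elim!: eventually_mono)
  ultimately show ?thesis unfolding continuous_within using fin[of t] t by (simp add: tendsto_cong)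
qed

lemma J_left:
  assumes t: "t > 0"
  shows "\<exists>l. (J \<longlongrightarrow> l) (at_left t)"
proof -
  define K where "K = nat \<lceil>N t\<rceil>"
  have K: "N t \<le> real K" using N_nonneg[of t] t by (simp add: K_def)
  have fin: "J s = (\<Sum>j<K. w j *\<^sub>R (Y (min (\<tau> (Suc j)) s) - Y 0)) + exp (- real K) *\<^sub>R (Y s - Y 0)" if "0 \<le> s" "s \<le> t" for s
    using that K N_mono[of s t] by (intro J_finite) auto
  obtain l where l: "\<And>T. ((\<lambda>s. Y (min T s)) \<longlongrightarrow> l T) (at_left t)" using stopped_left[OF t] by metis
  obtain l' where l': "(Y \<longlongrightarrow> l') (at_left t)" using Y_left[OF t] by blast
  have "((\<lambda>s. (\<Sum>j<K. w j *\<^sub>R (Y (min (\<tau> (Suc j)) s) - Y 0)) + exp (- real K) *\<^sub>R (Y s - Y 0)) \<longlongrightarrow>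
     (\<Sum>j<K. w j *\<^sub>R (l (\<tau> (Suc j)) - Y 0)) + exp (- real K) *\<^sub>R (l' - Y 0)) (at_left t)"
    by (intro tendsto_intros l l')
  moreover have "\<forall>\<^sub>F s in at_left t. (\<Sum>j<K. w j *\<^sub>R (Y (min (\<tau> (Suc j)) s) - Y 0)) + exp (- real K) *\<^sub>R (Y s - Y 0) = J s"
    using eventually_at_left_real[OF t] fin by (auto elim!: eventually_mono)
  ultimately show ?thesis by (auto simp: tendsto_cong)
qed

text \<open>By the linear growth of \<open>N\<close>, level \<open>j + 1\<close> is reached by time
  \<open>(j + 1 + \<bar>B\<bar>) / \<delta>\<close>, where \<open>Y\<close> is at most of order
  \<open>exp (j / 2)\<close>; the weight, at most \<open>exp (- j)\<close>, beats this. The series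
  converges uniformly in \<open>t\<close> and each term is eventually constant, so the limits can be
  interchanged.\<close>

lemma J_tendsto: "\<exists>l. (J \<longlongrightarrow> l) at_top"
proof -
  define D where "D = C * exp (\<bar>B\<bar> / 2 + 1/2) + norm (Y 0)"
  have "0 \<le> C" using Y_growth[of 0] norm_ge_zero[of "Y 0"] by (simp del: norm_ge_zero)
  have b: "norm (Y (min (\<tau> (Suc j)) t) - Y 0) \<le> D * exp (real j / 2)" if t: "t \<ge> 0" for j t
  proof -
    let ?m = "min (\<tau> (Suc j)) t"
    have m: "?m \<ge> 0" using t \<tau>_nonneg by simp
    have "\<delta> / 2 * ?m \<le> \<delta> / 2 * \<tau> (Suc j)" using \<delta> by (intro mult_left_mono) auto
    also have "\<dots> \<le> \<delta> / 2 * ((real (Suc j) + \<bar>B\<bar>) / \<delta>)" using \<delta> by (intro mult_left_mono \<tau>_le) auto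
    also have "\<dots> = real j / 2 + (\<bar>B\<bar> / 2 + 1/2)" using \<delta> by (simp add: field_simps)
    finally have "C * exp (\<delta> / 2 * ?m) \<le> C * exp (real j / 2 + (\<bar>B\<bar> / 2 + 1/2))" using \<open>0 \<le> C\<close> by (intro mult_left_mono) auto
    then have "norm (Y ?m) \<le> C * exp (real j / 2 + (\<bar>B\<bar> / 2 + 1/2))" using Y_growth[OF m] by simp
    moreover have "norm (Y 0) * 1 \<le> norm (Y 0) * exp (real j / 2)" by (intro mult_left_mono) auto
    ultimately show ?thesis using norm_triangle_ineq4[of "Y ?m" "Y 0"] by (simp add: D_def exp_add algebra_simps)
  qed
  have "D \<ge> 0" using \<open>0 \<le> C\<close> by (simp add: D_def)
  let ?a = "\<lambda>j t. w j *\<^sub>R (Y (min (\<tau> (Suc j)) t) - Y 0)"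
  have bound: "norm (?a j t) \<le> D * exp (- 1 / 2) ^ j" if "t \<ge> 0" for j t
  proof -
    have "w j \<le> exp (- real j)" by (simp add: w_def)
    then have "norm (?a j t) \<le> exp (- real j) * (D * exp (real j / 2))"
      using b[OF that] w_nonneg[of j] by (simp add: mult_mono)
    also have "\<dots> = D * exp (- 1 / 2) ^ j" by (simp add: exp_of_nat_mult[symmetric] exp_add[symmetric] mult.left_commute)
    finally show ?thesis .
  qed
  have M: "summable (\<lambda>j. D * exp (- 1 / 2) ^ j)" by (intro summable_mult summable_geometric) simp
  have "summable (\<lambda>j. ?a j (\<tau> (Suc j)))"
    by (rule summable_comparison_test[OF _ M]) (use bound[OF \<tau>_nonneg] in blast)
  then have lim: "(\<lambda>n. \<Sum>j<n. ?a j (\<tau> (Suc j))) \<longlonglongrightarrow> (\<Sum>j. ?a j (\<tau> (Suc j)))" by (rule summable_LIMSEQ)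
  have part: "((\<lambda>t. \<Sum>j<n. ?a j t) \<longlongrightarrow> (\<Sum>j<n. ?a j (\<tau> (Suc j)))) at_top" for n
  proof (intro tendsto_sum)
    fix j
    have "\<forall>\<^sub>F t in at_top. ?a j t = ?a j (\<tau> (Suc j))"
      using eventually_ge_at_top[of "\<tau> (Suc j)"] by eventually_elim (simp add: min_def)
    then show "(?a j \<longlongrightarrow> ?a j (\<tau> (Suc j))) at_top" by (rule tendsto_eventually)
  qed
  have unif: "uniform_limit {0..} (\<lambda>n t. \<Sum>j<n. ?a j t) J sequentially"
    unfolding J_def by (rule Weierstrass_m_test[OF _ M]) (use bound in auto)
  have "(J \<longlongrightarrow> (\<Sum>j. ?a j (\<tau> (Suc j)))) at_top"
  proof (rule swap_uniform_limit'[OF always_eventually lim unif])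
    show "\<forall>n. ((\<lambda>t. \<Sum>j<n. ?a j t) \<longlongrightarrow> (\<Sum>j<n. ?a j (\<tau> (Suc j)))) at_top" using part by blast
    show "\<forall>\<^sub>F t in at_top. t \<in> {0::real..}" using eventually_ge_at_top[of "0::real"] by eventually_elim simp
  qed simp
  then show ?thesis by blast
qed

end

section \<open>A maximal inequality and the growth of the paths of \<open>Y\<close>\<close>

context levy_proc
begin

lemma prob_increment:
  assumes "s \<ge> 0" "t \<ge> 0" and [measurable]: "Measurable.pred borel P"
  shows "prob {\<omega> \<in> space M. P (X (s + t) \<omega> - X s \<omega>)} = prob {\<omega> \<in> space M. P (X t \<omega>)}"
proof -
  have [measurable]: "X (s + t) \<in> borel_measurable M" "X s \<in> borel_measurable M" "X t \<in> borel_measurable M" using assms by auto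
  have "prob {\<omega> \<in> space M. P (X (s + t) \<omega> - X s \<omega>)} = measure (distr M borel (\<lambda>\<omega>. X (s + t) \<omega> - X s \<omega>)) {x. P x}"
    by (subst measure_distr) (auto intro!: arg_cong[where f=prob])
  also have "\<dots> = measure (distr M borel (X t)) {x. P x}" using assms by (simp add: distr_increment)
  also have "\<dots> = prob {\<omega> \<in> space M. P (X t \<omega>)}"
    by (subst measure_distr) (auto intro!: arg_cong[where f=prob])
  finally show ?thesis .
qed

text \<open>Ottaviani's inequality: decompose according to the first \<open>j\<close> at which the level \<open>2 a\<close> is exceeded; the
  remaining increment is independent of this event and at most \<open>a\<close> with probability at least \<open>1 / 2\<close>.\<close>

lemma maximal_inequality:
  assumes r: "r \<ge> 0" and h: "h \<ge> 0"
    and half: "\<And>j. j \<le> n \<Longrightarrow> prob {\<omega> \<in> space M. a < norm (X (real j * h) \<omega>)} \<le> 1 / 2"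
  shows "prob {\<omega> \<in> space M. \<exists>j\<le>n. 2 * a < norm (X (r + real j * h) \<omega> - X r \<omega>)} \<le> 2 * prob {\<omega> \<in> space M. a < norm (X (real n * h) \<omega>)}"
proof -
  define t where "t = (\<lambda>i. r + real i * h)"
  have t0: "t i \<ge> 0" for i using r h by (simp add: t_def)
  have [measurable]: "X (t i) \<in> borel_measurable M" "X r \<in> borel_measurable M" for i using t0 r by auto
  define D where "D = (\<lambda>i \<omega>. X (t (Suc i)) \<omega> - X (t i) \<omega>)"
  have ind: "indep_vars (\<lambda>_. borel) D {..<n}"
    unfolding D_def by (rule indep_increments) (use r h in \<open>auto simp: t_def intro: mult_right_mono\<close>)
  have tel: "(\<Sum>l<j. D l \<omega>) = X (t j) \<omega> - X r \<omega>" for j \<omega>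
    unfolding D_def by (subst sum_lessThan_telescope) (simp add: t_def)
  define u :: "nat \<Rightarrow> (nat \<Rightarrow> 'a) \<Rightarrow> real" where "u = (\<lambda>j x. of_bool (2 * a < norm (\<Sum>l<j. x l) \<and> (\<forall>i<j. \<not> 2 * a < norm (\<Sum>l<i. x l))))"
  define v :: "nat \<Rightarrow> (nat \<Rightarrow> 'a) \<Rightarrow> real" where "v = (\<lambda>j x. of_bool (norm (\<Sum>l=j..<n. x l) \<le> a))"
  define A where "A = (\<lambda>j. {\<omega> \<in> space M. 2 * a < norm (X (t j) \<omega> - X r \<omega>) \<and> (\<forall>i<j. \<not> 2 * a < norm (X (t i) \<omega> - X r \<omega>))})"
  define B where "B = (\<lambda>j. {\<omega> \<in> space M. norm (X (t n) \<omega> - X (t j) \<omega>) \<le> a})"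
  have [measurable]: "A j \<in> sets M" "B j \<in> sets M" for j unfolding A_def B_def by measurable
  have AB: "prob (A j \<inter> B j) = prob (A j) * prob (B j)" if j: "j \<le> n" for j
  proof -
    have "indep_var (PiM {..<j} (\<lambda>_. borel)) (\<lambda>\<omega>. restrict (\<lambda>i. D i \<omega>) {..<j}) (PiM {j..<n} (\<lambda>_. borel)) (\<lambda>\<omega>. restrict (\<lambda>i. D i \<omega>) {j..<n})"
      by (rule indep_var_restrict[OF ind]) (use j in auto)
    then have "indep_var borel (u j \<circ> (\<lambda>\<omega>. restrict (\<lambda>i. D i \<omega>) {..<j})) borel (v j \<circ> (\<lambda>\<omega>. restrict (\<lambda>i. D i \<omega>) {j..<n}))"
    proof (rule indep_var_compose)
      have S: "(\<lambda>x. \<Sum>l<i. x l) \<in> borel_measurable (PiM {..<j} (\<lambda>_. borel :: 'a measure))" if "i \<le> j" for i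
        by (intro borel_measurable_sum measurable_component_singleton) (use that in auto)
      have "Measurable.pred (PiM {..<j} (\<lambda>_. borel :: 'a measure)) (\<lambda>x. \<not> 2 * a < norm (\<Sum>l<i. x l))" if "i < j" for i
        by (rule measurable_compose[OF S[OF less_imp_le[OF that]]]) measurable
      moreover have "Measurable.pred (PiM {..<j} (\<lambda>_. borel :: 'a measure)) (\<lambda>x. 2 * a < norm (\<Sum>l<j. x l))"
        by (rule measurable_compose[OF S[OF order_refl]]) measurable
      ultimately have P: "Measurable.pred (PiM {..<j} (\<lambda>_. borel :: 'a measure)) (\<lambda>x. 2 * a < norm (\<Sum>l<j. x l) \<and> (\<forall>i\<in>{..<j}. \<not> 2 * a < norm (\<Sum>l<i. x l)))"
        by (intro pred_intros_logic pred_intros_finite) auto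
      have "(\<lambda>x. of_bool (2 * a < norm (\<Sum>l<j. x l) \<and> (\<forall>i\<in>{..<j}. \<not> 2 * a < norm (\<Sum>l<i. x l))) :: real) \<in> borel_measurable (PiM {..<j} (\<lambda>_. borel :: 'a measure))"
        by (rule measurable_compose[OF P]) simp
      then show "u j \<in> PiM {..<j} (\<lambda>_. borel) \<rightarrow>\<^sub>M borel"
        unfolding u_def by (simp add: Ball_def)
      have "(\<lambda>x. \<Sum>l=j..<n. x l) \<in> borel_measurable (PiM {j..<n} (\<lambda>_. borel :: 'a measure))"
        by (intro borel_measurable_sum measurable_component_singleton) auto
      then show "v j \<in> PiM {j..<n} (\<lambda>_. borel) \<rightarrow>\<^sub>M borel"
        unfolding v_def by (rule measurable_compose) measurable
    qed
    moreover have "(u j \<circ> (\<lambda>\<omega>. restrict (\<lambda>i. D i \<omega>) {..<j})) \<omega> = indicator (A j) \<omega>" if "\<omega> \<in> space M" for \<omega>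
    proof -
      have "(\<Sum>l<i. restrict (\<lambda>i. D i \<omega>) {..<j} l) = X (t i) \<omega> - X r \<omega>" if "i \<le> j" for i
        unfolding tel[symmetric] using that by (intro sum.cong) auto
      then show ?thesis using that by (auto simp: u_def A_def indicator_def)
    qed
    moreover have "(v j \<circ> (\<lambda>\<omega>. restrict (\<lambda>i. D i \<omega>) {j..<n})) \<omega> = indicator (B j) \<omega>" if "\<omega> \<in> space M" for \<omega>
    proof -
      have "(\<Sum>l=j..<n. restrict (\<lambda>i. D i \<omega>) {j..<n} l) = (\<Sum>l=j..<n. D l \<omega>)" by (intro sum.cong) auto
      also have "\<dots> = X (t n) \<omega> - X (t j) \<omega>" unfolding D_def using sum_Suc_diff'[OF j, of "\<lambda>i. X (t i) \<omega>"] by simp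
      finally show ?thesis using that by (auto simp: v_def B_def indicator_def)
    qed
    ultimately have "expectation (\<lambda>\<omega>. indicator (A j) \<omega> * indicator (B j) \<omega> :: real) = expectation (indicator (A j)) * expectation (indicator (B j))"
    proof -
      assume i: "indep_var borel (u j \<circ> (\<lambda>\<omega>. restrict (\<lambda>i. D i \<omega>) {..<j})) borel (v j \<circ> (\<lambda>\<omega>. restrict (\<lambda>i. D i \<omega>) {j..<n}))"
        and U: "\<And>\<omega>. \<omega> \<in> space M \<Longrightarrow> (u j \<circ> (\<lambda>\<omega>. restrict (\<lambda>i. D i \<omega>) {..<j})) \<omega> = indicator (A j) \<omega>"
        and V: "\<And>\<omega>. \<omega> \<in> space M \<Longrightarrow> (v j \<circ> (\<lambda>\<omega>. restrict (\<lambda>i. D i \<omega>) {j..<n})) \<omega> = indicator (B j) \<omega>"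
      have "integrable M (u j \<circ> (\<lambda>\<omega>. restrict (\<lambda>i. D i \<omega>) {..<j})) \<longleftrightarrow> integrable M (indicator (A j) :: 'w \<Rightarrow> real)"
        by (rule Bochner_Integration.integrable_cong[OF refl]) (rule U)
      then have iU: "integrable M (u j \<circ> (\<lambda>\<omega>. restrict (\<lambda>i. D i \<omega>) {..<j}))" by (simp add: emeasure_eq_measure)
      have "integrable M (v j \<circ> (\<lambda>\<omega>. restrict (\<lambda>i. D i \<omega>) {j..<n})) \<longleftrightarrow> integrable M (indicator (B j) :: 'w \<Rightarrow> real)"
        by (rule Bochner_Integration.integrable_cong[OF refl]) (rule V)
      then have iV: "integrable M (v j \<circ> (\<lambda>\<omega>. restrict (\<lambda>i. D i \<omega>) {j..<n}))" by (simp add: emeasure_eq_measure)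
      have "expectation (\<lambda>\<omega>. indicator (A j) \<omega> * indicator (B j) \<omega> :: real) = expectation (\<lambda>\<omega>. (u j \<circ> (\<lambda>\<omega>. restrict (\<lambda>i. D i \<omega>) {..<j})) \<omega> * (v j \<circ> (\<lambda>\<omega>. restrict (\<lambda>i. D i \<omega>) {j..<n})) \<omega>)"
        by (rule Bochner_Integration.integral_cong[OF refl]) (simp only: U V)
      also have "\<dots> = expectation (u j \<circ> (\<lambda>\<omega>. restrict (\<lambda>i. D i \<omega>) {..<j})) * expectation (v j \<circ> (\<lambda>\<omega>. restrict (\<lambda>i. D i \<omega>) {j..<n}))"
        by (rule indep_var_lebesgue_integral[OF i iU iV])
      also have "expectation (u j \<circ> (\<lambda>\<omega>. restrict (\<lambda>i. D i \<omega>) {..<j})) = expectation (indicator (A j))"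
        by (rule Bochner_Integration.integral_cong[OF refl]) (rule U)
      also have "expectation (v j \<circ> (\<lambda>\<omega>. restrict (\<lambda>i. D i \<omega>) {j..<n})) = expectation (indicator (B j))"
        by (rule Bochner_Integration.integral_cong[OF refl]) (rule V)
      finally show ?thesis .
    qed
    then show ?thesis by (simp add: indicator_inter_arith[symmetric])
  qed
  have B2: "prob (B j) \<ge> 1 / 2" if j: "j \<le> n" for j
  proof -
    have "t n = t j + real (n - j) * h" using j by (simp add: t_def of_nat_diff algebra_simps)
    then have "prob {\<omega> \<in> space M. a < norm (X (t n) \<omega> - X (t j) \<omega>)} = prob {\<omega> \<in> space M. a < norm (X (real (n - j) * h) \<omega>)}"
      using prob_increment[of "t j" "real (n - j) * h" "\<lambda>x. a < norm x"] t0 h by simp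
    also have "\<dots> \<le> 1 / 2" by (rule half) simp
    finally have "prob (space M - B j) \<le> 1 / 2"
      unfolding B_def by (auto simp: not_le set_diff_eq cong: conj_cong elim!: order_trans[rotated] intro!: eq_refl arg_cong[where f=prob])
    then show ?thesis by (subst (asm) prob_compl) auto
  qed
  have disj: "disjoint_family_on A {..n}"
  proof -
    have "A i \<inter> A j = {}" if "i < j" for i j using that by (auto simp: A_def)
    then show ?thesis unfolding disjoint_family_on_def by (metis Int_commute linorder_neqE_nat)
  qed
  have U: "{\<omega> \<in> space M. \<exists>j\<le>n. 2 * a < norm (X (r + real j * h) \<omega> - X r \<omega>)} = (\<Union>j\<in>{..n}. A j)"
  proof (intro set_eqI iffI)
    fix \<omega> assume "\<omega> \<in> {\<omega> \<in> space M. \<exists>j\<le>n. 2 * a < norm (X (r + real j * h) \<omega> - X r \<omega>)}"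
    then obtain j where j: "j \<le> n" "2 * a < norm (X (t j) \<omega> - X r \<omega>)" "\<omega> \<in> space M" by (auto simp: t_def)
    define l where "l = (LEAST j. 2 * a < norm (X (t j) \<omega> - X r \<omega>))"
    have "2 * a < norm (X (t l) \<omega> - X r \<omega>)" unfolding l_def using j(2) by (rule LeastI)
    moreover have "l \<le> j" unfolding l_def using j(2) by (rule Least_le)
    moreover have "\<not> 2 * a < norm (X (t i) \<omega> - X r \<omega>)" if "i < l" for i using not_less_Least that unfolding l_def by blast
    ultimately show "\<omega> \<in> (\<Union>j\<in>{..n}. A j)" using j by (auto simp: A_def intro!: bexI[of _ l])
  qed (auto simp: A_def t_def)
  have "prob (\<Union>j\<in>{..n}. A j) = (\<Sum>j\<le>n. prob (A j))"
    by (rule finite_measure_finite_Union) (use disj in auto)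
  also have "\<dots> \<le> (\<Sum>j\<le>n. 2 * prob (A j \<inter> B j))"
  proof (intro sum_mono)
    fix j assume "j \<in> {..n}"
    then show "prob (A j) \<le> 2 * prob (A j \<inter> B j)"
      using AB[of j] mult_left_mono[OF B2[of j], of "prob (A j)"] by simp
  qed
  also have "\<dots> = 2 * prob (\<Union>j\<in>{..n}. A j \<inter> B j)"
    by (subst finite_measure_finite_Union) (use disj in \<open>auto simp: sum_distrib_left disjoint_family_on_def\<close>)
  also have "prob (\<Union>j\<in>{..n}. A j \<inter> B j) \<le> prob {\<omega> \<in> space M. a < norm (X (r + real n * h) \<omega> - X r \<omega>)}"
  proof (rule finite_measure_mono)
    show "(\<Union>j\<in>{..n}. A j \<inter> B j) \<subseteq> {\<omega> \<in> space M. a < norm (X (r + real n * h) \<omega> - X r \<omega>)}"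
    proof
      fix \<omega> assume "\<omega> \<in> (\<Union>j\<in>{..n}. A j \<inter> B j)"
      then obtain j where "\<omega> \<in> space M" "2 * a < norm (X (t j) \<omega> - X r \<omega>)" "norm (X (t n) \<omega> - X (t j) \<omega>) \<le> a" by (auto simp: A_def B_def)
      then show "\<omega> \<in> {\<omega> \<in> space M. a < norm (X (r + real n * h) \<omega> - X r \<omega>)}"
        using norm_triangle_ineq4[of "X (t n) \<omega> - X r \<omega>" "X (t n) \<omega> - X (t j) \<omega>"] by (simp add: t_def)
    qed
    show "{\<omega> \<in> space M. a < norm (X (r + real n * h) \<omega> - X r \<omega>)} \<in> sets M"
    proof -
      have "{\<omega> \<in> space M. a < norm (X (t n) \<omega> - X r \<omega>)} \<in> sets M" by measurable
      then show ?thesis by (simp add: t_def)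
    qed
  qed
  also have "\<dots> = prob {\<omega> \<in> space M. a < norm (X (real n * h) \<omega>)}"
    using prob_increment[of r "real n * h" "\<lambda>x. a < norm x"] r h by simp
  finally show ?thesis unfolding U by simp
qed

text \<open>Restriction to dyadic times makes this an event of \<open>M\<close>; right-continuity
  recovers the whole unit interval. The factor 2 is that of the maximal inequality.\<close>

definition exceed :: "real \<Rightarrow> real \<Rightarrow> 'w set" where
  "exceed r a = (\<Union>m. {\<omega> \<in> space M. \<exists>j\<le>(2::nat) ^ m. 2 * a < norm (X (r + real j * (1 / 2 ^ m)) \<omega> - X r \<omega>)})"

lemma exceed_sets [measurable]: "r \<ge> 0 \<Longrightarrow> exceed r a \<in> sets M"
proof -
  assume r: "r \<ge> 0"
  have [measurable]: "X (r + real j * (1 / 2 ^ m)) \<in> borel_measurable M" "X r \<in> borel_measurable M" for j m using r by auto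
  show ?thesis unfolding exceed_def by measurable
qed

lemma prob_exceed:
  assumes r: "r \<ge> 0" and half: "\<And>s. 0 \<le> s \<Longrightarrow> s \<le> 1 \<Longrightarrow> prob {\<omega> \<in> space M. a < norm (X s \<omega>)} \<le> 1 / 2"
  shows "prob (exceed r a) \<le> 2 * prob {\<omega> \<in> space M. a < norm (X 1 \<omega>)}"
proof -
  let ?E = "\<lambda>m. {\<omega> \<in> space M. \<exists>j\<le>(2::nat) ^ m. 2 * a < norm (X (r + real j * (1 / 2 ^ m)) \<omega> - X r \<omega>)}"
  have [measurable]: "X (r + real j * (1 / 2 ^ m)) \<in> borel_measurable M" "X r \<in> borel_measurable M" for j m using r by auto
  have E [measurable]: "?E m \<in> sets M" for m by measurable
  have "incseq ?E"
  proof (rule incseq_SucI, rule subsetI)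
    fix m \<omega> assume "\<omega> \<in> ?E m"
    then obtain j where j: "\<omega> \<in> space M" "j \<le> 2 ^ m" "2 * a < norm (X (r + real j * (1 / 2 ^ m)) \<omega> - X r \<omega>)" by auto
    have "real (2 * j) * (1 / 2 ^ Suc m) = real j * (1 / 2 ^ m)" by simp
    then have "2 * a < norm (X (r + real (2 * j) * (1 / 2 ^ Suc m)) \<omega> - X r \<omega>)" using j(3) by (simp only:)
    moreover have "2 * j \<le> 2 ^ Suc m" using j(2) by simp
    ultimately show "\<omega> \<in> ?E (Suc m)" using j(1) by blast
  qed
  then have "(\<lambda>m. prob (?E m)) \<longlonglongrightarrow> prob (exceed r a)"
    unfolding exceed_def by (intro finite_Lim_measure_incseq image_subsetI E)
  moreover have "prob (?E m) \<le> 2 * prob {\<omega> \<in> space M. a < norm (X 1 \<omega>)}" for m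
  proof -
    have "prob (?E m) \<le> 2 * prob {\<omega> \<in> space M. a < norm (X (real (2 ^ m) * (1 / 2 ^ m)) \<omega>)}"
    proof (rule maximal_inequality[OF r])
      fix j :: nat assume "j \<le> 2 ^ m"
      then have "real j \<le> 2 ^ m" by (metis of_nat_le_iff of_nat_numeral of_nat_power)
      then show "prob {\<omega> \<in> space M. a < norm (X (real j * (1 / 2 ^ m)) \<omega>)} \<le> 1 / 2"
        by (intro half) auto
    qed simp
    then show ?thesis by simp
  qed
  ultimately show ?thesis by (intro LIMSEQ_le_const2) auto
qed

lemma grid_right:
  fixes t b :: real
  assumes "b > 0"
  shows "t < (of_int \<lfloor>b * t\<rfloor> + 1) / b" "(of_int \<lfloor>b * t\<rfloor> + 1) / b \<le> t + 1 / b"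
proof -
  have "b * t < of_int \<lfloor>b * t\<rfloor> + 1" "of_int \<lfloor>b * t\<rfloor> + 1 \<le> b * t + 1" by linarith+
  then show "t < (of_int \<lfloor>b * t\<rfloor> + 1) / b" "(of_int \<lfloor>b * t\<rfloor> + 1) / b \<le> t + 1 / b"
    using assms by (simp_all add: field_simps)
qed

text \<open>Every time before \<open>r + 1\<close> is the limit from the right of dyadic times
  inside the window. The endpoint \<open>r + 1\<close> cannot be approached that way, but is itself
  dyadic.\<close>

lemma not_exceed:
  assumes \<omega>: "\<omega> \<in> good" "\<omega> \<notin> exceed r a" and r: "r \<ge> 0" and s: "r \<le> s" "s \<le> r + 1"
  shows "norm (X s \<omega> - X r \<omega>) \<le> 2 * a"
proof -
  have sp: "\<omega> \<in> space M" using \<omega>(1) good(1) sets.sets_into_space by blast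
  have D: "norm (X (r + real j * (1 / 2 ^ m)) \<omega> - X r \<omega>) \<le> 2 * a" if "j \<le> 2 ^ m" for j m
    using \<omega>(2) sp that by (auto simp: exceed_def not_less)
  show ?thesis
  proof (cases "s = r + 1")
    case True
    then show ?thesis using D[of 1 0] by simp
  next
    case False
    define q :: "nat \<Rightarrow> real" where "q = (\<lambda>m. (of_int \<lfloor>2 ^ m * (s - r)\<rfloor> + 1) / 2 ^ m)"
    have q: "s - r < q m" "q m \<le> (s - r) + 1 / 2 ^ m" for m
      unfolding q_def by (rule grid_right, simp)+
    have lim: "(\<lambda>m. r + q m) \<longlonglongrightarrow> s"
    proof (rule tendsto_sandwich)
      show "\<forall>\<^sub>F m in sequentially. s \<le> r + q m" using q(1) by (intro always_eventually) (simp add: less_imp_le algebra_simps)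
      show "\<forall>\<^sub>F m in sequentially. r + q m \<le> s + 1 / 2 ^ m" using q(2) by (intro always_eventually) (simp add: algebra_simps)
      show "(\<lambda>m. s + 1 / 2 ^ m) \<longlonglongrightarrow> s" by real_asymp
    qed simp
    have "filterlim (\<lambda>m. r + q m) (at_right s) sequentially"
      using lim q(1) by (auto simp: filterlim_at algebra_simps intro!: always_eventually)
    moreover have "((\<lambda>s. X s \<omega>) \<longlongrightarrow> X s \<omega>) (at_right s)"
      using good(3)[OF \<omega>(1), of s] r s by (simp add: continuous_within)
    ultimately have "(\<lambda>m. X (r + q m) \<omega>) \<longlonglongrightarrow> X s \<omega>" by (rule filterlim_compose[rotated])
    then have "(\<lambda>m. norm (X (r + q m) \<omega> - X r \<omega>)) \<longlonglongrightarrow> norm (X s \<omega> - X r \<omega>)" by (intro tendsto_intros)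
    moreover have "norm (X (r + q m) \<omega> - X r \<omega>) \<le> 2 * a" for m
    proof -
      define j where "j = nat (\<lfloor>2 ^ m * (s - r)\<rfloor> + 1)"
      have "0 \<le> \<lfloor>2 ^ m * (s - r)\<rfloor>" using s by simp
      moreover have "\<lfloor>2 ^ m * (s - r)\<rfloor> < 2 ^ m"
      proof -
        have "2 ^ m * (s - r) < 2 ^ m * 1" using s False by (intro mult_strict_left_mono) auto
        then show ?thesis by (simp add: floor_less_iff)
      qed
      ultimately have "j \<le> 2 ^ m" "real j = of_int \<lfloor>2 ^ m * (s - r)\<rfloor> + 1"
        unfolding j_def by (auto simp: nat_le_iff)
      then show ?thesis using D[of j m] by (simp add: q_def)
    qed
    ultimately show ?thesis by (intro LIMSEQ_le_const2) auto
  qed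
qed

end

context levy_log
begin

text \<open>Markov's inequality for \<open>ln (1 + norm (Y s))\<close>, whose mean is at most
  \<open>2 * C\<close> for \<open>s <= 1\<close>; the threshold \<open>exp (4 * C + 1)\<close>
  brings the probability below \<open>1 / 2\<close>, as the maximal inequality requires.\<close>

lemma small_tails:
  obtains a\<^sub>0 where "a\<^sub>0 \<ge> 1" "\<And>a s. a \<ge> a\<^sub>0 \<Longrightarrow> 0 \<le> s \<Longrightarrow> s \<le> 1 \<Longrightarrow> prob {\<omega> \<in> space M. a < norm (Y s \<omega>)} \<le> 1 / 2"
proof -
  obtain C where C: "C \<ge> 0" "\<And>t. t \<ge> 0 \<Longrightarrow> (\<integral>\<^sup>+\<omega>. ennreal (ln (1 + norm (Y t \<omega>))) \<partial>M) \<le> ennreal (C * (1 + t))"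
    using nn_integral_ln_linear by blast
  show ?thesis
  proof
    show "exp (4 * C + 1) \<ge> 1" using C by simp
    fix a s :: real assume a: "exp (4 * C + 1) \<le> a" and s: "0 \<le> s" "s \<le> 1"
    have [measurable]: "Y s \<in> borel_measurable M" using s by simp
    have a1: "1 \<le> a" using a C by (intro order_trans[OF _ a]) simp
    let ?B = "{\<omega> \<in> space M. a < norm (Y s \<omega>)}"
    have l: "4 * C + 1 \<le> ln (1 + a)"
    proof -
      have "exp (4 * C + 1) \<le> 1 + a" using a by simp
      then show ?thesis using a1 by (subst ln_ge_iff) auto
    qed
    have "ennreal (4 * C + 1) * emeasure M ?B = (\<integral>\<^sup>+\<omega>. ennreal (4 * C + 1) * indicator ?B \<omega> \<partial>M)"
      by (simp add: nn_integral_cmult_indicator)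
    also have "\<dots> \<le> (\<integral>\<^sup>+\<omega>. ennreal (ln (1 + norm (Y s \<omega>))) \<partial>M)"
    proof (intro nn_integral_mono)
      fix \<omega>
      have "ln (1 + a) \<le> ln (1 + norm (Y s \<omega>))" if "\<omega> \<in> ?B" using that a1 by (intro ln_mono) auto
      then show "ennreal (4 * C + 1) * indicator ?B \<omega> \<le> ennreal (ln (1 + norm (Y s \<omega>)))"
        using l by (auto split: split_indicator intro!: ennreal_leI)
    qed
    also have "\<dots> \<le> ennreal (C * (1 + s))" by (rule C) fact
    also have "\<dots> \<le> ennreal (2 * C)" using C s by (intro ennreal_leI) (simp add: mult_left_le algebra_simps)
    finally have "ennreal ((4 * C + 1) * prob ?B) \<le> ennreal (2 * C)"
      using C by (simp add: emeasure_eq_measure ennreal_mult)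
    then have "(4 * C + 1) * prob ?B \<le> 2 * C" using C by (simp add: ennreal_le_iff)
    also have "\<dots> \<le> (4 * C + 1) * (1 / 2)" by (simp add: field_simps)
    finally have "(4 * C + 1) * prob ?B \<le> (4 * C + 1) * (1 / 2)" .
    then show "prob ?B \<le> 1 / 2" by (rule mult_left_le_imp_le) (use C in auto)
  qed
qed

text \<open>Borel--Cantelli: the bound for a window does not depend on its start, and the tails of
  \<open>Y 1\<close> at exponential levels are summable. The starts \<open>r n\<close> are free
  because both moving windows and one fixed window with rising levels are used.\<close>

lemma AE_not_exceed:
  assumes \<epsilon>: "\<epsilon> > 0" and r: "\<And>n. r n \<ge> 0"
  shows "AE \<omega> in M. \<forall>\<^sub>F n in sequentially. \<omega> \<notin> exceed (r n) (exp (\<epsilon> * real n))"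
proof -
  obtain a\<^sub>0 where a0: "a\<^sub>0 \<ge> 1" "\<And>a s. a \<ge> a\<^sub>0 \<Longrightarrow> 0 \<le> s \<Longrightarrow> s \<le> 1 \<Longrightarrow> prob {\<omega> \<in> space M. a < norm (Y s \<omega>)} \<le> 1 / 2"
    using small_tails by blast
  have "filterlim (\<lambda>n. exp (\<epsilon> * real n)) at_top sequentially" using \<epsilon> by real_asymp
  then have ev: "\<forall>\<^sub>F n in sequentially. a\<^sub>0 \<le> exp (\<epsilon> * real n)" by (simp add: filterlim_at_top)
  have "summable (\<lambda>n. 2 * measure (distr M borel (Y 1)) {x. exp \<epsilon> ^ n \<le> norm x})"
    using \<epsilon> by (intro summable_mult log_moment_summable_tails distribution_X log_moment_Y) auto
  then have "summable (\<lambda>n. prob (exceed (r n) (exp (\<epsilon> * real n))))"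
  proof (rule summable_comparison_test_ev[rotated])
    show "\<forall>\<^sub>F n in sequentially. norm (prob (exceed (r n) (exp (\<epsilon> * real n)))) \<le> 2 * measure (distr M borel (Y 1)) {x. exp \<epsilon> ^ n \<le> norm x}"
      using ev
    proof eventually_elim
      case (elim n)
      have "prob (exceed (r n) (exp (\<epsilon> * real n))) \<le> 2 * prob {\<omega> \<in> space M. exp (\<epsilon> * real n) < norm (Y 1 \<omega>)}"
        using elim a0(2) by (intro prob_exceed r) auto
      also have "prob {\<omega> \<in> space M. exp (\<epsilon> * real n) < norm (Y 1 \<omega>)} \<le> prob {\<omega> \<in> space M. exp \<epsilon> ^ n \<le> norm (Y 1 \<omega>)}"
        by (intro finite_measure_mono) (auto simp: exp_of_nat_mult[symmetric] mult.commute)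
      also have "\<dots> = measure (distr M borel (Y 1)) {x. exp \<epsilon> ^ n \<le> norm x}"
        by (subst measure_distr) (auto intro!: arg_cong[where f=prob])
      finally show ?case by simp
    qed
  qed
  then have "AE \<omega> in M. \<forall>\<^sub>F n in sequentially. \<omega> \<in> space M - exceed (r n) (exp (\<epsilon> * real n))"
    by (intro borel_cantelli_AE1) (auto simp: r emeasure_eq_measure)
  then show ?thesis by eventually_elim (auto elim: eventually_mono)
qed

text \<open>The oscillation on \<open>[k, k + 1]\<close> is finite for each \<open>k\<close> and
  eventually at most \<open>2 * exp (\<epsilon> * k)\<close>. Summation over the windows loses a
  factor of order \<open>k + 1\<close>, which is absorbed by doubling the exponential rate.\<close>

lemma AE_growth:
  assumes \<epsilon>: "\<epsilon> > 0"
  shows "AE \<omega> in M. \<exists>C. \<forall>t\<ge>0. norm (Y t \<omega>) \<le> C * exp (2 * \<epsilon> * t)"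
proof -
  have "AE \<omega> in M. \<forall>k. \<forall>\<^sub>F n in sequentially. \<omega> \<notin> exceed (real k) (exp (\<epsilon> * real n))"
    by (subst AE_all_countable) (auto intro!: AE_not_exceed \<epsilon>)
  moreover have "AE \<omega> in M. \<forall>\<^sub>F n in sequentially. \<omega> \<notin> exceed (real n) (exp (\<epsilon> * real n))"
    by (intro AE_not_exceed \<epsilon>) auto
  ultimately show ?thesis using AE_good
  proof eventually_elim
    case (elim \<omega>)
    have fin: "\<exists>d\<ge>0. \<forall>s. real k \<le> s \<longrightarrow> s \<le> real k + 1 \<longrightarrow> norm (Y s \<omega> - Y (real k) \<omega>) \<le> d" for k
    proof -
      obtain n where n: "\<omega> \<notin> exceed (real k) (exp (\<epsilon> * real n))" using eventually_happens'[OF sequentially_bot elim(1)[rule_format, of k]] by blast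
      show ?thesis by (intro exI[of _ "2 * exp (\<epsilon> * real n)"] conjI allI impI not_exceed[OF elim(3) n]) auto
    qed
    define d where "d = (\<lambda>k. if \<omega> \<notin> exceed (real k) (exp (\<epsilon> * real k)) then 2 * exp (\<epsilon> * real k)
       else SOME d. d \<ge> 0 \<and> (\<forall>s. real k \<le> s \<longrightarrow> s \<le> real k + 1 \<longrightarrow> norm (Y s \<omega> - Y (real k) \<omega>) \<le> d))"
    have d: "d k \<ge> 0 \<and> (\<forall>s. real k \<le> s \<longrightarrow> s \<le> real k + 1 \<longrightarrow> norm (Y s \<omega> - Y (real k) \<omega>) \<le> d k)" for k
    proof (cases "\<omega> \<notin> exceed (real k) (exp (\<epsilon> * real k))")
      case True
      then show ?thesis unfolding d_def using not_exceed[OF elim(3) True] by auto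
    next
      case False
      then show ?thesis unfolding d_def using someI_ex[OF fin[of k]] by auto
    qed
    obtain K where "\<forall>k\<ge>K. \<omega> \<notin> exceed (real k) (exp (\<epsilon> * real k))"
      using elim(2) unfolding eventually_sequentially by blast
    then have K: "\<And>k. k \<ge> K \<Longrightarrow> d k = 2 * exp (\<epsilon> * real k)" by (simp add: d_def)
    have Yk: "norm (Y (real k) \<omega>) \<le> norm (Y 0 \<omega>) + (\<Sum>i<k. d i)" for k
    proof (induction k)
      case (Suc k)
      have "norm (Y (real (Suc k)) \<omega> - Y (real k) \<omega>) \<le> d k" using d[of k] by simp
      then show ?case using Suc norm_triangle_ineq[of "Y (real (Suc k)) \<omega> - Y (real k) \<omega>" "Y (real k) \<omega>"] by simp
    qed simp
    define D where "D = norm (Y 0 \<omega>) + (\<Sum>i<K. d i)"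
    have D0: "D \<ge> 0" unfolding D_def using d by (intro add_nonneg_nonneg sum_nonneg) auto
    have sumd: "(\<Sum>i<k. d i) \<le> (\<Sum>i<K. d i) + real k * (2 * exp (\<epsilon> * real k))" for k
    proof -
      have "(\<Sum>i<k. d i) \<le> (\<Sum>i<k. of_bool (i < K) * d i + 2 * exp (\<epsilon> * real k))"
      proof (intro sum_mono)
        fix i assume i: "i \<in> {..<k}"
        then have "exp (\<epsilon> * real i) \<le> exp (\<epsilon> * real k)" using \<epsilon> by auto
        then show "d i \<le> of_bool (i < K) * d i + 2 * exp (\<epsilon> * real k)" using K[of i] by (cases "i < K") auto
      qed
      also have "\<dots> = (\<Sum>i<k. of_bool (i < K) * d i) + real k * (2 * exp (\<epsilon> * real k))" by (simp add: sum.distrib)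
      also have "(\<Sum>i<k. of_bool (i < K) * d i) \<le> (\<Sum>i<K. d i)"
        unfolding of_bool_def if_distrib[of "\<lambda>x. x * _"] using d
        by (subst sum.If_cases) (auto intro!: sum_mono2)
      finally show ?thesis by simp
    qed
    show ?case
    proof (intro exI[of _ "D + 2 * (1 / \<epsilon> + 1)"] allI impI)
      fix t :: real assume t: "t \<ge> 0"
      define k where "k = nat \<lfloor>t\<rfloor>"
      have k: "real k \<le> t" "t \<le> real k + 1" using t by (auto simp: k_def of_nat_nat)
      have "norm (Y t \<omega> - Y (real k) \<omega>) \<le> d k" using d[of k] k by blast
      then have "norm (Y t \<omega>) \<le> norm (Y (real k) \<omega>) + d k"
        using norm_triangle_ineq[of "Y t \<omega> - Y (real k) \<omega>" "Y (real k) \<omega>"] by simp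
      also have "\<dots> \<le> norm (Y 0 \<omega>) + (\<Sum>i<k. d i) + d k" using Yk[of k] by simp
      also have "\<dots> \<le> D + (real k + 1) * (2 * exp (\<epsilon> * real k))"
      proof (cases "k < K")
        case True
        have "(\<Sum>i<k. d i) + d k = (\<Sum>i<Suc k. d i)" by simp
        also have "\<dots> \<le> (\<Sum>i<K. d i)" using True d by (intro sum_mono2) auto
        finally show ?thesis unfolding D_def by (smt (verit) exp_gt_zero mult_nonneg_nonneg of_nat_0_le_iff)
      next
        case False
        then show ?thesis using sumd[of k] K[of k] by (simp add: D_def algebra_simps)
      qed
      also have "(real k + 1) \<le> (1 / \<epsilon> + 1) * exp (\<epsilon> * real k)"
      proof -
        have e: "1 + \<epsilon> * real k \<le> exp (\<epsilon> * real k)" by (rule exp_ge_add_one_self)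
        have "real k = (1 / \<epsilon>) * (\<epsilon> * real k)" using \<epsilon> by simp
        also have "\<dots> \<le> (1 / \<epsilon>) * exp (\<epsilon> * real k)"
        proof (rule mult_left_mono)
          show "\<epsilon> * real k \<le> exp (\<epsilon> * real k)" using e by linarith
        qed (use \<epsilon> in auto)
        finally have "real k \<le> (1 / \<epsilon>) * exp (\<epsilon> * real k)" .
        moreover have "1 \<le> exp (\<epsilon> * real k)" using \<epsilon> by simp
        ultimately show ?thesis unfolding distrib_right mult_1_left by (rule add_mono)
      qed
      also have "D + (1 / \<epsilon> + 1) * exp (\<epsilon> * real k) * (2 * exp (\<epsilon> * real k)) = D * 1 + 2 * (1 / \<epsilon> + 1) * exp (2 * \<epsilon> * real k)"
        by (simp add: exp_add[symmetric] algebra_simps)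
      also have "\<dots> \<le> D * exp (2 * \<epsilon> * t) + 2 * (1 / \<epsilon> + 1) * exp (2 * \<epsilon> * t)"
        using D0 \<epsilon> t k by (intro add_mono mult_left_mono) auto
      finally show "norm (Y t \<omega>) \<le> (D + 2 * (1 / \<epsilon> + 1)) * exp (2 * \<epsilon> * t)" by (simp add: ring_distribs)
    qed
  qed
qed

end

lemma poisson_pmf_exp:
  assumes l: "l > 0"
  shows "measure_pmf.expectation (poisson_pmf l) (\<lambda>k. exp (- real k)) = exp (- (l * (1 - exp (- 1))))"
proof -
  have int: "integrable (measure_pmf (poisson_pmf l)) (\<lambda>k. exp (- real k))"
    by (intro measure_pmf.integrable_const_bound[where B=1]) auto
  have "(\<lambda>k. pmf (poisson_pmf l) k * exp (- real k)) sums measure_pmf.expectation (poisson_pmf l) (\<lambda>k. exp (- real k))"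
    using int unfolding measure_pmf_eq_density
    by (subst (asm) integrable_density, simp_all, subst integral_density, simp_all) (auto intro: sums_integral_count_space_nat)
  moreover have "(\<lambda>k. pmf (poisson_pmf l) k * exp (- real k)) sums (exp (- l) * exp (l * exp (- 1)))"
  proof -
    have "pmf (poisson_pmf l) k * exp (- real k) = exp (- l) * ((l * exp (- 1)) ^ k /\<^sub>R fact k)" for k
      using l by (simp add: power_mult_distrib exp_of_nat_mult[symmetric] divide_inverse)
    then show ?thesis using sums_mult[OF exp_converges[of "l * exp (- 1)"], of "exp (- l)"] by simp
  qed
  ultimately have "measure_pmf.expectation (poisson_pmf l) (\<lambda>k. exp (- real k)) = exp (- l) * exp (l * exp (- 1))"
    by (rule sums_unique2)
  then show ?thesis by (simp add: exp_add[symmetric] algebra_simps)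
qed

lemma (in levy_proc) good_grid_LIMSEQ:
  assumes "\<omega> \<in> good" "t \<ge> 0"
  shows "(\<lambda>n. X ((of_int \<lfloor>real (Suc n) * t\<rfloor> + 1) / real (Suc n)) \<omega>) \<longlonglongrightarrow> X t \<omega>"
proof (rule filterlim_compose[where g="\<lambda>s. X s \<omega>"])
  show "((\<lambda>s. X s \<omega>) \<longlongrightarrow> X t \<omega>) (at_right t)" using good(3)[OF assms] by (simp add: continuous_within)
  have g: "t < (of_int \<lfloor>real (Suc n) * t\<rfloor> + 1) / real (Suc n)" "(of_int \<lfloor>real (Suc n) * t\<rfloor> + 1) / real (Suc n) \<le> t + 1 / real (Suc n)" for n
    by (rule grid_right, simp)+
  have "(\<lambda>n. (of_int \<lfloor>real (Suc n) * t\<rfloor> + 1) / real (Suc n)) \<longlonglongrightarrow> t"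
  proof (rule tendsto_sandwich)
    show "\<forall>\<^sub>F n in sequentially. t \<le> (of_int \<lfloor>real (Suc n) * t\<rfloor> + 1) / real (Suc n)" using g(1) by (intro always_eventually allI less_imp_le)
    show "\<forall>\<^sub>F n in sequentially. (of_int \<lfloor>real (Suc n) * t\<rfloor> + 1) / real (Suc n) \<le> t + 1 / real (Suc n)" using g(2) by (intro always_eventually allI)
    show "(\<lambda>n. t + 1 / real (Suc n)) \<longlonglongrightarrow> t" using LIMSEQ_inverse_real_of_nat_add[of t] by (simp add: inverse_eq_divide)
  qed simp
  then show "filterlim (\<lambda>n. (of_int \<lfloor>real (Suc n) * t\<rfloor> + 1) / real (Suc n)) (at_right t) sequentially"
    using g(1) by (auto simp: filterlim_at less_imp_neq[THEN not_sym] intro!: always_eventually)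
qed

text \<open>Null sets are collected over pairs of rational times with a common denominator. Rounding
  both times up on the same grid preserves their order, and right-continuity together with
  closedness of \<open>S\<close> reaches all times at once.\<close>

lemma (in levy_proc) AE_increments_closed:
  assumes S: "closed S" and AE: "\<And>t. t \<ge> 0 \<Longrightarrow> AE \<omega> in M. X t \<omega> \<in> S"
  shows "AE \<omega> in M. \<forall>s\<ge>0. \<forall>t\<ge>s. X t \<omega> - X s \<omega> \<in> S"
proof -
  have inc: "AE \<omega> in M. X t \<omega> - X s \<omega> \<in> S" if s: "0 \<le> s" "s \<le> t" for s t
  proof -
    have [measurable]: "X s \<in> borel_measurable M" "X t \<in> borel_measurable M" "S \<in> sets borel" using s S by auto
    have [measurable]: "X (t - s) \<in> borel_measurable M" using s by simp
    have "AE x in distr M borel (X (t - s)). x \<in> S"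
      using AE[of "t - s"] s by (subst AE_distr_iff) auto
    moreover have eq: "distr M borel (\<lambda>\<omega>. X (s + (t - s)) \<omega> - X s \<omega>) = distr M borel (X (t - s))"
      by (rule distr_increment) (use s in auto)
    ultimately have "AE x in distr M borel (\<lambda>\<omega>. X (s + (t - s)) \<omega> - X s \<omega>). x \<in> S"
      unfolding eq by blast
    then show ?thesis by (subst (asm) AE_distr_iff) auto
  qed
  have "AE \<omega> in M. \<forall>i j m::nat. i \<le> j \<longrightarrow> X (real j / real (Suc m)) \<omega> - X (real i / real (Suc m)) \<omega> \<in> S"
    unfolding AE_all_countable by (intro allI AE_impI inc) (auto intro!: divide_right_mono)
  then show ?thesis using AE_good
  proof eventually_elim
    case (elim \<omega>)
    define d :: "nat \<Rightarrow> real \<Rightarrow> real" where "d = (\<lambda>n t. (of_int \<lfloor>real (Suc n) * t\<rfloor> + 1) / real (Suc n))"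
    have lim: "(\<lambda>n. X (d n t) \<omega>) \<longlonglongrightarrow> X t \<omega>" if "t \<ge> 0" for t
      unfolding d_def by (rule good_grid_LIMSEQ[OF elim(2) that])
    have d: "d n t = real (nat (\<lfloor>real (Suc n) * t\<rfloor> + 1)) / real (Suc n)" if "t \<ge> 0" for n t
    proof -
      have "0 \<le> \<lfloor>real (Suc n) * t\<rfloor>" using that by simp
      then show ?thesis unfolding d_def by simp
    qed
    have "X t \<omega> - X s \<omega> \<in> S" if st: "0 \<le> s" "s \<le> t" for s t
    proof (rule closed_sequentially[OF S _ tendsto_diff[OF lim lim]])
      fix n
      have "real (Suc n) * s \<le> real (Suc n) * t" using st by (intro mult_left_mono) auto
      then have "nat (\<lfloor>real (Suc n) * s\<rfloor> + 1) \<le> nat (\<lfloor>real (Suc n) * t\<rfloor> + 1)" by (intro nat_mono add_right_mono floor_mono)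
      then show "X (d n t) \<omega> - X (d n s) \<omega> \<in> S"
        using elim(1) st unfolding d[OF st(1)] d[OF order_trans[OF st]] by blast
    qed (use st in auto)
    then show ?case by blast
  qed
qed

lemma borel_measurable_completion_AE:
  fixes f g :: "'a \<Rightarrow> 'b::topological_space"
  assumes f: "f \<in> borel_measurable M" and eq: "AE x in M. f x = g x"
  shows "g \<in> borel_measurable (completion M)"
proof (rule measurableI)
  fix A :: "'b set" assume A: "A \<in> sets borel"
  show "g -` A \<inter> space (completion M) \<in> sets (completion M)"
  proof (rule completion.in_sets_AE)
    show "f -` A \<inter> space M \<in> sets (completion M)" using measurable_sets[OF f A] by (rule sets_completionI_sets)
    show "AE x in completion M. (x \<in> f -` A \<inter> space M) = (x \<in> g -` A \<inter> space (completion M))"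
      using AE_completion[OF eq] by eventually_elim simp
  qed auto
qed auto

section \<open>Almost sure path properties of \<open>N\<close> and existence of the integral\<close>

context pois_levy
begin

text \<open>Half the rate at which the expectation of \<open>exp (- N t)\<close> decays, so that a
  Chernoff bound at the level \<open>\<delta> * n\<close> still leaves
  \<open>exp (- \<delta> * n)\<close>.\<close>

definition \<delta> :: real where "\<delta> = c * (1 - exp (- 1)) / 2"

lemma \<delta>_pos: "\<delta> > 0"
  using c by (simp add: \<delta>_def)

lemma AE_N_Ints: "t \<ge> 0 \<Longrightarrow> AE \<omega> in M. N t \<omega> \<in> \<int> \<and> 0 \<le> N t \<omega>"
proof (cases "t = 0")
  case True
  then show ?thesis using N.start_0 by (auto elim!: eventually_mono)
next
  case False
  assume "t \<ge> 0"
  then have t: "t > 0" using False by simp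
  have cl: "closed (\<int> \<inter> {0::real..})" by (intro closed_Int closed_Ints) auto
  have "AE x in distr (measure_pmf (poisson_pmf (c * t))) borel real. x \<in> \<int> \<inter> {0..}"
    by (subst AE_distr_iff) (use borel_closed[OF cl] in auto)
  then have "AE x in distr M borel (N t). x \<in> \<int> \<inter> {0..}" unfolding poisson[OF t] .
  moreover have "N t \<in> borel_measurable M" using t by simp
  ultimately have "AE \<omega> in M. N t \<omega> \<in> \<int> \<inter> {0..}" using AE_distrD by blast
  then show ?thesis by eventually_elim auto
qed

lemma AE_N_paths: "AE \<omega> in M. N 0 \<omega> = 0 \<and> (\<forall>s t. 0 \<le> s \<longrightarrow> s \<le> t \<longrightarrow> N s \<omega> \<le> N t \<omega>) \<and> (\<forall>t\<ge>0. N t \<omega> \<in> \<int>)"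
proof -
  have "AE \<omega> in M. \<forall>s\<ge>0. \<forall>t\<ge>s. N t \<omega> - N s \<omega> \<in> {0..} \<inter> \<int>"
    by (intro N.AE_increments_closed closed_Int closed_Ints) (use AE_N_Ints in \<open>auto elim!: eventually_mono\<close>)
  then show ?thesis using N.start_0
  proof eventually_elim
    case (elim \<omega>)
    have "N t \<omega> - N s \<omega> \<in> {0..} \<inter> \<int>" if "0 \<le> s" "s \<le> t" for s t using elim(1) that by blast
    from this this[of 0] show ?case using elim(2) by auto
  qed
qed

text \<open>A Chernoff bound and Borel--Cantelli settle the integer times from some \<open>K\<close>
  on; monotonicity fills the gaps, and the shift by \<open>\<delta> * (K + 1)\<close> covers the
  beginning.\<close>

lemma AE_N_growth: "AE \<omega> in M. \<exists>B. \<forall>t\<ge>0. \<delta> * t - B \<le> N t \<omega>"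
proof -
  define A where "A = (\<lambda>n. {\<omega> \<in> space M. N (real n) \<omega> < \<delta> * real n})"
  have A [measurable]: "A n \<in> sets M" for n unfolding A_def by measurable
  have pA: "prob (A n) \<le> exp (- \<delta>) ^ n" if n: "n \<ge> 1" for n
  proof -
    have t: "real n > 0" "c * real n > 0" using n c by auto
    have int: "integrable M (\<lambda>\<omega>. exp (- N (real n) \<omega>))"
      using AE_N_Ints[of "real n"] by (intro integrable_const_bound[where B=1]) (auto elim!: eventually_mono)
    have "prob (A n) = expectation (indicator (A n))" by simp
    also have "\<dots> \<le> expectation (\<lambda>\<omega>. exp (\<delta> * real n) * exp (- N (real n) \<omega>))"
    proof (rule integral_mono)
      show "integrable M (\<lambda>\<omega>. exp (\<delta> * real n) * exp (- N (real n) \<omega>))" using int by simp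
      show "indicator (A n) \<omega> \<le> exp (\<delta> * real n) * exp (- N (real n) \<omega>)" for \<omega>
        by (auto simp: A_def exp_add[symmetric] split: split_indicator)
    qed (simp add: emeasure_eq_measure)
    also have "\<dots> = exp (\<delta> * real n) * (LINT x|distr M borel (N (real n)). exp (- x))"
      by (subst integral_distr) auto
    also have "(LINT x|distr M borel (N (real n)). exp (- x)) = measure_pmf.expectation (poisson_pmf (c * real n)) (\<lambda>k. exp (- real k))"
      unfolding poisson[OF t(1)] by (subst integral_distr) auto
    also have "exp (\<delta> * real n) * \<dots> = exp (\<delta> * real n) * exp (- (c * real n * (1 - exp (- 1))))"
      by (subst poisson_pmf_exp[OF t(2)]) simp
    also have "\<dots> = exp (real n * (- \<delta>))" by (simp add: exp_add[symmetric] \<delta>_def field_simps)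
    also have "\<dots> = exp (- \<delta>) ^ n" by (rule exp_of_nat_mult)
    finally show ?thesis .
  qed
  have "summable (\<lambda>n. prob (A n))"
  proof (rule summable_comparison_test)
    show "summable (\<lambda>n. exp (- \<delta>) ^ n)" using \<delta>_pos by (intro summable_geometric) simp
    show "\<exists>N. \<forall>n\<ge>N. norm (prob (A n)) \<le> exp (- \<delta>) ^ n" using pA by (intro exI[of _ 1]) simp
  qed
  then have "AE \<omega> in M. \<forall>\<^sub>F n in sequentially. \<omega> \<in> space M - A n"
    by (intro borel_cantelli_AE1) (auto simp: emeasure_eq_measure)
  then show ?thesis using AE_N_paths
  proof eventually_elim
    case (elim \<omega>)
    then obtain K where K: "\<And>n. n \<ge> K \<Longrightarrow> \<delta> * real n \<le> N (real n) \<omega>"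
      unfolding eventually_sequentially A_def by (auto simp: not_less)
    show ?case
    proof (intro exI[of _ "\<delta> * (real K + 1)"] allI impI)
      fix t :: real assume t: "t \<ge> 0"
      show "\<delta> * t - \<delta> * (real K + 1) \<le> N t \<omega>"
      proof (cases "nat \<lfloor>t\<rfloor> \<ge> K")
        case True
        have "\<delta> * t \<le> \<delta> * (real (nat \<lfloor>t\<rfloor>) + 1)" using t \<delta>_pos by (intro mult_left_mono) (auto simp: of_nat_nat)
        moreover have "N (real (nat \<lfloor>t\<rfloor>)) \<omega> \<le> N t \<omega>" using elim(2) t by (auto simp: of_nat_nat)
        moreover have "0 \<le> \<delta> * real K" using \<delta>_pos by simp
        ultimately show ?thesis using K[OF True] by (simp add: ring_distribs)
      next
        case False
        then have "t \<le> real K + 1" using t by linarith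
        then have "\<delta> * t \<le> \<delta> * (real K + 1)" using \<delta>_pos by (intro mult_left_mono) auto
        moreover have "0 \<le> N t \<omega>" using elim(2) t by (metis order_refl)
        ultimately show ?thesis by simp
      qed
    qed
  qed
qed

lemma AE_jump_path: "AE \<omega> in M. \<exists>B C. jump_path (\<lambda>t. N t \<omega>) (\<lambda>t. Y t \<omega>) \<delta> B C"
proof -
  \<comment> \<open>The growth lemma doubles its parameter, which gives the rate
    \<open>\<delta> / 2\<close> demanded by \<open>jump_path\<close>.\<close>
  have "\<delta> / 4 > 0" using \<delta>_pos by simp
  from AE_growth[OF this] AE_N_paths AE_N_growth AE_good N.AE_good show ?thesis
  proof eventually_elim
    case (elim \<omega>)
    then obtain B C where BC: "\<forall>t\<ge>0. \<delta> * t - B \<le> N t \<omega>" "\<forall>t\<ge>0. norm (Y t \<omega>) \<le> C * exp (2 * (\<delta> / 4) * t)" by blast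
    have "jump_path (\<lambda>t. N t \<omega>) (\<lambda>t. Y t \<omega>) \<delta> B C"
      by unfold_locales (use elim(2) BC \<delta>_pos good(3,4)[OF elim(4)] N.good(4)[OF elim(5)] in auto)
    then show ?case by blast
  qed
qed

text \<open>On a measurable set \<open>G\<close> of full probability everything is pathwise
  convergence, which also yields convergence in probability for all partitions. Measurability of the
  integral comes from one explicit sequence of partitions.\<close>

lemma has_improper_integral_exists: "\<exists>Z. has_improper_integral M H Y Z"
proof -
  obtain Nu where Nu: "Nu \<in> null_sets M" "{\<omega> \<in> space M. \<not> (\<exists>B C. jump_path (\<lambda>t. N t \<omega>) (\<lambda>t. Y t \<omega>) \<delta> B C)} \<subseteq> Nu"
    using AE_jump_path unfolding eventually_ae_filter by blast
  define G where "G = space M - Nu"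
  have [measurable]: "G \<in> sets M" using Nu by (auto simp: G_def)
  have G: "\<exists>B C. jump_path (\<lambda>t. N t \<omega>) (\<lambda>t. Y t \<omega>) \<delta> B C" if "\<omega> \<in> G" for \<omega>
    using that Nu by (auto simp: G_def)
  have AG: "AE \<omega> in M. \<omega> \<in> G" using AE_not_in[OF Nu(1)] by (auto simp: G_def elim!: AE_mp intro!: AE_I2)
  define I where "I = (\<lambda>t \<omega>. if \<omega> \<in> G then jump_path.J (\<lambda>t. N t \<omega>) (\<lambda>t. Y t \<omega>) t else 0)"
  have NL: "jump_path.NL (\<lambda>t. N t \<omega>) s = left_limit N s \<omega>" if \<omega>: "\<omega> \<in> G" for \<omega> s
  proof -
    obtain B C where "jump_path (\<lambda>t. N t \<omega>) (\<lambda>t. Y t \<omega>) \<delta> B C" using G[OF \<omega>] by blast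
    then show ?thesis by (simp add: jump_path.NL_def left_limit_def)
  qed
  \<comment> \<open>Set to 0 off \<open>G\<close>, the integrand becomes measurable for
    \<open>M\<close>, being a pointwise limit of values of \<open>N\<close> from the left; sums with
    \<open>H\<close> itself are handled through the completion.\<close>
  define HG where "HG = (\<lambda>s \<omega>. if \<omega> \<in> G then H s \<omega> else 0)"
  have HG: "HG s \<in> borel_measurable M" if s: "s \<ge> 0" for s
  proof (cases "s = 0")
    case True
    then have "HG s = (\<lambda>\<omega>. if \<omega> \<in> G then exp (- N 0 \<omega>) else 0)" by (auto simp: HG_def left_limit_def)
    then show ?thesis by simp
  next
    case False
    define u where "u = (\<lambda>n. s - s / real (n + 2))"
    have u0: "0 \<le> u n" "u n < s" for n
    proof -
      have "s / real (n + 2) \<le> s / 1" using s by (intro divide_left_mono) auto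
      then show "0 \<le> u n" by (simp add: u_def)
      show "u n < s" using s False by (simp add: u_def)
    qed
    have [measurable]: "N (u n) \<in> borel_measurable M" for n using u0 by simp
    show ?thesis
    proof (rule borel_measurable_LIMSEQ_metric)
      show "(\<lambda>\<omega>. if \<omega> \<in> G then exp (- N (u n) \<omega>) else 0) \<in> borel_measurable M" for n by measurable
      show "(\<lambda>n. if \<omega> \<in> G then exp (- N (u n) \<omega>) else 0) \<longlonglongrightarrow> HG s \<omega>" for \<omega>
      proof (cases "\<omega> \<in> G")
        case True
        then obtain B C where "jump_path (\<lambda>t. N t \<omega>) (\<lambda>t. Y t \<omega>) \<delta> B C" using G by blast
        then have "((\<lambda>t. N t \<omega>) \<longlongrightarrow> left_limit N s \<omega>) (at_left s)"
          using jump_path.NL_tendsto[of "\<lambda>t. N t \<omega>" "\<lambda>t. Y t \<omega>" \<delta> B C s] s False NL[OF True] by simp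
        moreover have "filterlim u (at_left s) sequentially"
        proof -
          have "(\<lambda>n. s - s / real (n + 2)) \<longlonglongrightarrow> s - 0" by (intro tendsto_intros) real_asymp
          then show ?thesis using u0 unfolding u_def by (auto simp: filterlim_at less_imp_neq)
        qed
        ultimately have "(\<lambda>n. N (u n) \<omega>) \<longlonglongrightarrow> left_limit N s \<omega>" by (rule filterlim_compose)
        then show ?thesis using True by (auto simp: HG_def intro!: tendsto_intros)
      qed (simp add: HG_def)
    qed
  qed
  have conv: "(\<lambda>n. \<Sum>i<k n. HG (p n i) \<omega> *\<^sub>R (Y (p n (Suc i)) \<omega> - Y (p n i) \<omega>)) \<longlonglongrightarrow> I t \<omega>"
    if t: "t \<ge> 0" and P: "partition_seq t k p" for t k p \<omega>
  proof (cases "\<omega> \<in> G")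
    case True
    then obtain B C where "jump_path (\<lambda>t. N t \<omega>) (\<lambda>t. Y t \<omega>) \<delta> B C" using G by blast
    from jump_path.partition_sums_tendsto[OF this t P] show ?thesis
      using True by (simp add: I_def HG_def NL)
  qed (simp add: I_def HG_def)
  have p_range: "0 \<le> p n i" if P: "partition_seq t k p" and "i \<le> k n" for t p n i and k :: "nat \<Rightarrow> nat"
    using that(2)
  proof (induction i)
    case 0
    then show ?case using P by (simp add: partition_seq_def)
  next
    case (Suc i)
    then have "p n i \<le> p n (Suc i)" using P by (simp add: partition_seq_def)
    then show ?case using Suc by simp
  qed
  have S_meas: "(\<lambda>\<omega>. \<Sum>i<k n. HG (p n i) \<omega> *\<^sub>R (Y (p n (Suc i)) \<omega> - Y (p n i) \<omega>)) \<in> borel_measurable M"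
    if P: "partition_seq t k p" for t p n and k :: "nat \<Rightarrow> nat"
    using p_range[OF P] by (intro borel_measurable_sum borel_measurable_scaleR HG borel_measurable_diff meas) auto
  have I_meas: "I t \<in> borel_measurable M" if t: "t \<ge> 0" for t
  proof -
    define p where "p = (\<lambda>n i. t * (real i / real (Suc n)))"
    have P: "partition_seq t Suc p"
      unfolding partition_seq_def
    proof (intro conjI allI impI)
      show "p n 0 = 0" "p n (Suc n) = t" for n by (auto simp: p_def)
      show "p n i \<le> p n (Suc i)" for n i unfolding p_def using t by (intro mult_left_mono divide_right_mono) auto
      fix \<epsilon> :: real assume "\<epsilon> > 0"
      have "(\<lambda>n. t / real (Suc n)) \<longlonglongrightarrow> 0" by real_asymp
      then have "\<forall>\<^sub>F n in sequentially. t / real (Suc n) < \<epsilon>" using \<open>\<epsilon> > 0\<close> by (intro order_tendstoD) auto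
      then show "\<forall>\<^sub>F n in sequentially. \<forall>i<Suc n. p n (Suc i) - p n i < \<epsilon>"
      proof eventually_elim
        case (elim n)
        have "t * ((1 + x) / y) - t * (x / y) = t / y" for x y :: real by (simp add: add_divide_distrib algebra_simps)
        then have "p n (Suc i) - p n i = t / real (Suc n)" for i unfolding p_def of_nat_Suc[of i] .
        then show ?case using elim by simp
      qed
    qed
    show ?thesis
      by (rule borel_measurable_LIMSEQ_metric[OF S_meas[OF P] conv[OF t P]])
  qed
  have cad: "cadlag_paths M I"
    unfolding cadlag_paths_def using AG
  proof eventually_elim
    case (elim \<omega>)
    then obtain B C where J: "jump_path (\<lambda>t. N t \<omega>) (\<lambda>t. Y t \<omega>) \<delta> B C" using G by blast
    have "(\<lambda>s. I s \<omega>) = jump_path.J (\<lambda>t. N t \<omega>) (\<lambda>t. Y t \<omega>)" using elim by (simp add: I_def)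
    then show ?case using jump_path.J_right[OF J] jump_path.J_left[OF J] by simp
  qed
  have prob_lim: "tendsto_in_prob M (\<lambda>n \<omega>. \<Sum>i<k n. H (p n i) \<omega> *\<^sub>R (Y (p n (Suc i)) \<omega> - Y (p n i) \<omega>)) (I t)"
    if t: "t \<ge> 0" and P: "partition_seq t k p" for t p and k :: "nat \<Rightarrow> nat"
    unfolding tendsto_in_prob_def
  proof (intro conjI allI impI)
    let ?S = "\<lambda>n \<omega>. \<Sum>i<k n. H (p n i) \<omega> *\<^sub>R (Y (p n (Suc i)) \<omega> - Y (p n i) \<omega>)"
    let ?SG = "\<lambda>n \<omega>. \<Sum>i<k n. HG (p n i) \<omega> *\<^sub>R (Y (p n (Suc i)) \<omega> - Y (p n i) \<omega>)"
    have eq: "AE \<omega> in M. ?SG n \<omega> = ?S n \<omega>" for n using AG by eventually_elim (simp add: HG_def)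
    show S: "?S n \<in> borel_measurable (completion M)" for n
      by (rule borel_measurable_completion_AE[OF S_meas[OF P] eq])
    show It: "I t \<in> borel_measurable (completion M)" by (rule measurable_completion[OF I_meas[OF t]])
    fix \<epsilon> :: real assume \<epsilon>: "\<epsilon> > 0"
    interpret C: prob_space "completion M" by (rule prob_space_completion)
    let ?A = "\<lambda>n. {\<omega> \<in> space (completion M). \<epsilon> < dist (?S n \<omega>) (I t \<omega>)}"
    have A: "?A n \<in> sets (completion M)" for n
      by (rule borel_measurable_less[OF borel_measurable_const borel_measurable_dist[OF S It]])
    have "(\<lambda>n. LINT \<omega>|completion M. indicator (?A n) \<omega> :: real) \<longlonglongrightarrow> (LINT \<omega>|completion M. 0)"
    proof (rule integral_dominated_convergence[where w="\<lambda>_. 1"])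
      have "AE \<omega> in completion M. \<omega> \<in> G" by (rule AE_completion[OF AG])
      then show "AE \<omega> in completion M. (\<lambda>n. indicator (?A n) \<omega> :: real) \<longlonglongrightarrow> 0"
      proof eventually_elim
        case (elim \<omega>)
        then have "(\<lambda>n. ?S n \<omega>) \<longlonglongrightarrow> I t \<omega>" using conv[OF t P, of \<omega>] by (simp add: HG_def)
        then have "\<forall>\<^sub>F n in sequentially. dist (?S n \<omega>) (I t \<omega>) < \<epsilon>" using \<epsilon> by (rule tendstoD)
        then have "\<forall>\<^sub>F n in sequentially. indicator (?A n) \<omega> = (0::real)" by eventually_elim simp
        then show ?case by (rule tendsto_eventually)
      qed
      show "indicator (?A n) \<in> borel_measurable (completion M)" for n using A by simp
    qed (auto split: split_indicator)
    moreover have "(LINT \<omega>|completion M. indicator (?A n) \<omega> :: real) = measure (completion M) (?A n)" for n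
      by (simp only: Bochner_Integration.integral_indicator sets.Int_space_eq2[OF A])
    ultimately show "(\<lambda>n. measure (completion M) {\<omega> \<in> space M. \<epsilon> < dist (?S n \<omega>) (I t \<omega>)}) \<longlonglongrightarrow> 0"
      by simp
  qed
  define Z where "Z = (\<lambda>\<omega>. lim (\<lambda>n. I (real n) \<omega>))"
  have [measurable]: "I (real n) \<in> borel_measurable M" for n by (rule I_meas) simp
  have Z: "Z \<in> borel_measurable M" unfolding Z_def by measurable
  have "AE \<omega> in M. ((\<lambda>t. I t \<omega>) \<longlongrightarrow> Z \<omega>) at_top"
    using AG
  proof eventually_elim
    case (elim \<omega>)
    then obtain B C where J: "jump_path (\<lambda>t. N t \<omega>) (\<lambda>t. Y t \<omega>) \<delta> B C" using G by blast
    obtain l where l: "((\<lambda>t. I t \<omega>) \<longlongrightarrow> l) at_top" using jump_path.J_tendsto[OF J] elim by (auto simp: I_def)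
    have "(\<lambda>n. I (real n) \<omega>) \<longlonglongrightarrow> l" by (rule filterlim_compose[OF l filterlim_real_sequentially])
    then have "Z \<omega> = l" unfolding Z_def by (rule limI)
    then show ?case using l by simp
  qed
  then have "has_improper_integral M H Y Z"
    unfolding has_improper_integral_def has_stochastic_integral_def using Z I_meas cad prob_lim by blast
  then show ?thesis by blast
qed

end

section \<open>Semi-selfdecomposability and selfdecomposability\<close>

lemma char_fun_scaleR:
  fixes \<mu> :: "'a::euclidean_space measure"
  assumes d: "distribution \<mu>"
  shows "distribution (distr \<mu> borel (\<lambda>x. b *\<^sub>R x))" "char_fun (distr \<mu> borel (\<lambda>x. b *\<^sub>R x)) z = char_fun \<mu> (b *\<^sub>R z)"
proof -
  have [measurable_cong]: "sets \<mu> = sets borel" using d by (simp add: distribution_def)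
  show "distribution (distr \<mu> borel (\<lambda>x. b *\<^sub>R x))"
    using d by (intro distribution_distr) (auto simp: distribution_def)
  show "char_fun (distr \<mu> borel (\<lambda>x. b *\<^sub>R x)) z = char_fun \<mu> (b *\<^sub>R z)"
    by (subst char_fun_distr) (auto simp: char_fun_def)
qed

lemma infinitely_divisible_convolution:
  assumes "infinitely_divisible \<mu>" "infinitely_divisible \<nu>"
  shows "infinitely_divisible (\<mu> \<star> \<nu>)"
proof (rule infinitely_divisibleI)
  have d: "distribution \<mu>" "distribution \<nu>" using assms by (auto simp: infinitely_divisible_def)
  then show "distribution (\<mu> \<star> \<nu>)" by (rule distribution_convolution)
  fix n :: nat assume n: "n \<ge> 1"
  obtain \<mu>' \<nu>' where "distribution \<mu>'" "\<And>z. char_fun \<mu> z = char_fun \<mu>' z ^ n" "distribution \<nu>'" "\<And>z. char_fun \<nu> z = char_fun \<nu>' z ^ n"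
    using infinitely_divisibleD[OF assms(1) n] infinitely_divisibleD[OF assms(2) n] by blast
  then show "\<exists>\<kappa>. distribution \<kappa> \<and> (\<forall>z. char_fun (\<mu> \<star> \<nu>) z = char_fun \<kappa> z ^ n)"
    using d by (intro exI[of _ "\<mu>' \<star> \<nu>'"]) (simp add: distribution_convolution char_fun_convolution power_mult_distrib)
qed

text \<open>Each factor \<open>b\<close> of \<rho> produces one of \<mu>: the cofactor \<sigma>
  inherits the logarithmic moment from \<rho>, so the product of its dilations converges, and
  dilation by \<open>b\<close> commutes with the dilations in the product.\<close>

lemma selfdecomposable_scaling_product:
  fixes \<mu> \<rho> :: "'a::euclidean_space measure"
  assumes d: "distribution \<mu>" "distribution \<rho>" and lm: "log_moment \<rho>" and b\<^sub>0: "0 < b\<^sub>0" "b\<^sub>0 < 1"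
    and eq: "\<And>z. char_fun \<mu> z = char_fun \<mu> (b\<^sub>0 *\<^sub>R z) * char_fun \<rho> z"
    and fac: "\<And>b. 0 < b \<Longrightarrow> b < 1 \<Longrightarrow> \<exists>\<sigma>. distribution \<sigma> \<and> (\<forall>z. char_fun \<rho> z = char_fun \<rho> (b *\<^sub>R z) * char_fun \<sigma> z)"
  shows "selfdecomposable \<mu>"
  unfolding selfdecomposable_def
proof (intro conjI ballI d)
  fix b :: real assume "b \<in> {0<..<1}"
  then have b: "0 < b" "b < 1" by auto
  obtain \<sigma> where \<sigma>: "distribution \<sigma>" "\<And>z. char_fun \<rho> z = char_fun \<rho> (b *\<^sub>R z) * char_fun \<sigma> z" using fac[OF b] by blast
  have "log_moment \<sigma>"
  proof (rule log_moment_convolution_factor[OF char_fun_scaleR(1)[OF d(2), of b] \<sigma>(1) d(2) lm])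
    show "char_fun \<rho> z = char_fun (distr \<rho> borel (\<lambda>x. b *\<^sub>R x)) z * char_fun \<sigma> z" for z
      unfolding char_fun_scaleR(2)[OF d(2)] by (rule \<sigma>(2))
  qed
  from log_moment_series[OF \<sigma>(1) this b\<^sub>0] obtain \<kappa> where
    \<kappa>: "distribution \<kappa>" "\<And>z. (\<lambda>J. \<Prod>j<J. char_fun \<sigma> (b\<^sub>0 ^ j *\<^sub>R z)) \<longlonglongrightarrow> char_fun \<kappa> z" by blast
  have "char_fun \<mu> z = char_fun \<mu> (b *\<^sub>R z) * char_fun \<kappa> z" for z
  proof (rule LIMSEQ_unique[OF char_fun_scaling_product[OF d(1) b\<^sub>0 eq]])
    have "(\<lambda>J. (\<Prod>j<J. char_fun \<rho> (b\<^sub>0 ^ j *\<^sub>R (b *\<^sub>R z))) * (\<Prod>j<J. char_fun \<sigma> (b\<^sub>0 ^ j *\<^sub>R z))) \<longlonglongrightarrow> char_fun \<mu> (b *\<^sub>R z) * char_fun \<kappa> z"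
      by (intro tendsto_mult char_fun_scaling_product[OF d(1) b\<^sub>0 eq] \<kappa>)
    moreover have "char_fun \<rho> (b\<^sub>0 ^ j *\<^sub>R z) = char_fun \<rho> (b\<^sub>0 ^ j *\<^sub>R (b *\<^sub>R z)) * char_fun \<sigma> (b\<^sub>0 ^ j *\<^sub>R z)" for j
      unfolding scaleR_left_commute[of "b\<^sub>0 ^ j" b z] by (rule \<sigma>(2))
    ultimately show "(\<lambda>J. \<Prod>j<J. char_fun \<rho> (b\<^sub>0 ^ j *\<^sub>R z)) \<longlonglongrightarrow> char_fun \<mu> (b *\<^sub>R z) * char_fun \<kappa> z"
      by (simp only: prod.distrib)
  qed
  then show "\<exists>\<kappa>. distribution \<kappa> \<and> decomposition_factor b \<mu> \<kappa>"
    using \<kappa>(1) unfolding decomposition_factor_def by blast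
qed

text \<open>\<open>1 / (1 - \<i> * (v \<bullet> z))\<close> belongs to an exponential time
  multiplied by the vector \<open>v\<close>, and the geometric compound identity applies as on the
  line. Infinite divisibility of \<sigma> is recorded with a view to the class
  \<open>L1\<close>.\<close>

lemma exponential_ray:
  fixes v :: "'a::ordered_euclidean_space"
  assumes b: "0 < b" "b < 1"
  shows "\<exists>\<sigma>. infinitely_divisible \<sigma> \<and> (\<forall>z. 1 / (1 - \<i> * (v \<bullet> z)) = 1 / (1 - \<i> * (v \<bullet> (b *\<^sub>R z))) * char_fun \<sigma> z)"
proof -
  define \<rho> where "\<rho> = distr exp_law borel (\<lambda>t. (b * t) *\<^sub>R v)"
  have \<rho>: "distribution \<rho>" unfolding \<rho>_def by (rule distribution_distr) (auto intro: prob_space_exp_law)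
  have c\<rho>: "char_fun \<rho> z = 1 / (1 - of_real b * (\<i> * (v \<bullet> z)))" for z
    unfolding \<rho>_def using char_fun_exp_law[of "b * (v \<bullet> z)"]
    by (subst char_fun_distr) (auto simp: char_fun_def mult_ac inner_commute)
  obtain \<sigma> where \<sigma>: "infinitely_divisible \<sigma>" "\<And>z. char_fun \<sigma> z = complex_of_real b / (1 - complex_of_real (1 - b) * char_fun \<rho> z)"
    using geometric_compound_infinitely_divisible[OF \<rho> b] by blast
  have "1 / (1 - \<i> * (v \<bullet> z)) = 1 / (1 - \<i> * (v \<bullet> (b *\<^sub>R z))) * char_fun \<sigma> z" for z
  proof -
    have re: "Re (\<i> * complex_of_real (v \<bullet> z)) \<le> 0" by simp
    have "char_fun \<sigma> z = of_real b + of_real (1 - b) * (1 / (1 - \<i> * (v \<bullet> z)))"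
      unfolding \<sigma>(2) c\<rho> by (rule compound_exponential_identity(2)[OF re b])
    moreover have "\<i> * complex_of_real (v \<bullet> (b *\<^sub>R z)) = of_real b * (\<i> * (v \<bullet> z))" by simp
    ultimately show ?thesis
      using compound_exponential_identity(1)[OF re b] by (simp only:)
  qed
  then show ?thesis using \<sigma>(1) by blast
qed

text \<open>A single time determines the exponent only up to multiples of
  \<open>2 * pi * \<i>\<close>. For \<open>t\<close> so small that \<open>t * Im (u - v)\<close> is
  below 1, only the multiple zero remains.\<close>

lemma exp_scaled_eq_imp_eq:
  fixes u v :: complex
  assumes "\<And>t::real. t > 0 \<Longrightarrow> exp (of_real t * u) = exp (of_real t * v)"
  shows "u = v"
proof -
  have e: "exp (of_real t * (u - v)) = 1" if "t > 0" for t :: real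
    using assms[OF that] by (simp add: algebra_simps exp_diff)
  have "Re (u - v) = 0" using e[of 1] by (simp add: exp_eq_1)
  moreover have "Im (u - v) = 0"
  proof -
    define t where "t = 1 / (\<bar>Im (u - v)\<bar> + 1)"
    have t: "t > 0" by (simp add: t_def add_nonneg_pos)
    from e[OF t] obtain n :: int where n: "t * Im (u - v) = of_int (2 * n) * pi" by (auto simp: exp_eq_1)
    have "\<bar>t * Im (u - v)\<bar> < 1" by (simp add: t_def abs_mult field_simps add_nonneg_pos)
    then have "\<bar>of_int (2 * n) * pi\<bar> < 1" using n by simp
    then have "n = 0"
    proof (rule contrapos_pp)
      assume "n \<noteq> 0"
      then have "2 \<le> \<bar>real_of_int (2 * n)\<bar>" by simp
      then have "2 * 1 \<le> \<bar>real_of_int (2 * n)\<bar> * \<bar>pi\<bar>" using pi_ge_two by (intro mult_mono) auto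
      then show "\<not> \<bar>of_int (2 * n) * pi\<bar> < 1" by (simp add: abs_mult)
    qed
    then show ?thesis using n t by simp
  qed
  ultimately show ?thesis by (simp add: complex_eq_iff)
qed

lemma stable_marginal:
  fixes X :: "real \<Rightarrow> 'w \<Rightarrow> 'a::euclidean_space"
  assumes st: "strictly_stable_process M \<alpha> X" and a: "a > 0" and t: "t \<ge> 0"
  shows "distr M borel (X (a * t)) = distr M borel (\<lambda>\<omega>. a powr (1 / \<alpha>) *\<^sub>R X t \<omega>)"
proof -
  have X [measurable]: "X s \<in> borel_measurable M" if "s \<ge> 0" for s
    using st that by (simp add: strictly_stable_process_def levy_process_def)
  have eq: "process_law M (\<lambda>t. X (a * t)) = process_law M (\<lambda>t \<omega>. a powr (1 / \<alpha>) *\<^sub>R X t \<omega>)"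
    using st a by (simp add: strictly_stable_process_def)
  have marg: "distr (process_law M W) borel (\<lambda>f. f t) = distr M borel (W t)" if W: "\<And>s. s \<ge> 0 \<Longrightarrow> W s \<in> borel_measurable M" for W :: "real \<Rightarrow> 'w \<Rightarrow> 'a"
  proof -
    have 1: "(\<lambda>\<omega>. \<lambda>s\<in>{0..}. W s \<omega>) \<in> M \<rightarrow>\<^sub>M PiM {0..} (\<lambda>_. borel)" by (rule measurable_restrict) (use W in auto)
    have 2: "(\<lambda>f. f t) \<in> PiM {0..} (\<lambda>_. borel :: 'a measure) \<rightarrow>\<^sub>M borel" by (rule measurable_component_singleton) (use t in auto)
    show ?thesis unfolding process_law_def using t by (subst distr_distr[OF 2 1]) (simp add: comp_def)
  qed
  have "distr M borel (X (a * t)) = distr (process_law M (\<lambda>t. X (a * t))) borel (\<lambda>f. f t)"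
    by (rule marg[symmetric]) (use a in auto)
  also have "\<dots> = distr M borel (\<lambda>\<omega>. a powr (1 / \<alpha>) *\<^sub>R X t \<omega>)"
    unfolding eq by (rule marg) auto
  finally show ?thesis .
qed

context levy_lk
begin

text \<open>With \<open>s = \<psi> z / c\<close>, the dilated law has the characteristic function
  \<open>1 / (1 - q * s)\<close>, so the geometric compound identity applies with \<open>q\<close>
  in place of \<open>b\<close>. The cofactor is 0 with probability \<open>q\<close> and a copy of
  the undilated law otherwise. For a stable process \<open>q = b powr \<alpha>\<close>.\<close>

lemma exp_time_law_scaling:
  assumes c: "c > 0" and b: "0 < b" "b < 1" and \<beta>: "0 < q" "q < 1" and sc: "\<And>z. \<psi> (b *\<^sub>R z) = of_real q * \<psi> z"
  shows "\<exists>\<sigma>. infinitely_divisible \<sigma> \<and> (\<forall>z. char_fun (exp_time_law c) z = char_fun (exp_time_law c) (b *\<^sub>R z) * char_fun \<sigma> z)"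
proof -
  let ?\<rho> = "exp_time_law c"
  have d: "distribution ?\<rho>" by (rule distribution_exp_time_law)
  define \<rho>' where "\<rho>' = distr ?\<rho> borel (\<lambda>x. b *\<^sub>R x)"
  have \<rho>': "distribution \<rho>'" "char_fun \<rho>' z = 1 / (1 - of_real q * (\<psi> z / of_real c))" for z
    unfolding \<rho>'_def using char_fun_scaleR[OF d] by (simp_all add: char_fun_exp_time_law[OF c] sc)
  obtain \<sigma> where \<sigma>: "infinitely_divisible \<sigma>" "\<And>z. char_fun \<sigma> z = complex_of_real q / (1 - complex_of_real (1 - q) * char_fun \<rho>' z)"
    using geometric_compound_infinitely_divisible[OF \<rho>'(1) \<beta>] by blast
  have "char_fun ?\<rho> z = char_fun ?\<rho> (b *\<^sub>R z) * char_fun \<sigma> z" for z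
  proof -
    have re: "Re (\<psi> z / of_real c) \<le> 0"
      using Re_\<psi>_le_0[of z] c divide_nonpos_pos[of "Re (\<psi> z)" c] by (simp add: Re_divide_of_real)
    have "char_fun \<sigma> z = of_real q + of_real (1 - q) * (1 / (1 - \<psi> z / of_real c))"
      unfolding \<sigma>(2) \<rho>'(2) by (rule compound_exponential_identity(2)[OF re \<beta>])
    moreover have "char_fun ?\<rho> (b *\<^sub>R z) = 1 / (1 - of_real q * (\<psi> z / of_real c))"
      by (simp add: char_fun_exp_time_law[OF c] sc)
    ultimately show ?thesis
      using compound_exponential_identity(1)[OF re \<beta>] by (simp only: char_fun_exp_time_law[OF c])
  qed
  then show ?thesis using \<sigma>(1) by blast
qed

lemma \<psi>_stable:
  assumes st: "strictly_stable_process M \<alpha> Y" and \<alpha>: "\<alpha> > 0" and r: "r > 0"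
  shows "\<psi> (r *\<^sub>R z) = of_real (r powr \<alpha>) * \<psi> z"
proof (rule exp_scaled_eq_imp_eq)
  fix t :: real assume t: "t > 0"
  have a: "r powr \<alpha> > 0" "(r powr \<alpha>) powr (1 / \<alpha>) = r" using r \<alpha> by (simp_all add: powr_powr)
  have [measurable]: "Y t \<in> borel_measurable M" using t by simp
  have "\<phi> (r powr \<alpha> * t) z = char_fun (distr M borel (\<lambda>\<omega>. r *\<^sub>R Y t \<omega>)) z"
    unfolding \<phi>_def using stable_marginal[OF st a(1), of t] a(2) t by simp
  also have "\<dots> = \<phi> t (r *\<^sub>R z)"
    using t by (subst char_fun_distr) (auto simp: \<phi>_expectation)
  finally show "exp (of_real t * \<psi> (r *\<^sub>R z)) = exp (of_real t * (of_real (r powr \<alpha>) * \<psi> z))"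
    using t r by (simp add: \<phi>_eq mult_ac)
qed

lemma \<psi>_brownian:
  assumes i: "UNIV = {i :: 'd}" and bm: "brownian_motion_with_drift M (\<lambda>t \<omega>. Y t \<omega> $ i)"
  obtains \<sigma> g where "\<sigma> > 0" "\<And>z. \<psi> z = \<i> * of_real (g * z $ i) - of_real (\<sigma>\<^sup>2 * (z $ i)\<^sup>2 / 2)"
proof -
  obtain \<sigma> g where \<sigma>: "\<sigma> > 0" and D: "\<And>t. t > 0 \<Longrightarrow> distributed M lborel (\<lambda>\<omega>. Y t \<omega> $ i) (normal_density (g * t) (\<sigma> * sqrt t))"
    using bm unfolding brownian_motion_with_drift_def by blast
  have "\<psi> z = \<i> * of_real (g * z $ i) - of_real (\<sigma>\<^sup>2 * (z $ i)\<^sup>2 / 2)" for z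
  proof (rule exp_scaled_eq_imp_eq)
    fix t :: real assume t: "t > 0"
    have st: "\<sigma> * sqrt t > 0" using \<sigma> t by simp
    have "distributed M lborel (\<lambda>\<omega>. (Y t \<omega> $ i - g * t) / (\<sigma> * sqrt t)) std_normal_density"
      by (rule normal_standard_normal_convert[OF st, THEN iffD1, OF D[OF t]])
    then have std: "distr M lborel (\<lambda>\<omega>. (Y t \<omega> $ i - g * t) / (\<sigma> * sqrt t)) = std_normal_distribution"
      by (simp add: distributed_def)
    have [measurable]: "(\<lambda>\<omega>. Y t \<omega> $ i) \<in> borel_measurable M" using D[OF t] by (simp add: distributed_def)
    have "exp (of_real t * \<psi> z) = (CLINT \<omega>|M. iexp (z \<bullet> Y t \<omega>))" using t by (simp add: \<phi>_eq[symmetric] \<phi>_expectation)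
    also have "\<dots> = (CLINT \<omega>|M. iexp (g * t * z $ i) * iexp ((\<sigma> * sqrt t * z $ i) * ((Y t \<omega> $ i - g * t) / (\<sigma> * sqrt t))))"
    proof (intro Bochner_Integration.integral_cong refl)
      fix \<omega>
      have "(\<sigma> * sqrt t * z $ i) * ((Y t \<omega> $ i - g * t) / (\<sigma> * sqrt t)) = z $ i * (Y t \<omega> $ i - g * t)"
      proof -
        have "(k * x) * (w / k) = x * w" if "k > 0" for k x w :: real using that by simp
        from this[OF st] show ?thesis .
      qed
      then have "z \<bullet> Y t \<omega> = g * t * z $ i + (\<sigma> * sqrt t * z $ i) * ((Y t \<omega> $ i - g * t) / (\<sigma> * sqrt t))"
        by (simp add: inner_vec_def i algebra_simps)
      then show "iexp (z \<bullet> Y t \<omega>) = iexp (g * t * z $ i) * iexp ((\<sigma> * sqrt t * z $ i) * ((Y t \<omega> $ i - g * t) / (\<sigma> * sqrt t)))"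
        by (simp only: of_real_add distrib_left exp_add)
    qed
    also have "\<dots> = iexp (g * t * z $ i) * (CLINT \<omega>|M. iexp ((\<sigma> * sqrt t * z $ i) * ((Y t \<omega> $ i - g * t) / (\<sigma> * sqrt t))))"
      by simp
    also have "(CLINT \<omega>|M. iexp ((\<sigma> * sqrt t * z $ i) * ((Y t \<omega> $ i - g * t) / (\<sigma> * sqrt t)))) = char std_normal_distribution (\<sigma> * sqrt t * z $ i)"
      unfolding std[symmetric] char_def by (subst integral_distr) auto
    also have "\<dots> = exp (of_real (- (\<sigma> * sqrt t * z $ i)\<^sup>2 / 2))"
      unfolding char_std_normal_distribution by (simp add: exp_of_real[symmetric])
    also have "- (\<sigma> * sqrt t * z $ i)\<^sup>2 / 2 = - t * (\<sigma>\<^sup>2 * (z $ i)\<^sup>2 / 2)" using t by (simp add: power_mult_distrib)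
    finally show "exp (of_real t * \<psi> z) = exp (of_real t * (\<i> * of_real (g * z $ i) - of_real (\<sigma>\<^sup>2 * (z $ i)\<^sup>2 / 2)))"
      by (simp only: exp_add[symmetric]) (auto intro!: arg_cong[where f=exp] simp: algebra_simps)
  qed
  then show ?thesis using that \<sigma> by blast
qed

text \<open>The law of a Brownian motion with drift at an independent exponential time is the convolution of two
  exponential laws on opposite half-lines: \<open>1 - \<i> g x / c + \<sigma>\<^sup>2 x\<^sup>2 / (2 c) = (1 - \<i> p x) (1 + \<i> q x)\<close>.\<close>

lemma exp_time_law_brownian:
  assumes c: "c > 0" and i: "UNIV = {i :: 'd}" and bm: "brownian_motion_with_drift M (\<lambda>t \<omega>. Y t \<omega> $ i)"
    and b: "0 < b" "b < 1"
  shows "\<exists>\<sigma>. infinitely_divisible \<sigma> \<and> (\<forall>z. char_fun (exp_time_law c) z = char_fun (exp_time_law c) (b *\<^sub>R z) * char_fun \<sigma> z)"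
proof -
  obtain \<sigma> g where \<sigma>: "\<sigma> > 0" and \<psi>: "\<And>z. \<psi> z = \<i> * of_real (g * z $ i) - of_real (\<sigma>\<^sup>2 * (z $ i)\<^sup>2 / 2)"
    using \<psi>_brownian[OF i bm] by blast
  \<comment> \<open>\<open>s\<close> is to be \<open>p + q\<close>, computed from the required
    values of \<open>p - q\<close> and \<open>p * q\<close> by
    \<open>(p + q)^2 = (p - q)^2 + 4 * p * q\<close>.\<close>
  define s where "s = sqrt ((g / c)\<^sup>2 + 2 * \<sigma>\<^sup>2 / c)"
  define p where "p = (s + g / c) / 2"
  define q where "q = (s - g / c) / 2"
  have "s * s = (g / c)\<^sup>2 + 2 * \<sigma>\<^sup>2 / c" unfolding s_def using c by simp
  moreover have "p * q = (s * s - (g / c)\<^sup>2) / 4"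
    unfolding p_def q_def by (simp add: power2_eq_square algebra_simps diff_divide_distrib add_divide_distrib)
  ultimately have pq: "p * q = \<sigma>\<^sup>2 / (2 * c)" "p - q = g / c"
    by (simp_all add: p_def q_def field_simps)
  have \<rho>: "char_fun (exp_time_law c) z = 1 / (1 - \<i> * ((p *\<^sub>R axis i 1) \<bullet> z)) * (1 / (1 - \<i> * ((- q *\<^sub>R axis i 1) \<bullet> z)))" for z
  proof -
    have in1: "(p *\<^sub>R axis i 1) \<bullet> z = p * z $ i" "(- q *\<^sub>R axis i 1) \<bullet> z = - (q * z $ i)" by (simp_all add: inner_axis')
    have "(1 - \<i> * of_real (p * z $ i)) * (1 - \<i> * of_real (- (q * z $ i))) = 1 - \<i> * of_real ((p - q) * z $ i) + of_real (p * q * (z $ i)\<^sup>2)"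
      by (simp add: algebra_simps power2_eq_square)
    also have "\<dots> = 1 - \<psi> z / of_real c"
      unfolding pq \<psi> using c by (simp add: field_simps)
    finally have "1 - \<psi> z / of_real c = (1 - \<i> * of_real (p * z $ i)) * (1 - \<i> * of_real (- (q * z $ i)))" ..
    then show ?thesis unfolding char_fun_exp_time_law[OF c] in1 by simp
  qed
  obtain \<sigma>1 where 1: "infinitely_divisible \<sigma>1" "\<And>z :: real^'d. 1 / (1 - \<i> * ((p *\<^sub>R axis i 1) \<bullet> z)) = 1 / (1 - \<i> * ((p *\<^sub>R axis i 1) \<bullet> (b *\<^sub>R z))) * char_fun \<sigma>1 z"
    using exponential_ray[OF b, of "p *\<^sub>R axis i 1 :: real^'d"] by blast
  obtain \<sigma>2 where 2: "infinitely_divisible \<sigma>2" "\<And>z :: real^'d. 1 / (1 - \<i> * ((- q *\<^sub>R axis i 1) \<bullet> z)) = 1 / (1 - \<i> * ((- q *\<^sub>R axis i 1) \<bullet> (b *\<^sub>R z))) * char_fun \<sigma>2 z"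
    using exponential_ray[OF b, of "- q *\<^sub>R axis i 1 :: real^'d"] by blast
  have d: "distribution \<sigma>1" "distribution \<sigma>2" using 1 2 by (auto simp: infinitely_divisible_def)
  have "char_fun (exp_time_law c) z = char_fun (exp_time_law c) (b *\<^sub>R z) * char_fun (\<sigma>1 \<star> \<sigma>2) z" for z
    unfolding char_fun_convolution[OF d] \<rho>[of "b *\<^sub>R z"]
    by (subst \<rho>, subst 1(2), subst 2(2)) (simp only: mult_ac)
  then show ?thesis using infinitely_divisible_convolution[OF 1(1) 2(1)] by blast
qed

end

context pois_levy
begin

lemma char_fun_integral_factor:
  assumes Z: "has_improper_integral M H Y Z"
  shows "distribution (distr M borel Z)"
    and "char_fun (distr M borel Z) z = char_fun (distr M borel Z) (exp (- 1) *\<^sub>R z) * char_fun (exp_time_law c) z"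
proof -
  obtain I where I: "has_stochastic_integral M H Y I" "AE \<omega> in M. ((\<lambda>t. I t \<omega>) \<longlongrightarrow> Z \<omega>) at_top" and Zm: "Z \<in> borel_measurable M"
    using Z unfolding has_improper_integral_def by blast
  show "distribution (distr M borel Z)" by (rule distribution_distr[OF prob_space_axioms Zm])
  have "Re (of_real c - \<psi> z) > 0" using Re_\<psi>_le_0[of z] c by simp
  then have nz: "of_real c - \<psi> z \<noteq> 0" by fastforce
  have "1 - \<psi> z / of_real c = (of_real c - \<psi> z) / of_real c" using c by (simp add: field_simps)
  then show "char_fun (distr M borel Z) z = char_fun (distr M borel Z) (exp (- 1) *\<^sub>R z) * char_fun (exp_time_law c) z"
    using functional_equation[OF I(1) Zm I(2), of z] nz c unfolding char_fun_exp_time_law[OF c] by (simp add: field_simps)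
qed

lemma semi_selfdecomposable_integral:
  assumes Z: "has_improper_integral M H Y Z"
  shows "infinitely_divisible (distr M borel Z) \<and> semi_selfdecomposable (exp (- 1)) (distr M borel Z)"
proof
  have b: "0 < exp (- 1 :: real)" "exp (- 1 :: real) < 1" by auto
  note f = char_fun_integral_factor[OF Z]
  show "infinitely_divisible (distr M borel Z)"
    by (rule infinitely_divisible_scaling_product[OF f(1) b infinitely_divisible_exp_time_law[OF c] log_moment_exp_time_law[OF c] f(2)])
  show "semi_selfdecomposable (exp (- 1)) (distr M borel Z)"
    unfolding semi_selfdecomposable_def decomposition_factor_def
    using b f infinitely_divisible_exp_time_law[OF c] by blast
qed

text \<open>One hypothesis serves both claims: the cofactors for all \<open>b\<close> give
  selfdecomposability, and the infinitely divisible one for \<open>b = exp (- 1)\<close> puts the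
  factor of the integral itself into the class \<open>L0\<close>.\<close>

lemma selfdecomposable_integral_aux:
  assumes Z: "has_improper_integral M H Y Z"
    and fac: "\<And>b. 0 < b \<Longrightarrow> b < 1 \<Longrightarrow> \<exists>\<sigma>. infinitely_divisible \<sigma> \<and> (\<forall>z. char_fun (exp_time_law c) z = char_fun (exp_time_law c) (b *\<^sub>R z) * char_fun \<sigma> z)"
  shows "selfdecomposable (distr M borel Z) \<and> class_L1 (exp (- 1)) (distr M borel Z)"
proof
  have b: "0 < exp (- 1 :: real)" "exp (- 1 :: real) < 1" by auto
  note f = char_fun_integral_factor[OF Z]
  show "selfdecomposable (distr M borel Z)"
    by (rule selfdecomposable_scaling_product[OF f(1) distribution_exp_time_law log_moment_exp_time_law[OF c] b f(2)])
       (use fac infinitely_divisible_def in blast)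
  have "semi_selfdecomposable (exp (- 1)) (exp_time_law c)"
    unfolding semi_selfdecomposable_def decomposition_factor_def
    using b fac[OF b] distribution_exp_time_law by blast
  then show "class_L1 (exp (- 1)) (distr M borel Z)"
    unfolding class_L1_def decomposition_factor_def
    using b f infinitely_divisible_exp_time_law[OF c] by blast
qed

lemma selfdecomposable_integral:
  assumes Z: "has_improper_integral M H Y Z"
    and Y: "(\<exists>\<alpha>. 0 < \<alpha> \<and> \<alpha> \<le> 2 \<and> strictly_stable_process M \<alpha> Y) \<or>
       (CARD('d) = 1 \<and> (\<forall>i. brownian_motion_with_drift M (\<lambda>t \<omega>. Y t \<omega> $ i)))"
  shows "selfdecomposable (distr M borel Z) \<and> class_L1 (exp (- 1)) (distr M borel Z)"
  using Y
proof
  assume "\<exists>\<alpha>. 0 < \<alpha> \<and> \<alpha> \<le> 2 \<and> strictly_stable_process M \<alpha> Y"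
  then obtain \<alpha> where \<alpha>: "0 < \<alpha>" "strictly_stable_process M \<alpha> Y" by blast
  show ?thesis
  proof (rule selfdecomposable_integral_aux[OF Z])
    fix b :: real assume b: "0 < b" "b < 1"
    show "\<exists>\<sigma>. infinitely_divisible \<sigma> \<and> (\<forall>z. char_fun (exp_time_law c) z = char_fun (exp_time_law c) (b *\<^sub>R z) * char_fun \<sigma> z)"
    proof (rule exp_time_law_scaling[OF c b])
      show "0 < b powr \<alpha>" "b powr \<alpha> < 1" using b \<alpha> powr_less_mono2[of \<alpha> b 1] by auto
      show "\<psi> (b *\<^sub>R z) = of_real (b powr \<alpha>) * \<psi> z" for z by (rule \<psi>_stable[OF \<alpha>(2,1) b(1)])
    qed
  qed
next
  assume bm: "CARD('d) = 1 \<and> (\<forall>i. brownian_motion_with_drift M (\<lambda>t \<omega>. Y t \<omega> $ i))"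
  then have "CARD('d) = 1" by (rule conjunct1)
  then obtain i :: 'd where i: "UNIV = {i}" by (rule card_1_singletonE)
  show ?thesis
    by (rule selfdecomposable_integral_aux[OF Z exp_time_law_brownian[OF c i]]) (use bm in auto)
qed

end

section \<open>Integer-valued processes\<close>

locale int_levy = levy_log M Y A \<nu> \<gamma>
  for M :: "'w measure" and Y :: "real \<Rightarrow> 'w \<Rightarrow> real^'d" and A \<nu> \<gamma> +
  fixes i :: 'd
  assumes UNIV_i: "UNIV = {i}" and int_valued: "integer_valued_process M Y" and nonzero: "\<not> zero_process M Y"
begin

lemma norm_eq: "norm (y :: real^'d) = \<bar>y $ i\<bar>"
  by (simp add: norm_vec_def L2_set_def UNIV_i)

lemma vec_eq: "(y :: real^'d) = z \<longleftrightarrow> y $ i = z $ i"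
proof -
  have "j = i" for j :: 'd using UNIV_i by auto
  then show ?thesis by (metis vec_eq_iff)
qed

lemma AE_Ints: "AE \<omega> in M. \<forall>t\<ge>0. Y t \<omega> $ i \<in> \<int>"
  using int_valued unfolding integer_valued_process_def by eventually_elim blast

lemma norm_ge_1: "y \<noteq> (0 :: real^'d) \<Longrightarrow> y $ i \<in> \<int> \<Longrightarrow> norm y \<ge> 1"
  unfolding norm_eq vec_eq by (rule Ints_nonzero_abs_ge1) auto

text \<open>Allows the frequency to be doubled at the price of a factor 4: for a nonzero integer
  \<open>y\<close> the number \<open>2 * y\<close> has modulus at least 2, where the averaged
  \<open>1 - cos\<close> is bounded below.\<close>

lemma one_minus_cos_double_le: "1 - cos (2 * x) \<le> 4 * (1 - cos (x::real))"
proof -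
  have "4 * (1 - cos x) - (1 - cos (2 * x)) = 2 * (1 - cos x)\<^sup>2"
    using cos_double_cos[of x] by (simp add: power2_eq_square algebra_simps)
  then show ?thesis using zero_le_power2[of "1 - cos x"] by linarith
qed

text \<open>Nonzero integer values stay away from 0, so the tail argument works at the fixed scale
  \<open>u = 1\<close>; the constant 8 is the 2 of the tail bound times the 4 for doubling the
  frequency.\<close>

lemma prob_Y_nonzero_le:
  assumes t: "t \<ge> 0"
  shows "emeasure M {\<omega> \<in> space M. Y t \<omega> \<noteq> 0} \<le> ennreal (8 * t * \<beta> 1)"
proof -
  have [measurable]: "Y t \<in> borel_measurable M" using t by simp
  let ?e = "axis i 1 :: real^'d"
  let ?B = "{\<omega> \<in> space M. Y t \<omega> \<noteq> 0}"
  have e: "norm ?e = 1" by simp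
  have b: "0 \<le> t * \<beta> 1" using t \<beta>_nonneg by simp
  let ?I = "\<lambda>\<omega>. \<integral>\<^sup>+v. ennreal (1 - cos (1 * (?e \<bullet> Y t \<omega>) * v)) * indicator {0..1} v \<partial>lborel"
  have "ennreal (1/2) * emeasure M ?B = (\<integral>\<^sup>+\<omega>. ennreal (1/2) * indicator ?B \<omega> \<partial>M)"
    by (simp add: nn_integral_cmult_indicator)
  also have "\<dots> \<le> (\<integral>\<^sup>+\<omega>. 4 * ?I \<omega> \<partial>M)"
    using AE_Ints
  proof (intro nn_integral_mono_AE, eventually_elim)
    case (elim \<omega>)
    show ?case
    proof (cases "\<omega> \<in> ?B")
      case True
      then have "2 \<le> \<bar>2 * (?e \<bullet> Y t \<omega>)\<bar>" using norm_ge_1[of "Y t \<omega>"] elim t by (simp add: inner_axis' norm_eq)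
      from nn_integral_1_minus_cos_ge[OF this]
      have "ennreal (1/2) \<le> (\<integral>\<^sup>+v. ennreal (1 - cos (2 * (?e \<bullet> Y t \<omega>) * v)) * indicator {0..1} v \<partial>lborel)" .
      also have "\<dots> \<le> (\<integral>\<^sup>+v. 4 * (ennreal (1 - cos (1 * (?e \<bullet> Y t \<omega>) * v)) * indicator {0..1} v) \<partial>lborel)"
      proof (intro nn_integral_mono)
        fix v :: real
        have "ennreal (1 - cos (2 * (?e \<bullet> Y t \<omega>) * v)) \<le> ennreal (4 * (1 - cos (1 * (?e \<bullet> Y t \<omega>) * v)))"
          using one_minus_cos_double_le[of "(?e \<bullet> Y t \<omega>) * v"] by (intro ennreal_leI) (simp add: mult.assoc)
        also have "\<dots> = 4 * ennreal (1 - cos (1 * (?e \<bullet> Y t \<omega>) * v))" by (subst ennreal_mult) auto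
        finally show "ennreal (1 - cos (2 * (?e \<bullet> Y t \<omega>) * v)) * indicator {0..1} v
            \<le> 4 * (ennreal (1 - cos (1 * (?e \<bullet> Y t \<omega>) * v)) * indicator {0..1} v)"
          by (auto split: split_indicator)
      qed
      also have "\<dots> = 4 * ?I \<omega>" by (rule nn_integral_cmult) measurable
      finally show ?thesis using True by simp
    qed simp
  qed
  also have "\<dots> = 4 * (\<integral>\<^sup>+\<omega>. ?I \<omega> \<partial>M)" by (rule nn_integral_cmult) measurable
  also have "\<dots> \<le> 4 * ennreal (t * \<beta> 1)"
    by (intro mult_left_mono nn_integral_1_minus_cos_Y_le[OF t _ _ e]) auto
  also have "\<dots> = ennreal (4 * (t * \<beta> 1))" using b by (subst ennreal_mult) auto
  finally have "ennreal (1/2 * measure M ?B) \<le> ennreal (4 * (t * \<beta> 1))"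
    by (subst ennreal_mult) (auto simp: emeasure_eq_measure)
  then show ?thesis using b by (simp add: emeasure_eq_measure ennreal_le_iff)
qed

text \<open>This is where integer values are needed: the small values \<open>exp (- j) * \<bar>Y\<bar>\<close> are summable over \<open>j\<close>
  with sum of order \<open>1 + ln \<bar>Y\<bar>\<close>, and they vanish unless \<open>Y\<close> has jumped.\<close>

lemma suminf_min_moment_le:
  "\<exists>C\<ge>0. \<forall>t\<ge>0. (\<integral>\<^sup>+\<omega>. (\<Sum>j. ennreal (min 1 (exp (- real j) * norm (Y t \<omega>)))) \<partial>M) \<le> ennreal (C * t)"
proof -
  define s where "s = enn2real S\<^sub>0"
  have s: "S\<^sub>0 = ennreal s" "s \<ge> 0" using S\<^sub>0_finite by (auto simp: s_def)
  have b: "0 \<le> \<beta> 1" using \<beta>_nonneg by simp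
  define D where "D = real DIM(real^'d)"
  have D: "D \<ge> 0" by (simp add: D_def)
  define C where "C = 24 * \<beta> 1 + D * (ln 3 * (8 * \<beta> 1) + 2 * s)"
  show ?thesis
  proof (intro exI[of _ C] conjI allI impI)
    show "C \<ge> 0" unfolding C_def using b D s by simp
    fix t :: real assume t: "t \<ge> 0"
    then have [measurable]: "Y t \<in> borel_measurable M" by simp
    let ?B = "{\<omega> \<in> space M. Y t \<omega> \<noteq> 0}"
    note p = prob_Y_nonzero_le[OF t]
    have ln: "(\<integral>\<^sup>+\<omega>. ennreal (ln (1 + norm (Y t \<omega>))) \<partial>M) \<le> ennreal (D * (ln 3 * (8 * \<beta> 1) + 2 * s) * t)"
    proof -
      have "(\<integral>\<^sup>+\<omega>. ennreal (ln 3 * indicator {0<..} \<bar>e \<bullet> Y t \<omega>\<bar>) \<partial>M) \<le> ennreal (ln 3) * ennreal (8 * t * \<beta> 1)" for e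
      proof -
        have "(\<integral>\<^sup>+\<omega>. ennreal (ln 3 * indicator {0<..} \<bar>e \<bullet> Y t \<omega>\<bar>) \<partial>M) \<le> (\<integral>\<^sup>+\<omega>. ennreal (ln 3) * indicator ?B \<omega> \<partial>M)"
          by (intro nn_integral_mono) (auto split: split_indicator)
        also have "\<dots> = ennreal (ln 3) * emeasure M ?B" by (simp add: nn_integral_cmult_indicator)
        finally show ?thesis using mult_left_mono[OF p, of "ennreal (ln 3)"] by (rule order_trans) simp
      qed
      then have "(\<integral>\<^sup>+\<omega>. ennreal (ln (1 + norm (Y t \<omega>))) \<partial>M) \<le> (\<Sum>e\<in>(Basis :: (real^'d) set). ennreal (ln 3) * ennreal (8 * t * \<beta> 1) + ennreal (2 * t) * S\<^sub>0)"
        by (intro order_trans[OF nn_integral_ln_le[OF t]] sum_mono add_right_mono)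
      also have "\<dots> = (\<Sum>e\<in>(Basis :: (real^'d) set). ennreal ((ln 3 * (8 * \<beta> 1) + 2 * s) * t))"
      proof (intro sum.cong refl)
        have "ennreal (ln 3) * ennreal (8 * t * \<beta> 1) + ennreal (2 * t) * S\<^sub>0 = ennreal (ln 3 * (8 * t * \<beta> 1) + 2 * t * s)"
          using t s b by (simp add: ennreal_plus ennreal_mult)
        then show "ennreal (ln 3) * ennreal (8 * t * \<beta> 1) + ennreal (2 * t) * S\<^sub>0 = ennreal ((ln 3 * (8 * \<beta> 1) + 2 * s) * t)"
          by (simp add: algebra_simps)
      qed
      also have "\<dots> = ennreal (D * (ln 3 * (8 * \<beta> 1) + 2 * s) * t)"
        using t s b by (subst sum_ennreal) (auto simp: D_def mult.assoc)
      finally show ?thesis .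
    qed
    have "(\<integral>\<^sup>+\<omega>. (\<Sum>j. ennreal (min 1 (exp (- real j) * norm (Y t \<omega>)))) \<partial>M)
      \<le> (\<integral>\<^sup>+\<omega>. 3 * indicator ?B \<omega> + ennreal (ln (1 + norm (Y t \<omega>))) \<partial>M)"
      using AE_Ints AE_space[of M]
    proof (intro nn_integral_mono_AE, eventually_elim)
      case (elim \<omega>)
      show ?case
      proof (cases "Y t \<omega> = 0")
        case False
        then have n1: "norm (Y t \<omega>) \<ge> 1" using norm_ge_1 elim t by blast
        have "(\<Sum>j. ennreal (min 1 (exp (- real j) * norm (Y t \<omega>)))) = ennreal (\<Sum>j. min 1 (exp (- real j) * norm (Y t \<omega>)))"
          by (intro suminf_ennreal2 suminf_min_exp_le(1) n1) simp
        also have "\<dots> \<le> ennreal (3 + ln (1 + norm (Y t \<omega>)))"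
        proof (intro ennreal_leI order_trans[OF suminf_min_exp_le(2)[OF n1]])
          show "3 + ln (norm (Y t \<omega>)) \<le> 3 + ln (1 + norm (Y t \<omega>))" using n1 False by simp
        qed
        also have "\<dots> = 3 + ennreal (ln (1 + norm (Y t \<omega>)))" by (subst ennreal_plus) auto
        also have "3 = 3 * (indicator ?B \<omega> :: ennreal)" using False elim by (auto simp: indicator_def)
        finally show ?thesis .
      qed simp
    qed
    also have "\<dots> = 3 * emeasure M ?B + (\<integral>\<^sup>+\<omega>. ennreal (ln (1 + norm (Y t \<omega>))) \<partial>M)"
      by (subst nn_integral_add) (auto simp: nn_integral_cmult_indicator)
    also have "\<dots> \<le> 3 * ennreal (8 * t * \<beta> 1) + ennreal (D * (ln 3 * (8 * \<beta> 1) + 2 * s) * t)"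
      by (intro add_mono mult_left_mono p ln) simp
    also have "\<dots> = ennreal (3 * (8 * t * \<beta> 1) + D * (ln 3 * (8 * \<beta> 1) + 2 * s) * t)"
    proof -
      have "3 * ennreal (8 * t * \<beta> 1) = ennreal (3 * (8 * t * \<beta> 1))"
        using t b by (subst (2) ennreal_mult) auto
      then show ?thesis using t b D s by (subst ennreal_plus) auto
    qed
    also have "3 * (8 * t * \<beta> 1) + D * (ln 3 * (8 * \<beta> 1) + 2 * s) * t = C * t"
      by (simp add: C_def algebra_simps)
    finally show "(\<integral>\<^sup>+\<omega>. (\<Sum>j. ennreal (min 1 (exp (- real j) * norm (Y t \<omega>)))) \<partial>M) \<le> ennreal (C * t)" .
  qed
qed

text \<open>Integer values make every characteristic function of the process periodic; since this
  holds at all times \<open>t\<close>, it descends to the exponent.\<close>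

lemma \<psi>_periodic: "\<psi> ((r + 2 * pi * real n) *\<^sub>R axis i 1) = \<psi> (r *\<^sub>R axis i 1)"
proof (rule exp_scaled_eq_imp_eq)
  fix t :: real assume t: "t > 0"
  then have [measurable]: "Y t \<in> borel_measurable M" by simp
  have "(CLINT \<omega>|M. iexp (((r + 2 * pi * real n) *\<^sub>R axis i 1) \<bullet> Y t \<omega>)) = (CLINT \<omega>|M. iexp ((r *\<^sub>R axis i 1) \<bullet> Y t \<omega>))"
  proof (rule integral_cong_AE)
    show "AE \<omega> in M. iexp (((r + 2 * pi * real n) *\<^sub>R axis i 1) \<bullet> Y t \<omega>) = iexp ((r *\<^sub>R axis i 1) \<bullet> Y t \<omega>)"
      using AE_Ints
    proof eventually_elim
      case (elim \<omega>)
      then have "Y t \<omega> $ i \<in> \<int>" using t by simp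
      then obtain m where "Y t \<omega> $ i = of_int m" by (rule Ints_cases)
      then show ?case unfolding exp_eq
        by (intro exI[of _ "int n * m"]) (simp add: inner_axis' algebra_simps)
    qed
  qed measurable
  then show "exp (of_real t * \<psi> ((r + 2 * pi * real n) *\<^sub>R axis i 1)) = exp (of_real t * \<psi> (r *\<^sub>R axis i 1))"
    using t by (simp add: \<phi>_eq[symmetric] \<phi>_expectation del: inner_scaleR_left)
qed

lemma ex_\<psi>_nonzero: "\<exists>z. \<psi> z \<noteq> 0"
proof (rule ccontr)
  assume "\<not> (\<exists>z. \<psi> z \<noteq> 0)"
  then have \<psi>: "\<psi> z = 0" for z by blast
  have "AE \<omega> in M. Y t \<omega> \<in> {0}" if t: "t \<ge> 0" for t
  proof -
    have [measurable]: "Y t \<in> borel_measurable M" using t by simp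
    have "distr M borel (Y t) = return borel 0"
    proof (rule char_fun_eq_imp_eq[OF distribution_X[OF t] distribution_return])
      show "char_fun (distr M borel (Y t)) z = char_fun (return borel 0) z" for z
        using \<phi>_eq[OF t, of z] \<psi> by (simp add: \<phi>_def char_fun_def integral_return)
    qed
    then have "AE y in distr M borel (Y t). y = 0" by (simp only:) (subst AE_return, auto)
    then show ?thesis by (subst (asm) AE_distr_iff) auto
  qed
  from AE_increments_closed[OF _ this] have "AE \<omega> in M. \<forall>s\<ge>0. \<forall>t\<ge>s. Y t \<omega> - Y s \<omega> \<in> {0}" by simp
  then have "zero_process M Y" unfolding zero_process_def using start_0
  proof eventually_elim
    case (elim \<omega>)
    have "Y t \<omega> - Y 0 \<omega> \<in> {0}" if "t \<ge> 0" for t using elim(1) that by blast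
    then show ?case using elim(2) by simp
  qed
  then show False using nonzero by simp
qed

text \<open>For a selfdecomposable \<open>\<mu>\<close> the modulus of the characteristic function decreases along rays.  By periodicity of
  the factor it takes equal values at the ends of the intervals \<open>[2 \<pi> n / e, 2 \<pi> n]\<close>, which overlap.  So it is constant from \<open>2 \<pi> / e\<close>
  on, and hence the factor has modulus 1 everywhere.\<close>

lemma not_selfdecomposable:
  assumes c: "c > 0" and d: "distribution \<mu>" and nz: "\<And>z. char_fun \<mu> z \<noteq> 0"
    and eq: "\<And>z. char_fun \<mu> z = char_fun \<mu> (exp (- 1) *\<^sub>R z) * char_fun (exp_time_law c) z"
  shows "\<not> selfdecomposable \<mu>"
proof
  assume sd: "selfdecomposable \<mu>"
  define F where "F = (\<lambda>r. norm (char_fun \<mu> (r *\<^sub>R axis i 1)))"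
  have Fpos: "F r > 0" for r using nz by (simp add: F_def)
  have anti: "F r \<le> F s" if "0 < s" "s \<le> r" for r s
  proof (cases "s = r")
    case False
    then have b: "s / r \<in> {0<..<1}" using that by auto
    then obtain \<rho> where \<rho>: "distribution \<rho>" "decomposition_factor (s / r) \<mu> \<rho>"
      using sd unfolding selfdecomposable_def by blast
    have "F r = norm (char_fun \<mu> ((s / r) *\<^sub>R r *\<^sub>R axis i 1)) * norm (char_fun \<rho> (r *\<^sub>R axis i 1))"
      unfolding F_def norm_mult[symmetric]
      by (rule arg_cong[of _ _ norm], rule \<rho>(2)[unfolded decomposition_factor_def, rule_format])
    also have "(s / r) *\<^sub>R r *\<^sub>R (axis i 1 :: real^'d) = s *\<^sub>R axis i 1" using that by simp
    also have "norm (char_fun \<mu> (s *\<^sub>R axis i 1)) * norm (char_fun \<rho> (r *\<^sub>R axis i 1)) \<le> F s * 1"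
      unfolding F_def by (intro mult_left_mono norm_char_fun_le_1 \<rho>) auto
    finally show ?thesis by simp
  qed simp
  have step: "F r = F (exp (- 1) * r) * norm (1 / (1 - \<psi> (r *\<^sub>R axis i 1) / of_real c))" for r
    using arg_cong[OF eq[of "r *\<^sub>R axis i 1"], of norm] c by (simp add: F_def norm_mult norm_divide char_fun_exp_time_law)
  have e: "exp (- 1 :: real) \<le> 1 / 2"
    using exp_ge_add_one_self[of 1] by (simp add: exp_minus field_simps)
  have e0: "exp (- 1 :: real) > 0" by simp
  have ends: "F (2 * pi * real n) = F (exp (- 1) * (2 * pi * real n))" for n
    using step[of "2 * pi * real n"] \<psi>_periodic[of 0 n] by simp
  have peaks: "F (2 * pi * real (Suc n)) = F (2 * pi)" for n
  proof (induction n)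
    case (Suc n)
    \<comment> \<open>The overlap of neighbouring intervals: \<open>(n + 2) / e\<close> is at most
      \<open>(n + 2) / 2\<close> and hence at most \<open>n + 1\<close>.\<close>
    have "exp (- 1) * (2 * pi * real (Suc (Suc n))) \<le> 1 / 2 * (2 * pi * real (Suc (Suc n)))"
      using e by (intro mult_right_mono) auto
    also have "\<dots> \<le> 2 * pi * real (Suc n)" by (simp add: field_simps)
    finally have "F (2 * pi * real (Suc n)) \<le> F (exp (- 1) * (2 * pi * real (Suc (Suc n))))"
      using e0 by (intro anti) auto
    moreover have "F (2 * pi * real (Suc (Suc n))) \<le> F (2 * pi * real (Suc n))"
      by (intro anti) auto
    ultimately show ?case using Suc ends[of "Suc (Suc n)"] by linarith
  qed simp
  have const: "F r = F (2 * pi)" if r: "r \<ge> exp (- 1) * (2 * pi)" for r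
  proof (rule antisym)
    show "F r \<le> F (2 * pi)" using anti[OF _ r] ends[of 1] e0 by simp
    have r0: "0 < r" using r e0 less_le_trans[of 0 "exp (- 1) * (2 * pi)" r] by simp
    obtain n where n: "r / (2 * pi) \<le> real n" using real_arch_simple by blast
    then have "r \<le> 2 * pi * real (Suc n)" by (simp add: field_simps) (use pi_gt_zero in linarith)
    then show "F (2 * pi) \<le> F r" using anti[OF r0, of "2 * pi * real (Suc n)"] peaks[of n] by (simp only:)
  qed
  have \<psi>_large: "\<psi> (r *\<^sub>R axis i 1) = 0" if r: "r \<ge> 2 * pi" for r
  proof -
    define w where "w = \<psi> (r *\<^sub>R axis i 1) / of_real c"
    have "exp (- 1) * (2 * pi) \<le> exp (- 1) * r" using r by (intro mult_left_mono) auto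
    moreover have "exp (- 1) * (2 * pi) \<le> r"
      using mult_right_mono[OF e, of "2 * pi"] r pi_gt_zero by linarith
    ultimately have "F r = F (exp (- 1) * r)" using const by metis
    then have "norm (1 / (1 - w)) = 1" using step[of r] Fpos[of "exp (- 1) * r"] by (simp add: w_def)
    then have "norm (1 - w) = 1" by (simp add: norm_divide)
    \<comment> \<open>The unit circle around 1 meets the half-plane of nonpositive real part only in
      0.\<close>
    then have "(1 - Re w)\<^sup>2 + (Im w)\<^sup>2 = 1" using cmod_power2[of "1 - w"] by simp
    moreover have re: "Re w \<le> 0"
      using Re_\<psi>_le_0[of "r *\<^sub>R axis i 1"] c by (simp add: w_def Re_divide_of_real divide_nonpos_pos)
    ultimately have "(Re w)\<^sup>2 + (Im w)\<^sup>2 \<le> 0" by (simp add: power2_eq_square algebra_simps)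
    then have "w = 0" by (metis cmod_power2 norm_eq_zero power2_less_eq_zero_iff)
    then show ?thesis using c by (simp add: w_def)
  qed
  have "\<psi> z = 0" for z
  proof -
    \<comment> \<open>Periodicity moves an arbitrary argument beyond \<open>2 * pi\<close>.\<close>
    obtain n where n: "(2 * pi - z $ i) / (2 * pi) \<le> real n" using real_arch_simple by blast
    then have "2 * pi - z $ i \<le> real n * (2 * pi)" by (subst (asm) pos_divide_le_eq) auto
    then have "2 * pi \<le> z $ i + 2 * pi * real n" by (simp add: mult_ac)
    then have "\<psi> ((z $ i) *\<^sub>R axis i 1) = 0" using \<psi>_large \<psi>_periodic by metis
    moreover have "(z $ i) *\<^sub>R axis i 1 = z" by (simp add: vec_eq)
    ultimately show ?thesis by simp
  qed
  then show False using ex_\<psi>_nonzero by blast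
qed

end

section \<open>The Levy measure of the integral for integer-valued \<open>Y\<close>\<close>

context int_levy
begin

definition dilation_measure :: "real \<Rightarrow> real measure" where
  "dilation_measure c = density lborel (\<lambda>u. ennreal (indicator {0<..<1 / c} u / u))"

text \<open>The components of \<open>p\<close> are the dilation index, a mean \<open>u\<close>, a
  standard exponential time and a sample point; \<open>u\<close> times that time is exponential with
  mean \<open>u\<close>.\<close>

definition jump :: "nat \<times> real \<times> real \<times> 'w \<Rightarrow> real^'d" where
  "jump p = exp (- real (fst p)) *\<^sub>R regular (fst (snd p) * fst (snd (snd p))) (snd (snd (snd p)))"

text \<open>The law of \<open>Y\<close> at an exponential time with mean \<open>1 / c\<close> has as Levy measure the integral over \<open>0 < u < 1 / c\<close>
  of \<open>du / u\<close> times the law at an exponential time with mean \<open>u\<close>, because of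
  \<open>\<integral> (1 / (1 - u \<psi>) - 1) du / u = - Ln (1 - \<psi> / c)\<close>.  Its images under the dilations by \<open>exp (- j)\<close> are added up.\<close>

definition levy_meas :: "real \<Rightarrow> (real^'d) measure" where
  "levy_meas c = density (distr (count_space UNIV \<Otimes>\<^sub>M (dilation_measure c \<Otimes>\<^sub>M (exp_law \<Otimes>\<^sub>M M))) borel jump)
     (\<lambda>x. ennreal (indicator (- {0}) x))"

lemma sets_dilation_measure [simp, measurable_cong]: "sets (dilation_measure c) = sets borel"
  by (simp add: dilation_measure_def)

lemma sets_levy_meas [simp, measurable_cong]: "sets (levy_meas c) = sets borel"
  by (simp add: levy_meas_def)

lemma sigma_finite_dilation_measure: "sigma_finite_measure (dilation_measure c)"
  unfolding dilation_measure_def by (subst sigma_finite_measure.sigma_finite_iff_density_finite[OF sigma_finite_lborel]) auto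

lemma sigma_finite_base:
  "sigma_finite_measure (exp_law \<Otimes>\<^sub>M M)" "sigma_finite_measure (dilation_measure c \<Otimes>\<^sub>M (exp_law \<Otimes>\<^sub>M M))"
proof -
  interpret E: prob_space exp_law by (rule prob_space_exp_law)
  interpret EM: pair_sigma_finite exp_law M ..
  show 1: "sigma_finite_measure (exp_law \<Otimes>\<^sub>M M)" by (rule EM.sigma_finite_measure_axioms)
  interpret V: sigma_finite_measure "dilation_measure c" by (rule sigma_finite_dilation_measure)
  interpret VEM: pair_sigma_finite "dilation_measure c" "exp_law \<Otimes>\<^sub>M M"
    by (intro pair_sigma_finite.intro V.sigma_finite_measure_axioms 1)
  show "sigma_finite_measure (dilation_measure c \<Otimes>\<^sub>M (exp_law \<Otimes>\<^sub>M M))" by (rule VEM.sigma_finite_measure_axioms)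
qed

lemma regular_scaled_measurable [measurable]:
  "(\<lambda>q. regular (fst q * fst (snd q)) (snd (snd q))) \<in> borel_measurable (dilation_measure c \<Otimes>\<^sub>M (exp_law \<Otimes>\<^sub>M M))"
  "(\<lambda>p. regular (u * fst p) (snd p)) \<in> borel_measurable (exp_law \<Otimes>\<^sub>M M)"
proof -
  have "(\<lambda>q. (fst q * fst (snd q), snd (snd q))) \<in> dilation_measure c \<Otimes>\<^sub>M (exp_law \<Otimes>\<^sub>M M) \<rightarrow>\<^sub>M borel \<Otimes>\<^sub>M M"
    by measurable
  from measurable_compose[OF this regular_measurable]
  show "(\<lambda>q. regular (fst q * fst (snd q)) (snd (snd q))) \<in> borel_measurable (dilation_measure c \<Otimes>\<^sub>M (exp_law \<Otimes>\<^sub>M M))" by simp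
  have "(\<lambda>p. (u * fst p, snd p)) \<in> exp_law \<Otimes>\<^sub>M M \<rightarrow>\<^sub>M borel \<Otimes>\<^sub>M M" by measurable
  from measurable_compose[OF this regular_measurable]
  show "(\<lambda>p. regular (u * fst p) (snd p)) \<in> borel_measurable (exp_law \<Otimes>\<^sub>M M)" by simp
qed

lemma jump_measurable [measurable]:
  "jump \<in> borel_measurable (count_space UNIV \<Otimes>\<^sub>M (dilation_measure c \<Otimes>\<^sub>M (exp_law \<Otimes>\<^sub>M M)))"
proof -
  have [measurable]: "(\<lambda>p :: nat \<times> real \<times> real \<times> 'w. regular (fst (snd p) * fst (snd (snd p))) (snd (snd (snd p))))
      \<in> borel_measurable (count_space UNIV \<Otimes>\<^sub>M (dilation_measure c \<Otimes>\<^sub>M (exp_law \<Otimes>\<^sub>M M)))"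
    using measurable_compose[OF measurable_snd regular_scaled_measurable(1)] by simp
  have [measurable]: "(\<lambda>p :: nat \<times> real \<times> real \<times> 'w. exp (- real (fst p)))
      \<in> borel_measurable (count_space UNIV \<Otimes>\<^sub>M (dilation_measure c \<Otimes>\<^sub>M (exp_law \<Otimes>\<^sub>M M)))"
    by (rule measurable_compose[OF measurable_fst]) simp
  show ?thesis unfolding jump_def by measurable
qed

text \<open>Because of \<open>F 0 = 0\<close> the restriction to nonzero points disappears from the
  integral; the version \<open>regular\<close> is needed only for joint measurability and is
  exchanged for \<open>Y\<close> at each fixed time.\<close>

lemma nn_integral_levy_meas:
  assumes F [measurable]: "F \<in> borel_measurable borel" and F0: "F 0 = 0"
  shows "(\<integral>\<^sup>+x. F x \<partial>levy_meas c) =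
    (\<integral>\<^sup>+u. \<integral>\<^sup>+t. \<integral>\<^sup>+\<omega>. (\<Sum>j. F (exp (- real j) *\<^sub>R Y (max 0 (u * t)) \<omega>)) \<partial>M \<partial>exp_law \<partial>dilation_measure c)"
proof -
  interpret B: sigma_finite_measure "dilation_measure c \<Otimes>\<^sub>M (exp_law \<Otimes>\<^sub>M M)" by (rule sigma_finite_base)
  interpret EM: sigma_finite_measure "exp_law \<Otimes>\<^sub>M M" by (rule sigma_finite_base)
  let ?B = "dilation_measure c \<Otimes>\<^sub>M (exp_law \<Otimes>\<^sub>M M)"
  let ?r = "\<lambda>q. regular (fst q * fst (snd q)) (snd (snd q))"
  have [measurable]: "(\<lambda>q. \<Sum>j. F (exp (- real j) *\<^sub>R ?r q)) \<in> borel_measurable ?B"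
    by (intro borel_measurable_suminf_order measurable_compose[OF _ F] borel_measurable_scaleR regular_scaled_measurable) auto
  have [measurable]: "(\<lambda>p. \<Sum>j. F (exp (- real j) *\<^sub>R regular (u * fst p) (snd p))) \<in> borel_measurable (exp_law \<Otimes>\<^sub>M M)" for u
    by (intro borel_measurable_suminf_order measurable_compose[OF _ F] borel_measurable_scaleR regular_scaled_measurable) auto
  have "(\<integral>\<^sup>+x. F x \<partial>levy_meas c) = (\<integral>\<^sup>+x. ennreal (indicator (- {0}) x) * F x \<partial>distr (count_space UNIV \<Otimes>\<^sub>M ?B) borel jump)"
    unfolding levy_meas_def by (rule nn_integral_density) auto
  also have "\<dots> = (\<integral>\<^sup>+x. F x \<partial>distr (count_space UNIV \<Otimes>\<^sub>M ?B) borel jump)"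
    using F0 by (intro nn_integral_cong) (auto split: split_indicator)
  also have "\<dots> = (\<integral>\<^sup>+p. F (jump p) \<partial>(count_space UNIV \<Otimes>\<^sub>M ?B))"
    by (rule nn_integral_distr) auto
  also have "\<dots> = (\<integral>\<^sup>+j. \<integral>\<^sup>+q. F (jump (j, q)) \<partial>?B \<partial>count_space UNIV)"
    by (rule B.nn_integral_fst[symmetric]) measurable
  also have "\<dots> = (\<Sum>j. \<integral>\<^sup>+q. F (exp (- real j) *\<^sub>R ?r q) \<partial>?B)"
    by (simp add: nn_integral_count_space_nat jump_def)
  also have "\<dots> = (\<integral>\<^sup>+q. (\<Sum>j. F (exp (- real j) *\<^sub>R ?r q)) \<partial>?B)"
    by (rule nn_integral_suminf[symmetric])
       (intro measurable_compose[OF _ F] borel_measurable_scaleR regular_scaled_measurable borel_measurable_const)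
  also have "\<dots> = (\<integral>\<^sup>+u. \<integral>\<^sup>+p. (\<Sum>j. F (exp (- real j) *\<^sub>R regular (u * fst p) (snd p))) \<partial>(exp_law \<Otimes>\<^sub>M M) \<partial>dilation_measure c)"
    by (subst EM.nn_integral_fst[symmetric]) auto
  also have "\<dots> = (\<integral>\<^sup>+u. \<integral>\<^sup>+t. \<integral>\<^sup>+\<omega>. (\<Sum>j. F (exp (- real j) *\<^sub>R regular (u * t) \<omega>)) \<partial>M \<partial>exp_law \<partial>dilation_measure c)"
    by (subst nn_integral_fst[symmetric]) auto
  also have "\<dots> = (\<integral>\<^sup>+u. \<integral>\<^sup>+t. \<integral>\<^sup>+\<omega>. (\<Sum>j. F (exp (- real j) *\<^sub>R Y (max 0 (u * t)) \<omega>)) \<partial>M \<partial>exp_law \<partial>dilation_measure c)"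
    using regular_AE by (intro nn_integral_cong nn_integral_cong_AE) (auto elim!: eventually_mono)
  finally show ?thesis .
qed

lemma AE_dilation_measure_pos: "AE u in dilation_measure c. u > 0"
  unfolding dilation_measure_def by (subst AE_density) (auto split: split_indicator)

text \<open>The bound \<open>C * t\<close> has no constant term, so it cancels the density
  \<open>1 / u\<close> and leaves \<open>C / c\<close>. Integrability of
  \<open>min 1 (norm x)\<close> is more than a Levy measure needs and permits an exponent without
  compensation.\<close>

lemma nn_integral_levy_meas_finite:
  assumes c: "c > 0"
  shows "(\<integral>\<^sup>+x. ennreal (min 1 (norm x)) \<partial>levy_meas c) < \<infinity>"
proof -
  obtain C where C: "C \<ge> 0" "\<And>t. t \<ge> 0 \<Longrightarrow> (\<integral>\<^sup>+\<omega>. (\<Sum>j. ennreal (min 1 (exp (- real j) * norm (Y t \<omega>)))) \<partial>M) \<le> ennreal (C * t)"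
    using suminf_min_moment_le by blast
  have "(\<integral>\<^sup>+x. ennreal (min 1 (norm x)) \<partial>levy_meas c) =
    (\<integral>\<^sup>+u. \<integral>\<^sup>+t. \<integral>\<^sup>+\<omega>. (\<Sum>j. ennreal (min 1 (exp (- real j) * norm (Y (max 0 (u * t)) \<omega>)))) \<partial>M \<partial>exp_law \<partial>dilation_measure c)"
    by (subst nn_integral_levy_meas) auto
  also have "\<dots> \<le> (\<integral>\<^sup>+u. ennreal (C * u) \<partial>dilation_measure c)"
    using AE_dilation_measure_pos[of c]
  proof (intro nn_integral_mono_AE, eventually_elim)
    case (elim u)
    then have pos: "u > 0" by blast
    have "(\<integral>\<^sup>+t. \<integral>\<^sup>+\<omega>. (\<Sum>j. ennreal (min 1 (exp (- real j) * norm (Y (max 0 (u * t)) \<omega>)))) \<partial>M \<partial>exp_law)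
      \<le> (\<integral>\<^sup>+t. ennreal (C * u) * ennreal t \<partial>exp_law)"
      using AE_exp_law_pos
    proof (intro nn_integral_mono_AE, eventually_elim)
      case (elim t)
      have ut: "0 \<le> u * t" using elim pos by simp
      then have m: "max 0 (u * t) = u * t" by simp
      have "ennreal (C * u) * ennreal t = ennreal (C * u * t)" using elim pos C(1) by (intro ennreal_mult[symmetric]) auto
      then show ?case using C(2)[OF ut] unfolding m by (simp only: mult.assoc)
    qed
    also have "\<dots> = ennreal (C * u) * (\<integral>\<^sup>+t. ennreal t \<partial>exp_law)" by (rule nn_integral_cmult) measurable
    also have "\<dots> = ennreal (C * u)" unfolding exp_law_mean by (rule mult_1_right)
    finally show ?case .
  qed
  also have "\<dots> = (\<integral>\<^sup>+u. ennreal (indicator {0<..<1 / c} u / u) * ennreal (C * u) \<partial>lborel)"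
    unfolding dilation_measure_def by (rule nn_integral_density) auto
  also have "\<dots> \<le> (\<integral>\<^sup>+u. ennreal C * indicator {0<..<1 / c} u \<partial>lborel)"
    using C(1) by (intro nn_integral_mono) (auto simp: ennreal_mult[symmetric] split: split_indicator)
  also have "\<dots> = ennreal C * ennreal (1 / c)"
    using c by (subst nn_integral_cmult_indicator) auto
  also have "\<dots> < \<infinity>" by (simp add: ennreal_mult_less_top)
  finally show ?thesis .
qed

text \<open>Fubini with the dilation index under the counting measure; it stays outermost to match
  the product of dilated factors.\<close>

lemma sums_integral_levy_meas:
  fixes f :: "real^'d \<Rightarrow> complex"
  assumes f0: "f 0 = 0" and f: "integrable (levy_meas c) f"
  shows "(\<lambda>j. LINT u|dilation_measure c. LINT p|(exp_law \<Otimes>\<^sub>M M). f (exp (- real j) *\<^sub>R regular (u * fst p) (snd p))) sums (LINT x|levy_meas c. f x)"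
proof -
  let ?EM = "exp_law \<Otimes>\<^sub>M M"
  let ?B = "dilation_measure c \<Otimes>\<^sub>M ?EM"
  let ?D = "distr (count_space UNIV \<Otimes>\<^sub>M ?B) borel jump"
  interpret B: sigma_finite_measure ?B by (rule sigma_finite_base)
  interpret EM: sigma_finite_measure ?EM by (rule sigma_finite_base)
  interpret V: sigma_finite_measure "dilation_measure c" by (rule sigma_finite_dilation_measure)
  interpret CB: pair_sigma_finite "count_space (UNIV :: nat set)" ?B
    by (intro pair_sigma_finite.intro sigma_finite_measure_count_space B.sigma_finite_measure_axioms)
  interpret VEM: pair_sigma_finite "dilation_measure c" ?EM ..
  have [measurable]: "f \<in> borel_measurable borel" using borel_measurable_integrable[OF f] by simp
  have ind: "indicator (- {0}) x *\<^sub>R f x = f x" for x using f0 by (auto split: split_indicator)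
  have "integrable ?D f"
    using f unfolding levy_meas_def by (subst (asm) integrable_density) (auto simp: ind)
  then have int: "integrable (count_space UNIV \<Otimes>\<^sub>M ?B) (\<lambda>p. f (jump p))"
    by (subst (asm) integrable_distr_eq) auto
  have "(LINT x|levy_meas c. f x) = (LINT x|?D. f x)"
    unfolding levy_meas_def by (subst integral_density) (auto simp: ind)
  also have "\<dots> = (LINT p|(count_space UNIV \<Otimes>\<^sub>M ?B). f (jump p))"
    by (subst integral_distr) auto
  also have "\<dots> = (LINT j|count_space UNIV. LINT q|?B. f (jump (j, q)))"
    by (rule CB.integral_fst'[symmetric, OF int])
  finally have eq: "(LINT x|levy_meas c. f x) = (LINT j|count_space UNIV. LINT q|?B. f (jump (j, q)))" .
  have "AE j in count_space UNIV. integrable ?B (\<lambda>q. f (jump (j, q)))"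
    by (rule CB.AE_integrable_fst'[OF int])
  then have intj: "integrable ?B (\<lambda>q. f (jump (j, q)))" for j by (simp add: AE_count_space)
  have "(LINT q|?B. f (jump (j, q))) = (LINT u|dilation_measure c. LINT p|?EM. f (exp (- real j) *\<^sub>R regular (u * fst p) (snd p)))" for j
    by (subst VEM.integral_fst'[symmetric, OF intj]) (simp add: jump_def)
  moreover have "(\<lambda>j. LINT q|?B. f (jump (j, q))) sums (LINT j|count_space UNIV. LINT q|?B. f (jump (j, q)))"
    by (rule sums_integral_count_space_nat[OF CB.integrable_fst'[OF int]])
  ultimately show ?thesis unfolding eq by simp
qed

lemma char_fun_scaled_exp_time:
  assumes u: "u > 0"
  shows "(LINT p|(exp_law \<Otimes>\<^sub>M M). iexp (z \<bullet> (b *\<^sub>R regular (u * fst p) (snd p))) - 1) = 1 / (1 - of_real u * \<psi> (b *\<^sub>R z)) - 1"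
proof -
  interpret E: prob_space exp_law by (rule prob_space_exp_law)
  interpret EM: pair_prob_space exp_law M ..
  have int: "integrable (exp_law \<Otimes>\<^sub>M M) (\<lambda>p. iexp (z \<bullet> (b *\<^sub>R regular (u * fst p) (snd p))))"
    by (intro EM.integrable_const_bound[where B=1]) auto
  have "(LINT p|(exp_law \<Otimes>\<^sub>M M). iexp (z \<bullet> (b *\<^sub>R regular (u * fst p) (snd p)))) = (LINT t|exp_law. LINT \<omega>|M. iexp (z \<bullet> (b *\<^sub>R regular (u * t) \<omega>)))"
    by (subst EM.integral_fst'[symmetric, OF int]) simp
  also have "\<dots> = (LINT t|exp_law. exp (complex_of_real (max 0 t) * (of_real u * \<psi> (b *\<^sub>R z))))"
  proof (intro Bochner_Integration.integral_cong refl)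
    fix t
    have m: "max 0 (u * t) = u * max 0 t" using u by (simp add: max_def zero_le_mult_iff)
    have "(LINT \<omega>|M. iexp (z \<bullet> (b *\<^sub>R regular (u * t) \<omega>))) = (LINT \<omega>|M. iexp ((b *\<^sub>R z) \<bullet> Y (max 0 (u * t)) \<omega>))"
      using regular_AE by (intro integral_cong_AE) (auto elim!: eventually_mono)
    also have "\<dots> = \<phi> (max 0 (u * t)) (b *\<^sub>R z)" by (rule \<phi>_expectation[symmetric]) simp
    also have "\<dots> = exp (complex_of_real (max 0 t) * (of_real u * \<psi> (b *\<^sub>R z)))"
      unfolding m using u by (subst \<phi>_eq) (auto simp: mult_ac)
    finally show "(LINT \<omega>|M. iexp (z \<bullet> (b *\<^sub>R regular (u * t) \<omega>))) = exp (complex_of_real (max 0 t) * (of_real u * \<psi> (b *\<^sub>R z)))" .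
  qed
  also have "\<dots> = (LINT t|exp_law. exp (complex_of_real t * (of_real u * \<psi> (b *\<^sub>R z))))"
    using AE_exp_law_pos by (intro integral_cong_AE) (auto elim!: eventually_mono)
  also have "\<dots> = 1 / (1 - of_real u * \<psi> (b *\<^sub>R z))"
  proof (rule exp_law_integral_exp)
    have "u * Re (\<psi> (b *\<^sub>R z)) \<le> 0" using u Re_\<psi>_le_0 by (intro mult_nonneg_nonpos) auto
    then show "Re (of_real u * \<psi> (b *\<^sub>R z)) < 1" by simp
  qed
  finally have "(LINT p|(exp_law \<Otimes>\<^sub>M M). iexp (z \<bullet> (b *\<^sub>R regular (u * fst p) (snd p)))) = 1 / (1 - of_real u * \<psi> (b *\<^sub>R z))" .
  then show ?thesis using int by (simp add: EM.prob_space)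
qed

text \<open>The numerator of \<open>1 / (1 - u * w) - 1\<close> cancels the singular density
  \<open>1 / u\<close>. As \<open>1 - u * w\<close> stays in the right half-plane, the principal
  logarithm supplies an antiderivative.\<close>

lemma integral_dilation_measure:
  fixes w :: complex
  assumes c: "c > 0" and w: "Re w \<le> 0"
  shows "(LINT u|dilation_measure c. 1 / (1 - of_real u * w) - 1) = - Ln (1 - w / of_real c)"
proof -
  have re: "Re (1 - of_real u * w) > 0" if "u \<ge> 0" for u :: real
    using mult_nonneg_nonpos[OF that w] by simp
  have nz: "1 - of_real u * w \<noteq> 0" if "u \<ge> 0" for u :: real
    using re[OF that] by (metis less_irrefl zero_complex.sel(1))
  have "(LINT u|dilation_measure c. 1 / (1 - of_real u * w) - 1) =
    (LINT u|lborel. (indicator {0<..<1 / c} u / u) *\<^sub>R (1 / (1 - of_real u * w) - 1))"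
    unfolding dilation_measure_def by (rule integral_density) (auto split: split_indicator)
  also have "\<dots> = (LINT u|lborel. indicator {0..1 / c} u *\<^sub>R (w / (1 - of_real u * w)))"
  proof (rule integral_cong_AE)
    have "AE u in lborel. u \<noteq> 0" "AE u in lborel. u \<noteq> 1 / c" by (rule AE_lborel_singleton)+
    then show "AE u in lborel. (indicator {0<..<1 / c} u / u) *\<^sub>R (1 / (1 - of_real u * w) - 1) = indicator {0..1 / c} u *\<^sub>R (w / (1 - of_real u * w))"
    proof eventually_elim
      case (elim u)
      show ?case
      proof (cases "u \<in> {0<..<1 / c}")
        case True
        then have u: "u > 0" by simp
        have "1 / (1 - of_real u * w) - 1 = of_real u * (w / (1 - of_real u * w))"
          using nz[of u] u by (simp add: field_simps)
        then show ?thesis using True u by (simp add: scaleR_conv_of_real)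
      qed (use elim in \<open>auto split: split_indicator\<close>)
    qed
  qed measurable
  also have "\<dots> = - Ln (1 - of_real (1 / c) * w) - (- Ln (1 - of_real 0 * w))"
  proof (rule integral_FTC_Icc)
    show "((\<lambda>u. - Ln (1 - of_real u * w)) has_vector_derivative w / (1 - of_real u * w)) (at u within {0..1 / c})"
      if "0 \<le> u" "u \<le> 1 / c" for u
    proof (rule has_vector_derivative_real_field[where f="\<lambda>u. - Ln (1 - u * w)"])
      have "1 - of_real u * w \<notin> \<real>\<^sub>\<le>\<^sub>0" using re[OF that(1)] by (auto simp: complex_nonpos_Reals_iff)
      then show "((\<lambda>u. - Ln (1 - u * w)) has_field_derivative w / (1 - of_real u * w)) (at (of_real u))"
        by (auto intro!: derivative_eq_intros simp: field_simps)
    qed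
    show "continuous_on {0..1 / c} (\<lambda>u. w / (1 - of_real u * w))"
      by (intro continuous_intros) (use nz in auto)
  qed (use c in auto)
  finally show ?thesis by (simp add: mult.commute)
qed

lemma integrable_levy_meas:
  assumes c: "c > 0"
  shows "integrable (levy_meas c) (\<lambda>x. min 1 (norm x))"
    and "integrable (levy_meas c) (\<lambda>x. iexp (z \<bullet> x) - 1)"
    and "integrable (levy_meas c) (\<lambda>x. indicator (cball 0 1) x *\<^sub>R x)"
proof -
  show 1: "integrable (levy_meas c) (\<lambda>x. min 1 (norm x))"
    using nn_integral_levy_meas_finite[OF c] by (intro integrableI_bounded) auto
  show "integrable (levy_meas c) (\<lambda>x. iexp (z \<bullet> x) - 1)"
  proof (rule Bochner_Integration.integrable_bound[OF integrable_mult_right[OF 1, of "2 + norm z"]])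
    show "AE x in levy_meas c. norm (iexp (z \<bullet> x) - 1) \<le> norm ((2 + norm z) * min 1 (norm x))"
    proof (rule AE_I2)
      fix x
      have "norm (iexp (z \<bullet> x) - 1) \<le> \<bar>z \<bullet> x\<bar>" using norm_exp_minus_1_le[of "\<i> * of_real (z \<bullet> x)"] by (simp add: norm_mult)
      also have "\<dots> \<le> norm z * norm x" by (rule Cauchy_Schwarz_ineq2)
      also have "\<dots> \<le> (2 + norm z) * norm x" by (intro mult_right_mono) auto
      finally have a: "norm (iexp (z \<bullet> x) - 1) \<le> (2 + norm z) * norm x" .
      have "norm (iexp (z \<bullet> x) - 1) \<le> norm (iexp (z \<bullet> x)) + norm (1 :: complex)" by (rule norm_triangle_ineq4)
      then have "norm (iexp (z \<bullet> x) - 1) \<le> 2" by simp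
      moreover have "2 \<le> (2 + norm z) * 1" by simp
      ultimately have b: "norm (iexp (z \<bullet> x) - 1) \<le> (2 + norm z) * 1" by (rule order_trans)
      have "norm (iexp (z \<bullet> x) - 1) \<le> (2 + norm z) * min 1 (norm x)" using a b by (simp add: min_def)
      then show "norm (iexp (z \<bullet> x) - 1) \<le> norm ((2 + norm z) * min 1 (norm x))" by (rule order_trans) simp
    qed
  qed measurable
  have [measurable]: "(\<lambda>x :: real^'d. indicator (cball 0 1) x *\<^sub>R x) \<in> borel_measurable borel"
    by (intro borel_measurable_scaleR borel_measurable_indicator) auto
  show "integrable (levy_meas c) (\<lambda>x. indicator (cball 0 1) x *\<^sub>R x)"
    by (rule Bochner_Integration.integrable_bound[OF 1]) (auto split: split_indicator)
qed

text \<open>The exponents of the dilated factors sum to the integral of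
  \<open>iexp (z \<bullet> x) - 1\<close>. There is no Gaussian part, and the drift merely undoes
  the compensation on the unit ball.\<close>

lemma has_levy_measure_levy_meas:
  assumes c: "c > 0" and d: "distribution \<mu>"
    and eq: "\<And>z. char_fun \<mu> z = char_fun \<mu> (exp (- 1) *\<^sub>R z) * char_fun (exp_time_law c) z"
  shows "has_levy_measure \<mu> (levy_meas c)"
proof -
  note int = integrable_levy_meas[OF c]
  define \<gamma>' where "\<gamma>' = (LINT x|levy_meas c. indicator (cball 0 1) x *\<^sub>R x)"
  have cf: "char_fun \<mu> z = exp (CLINT x|levy_meas c. iexp (z \<bullet> x) - 1)" for z
  proof (rule LIMSEQ_unique)
    have e1: "0 < exp (- 1 :: real)" "exp (- 1 :: real) < 1" by auto
    show "(\<lambda>J. \<Prod>j<J. char_fun (exp_time_law c) (exp (- 1) ^ j *\<^sub>R z)) \<longlonglongrightarrow> char_fun \<mu> z"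
      by (rule char_fun_scaling_product[OF d e1 eq])
    define I where "I = (\<lambda>j. LINT u|dilation_measure c. LINT p|(exp_law \<Otimes>\<^sub>M M). iexp (z \<bullet> (exp (- real j) *\<^sub>R regular (u * fst p) (snd p))) - 1)"
    have "exp (I j) = char_fun (exp_time_law c) (exp (- 1) ^ j *\<^sub>R z)" for j
    proof -
      define w where "w = \<psi> (exp (- real j) *\<^sub>R z)"
      have w: "Re w \<le> 0" unfolding w_def by (rule Re_\<psi>_le_0)
      have "I j = (LINT u|dilation_measure c. 1 / (1 - of_real u * w) - 1)"
        unfolding I_def
      proof (rule integral_cong_AE)
        show "AE u in dilation_measure c. (LINT p|(exp_law \<Otimes>\<^sub>M M). iexp (z \<bullet> (exp (- real j) *\<^sub>R regular (u * fst p) (snd p))) - 1) = 1 / (1 - of_real u * w) - 1"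
          using AE_dilation_measure_pos[of c] unfolding w_def
          by eventually_elim (rule char_fun_scaled_exp_time)
        interpret EM: sigma_finite_measure "exp_law \<Otimes>\<^sub>M M" by (rule sigma_finite_base)
        have "(\<lambda>q. iexp (z \<bullet> (exp (- real j) *\<^sub>R regular (fst q * fst (snd q)) (snd (snd q)))) - 1)
            \<in> borel_measurable (dilation_measure c \<Otimes>\<^sub>M (exp_law \<Otimes>\<^sub>M M))" by measurable
        from EM.borel_measurable_lebesgue_integral[of "\<lambda>u p. iexp (z \<bullet> (exp (- real j) *\<^sub>R regular (u * fst p) (snd p))) - 1"] this
        show "(\<lambda>u. LINT p|(exp_law \<Otimes>\<^sub>M M). iexp (z \<bullet> (exp (- real j) *\<^sub>R regular (u * fst p) (snd p))) - 1) \<in> borel_measurable (dilation_measure c)"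
          by (simp add: case_prod_beta)
      qed measurable
      also have "\<dots> = - Ln (1 - w / of_real c)" by (rule integral_dilation_measure[OF c w])
      finally have I: "I j = - Ln (1 - w / of_real c)" .
      have "Re (w / of_real c) \<le> 0" using w c by (simp add: Re_divide_of_real divide_nonpos_pos)
      then have "1 - w / of_real c \<noteq> 0" by (metis add_0 diff_add_cancel not_one_le_zero one_complex.sel(1))
      then have "exp (I j) = 1 / (1 - w / of_real c)" unfolding I by (simp add: exp_minus inverse_eq_divide)
      moreover have "exp (- real j) = exp (- 1) ^ j" by (simp add: exp_of_nat_mult[symmetric])
      ultimately show ?thesis by (simp add: char_fun_exp_time_law[OF c] w_def)
    qed
    then have "(\<Prod>j<J. char_fun (exp_time_law c) (exp (- 1) ^ j *\<^sub>R z)) = exp (\<Sum>j<J. I j)" for J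
      by (simp add: exp_sum)
    moreover have "I sums (CLINT x|levy_meas c. iexp (z \<bullet> x) - 1)"
      unfolding I_def by (rule sums_integral_levy_meas[OF _ int(2)]) simp
    then have "(\<lambda>J. exp (\<Sum>j<J. I j)) \<longlonglongrightarrow> exp (CLINT x|levy_meas c. iexp (z \<bullet> x) - 1)"
      unfolding sums_def by (rule tendsto_exp)
    ultimately show "(\<lambda>J. \<Prod>j<J. char_fun (exp_time_law c) (exp (- 1) ^ j *\<^sub>R z)) \<longlonglongrightarrow> exp (CLINT x|levy_meas c. iexp (z \<bullet> x) - 1)"
      by simp
  qed
  have comp: "(CLINT x|levy_meas c. iexp (z \<bullet> x) - 1 - \<i> * complex_of_real (z \<bullet> x * indicator (cball 0 1) x)) =
    (CLINT x|levy_meas c. iexp (z \<bullet> x) - 1) - \<i> * complex_of_real (\<gamma>' \<bullet> z)" for z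
  proof -
    have ii: "integrable (levy_meas c) (\<lambda>x. z \<bullet> (indicator (cball 0 1) x *\<^sub>R x))" by (rule integrable_inner_right) (rule int(3))
    have "(LINT x|levy_meas c. z \<bullet> (indicator (cball 0 1) x *\<^sub>R x)) = z \<bullet> \<gamma>'"
      unfolding \<gamma>'_def by (rule integral_inner_right) (use int(3) in simp)
    moreover have fe: "(\<lambda>x. z \<bullet> (indicator (cball 0 1) x *\<^sub>R x)) = (\<lambda>x. z \<bullet> x * indicator (cball 0 1) x)" by (auto simp: mult.commute)
    ultimately have "(CLINT x|levy_meas c. complex_of_real (z \<bullet> x * indicator (cball 0 1) x)) = complex_of_real (\<gamma>' \<bullet> z)"
      by (simp only: integral_complex_of_real inner_commute)
    moreover have "integrable (levy_meas c) (\<lambda>x. complex_of_real (z \<bullet> x * indicator (cball 0 1) x))"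
      using ii unfolding fe by (rule integrable_of_real)
    ultimately show ?thesis
      by (subst Bochner_Integration.integral_diff[OF int(2)]) (simp_all only: integral_mult_right_zero integrable_mult_right)
  qed
  have "levy_khintchine \<mu> 0 (levy_meas c) \<gamma>'"
    unfolding levy_khintchine_def
  proof (intro conjI allI)
    have "emeasure (levy_meas c) {0} = (\<integral>\<^sup>+x. ennreal (indicator (- {0}) x) * indicator {0} x \<partial>distr (count_space UNIV \<Otimes>\<^sub>M (dilation_measure c \<Otimes>\<^sub>M (exp_law \<Otimes>\<^sub>M M))) borel jump)"
      unfolding levy_meas_def by (rule emeasure_density) auto
    also have "\<dots> = (\<integral>\<^sup>+x. 0 \<partial>distr (count_space UNIV \<Otimes>\<^sub>M (dilation_measure c \<Otimes>\<^sub>M (exp_law \<Otimes>\<^sub>M M))) borel jump)"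
      by (intro nn_integral_cong) (auto split: split_indicator)
    finally show "emeasure (levy_meas c) {0} = 0" by simp
    have "(\<integral>\<^sup>+x. ennreal (min ((norm x)\<^sup>2) 1) \<partial>levy_meas c) \<le> (\<integral>\<^sup>+x. ennreal (min 1 (norm x)) \<partial>levy_meas c)"
    proof (intro nn_integral_mono ennreal_leI)
      fix x :: "real^'d"
      have "(norm x)\<^sup>2 \<le> norm x" if "norm x \<le> 1"
        using mult_left_le[OF that norm_ge_zero] by (simp add: power2_eq_square)
      then show "min ((norm x)\<^sup>2) 1 \<le> min 1 (norm x)" by (cases "norm x \<le> 1") (auto simp: min_def)
    qed
    then show "(\<integral>\<^sup>+x. ennreal (min ((norm x)\<^sup>2) 1) \<partial>levy_meas c) < \<infinity>"
      using nn_integral_levy_meas_finite[OF c] by (rule le_less_trans)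
    show "char_fun \<mu> z = exp (- complex_of_real (z \<bullet> (0 *v z)) / 2 + \<i> * complex_of_real (\<gamma>' \<bullet> z) +
        (CLINT x|levy_meas c. iexp (z \<bullet> x) - 1 - \<i> * complex_of_real (z \<bullet> x * indicator (cball 0 1) x)))" for z
      unfolding comp cf by simp
  qed (auto simp: transpose_def vec_eq_iff)
  then show ?thesis unfolding has_levy_measure_def using d by blast
qed

end

section \<open>Atoms of the Levy measure and their density\<close>

lemma AE_lborel_interval_False:
  fixes a b :: real
  assumes "AE t in lborel. t \<notin> {a<..<b}" "a < b"
  shows False
proof -
  have "(AE t in lborel. t \<notin> {a<..<b}) \<longleftrightarrow> emeasure lborel {a<..<b} = 0"
    by (rule AE_iff_measurable) auto
  then show False using assms by simp
qed

text \<open>For large \<open>j\<close> the spacing \<open>exp (- j) * k\<close> is below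
  \<open>e\<close>, and the first multiple beyond \<open>y\<close> will do. Rounding up ensures
  \<open>n >= 1\<close>, because the point 0 is no atom.\<close>

lemma dense_dilated_multiples:
  fixes k y e :: real
  assumes k: "k > 0" and y: "y \<ge> 0" and e: "e > 0"
  shows "\<exists>(j::nat) (n::nat). n \<ge> 1 \<and> \<bar>exp (- real j) * (real n * k) - y\<bar> < e"
proof -
  obtain j :: nat where j: "ln (k / e) < real j" using reals_Archimedean2 by blast
  define q where "q = exp (- real j) * k"
  have q: "0 < q" "q < e"
  proof -
    have "k / e = exp (ln (k / e))" using k e by simp
    also have "\<dots> < exp (real j)" using j by simp
    finally have "k / e < exp (real j)" .
    then show "q < e" using e by (simp add: q_def exp_minus field_simps)
  qed (use k in \<open>simp add: q_def\<close>)
  define n where "n = Suc (nat \<lfloor>y / q\<rfloor>)"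
  have f: "0 \<le> \<lfloor>y / q\<rfloor>" using y q by simp
  then have n: "real n = of_int \<lfloor>y / q\<rfloor> + 1" by (simp add: n_def)
  have "y / q < real n" "real n \<le> y / q + 1" unfolding n by linarith+
  then have "y < real n * q" "real n * q \<le> y + q" using q by (simp_all add: field_simps)
  then have "\<bar>real n * q - y\<bar> < e" using q by linarith
  then show ?thesis by (intro exI[of _ j] exI[of _ n]) (simp add: q_def n_def mult_ac)
qed

context int_levy
begin

definition mass :: "real \<Rightarrow> real^'d \<Rightarrow> real" where
  "mass t x = prob {\<omega> \<in> space M. Y t \<omega> = x}"

text \<open>Passing through \<open>x\<close> at time \<open>s\<close> is one way to be at
  \<open>x + y\<close> at time \<open>s + t\<close>.\<close>

lemma mass_add:
  assumes s: "s \<ge> 0" and t: "t \<ge> 0"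
  shows "mass s x * mass t y \<le> mass (s + t) (x + y)"
proof -
  have [measurable]: "Y s \<in> borel_measurable M" "Y t \<in> borel_measurable M" "Y (s + t) \<in> borel_measurable M" "Y 0 \<in> borel_measurable M"
    using s t by auto
  define \<tau> :: "nat \<Rightarrow> real" where "\<tau> = (\<lambda>i. if i = 0 then 0 else if i = 1 then s else s + t)"
  have \<tau>: "\<tau> 0 = 0" "\<tau> (Suc (Suc 0)) = s + t" "\<tau> (Suc 0) = s" by (auto simp: \<tau>_def)
  have ind: "indep_vars (\<lambda>_. borel) (\<lambda>i \<omega>. Y (\<tau> (Suc i)) \<omega> - Y (\<tau> i) \<omega>) {..<2}"
    by (rule indep_increments) (use s t in \<open>auto simp: \<tau>_def\<close>)
  define B where "B = (\<lambda>i::nat. if i = 0 then {x} else {y})"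
  have "prob (\<Inter>i\<in>{..<2}. (\<lambda>\<omega>. Y (\<tau> (Suc i)) \<omega> - Y (\<tau> i) \<omega>) -` B i \<inter> space M) =
      (\<Prod>i\<in>{..<2}. prob ((\<lambda>\<omega>. Y (\<tau> (Suc i)) \<omega> - Y (\<tau> i) \<omega>) -` B i \<inter> space M))"
    by (rule indep_varsD[OF ind]) (auto simp: B_def lessThan_empty_iff)
  also have "\<dots> = prob ((\<lambda>\<omega>. Y s \<omega> - Y 0 \<omega>) -` {x} \<inter> space M) * prob ((\<lambda>\<omega>. Y (s + t) \<omega> - Y s \<omega>) -` {y} \<inter> space M)"
    by (simp add: numeral_2_eq_2 \<tau> B_def)
  also have "prob ((\<lambda>\<omega>. Y s \<omega> - Y 0 \<omega>) -` {x} \<inter> space M) = mass s x"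
    unfolding mass_def by (rule finite_measure_eq_AE) (use start_0 in \<open>auto elim!: eventually_mono\<close>)
  also have "prob ((\<lambda>\<omega>. Y (s + t) \<omega> - Y s \<omega>) -` {y} \<inter> space M) = measure (distr M borel (\<lambda>\<omega>. Y (s + t) \<omega> - Y s \<omega>)) {y}"
    by (subst measure_distr) auto
  also have "\<dots> = mass t y"
    unfolding distr_increment[OF s t] mass_def by (subst measure_distr) (auto intro!: arg_cong[where f=prob])
  finally have "mass s x * mass t y = prob (\<Inter>i\<in>{..<2}. (\<lambda>\<omega>. Y (\<tau> (Suc i)) \<omega> - Y (\<tau> i) \<omega>) -` B i \<inter> space M)" ..
  also have "\<dots> \<le> mass (s + t) (x + y)"
    unfolding mass_def
  proof (rule finite_measure_mono_AE)
    show "AE \<omega> in M. \<omega> \<in> (\<Inter>i\<in>{..<2}. (\<lambda>\<omega>. Y (\<tau> (Suc i)) \<omega> - Y (\<tau> i) \<omega>) -` B i \<inter> space M) \<longrightarrow> \<omega> \<in> {\<omega> \<in> space M. Y (s + t) \<omega> = x + y}"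
      using start_0
    proof eventually_elim
      case (elim \<omega>)
      show ?case
      proof
        assume a: "\<omega> \<in> (\<Inter>i\<in>{..<2}. (\<lambda>\<omega>. Y (\<tau> (Suc i)) \<omega> - Y (\<tau> i) \<omega>) -` B i \<inter> space M)"
        have "\<omega> \<in> (\<lambda>\<omega>. Y (\<tau> (Suc 0)) \<omega> - Y (\<tau> 0) \<omega>) -` B 0 \<inter> space M" "\<omega> \<in> (\<lambda>\<omega>. Y (\<tau> (Suc (Suc 0))) \<omega> - Y (\<tau> (Suc 0)) \<omega>) -` B (Suc 0) \<inter> space M"
          using INT_D[OF a, of 0] INT_D[OF a, of "Suc 0"] by auto
        then show "\<omega> \<in> {\<omega> \<in> space M. Y (s + t) \<omega> = x + y}"
          using elim by (auto simp: \<tau> B_def algebra_simps)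
      qed
    qed
  qed measurable
  finally show ?thesis .
qed

lemma mass_multiple_pos:
  assumes s: "s > 0" and m: "mass s x > 0"
  shows "mass (real (Suc n) * s) (real (Suc n) *\<^sub>R x) > 0"
proof (induction n)
  case (Suc n)
  have "0 < mass s x * mass (real (Suc n) * s) (real (Suc n) *\<^sub>R x)" using m Suc by simp
  also have "\<dots> \<le> mass (s + real (Suc n) * s) (x + real (Suc n) *\<^sub>R x)" using s by (intro mass_add) auto
  also have "s + real (Suc n) * s = real (Suc (Suc n)) * s" by (simp add: algebra_simps)
  also have "x + real (Suc n) *\<^sub>R x = real (Suc (Suc n)) *\<^sub>R x"
    by (simp only: of_nat_Suc[of "Suc n"] scaleR_add_left scaleR_one)
  finally show ?case .
qed (use m in simp)

text \<open>On a short interval the process most likely does not move. The choice of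
  \<open>h\<close> brings \<open>8 * h * \<beta> 1\<close> down to \<open>1 / 2\<close>; adding 1 to
  \<open>\<beta> 1\<close> avoids a zero denominator.\<close>

lemma mass_0_ge:
  obtains h where "h > 0" "\<And>r. 0 \<le> r \<Longrightarrow> r \<le> h \<Longrightarrow> mass r 0 \<ge> 1 / 2"
proof -
  have b: "0 \<le> \<beta> 1" using \<beta>_nonneg by simp
  define h where "h = 1 / (16 * (\<beta> 1 + 1))"
  have h: "h > 0" using b by (simp add: h_def)
  have "mass r 0 \<ge> 1 / 2" if r: "0 \<le> r" "r \<le> h" for r
  proof -
    have [measurable]: "Y r \<in> borel_measurable M" using r by simp
    have "8 * r * \<beta> 1 \<le> 8 * h * (\<beta> 1 + 1)" using r b h by (intro mult_mono) auto
    also have "\<dots> = 1 / 2" using b by (simp add: h_def field_simps)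
    finally have le: "8 * r * \<beta> 1 \<le> 1 / 2" .
    have "ennreal (prob {\<omega> \<in> space M. Y r \<omega> \<noteq> 0}) \<le> ennreal (8 * r * \<beta> 1)"
      using prob_Y_nonzero_le[OF r(1)] by (simp add: emeasure_eq_measure)
    then have p: "prob {\<omega> \<in> space M. Y r \<omega> \<noteq> 0} \<le> 8 * r * \<beta> 1" using r b by (subst (asm) ennreal_le_iff) auto
    have "prob {\<omega> \<in> space M. \<not> Y r \<omega> \<noteq> 0} = 1 - prob {\<omega> \<in> space M. Y r \<omega> \<noteq> 0}" by (rule prob_neg) measurable
    then show ?thesis using p le by (simp add: mass_def)
  qed
  then show ?thesis using that h by blast
qed

text \<open>A single time \<open>s\<close> would be negligible under the random time. But after
  reaching \<open>x\<close> the process stays there for a duration below \<open>h\<close> with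
  probability at least \<open>1 / 2\<close>, so a whole interval of times contributes, and the pairs
  \<open>(u, t)\<close> with \<open>u * t\<close> in it have positive measure.\<close>

lemma emeasure_levy_meas_atom_pos:
  assumes c: "c > 0" and s: "s > 0" and x: "x \<noteq> 0" and m: "mass s x > 0"
  shows "0 < emeasure (levy_meas c) {exp (- real n) *\<^sub>R x}"
proof (rule ccontr)
  let ?a = "exp (- real n) *\<^sub>R x"
  assume "\<not> 0 < emeasure (levy_meas c) {?a}"
  then have "(\<integral>\<^sup>+y. indicator {?a} y \<partial>levy_meas c) = 0" by (simp add: not_less)
  then have 0: "(\<integral>\<^sup>+u. \<integral>\<^sup>+t. \<integral>\<^sup>+\<omega>. (\<Sum>j. indicator {?a} (exp (- real j) *\<^sub>R Y (max 0 (u * t)) \<omega>)) \<partial>M \<partial>exp_law \<partial>dilation_measure c) = 0"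
    using x by (subst (asm) nn_integral_levy_meas) auto
  obtain h where h: "h > 0" "\<And>r. 0 \<le> r \<Longrightarrow> r \<le> h \<Longrightarrow> mass r 0 \<ge> 1 / 2" using mass_0_ge by blast
  define \<delta> where "\<delta> = ennreal (mass s x * (1 / 2))"
  have lower: "\<delta> * indicator {s<..<s + h} r \<le> (\<integral>\<^sup>+\<omega>. (\<Sum>j. indicator {?a} (exp (- real j) *\<^sub>R Y (max 0 r) \<omega>)) \<partial>M)" for r
  proof (cases "r \<in> {s<..<s + h}")
    case True
    then have r: "r > 0" "max 0 r = r" using s by auto
    then have [measurable]: "Y r \<in> borel_measurable M" by simp
    have "mass s x * (1 / 2) \<le> mass s x * mass (r - s) 0" using True m by (intro mult_left_mono h) auto
    also have "\<dots> \<le> mass r x" using mass_add[of s "r - s" x 0] s True by simp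
    finally have "\<delta> \<le> emeasure M {\<omega> \<in> space M. Y r \<omega> = x}" unfolding \<delta>_def mass_def emeasure_eq_measure by (rule ennreal_leI)
    also have "\<dots> = (\<integral>\<^sup>+\<omega>. indicator {\<omega> \<in> space M. Y r \<omega> = x} \<omega> \<partial>M)" by simp
    also have "\<dots> \<le> (\<integral>\<^sup>+\<omega>. (\<Sum>j. indicator {?a} (exp (- real j) *\<^sub>R Y r \<omega>)) \<partial>M)"
    proof (intro nn_integral_mono)
      fix \<omega>
      have "indicator {\<omega> \<in> space M. Y r \<omega> = x} \<omega> \<le> (indicator {?a} (exp (- real n) *\<^sub>R Y r \<omega>) :: ennreal)"
        by (auto split: split_indicator)
      also have "\<dots> = (\<Sum>j\<in>{n}. indicator {?a} (exp (- real j) *\<^sub>R Y r \<omega>))" by simp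
      also have "\<dots> \<le> (\<Sum>j. indicator {?a} (exp (- real j) *\<^sub>R Y r \<omega>))" by (rule sum_le_suminf) auto
      finally show "indicator {\<omega> \<in> space M. Y r \<omega> = x} \<omega> \<le> (\<Sum>j. indicator {?a} (exp (- real j) *\<^sub>R Y r \<omega>) :: ennreal)" .
    qed
    finally show ?thesis using True r(2) by simp
  qed simp
  have \<delta>: "\<delta> \<noteq> 0" using m by (simp add: \<delta>_def)
  interpret E: prob_space exp_law by (rule prob_space_exp_law)
  have "(\<integral>\<^sup>+u. \<integral>\<^sup>+t. \<delta> * indicator {s<..<s + h} (u * t) \<partial>exp_law \<partial>dilation_measure c) \<le> 0"
    unfolding 0[symmetric] by (intro nn_integral_mono lower)
  then have "AE u in dilation_measure c. (\<integral>\<^sup>+t. \<delta> * indicator {s<..<s + h} (u * t) \<partial>exp_law) = 0"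
    by (subst (asm) le_zero_eq, subst (asm) nn_integral_0_iff_AE) measurable
  then have "AE u in lborel. u \<notin> {0<..<1 / c}"
    unfolding dilation_measure_def
  proof (subst (asm) AE_density, measurable, elim eventually_mono, intro notI)
    fix u :: real assume imp: "0 < ennreal (indicator {0<..<1 / c} u / u) \<longrightarrow> (\<integral>\<^sup>+t. \<delta> * indicator {s<..<s + h} (u * t) \<partial>exp_law) = 0"
      and u: "u \<in> {0<..<1 / c}"
    then have "(\<integral>\<^sup>+t. \<delta> * indicator {s<..<s + h} (u * t) \<partial>exp_law) = 0" by simp
    then have "AE t in exp_law. \<delta> * indicator {s<..<s + h} (u * t) = 0"
      by (subst (asm) nn_integral_0_iff_AE) auto
    then have "AE t in lborel. 0 < ennreal (exponential_density 1 t) \<longrightarrow> \<delta> * indicator {s<..<s + h} (u * t) = 0"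
      unfolding exp_law_def by (subst (asm) AE_density) auto
    then have "AE t in lborel. t \<notin> {s / u<..<(s + h) / u}"
    proof eventually_elim
      case (elim t)
      show ?case
      proof
        assume "t \<in> {s / u<..<(s + h) / u}"
        then have t: "s < u * t" "u * t < s + h" using u by (auto simp: field_simps)
        have "0 < u * t" using t s by linarith
        then have "t > 0" using u by (simp add: zero_less_mult_iff)
        then have "0 < ennreal (exponential_density 1 t)" by (simp add: exponential_density_def)
        then show False using elim t \<delta> by simp
      qed
    qed
    then show False by (rule AE_lborel_interval_False) (use u h in \<open>auto intro!: divide_strict_right_mono\<close>)
  qed
  then show False by (rule AE_lborel_interval_False) (use c in auto)
qed

lemma discrete_levy_meas:
  "discrete_measure (levy_meas c)"
proof -
  define C :: "(real^'d) set" where "C = (\<lambda>(j::nat, k::int). exp (- real j) *\<^sub>R of_int k *\<^sub>R axis i 1) ` UNIV"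
  have cC: "countable C" unfolding C_def by (rule countable_image) simp
  have 0: "0 \<in> C" unfolding C_def by (rule image_eqI[of _ _ "(0, 0)"]) auto
  have Cm [measurable]: "C \<in> sets borel" by (rule sets.countable[OF _ cC]) simp
  have "emeasure (levy_meas c) (UNIV - C) = (\<integral>\<^sup>+x. indicator (UNIV - C) x \<partial>levy_meas c)"
    using Cm by (intro nn_integral_indicator[symmetric]) auto
  also have "\<dots> = (\<integral>\<^sup>+u. \<integral>\<^sup>+t. \<integral>\<^sup>+\<omega>. (\<Sum>j. indicator (UNIV - C) (exp (- real j) *\<^sub>R Y (max 0 (u * t)) \<omega>)) \<partial>M \<partial>exp_law \<partial>dilation_measure c)"
  proof (rule nn_integral_levy_meas)
    show "(\<lambda>x. indicator (UNIV - C) x :: ennreal) \<in> borel_measurable borel"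
      using Cm by (intro borel_measurable_indicator) auto
    show "indicator (UNIV - C) 0 = (0 :: ennreal)" by (simp add: 0)
  qed
  also have "\<dots> = (\<integral>\<^sup>+u. \<integral>\<^sup>+t. 0 \<partial>exp_law \<partial>dilation_measure c)"
  proof (intro nn_integral_cong)
    fix u t
    have "AE \<omega> in M. (\<Sum>j. indicator (UNIV - C) (exp (- real j) *\<^sub>R Y (max 0 (u * t)) \<omega>)) = (0 :: ennreal)"
      using AE_Ints
    proof eventually_elim
      case (elim \<omega>)
      have "Y (max 0 (u * t)) \<omega> $ i \<in> \<int>" using elim by simp
      then obtain m where "Y (max 0 (u * t)) \<omega> $ i = of_int m" by (rule Ints_cases)
      then have "Y (max 0 (u * t)) \<omega> = of_int m *\<^sub>R axis i 1" by (simp add: vec_eq)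
      then have "exp (- real j) *\<^sub>R Y (max 0 (u * t)) \<omega> \<in> C" for j
        unfolding C_def by (intro image_eqI[of _ _ "(j, m)"]) auto
      then show ?case by simp
    qed
    then have "(\<integral>\<^sup>+\<omega>. (\<Sum>j. indicator (UNIV - C) (exp (- real j) *\<^sub>R Y (max 0 (u * t)) \<omega>)) \<partial>M) = (\<integral>\<^sup>+\<omega>. 0 \<partial>M)"
      by (rule nn_integral_cong_AE)
    then show "(\<integral>\<^sup>+\<omega>. (\<Sum>j. indicator (UNIV - C) (exp (- real j) *\<^sub>R Y (max 0 (u * t)) \<omega>)) \<partial>M) = 0" by simp
  qed
  finally have "emeasure (levy_meas c) (UNIV - C) = 0" by simp
  then show ?thesis unfolding discrete_measure_def using cC by blast
qed

text \<open>At a fixed time the process has countably many possible values. If none outside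
  \<open>S\<close> ever had positive mass, \<open>Y t\<close> would lie in \<open>S\<close> almost
  surely for each \<open>t\<close>, and so would all increments simultaneously.\<close>

lemma ex_mass_outside:
  assumes S: "closed S" "0 \<in> S" and no: "\<not> (AE \<omega> in M. \<forall>s\<ge>0. \<forall>t\<ge>s. Y t \<omega> - Y s \<omega> \<in> S)"
  obtains s x where "s > 0" "x \<notin> S" "mass s x > 0"
proof -
  have "\<exists>s x. s > 0 \<and> x \<notin> S \<and> mass s x > 0"
  proof (rule ccontr)
    assume neg: "\<not> (\<exists>s x. s > 0 \<and> x \<notin> S \<and> mass s x > 0)"
    have "AE \<omega> in M. Y t \<omega> \<in> S" if t: "t \<ge> 0" for t
    proof (cases "t = 0")
      case True
      then show ?thesis using start_0 S(2) by (auto elim!: eventually_mono)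
    next
      case False
      then have [measurable]: "Y t \<in> borel_measurable M" using t by simp
      have "AE \<omega> in M. \<forall>k::int. of_int k *\<^sub>R axis i 1 \<notin> S \<longrightarrow> Y t \<omega> \<noteq> of_int k *\<^sub>R axis i 1"
        unfolding AE_all_countable
      proof (intro allI AE_impI)
        fix k :: int assume "of_int k *\<^sub>R axis i 1 \<notin> S"
        then have "mass t (of_int k *\<^sub>R axis i 1) = 0"
          using neg False t measure_nonneg[of M] unfolding mass_def by (metis less_eq_real_def)
        then have "AE \<omega> in M. \<not> Y t \<omega> = of_int k *\<^sub>R axis i 1"
          unfolding mass_def by (subst (asm) prob_Collect_eq_0) auto
        then show "AE \<omega> in M. Y t \<omega> \<noteq> of_int k *\<^sub>R axis i 1" .
      qed
      then show ?thesis using AE_Ints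
      proof eventually_elim
        case (elim \<omega>)
        have "Y t \<omega> $ i \<in> \<int>" using elim(2) t by simp
        then obtain k where "Y t \<omega> $ i = of_int k" by (rule Ints_cases)
        then have "Y t \<omega> = of_int k *\<^sub>R axis i 1" by (simp add: vec_eq)
        then show ?case using elim(1) by auto
      qed
    qed
    then show False using AE_increments_closed[OF S(1)] no by blast
  qed
  then show ?thesis using that by blast
qed

text \<open>The points \<open>exp (- j) * n\<close> times \<open>x\<close> are atoms, as multiples
  of an attained value are attained, and they are dense on the half-line through \<open>x\<close>.
  The sign condition places \<open>y\<close> on that closed half-line.\<close>

lemma closure_atoms:
  assumes c: "c > 0" and s: "s > 0" and x: "x \<noteq> 0" "mass s x > 0"
    and y: "0 \<le> (y :: real^'d) $ i * sgn (x $ i)"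
    and D: "\<And>r. r > 0 \<Longrightarrow> r *\<^sub>R x \<in> D"
  shows "y \<in> closure ({x. 0 < emeasure (levy_meas c) {x}} \<inter> D)"
  unfolding closure_approachable
proof (intro allI impI)
  fix e :: real assume e: "e > 0"
  have x0: "x $ i \<noteq> 0" using x(1) by (simp add: vec_eq)
  then have "\<bar>x $ i\<bar> > 0" by simp
  from dense_dilated_multiples[OF this y e] obtain j n :: nat where jn: "n \<ge> 1" "\<bar>exp (- real j) * (real n * \<bar>x $ i\<bar>) - y $ i * sgn (x $ i)\<bar> < e"
    by blast
  obtain n' where n': "n = Suc n'" using jn(1) by (cases n) auto
  let ?w = "exp (- real j) *\<^sub>R (real n *\<^sub>R x)"
  have "0 < emeasure (levy_meas c) {?w}"
    using mass_multiple_pos[OF s x(2), of n'] x s jn(1) unfolding n'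
    by (intro emeasure_levy_meas_atom_pos[OF c, of "real (Suc n') * s"]) auto
  moreover have "?w \<in> D" using D[of "exp (- real j) * real n"] jn(1) by simp
  moreover have "dist ?w y < e"
  proof -
    have "exp (- real j) * (real n * \<bar>x $ i\<bar>) - y $ i * sgn (x $ i) = sgn (x $ i) * ((?w - y) $ i)"
      by (simp add: abs_sgn algebra_simps)
    then have "\<bar>exp (- real j) * (real n * \<bar>x $ i\<bar>) - y $ i * sgn (x $ i)\<bar> = \<bar>(?w - y) $ i\<bar>"
      using x0 by (simp add: abs_mult abs_sgn_eq_1)
    then show ?thesis using jn(2) unfolding dist_norm norm_eq by simp
  qed
  ultimately show "\<exists>w\<in>{x. 0 < emeasure (levy_meas c) {x}} \<inter> D. dist w y < e" by blast
qed

lemma le_iff: "(x :: real^'d) \<le> y \<longleftrightarrow> x $ i \<le> y $ i"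
proof -
  have "j = i" for j :: 'd using UNIV_i by auto
  then show ?thesis unfolding less_eq_vec_def by metis
qed

lemma less_iff: "(x :: real^'d) < y \<longleftrightarrow> x $ i < y $ i"
  by (auto simp: less_le_not_le le_iff)

lemma ex_positive_mass:
  assumes "\<not> decreasing_process M Y"
  obtains s x where "s > 0" "x $ i > 0" "mass s x > 0"
proof -
  let ?S = "{y :: real^'d. y $ i \<le> 0}"
  have "closed ?S" by (intro closed_Collect_le continuous_intros)
  moreover have "\<not> (AE \<omega> in M. \<forall>s\<ge>0. \<forall>t\<ge>s. Y t \<omega> - Y s \<omega> \<in> ?S)"
    using assms by (simp add: decreasing_process_def le_iff)
  ultimately obtain s x where "s > 0" "x \<notin> ?S" "mass s x > 0" using ex_mass_outside[of ?S] by auto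
  then show ?thesis by (simp add: not_le that)
qed

lemma ex_negative_mass:
  assumes "\<not> increasing_process M Y"
  obtains s x where "s > 0" "x $ i < 0" "mass s x > 0"
proof -
  let ?S = "{y :: real^'d. 0 \<le> y $ i}"
  have "closed ?S" by (intro closed_Collect_le continuous_intros)
  moreover have "\<not> (AE \<omega> in M. \<forall>s\<ge>0. \<forall>t\<ge>s. Y t \<omega> - Y s \<omega> \<in> ?S)"
    using assms by (simp add: increasing_process_def le_iff)
  ultimately obtain s x where "s > 0" "x \<notin> ?S" "mass s x > 0" using ex_mass_outside[of ?S] by auto
  then show ?thesis by (simp add: not_le that)
qed

lemma not_increasing_decreasing:
  assumes "increasing_process M Y" "decreasing_process M Y"
  shows False
proof -
  have "AE \<omega> in M. \<forall>t\<ge>0. Y t \<omega> = 0"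
    using assms[unfolded increasing_process_def decreasing_process_def] start_0
  proof eventually_elim
    case (elim \<omega>)
    have "Y t \<omega> = Y 0 \<omega>" if "t \<ge> 0" for t using elim(1,2) that by (intro antisym) auto
    then show ?case using elim(3) by simp
  qed
  then show False using nonzero by (simp add: zero_process_def)
qed

text \<open>Each direction in which \<open>Y\<close> can move fills a closed half-line with limits
  of atoms; in the two-sided case the two half-lines cover the line. Both kinds of monotonicity
  together are excluded, since they would make \<open>Y\<close> zero.\<close>

lemma dense_atoms:
  assumes c: "c > 0"
  defines "D \<equiv> (if increasing_process M Y then {0<..} else if decreasing_process M Y then {..<0} else UNIV)"
  shows "D \<subseteq> closure ({x. 0 < emeasure (levy_meas c) {x}} \<inter> D)"
proof
  fix y assume y: "y \<in> D"
  have pos: "y \<in> closure ({x. 0 < emeasure (levy_meas c) {x}} \<inter> D)" if nd: "\<not> decreasing_process M Y" and y0: "0 \<le> y $ i"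
  proof -
    obtain s x where x: "s > 0" "x $ i > 0" "mass s x > 0" using ex_positive_mass[OF nd] by blast
    then have "x \<noteq> 0" by auto
    then show ?thesis
      by (rule closure_atoms[OF c x(1) _ x(3)]) (use x y0 nd in \<open>auto simp: D_def less_iff\<close>)
  qed
  have neg: "y \<in> closure ({x. 0 < emeasure (levy_meas c) {x}} \<inter> D)" if ni: "\<not> increasing_process M Y" and y0: "y $ i \<le> 0"
  proof -
    obtain s x where x: "s > 0" "x $ i < 0" "mass s x > 0" using ex_negative_mass[OF ni] by blast
    then have "x \<noteq> 0" by auto
    then show ?thesis
      by (rule closure_atoms[OF c x(1) _ x(3)]) (use x y0 ni in \<open>auto simp: D_def less_iff mult_pos_neg\<close>)
  qed
  show "y \<in> closure ({x. 0 < emeasure (levy_meas c) {x}} \<inter> D)"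
  proof (cases "increasing_process M Y")
    case True
    then have "0 \<le> y $ i" using y by (simp add: D_def less_iff)
    then show ?thesis using pos True not_increasing_decreasing by blast
  next
    case ni: False
    show ?thesis
    proof (cases "decreasing_process M Y")
      case True
      then have "y $ i \<le> 0" using y ni by (simp add: D_def less_iff)
      then show ?thesis using neg ni by blast
    next
      case False
      then show ?thesis using pos neg ni linear[of 0 "y $ i"] by blast
    qed
  qed
qed

end

lemma (in pois_levy) integer_valued_integral:
  assumes Z: "has_improper_integral M H Y Z" and d: "CARD('d) = 1"
    and int: "integer_valued_process M Y" and nz: "\<not> zero_process M Y"
  defines "D \<equiv> (if increasing_process M Y then {0<..} else if decreasing_process M Y then {..<0} else UNIV)"
  shows "\<not> selfdecomposable (distr M borel Z) \<and>
    (\<exists>\<nu>'. has_levy_measure (distr M borel Z) \<nu>' \<and> discrete_measure \<nu>' \<and> D \<subseteq> closure ({x. 0 < emeasure \<nu>' {x}} \<inter> D))"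
proof -
  obtain i :: 'd where i: "UNIV = {i}" using d by (rule card_1_singletonE)
  interpret int_levy M Y A \<nu> \<gamma> i by unfold_locales (fact i int nz)+
  note f = char_fun_integral_factor[OF Z]
  note lm = has_levy_measure_levy_meas[OF c f]
  \<comment> \<open>By the Levy--Khintchine formula the characteristic function is an
    exponential.\<close>
  have "char_fun (distr M borel Z) z \<noteq> 0" for z
  proof -
    obtain A' \<gamma>' where "levy_khintchine (distr M borel Z) A' (levy_meas c) \<gamma>'"
      using lm unfolding has_levy_measure_def by blast
    then show ?thesis unfolding levy_khintchine_def by (elim conjE) (simp only: exp_not_eq_zero not_False_eq_True)
  qed
  then have "\<not> selfdecomposable (distr M borel Z)" by (rule not_selfdecomposable[OF c f(1) _ f(2)])
  then show ?thesis using lm discrete_levy_meas dense_atoms[OF c] unfolding D_def by blast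
qed

theorem theorem3p2:
  fixes M :: "'w measure"
    and N :: "real \<Rightarrow> 'w \<Rightarrow> real"
    and Y :: "real \<Rightarrow> 'w \<Rightarrow> real^'d"
    and \<nu>\<^sub>Y \<mu> :: "(real^'d) measure"
  assumes poisson: "poisson_process M N"
    and levy: "levy_process M Y"
    and indep: "independent_processes M N Y"
    and levy_measure: "has_levy_measure (distr M borel (Y 1)) \<nu>\<^sub>Y"
    and log_moment: "(\<integral>\<^sup>+y. ennreal (log_plus (norm y)) \<partial>\<nu>\<^sub>Y) < \<infinity>"
    and mu: "\<mu> = distr M borel (improper_integral M (\<lambda>s \<omega>. exp (- left_limit N s \<omega>)) Y)"
  shows "(infinitely_divisible \<mu> \<and> semi_selfdecomposable (exp (- 1)) \<mu>) \<and>
    ((\<exists>\<alpha>. 0 < \<alpha> \<and> \<alpha> \<le> 2 \<and> strictly_stable_process M \<alpha> Y) \<or>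
       (CARD('d) = 1 \<and> (\<forall>i. brownian_motion_with_drift M (\<lambda>t \<omega>. Y t \<omega> $ i))) \<longrightarrow>
     selfdecomposable \<mu> \<and> class_L1 (exp (- 1)) \<mu>) \<and>
    (CARD('d) = 1 \<and> integer_valued_process M Y \<and> \<not> zero_process M Y \<longrightarrow>
     (let D = (if increasing_process M Y then {0<..}
               else if decreasing_process M Y then {..<0} else UNIV) in
      \<not> selfdecomposable \<mu> \<and>
      (\<exists>\<nu>. has_levy_measure \<mu> \<nu> \<and> discrete_measure \<nu> \<and>
           D \<subseteq> closure ({x. 0 < emeasure \<nu> {x}} \<inter> D))))"
proof -
  obtain c where c: "c > 0" "\<And>t. t > 0 \<Longrightarrow> distr M borel (N t) = distr (measure_pmf (poisson_pmf (c * t))) borel real"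
    using poisson unfolding poisson_process_def by blast
  obtain A \<gamma> where lk: "levy_khintchine (distr M borel (Y 1)) A \<nu>\<^sub>Y \<gamma>"
    using levy_measure unfolding has_levy_measure_def by blast
  have N: "levy_process M N" using poisson by (simp add: poisson_process_def)
  interpret prob_space M using levy by (simp add: levy_process_def)
  interpret pois_levy M Y A \<nu>\<^sub>Y \<gamma> N c
    by unfold_locales (fact levy lk log_moment N c indep)+
  define Z where "Z = improper_integral M H Y"
  \<comment> \<open>Existence gives the choice its meaning; everything proved above holds for any
    version \<open>Z\<close>.\<close>
  have Z: "has_improper_integral M H Y Z"
    unfolding Z_def improper_integral_def by (rule someI_ex[OF has_improper_integral_exists])
  have \<mu>: "\<mu> = distr M borel Z" by (simp add: mu Z_def)
  show ?thesis
    unfolding \<mu> Let_def using semi_selfdecomposable_integral[OF Z] selfdecomposable_integral[OF Z] integer_valued_integral[OF Z] by blast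
qed

end
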